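(* Let $X$ be a nilmanifold of real dimension $4$ or $6$ with a left-invariant maximally non-integrable almost complex structure $J$. Then the Dolbeault cohomology of $(X,J)$ cannot be computed using left-invariant forms only; i.e. the map $$H_{\bar\partial}(H_{\bar\mu}(\mathcal{A}_{inv}^{\bullet,\bullet}))\longrightarrow H_{Dol}(X,J)$$ induced by the inclusion of the subcomplex $\mathcal{A}_{inv}^{\bullet,\bullet}$ of left-invariant forms into all forms is not an isomorphism.
   Context: A nilmanifold is a compact quotient $X$ of a simply connected nilpotent Lie group $G$ by a discrete subgroup; left-invariant structures and forms on $X$ are those induced from left-invariant ones on $G$ (the quotient being taken by the left action of the discrete subgroup). For an almost complex manifold $(X,J)$ of real dimension $2n$, let $T^{1,0}X,T^{0,1}X\subset TX\otimes\mathbb{C}$ be the $\pm i$-eigenbundles of $J$, $A^{1,0}_X$, $A^{0,1}_X$ their duals, $A^{p,q}_X=\Lambda^pA^{1,0}_X\otimes\Lambda^qA^{0,1}_X$, and $\mathcal{A}^{p,q}_X$ the space of smooth sections of $A^{p,q}_X$. The exterior derivative decomposes as $d=\bar\mu+\bar\partial+\partial+\mu$ with components of bidegrees $(-1,2),(0,1),(1,0),(2,-1)$. From $d^2=0$ one gets $\bar\mu^2=0$, $\bar\mu\bar\partial+\bar\partial\bar\mu=0$, $\bar\mu\partial+\partial\bar\mu+\bar\partial^2=0$, so that $H_{Dol}(X,J):=H_{\bar\partial}(H_{\bar\mu}(\mathcal{A}_X^{\bullet,\bullet}))$ is well defined; the same applies to the sub-bigraded space $\mathcal{A}_{inv}^{\bullet,\bullet}$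 of left-invariant forms, which is stable under all components of $d$ when $J$ is left-invariant. $J$ is maximally non-integrable if the bundle map $\bar\mu:A^{1,0}_X\to A^{0,2}_X$ has maximal complex rank $\min\{n,\binom n2\}$ at every point. *)

theory Defs
  imports "HOL-Analysis.Analysis" "HOL-Library.Function_Algebras" "HOL-Algebra.Generated_Groups"
begin

section \<open>Smooth manifolds\<close>

text \<open>\<open>C_k_on k S f\<close>: on the open set \<open>S\<close>, all iterated directional derivatives of \<open>f\<close> up to
  order \<open>k\<close> exist and are continuous.\<close>

primrec C_k_on ::
  "nat \<Rightarrow> 'e::euclidean_space set \<Rightarrow> ('e \<Rightarrow> 'b::real_normed_vector) \<Rightarrow> bool" where
  "C_k_on 0 S f \<longleftrightarrow> continuous_on S f"
| "C_k_on (Suc k) S f \<longleftrightarrow>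
     (\<forall>x\<in>S. f differentiable (at x)) \<and>
     (\<forall>v. C_k_on k S (\<lambda>x. frechet_derivative f (at x) v))"

definition smooth_on :: "'e::euclidean_space set \<Rightarrow> ('e \<Rightarrow> 'b::real_normed_vector) \<Rightarrow> bool" where
  "smooth_on S f \<longleftrightarrow> (\<forall>k. C_k_on k S f)"

text \<open>The dimension of a manifold modelled on \<open>'e\<close> is \<open>DIM('e)\<close>. A chart is a pair of its
  domain and a map that is only meaningful on this domain.\<close>

record ('a, 'e) manifold =
  mtop :: "'a topology"
  atlas :: "('a set \<times> ('a \<Rightarrow> 'e)) set"

abbreviation points :: "('a, 'e) manifold \<Rightarrow> 'a set" where
  "points M \<equiv> topspace (mtop M)"

definition smooth_manifold :: "('a, 'e::euclidean_space) manifold \<Rightarrow> bool" where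
  "smooth_manifold M \<longleftrightarrow>
     Hausdorff_space (mtop M) \<and> second_countable (mtop M) \<and>
     (\<Union>(U, \<phi>)\<in>atlas M. U) = points M \<and>
     (\<forall>(U, \<phi>)\<in>atlas M. openin (mtop M) U \<and> open (\<phi> ` U) \<and>
        homeomorphic_map (subtopology (mtop M) U) (top_of_set (\<phi> ` U)) \<phi>) \<and>
     (\<forall>(U, \<phi>)\<in>atlas M. \<forall>(V, \<psi>)\<in>atlas M. smooth_on (\<phi> ` (U \<inter> V)) (\<psi> \<circ> inv_into U \<phi>))"

definition prod_manifold ::
  "('a, 'e) manifold \<Rightarrow> ('b, 'f) manifold \<Rightarrow> ('a \<times> 'b, 'e \<times> 'f) manifold" where
  "prod_manifold M N =
     \<lparr>mtop = prod_topology (mtop M) (mtop N),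
      atlas = {(U \<times> V, map_prod \<phi> \<psi>) | U \<phi> V \<psi>. (U, \<phi>) \<in> atlas M \<and> (V, \<psi>) \<in> atlas N}\<rparr>"

definition smooth_map ::
  "('a, 'e::euclidean_space) manifold \<Rightarrow> ('b, 'f::euclidean_space) manifold \<Rightarrow> ('a \<Rightarrow> 'b) \<Rightarrow> bool" where
  "smooth_map M N F \<longleftrightarrow>
     continuous_map (mtop M) (mtop N) F \<and>
     (\<forall>(U, \<phi>)\<in>atlas M. \<forall>(V, \<psi>)\<in>atlas N.
        smooth_on (\<phi> ` (U \<inter> F -` V)) (\<psi> \<circ> F \<circ> inv_into U \<phi>))"

text \<open>Functions, tangent vectors, vector fields and forms on a manifold are total HOL functions.
  They are made to vanish outside their intended domain, so that equality is the intended one.\<close>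

definition smooth_fun ::
  "('a, 'e::euclidean_space) manifold \<Rightarrow> ('a \<Rightarrow> 'b::real_normed_vector) set" where
  "smooth_fun M =
     {f. (\<forall>x. x \<notin> points M \<longrightarrow> f x = 0) \<and>
         (\<forall>(U, \<phi>)\<in>atlas M. smooth_on (\<phi> ` U) (f \<circ> inv_into U \<phi>))}"

section \<open>Tangent vectors and vector fields\<close>

text \<open>Derivations at \<open>x\<close> of the algebra of real smooth functions, with values in \<open>'b\<close>. For
  \<open>'b = real\<close> this is the tangent space; for \<open>'b = complex\<close> it is the complexified tangent
  space, whose elements \<open>v\<close> are the sums of real derivations \<open>Re \<circ> v\<close> and \<open>\<i>\<close> times \<open>Im \<circ> v\<close>.\<close>

type_synonym ('a, 'b) tvec = "('a \<Rightarrow> real) \<Rightarrow> 'b"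

definition tangent_space ::
  "('a, 'e::euclidean_space) manifold \<Rightarrow> 'a \<Rightarrow> ('a, 'b::real_normed_vector) tvec set" where
  "tangent_space M x =
     {v. (\<forall>f\<in>smooth_fun M. \<forall>g\<in>smooth_fun M.
            v (\<lambda>y. f y + g y) = v f + v g \<and>
            v (\<lambda>y. f y * g y) = f x *\<^sub>R v g + g x *\<^sub>R v f) \<and>
         (\<forall>f\<in>smooth_fun M. \<forall>c. v (\<lambda>y. c * f y) = c *\<^sub>R v f) \<and>
         (\<forall>f. f \<notin> smooth_fun M \<longrightarrow> v f = 0)}"

definition vector_fields ::
  "('a, 'e::euclidean_space) manifold \<Rightarrow> ('a \<Rightarrow> ('a, 'b::real_normed_vector) tvec) set" where
  "vector_fields M =
     {V. (\<forall>x\<in>points M. V x \<in> tangent_space M x) \<and> (\<forall>x. x \<notin> points M \<longrightarrow> V x = 0) \<and>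
         (\<forall>f\<in>smooth_fun M. (\<lambda>x. V x f) \<in> smooth_fun M)}"

definition apply_complex :: "('a, complex) tvec \<Rightarrow> ('a \<Rightarrow> complex) \<Rightarrow> complex" where
  "apply_complex v h = v (\<lambda>x. Re (h x)) + \<i> * v (\<lambda>x. Im (h x))"

definition lie_bracket ::
  "('a \<Rightarrow> ('a, complex) tvec) \<Rightarrow> ('a \<Rightarrow> ('a, complex) tvec) \<Rightarrow> 'a \<Rightarrow> ('a, complex) tvec" where
  "lie_bracket V W x f =
     apply_complex (V x) (\<lambda>y. W y f) - apply_complex (W x) (\<lambda>y. V y f)"

definition pushforward ::
  "('a, 'e::euclidean_space) manifold \<Rightarrow> ('b, 'f::euclidean_space) manifold \<Rightarrow> ('a \<Rightarrow> 'b) \<Rightarrow>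
   ('a, 'c::real_normed_vector) tvec \<Rightarrow> ('b, 'c) tvec" where
  "pushforward M N F v =
     (\<lambda>h. if h \<in> smooth_fun N then v (\<lambda>x. if x \<in> points M then h (F x) else 0) else 0)"

section \<open>Complex differential forms\<close>

text \<open>A form takes a point and a list of complexified tangent vectors. The restriction to lists of
  length \<open>k\<close> is the component of degree \<open>k\<close>, so the forms below are the sums of forms of all
  degrees.\<close>

type_synonym 'a form = "'a \<Rightarrow> ('a, complex) tvec list \<Rightarrow> complex"

definition forms :: "('a, 'e::euclidean_space) manifold \<Rightarrow> 'a form set" where
  "forms M =
     {\<omega>. (\<forall>x vs. \<not> (x \<in> points M \<and> vs \<in> lists (tangent_space M x)) \<longrightarrow> \<omega> x vs = 0) \<and>
         (\<forall>x\<in>points M. \<forall>vs\<in>lists (tangent_space M x). \<forall>i<length vs.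
            \<forall>v\<in>tangent_space M x. \<forall>w\<in>tangent_space M x. \<forall>c.
              \<omega> x (vs[i := v + w]) = \<omega> x (vs[i := v]) + \<omega> x (vs[i := w]) \<and>
              \<omega> x (vs[i := (\<lambda>f. c * v f)]) = c * \<omega> x (vs[i := v])) \<and>
         (\<forall>x vs. \<not> distinct vs \<longrightarrow> \<omega> x vs = 0) \<and>
         (\<forall>Vs\<in>lists (vector_fields M). (\<lambda>x. \<omega> x (map (\<lambda>V. V x) Vs)) \<in> smooth_fun M)}"

definition form_pullback ::
  "('a, 'e::euclidean_space) manifold \<Rightarrow> ('b, 'f::euclidean_space) manifold \<Rightarrow> ('a \<Rightarrow> 'b) \<Rightarrow>
   'b form \<Rightarrow> 'a form" where
  "form_pullback M N F \<omega> x vs =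
     (if x \<in> points M \<and> vs \<in> lists (tangent_space M x)
      then \<omega> (F x) (map (pushforward M N F) vs) else 0)"

text \<open>The exterior derivative is given by the invariant (Koszul) formula, evaluated on vector fields
  that extend the given tangent vectors; the value does not depend on the extensions. In
  \<open>nths Vs (- {i})\<close> the entry number \<open>i\<close> is omitted.\<close>

definition koszul :: "'a form \<Rightarrow> ('a \<Rightarrow> ('a, complex) tvec) list \<Rightarrow> 'a \<Rightarrow> complex" where
  "koszul \<omega> Vs x =
     (\<Sum>i<length Vs. (-1) ^ i *
        apply_complex ((Vs ! i) x) (\<lambda>y. \<omega> y (map (\<lambda>V. V y) (nths Vs (- {i}))))) +
     (\<Sum>j<length Vs. \<Sum>i<j. (-1) ^ (i + j) *
        \<omega> x (lie_bracket (Vs ! i) (Vs ! j) x # map (\<lambda>V. V x) (nths Vs (- {i, j}))))"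

definition field_extension ::
  "('a, 'e::euclidean_space) manifold \<Rightarrow> 'a \<Rightarrow> ('a, complex) tvec \<Rightarrow> 'a \<Rightarrow> ('a, complex) tvec" where
  "field_extension M x v = (SOME V. V \<in> vector_fields M \<and> V x = v)"

definition ext_deriv :: "('a, 'e::euclidean_space) manifold \<Rightarrow> 'a form \<Rightarrow> 'a form" where
  "ext_deriv M \<omega> x vs =
     (if x \<in> points M \<and> vs \<in> lists (tangent_space M x)
      then koszul \<omega> (map (field_extension M x) vs) x else 0)"

section \<open>Almost complex structures\<close>

type_synonym 'a acs = "'a \<Rightarrow> ('a, real) tvec \<Rightarrow> ('a, real) tvec"

definition almost_complex :: "('a, 'e::euclidean_space) manifold \<Rightarrow> 'a acs \<Rightarrow> bool" where
  "almost_complex M J \<longleftrightarrow>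
     (\<forall>x\<in>points M. \<forall>v\<in>tangent_space M x.
        J x v \<in> tangent_space M x \<and> J x (J x v) = - v \<and>
        (\<forall>w\<in>tangent_space M x. J x (v + w) = J x v + J x w) \<and>
        (\<forall>c. J x (\<lambda>f. c * v f) = (\<lambda>f. c * J x v f))) \<and>
     (\<forall>V\<in>vector_fields M. (\<lambda>x. if x \<in> points M then J x (V x) else 0) \<in> vector_fields M)"

definition J_cplx :: "'a acs \<Rightarrow> 'a \<Rightarrow> ('a, complex) tvec \<Rightarrow> ('a, complex) tvec" where
  "J_cplx J x v =
     (\<lambda>f. complex_of_real (J x (Re \<circ> v) f) + \<i> * complex_of_real (J x (Im \<circ> v) f))"

definition T10 :: "('a, 'e::euclidean_space) manifold \<Rightarrow> 'a acs \<Rightarrow> 'a \<Rightarrow> ('a, complex) tvec set" where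
  "T10 M J x = {v \<in> tangent_space M x. J_cplx J x v = (\<lambda>f. \<i> * v f)}"

definition T01 :: "('a, 'e::euclidean_space) manifold \<Rightarrow> 'a acs \<Rightarrow> 'a \<Rightarrow> ('a, complex) tvec set" where
  "T01 M J x = {v \<in> tangent_space M x. J_cplx J x v = (\<lambda>f. - \<i> * v f)}"

text \<open>Sections of \<open>\<Lambda>\<^sup>p A\<^sup>1\<^sup>,\<^sup>0 \<otimes> \<Lambda>\<^sup>q A\<^sup>0\<^sup>,\<^sup>1\<close>, where the tensor product is viewed inside the exterior
  algebra of the dual of the complexified tangent bundle.\<close>

definition pq_forms ::
  "('a, 'e::euclidean_space) manifold \<Rightarrow> 'a acs \<Rightarrow> nat \<Rightarrow> nat \<Rightarrow> 'a form set" where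
  "pq_forms M J p q =
     {\<omega> \<in> forms M. \<forall>x\<in>points M. \<forall>vs\<in>lists (T10 M J x \<union> T01 M J x). \<omega> x vs \<noteq> 0 \<longrightarrow>
        length (filter (\<lambda>v. v \<in> T10 M J x) vs) = p \<and>
        length (filter (\<lambda>v. v \<in> T01 M J x) vs) = q}"

definition proj10 :: "'a acs \<Rightarrow> 'a \<Rightarrow> ('a, complex) tvec \<Rightarrow> ('a, complex) tvec" where
  "proj10 J x v = (\<lambda>f. (v f - \<i> * J_cplx J x v f) / 2)"

definition proj01 :: "'a acs \<Rightarrow> 'a \<Rightarrow> ('a, complex) tvec \<Rightarrow> ('a, complex) tvec" where
  "proj01 J x v = (\<lambda>f. (v f + \<i> * J_cplx J x v f) / 2)"

text \<open>The component of bidegree \<open>(p, q)\<close> of a form: expand every argument as the sum of its parts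
  of type \<open>(1, 0)\<close> and \<open>(0, 1)\<close> and keep the terms with \<open>p\<close> arguments of the first and \<open>q\<close> of the
  second kind.\<close>

definition bideg_comp ::
  "('a, 'e::euclidean_space) manifold \<Rightarrow> 'a acs \<Rightarrow> nat \<Rightarrow> nat \<Rightarrow> 'a form \<Rightarrow> 'a form" where
  "bideg_comp M J p q \<omega> x vs =
     (if x \<in> points M \<and> vs \<in> lists (tangent_space M x) \<and> length vs = p + q
      then \<Sum>S | S \<subseteq> {..<p + q} \<and> card S = p.
             \<omega> x (map (\<lambda>i. if i \<in> S then proj10 J x (vs ! i) else proj01 J x (vs ! i)) [0..<p + q])
      else 0)"

text \<open>The components of \<open>d\<close> of bidegree \<open>(-1, 2)\<close> and \<open>(0, 1)\<close>, acting on forms of all bidegrees.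
  Forms of bidegree \<open>(p, q)\<close> vanish if \<open>p\<close> or \<open>q\<close> exceeds half of \<open>DIM('e)\<close>, so that the summation
  ranges are sufficient.\<close>

definition mubar :: "('a, 'e::euclidean_space) manifold \<Rightarrow> 'a acs \<Rightarrow> 'a form \<Rightarrow> 'a form" where
  "mubar M J \<omega> =
     (\<Sum>p\<le>DIM('e). \<Sum>q\<le>DIM('e).
        bideg_comp M J p (q + 2) (ext_deriv M (bideg_comp M J (p + 1) q \<omega>)))"

definition delbar :: "('a, 'e::euclidean_space) manifold \<Rightarrow> 'a acs \<Rightarrow> 'a form \<Rightarrow> 'a form" where
  "delbar M J \<omega> =
     (\<Sum>p\<le>DIM('e). \<Sum>q\<le>DIM('e).
        bideg_comp M J p (q + 1) (ext_deriv M (bideg_comp M J p q \<omega>)))"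

text \<open>The image at \<open>x\<close> of the bundle map induced by \<open>mubar\<close> consists of the values at \<open>x\<close> of
  \<open>mubar \<alpha>\<close>, where \<open>\<alpha>\<close> runs through the sections of the source bundle. The rank is the complex
  dimension of this image.\<close>

definition max_non_integrable :: "('a, 'e::euclidean_space) manifold \<Rightarrow> 'a acs \<Rightarrow> bool" where
  "max_non_integrable M J \<longleftrightarrow>
     (\<forall>x\<in>points M.
        vector_space.dim (\<lambda>(c::complex) \<eta> vs. c * \<eta> vs) ((\<lambda>\<alpha>. mubar M J \<alpha> x) ` pq_forms M J 1 0)
          = min (DIM('e) div 2) ((DIM('e) div 2) choose 2))"

section \<open>Cohomology\<close>

text \<open>For an additive endomorphism \<open>\<delta>\<close> of \<open>A\<close> with square zero. The second function is the map induced
  in cohomology by a map \<open>h\<close> of complexes with target \<open>(B, \<epsilon>)\<close>: it sends the class of \<open>a\<close> to that of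
  \<open>h a\<close>.\<close>

definition cohomology :: "'v monoid \<Rightarrow> ('v \<Rightarrow> 'v) \<Rightarrow> 'v set monoid" where
  "cohomology A \<delta> = A\<lparr>carrier := kernel A A \<delta>\<rparr> Mod (\<delta> ` carrier A)"

definition cohomology_map ::
  "'w monoid \<Rightarrow> ('w \<Rightarrow> 'w) \<Rightarrow> ('v \<Rightarrow> 'w) \<Rightarrow> 'v set \<Rightarrow> 'w set" where
  "cohomology_map B \<epsilon> h C = (\<epsilon> ` carrier B) <#>\<^bsub>B\<^esub> (h ` C)"

definition additive_group :: "'v::monoid_add set \<Rightarrow> 'v monoid" where
  "additive_group V = \<lparr>carrier = V, mult = (+), one = 0\<rparr>"

text \<open>The Dolbeault cohomology (as a total space, that is, the sum over all bidegrees) computed from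
  a space \<open>\<Omega>\<close> of forms that is stable under \<open>mubar\<close> and \<open>delbar\<close>.\<close>

definition mubar_cohomology ::
  "('a, 'e::euclidean_space) manifold \<Rightarrow> 'a acs \<Rightarrow> 'a form set \<Rightarrow> 'a form set monoid" where
  "mubar_cohomology M J \<Omega> = cohomology (additive_group \<Omega>) (mubar M J)"

definition delbar_induced ::
  "('a, 'e::euclidean_space) manifold \<Rightarrow> 'a acs \<Rightarrow> 'a form set \<Rightarrow> 'a form set \<Rightarrow> 'a form set" where
  "delbar_induced M J \<Omega> = cohomology_map (additive_group \<Omega>) (mubar M J) (delbar M J)"

definition dolbeault ::
  "('a, 'e::euclidean_space) manifold \<Rightarrow> 'a acs \<Rightarrow> 'a form set \<Rightarrow> 'a form set set monoid" where
  "dolbeault M J \<Omega> = cohomology (mubar_cohomology M J \<Omega>) (delbar_induced M J \<Omega>)"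

text \<open>The map induced by the inclusion of a subcomplex of \<open>\<Omega>\<close>. It is complex linear and preserves
  bidegrees, so it is an isomorphism (of bigraded vector spaces) iff it is bijective.\<close>

definition dolbeault_inclusion ::
  "('a, 'e::euclidean_space) manifold \<Rightarrow> 'a acs \<Rightarrow> 'a form set \<Rightarrow>
   'a form set set \<Rightarrow> 'a form set set" where
  "dolbeault_inclusion M J \<Omega> =
     cohomology_map (mubar_cohomology M J \<Omega>) (delbar_induced M J \<Omega>)
       (cohomology_map (additive_group \<Omega>) (mubar M J) (\<lambda>\<omega>. \<omega>))"

section \<open>Nilmanifolds\<close>

definition lie_group :: "'g monoid \<Rightarrow> ('g, 'e::euclidean_space) manifold \<Rightarrow> bool" where
  "lie_group G M \<longleftrightarrow>
     group G \<and> smooth_manifold M \<and> points M = carrier G \<and>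
     smooth_map (prod_manifold M M) M (\<lambda>(a, b). a \<otimes>\<^bsub>G\<^esub> b) \<and>
     smooth_map M M (\<lambda>a. inv\<^bsub>G\<^esub> a)"

text \<open>Analogue of \<^const>\<open>simply_connected\<close> for abstract topologies. It includes path-connectedness,
  because constant loops are freely homotopic.\<close>

definition simply_connected_space :: "'a topology \<Rightarrow> bool" where
  "simply_connected_space T \<longleftrightarrow>
     (\<forall>p q. pathin T p \<and> p 1 = p 0 \<and> pathin T q \<and> q 1 = q 0 \<longrightarrow>
        homotopic_with (\<lambda>r. r 1 = r 0) (top_of_set {0..1::real}) T p q)"

primrec lower_central :: "'g monoid \<Rightarrow> nat \<Rightarrow> 'g set" where
  "lower_central G 0 = carrier G"
| "lower_central G (Suc k) =
     generate G {a \<otimes>\<^bsub>G\<^esub> b \<otimes>\<^bsub>G\<^esub> inv\<^bsub>G\<^esub> a \<otimes>\<^bsub>G\<^esub> inv\<^bsub>G\<^esub> b | a b. a \<in> carrier G \<and> b \<in> lower_central G k}"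

definition nilpotent_group :: "'g monoid \<Rightarrow> bool" where
  "nilpotent_group G \<longleftrightarrow> (\<exists>k. lower_central G k = {\<one>\<^bsub>G\<^esub>})"

definition discrete_subgroup :: "'g monoid \<Rightarrow> ('g, 'e) manifold \<Rightarrow> 'g set \<Rightarrow> bool" where
  "discrete_subgroup G M \<Gamma> \<longleftrightarrow>
     subgroup \<Gamma> G \<and> subtopology (mtop M) \<Gamma> = discrete_topology \<Gamma>"

text \<open>The quotient of \<open>G\<close> by the left action of \<open>\<Gamma>\<close>: its points are the orbits \<open>\<Gamma> #> g\<close>, it carries the
  quotient topology, and its charts are the charts of \<open>G\<close> on open sets that embed into the quotient.\<close>

definition quotient_manifold ::
  "'g monoid \<Rightarrow> ('g, 'e) manifold \<Rightarrow> 'g set \<Rightarrow> ('g set, 'e) manifold" where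
  "quotient_manifold G M \<Gamma> =
     \<lparr>mtop = topology (\<lambda>U. U \<subseteq> rcosets\<^bsub>G\<^esub> \<Gamma> \<and>
                        openin (mtop M) {g \<in> carrier G. \<Gamma> #>\<^bsub>G\<^esub> g \<in> U}),
      atlas = {((\<lambda>g. \<Gamma> #>\<^bsub>G\<^esub> g) ` V, \<phi> \<circ> inv_into V (\<lambda>g. \<Gamma> #>\<^bsub>G\<^esub> g)) | U V \<phi>.
                 (U, \<phi>) \<in> atlas M \<and> openin (mtop M) V \<and> V \<subseteq> U \<and>
                 inj_on (\<lambda>g. \<Gamma> #>\<^bsub>G\<^esub> g) V}\<rparr>"

definition nilmanifold_data ::
  "'g monoid \<Rightarrow> ('g, 'e::euclidean_space) manifold \<Rightarrow> 'g set \<Rightarrow> bool" where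
  "nilmanifold_data G M \<Gamma> \<longleftrightarrow>
     lie_group G M \<and> simply_connected_space (mtop M) \<and> nilpotent_group G \<and>
     discrete_subgroup G M \<Gamma> \<and> compact_space (mtop (quotient_manifold G M \<Gamma>))"

definition left_invariant_acs_on_group ::
  "'g monoid \<Rightarrow> ('g, 'e::euclidean_space) manifold \<Rightarrow> 'g acs \<Rightarrow> bool" where
  "left_invariant_acs_on_group G M J \<longleftrightarrow>
     almost_complex M J \<and>
     (\<forall>a\<in>carrier G. \<forall>g\<in>carrier G. \<forall>v\<in>tangent_space M g.
        pushforward M M (\<lambda>h. a \<otimes>\<^bsub>G\<^esub> h) (J g v) =
        J (a \<otimes>\<^bsub>G\<^esub> g) (pushforward M M (\<lambda>h. a \<otimes>\<^bsub>G\<^esub> h) v))"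

definition left_invariant_form_on_group ::
  "'g monoid \<Rightarrow> ('g, 'e::euclidean_space) manifold \<Rightarrow> 'g form \<Rightarrow> bool" where
  "left_invariant_form_on_group G M \<omega> \<longleftrightarrow>
     \<omega> \<in> forms M \<and> (\<forall>a\<in>carrier G. form_pullback M M (\<lambda>h. a \<otimes>\<^bsub>G\<^esub> h) \<omega> = \<omega>)"

definition left_invariant_acs ::
  "'g monoid \<Rightarrow> ('g, 'e::euclidean_space) manifold \<Rightarrow> 'g set \<Rightarrow> 'g set acs \<Rightarrow> bool" where
  "left_invariant_acs G M \<Gamma> J \<longleftrightarrow>
     (\<exists>J'. left_invariant_acs_on_group G M J' \<and>
        (\<forall>g\<in>carrier G. \<forall>v\<in>tangent_space M g.
           pushforward M (quotient_manifold G M \<Gamma>) (\<lambda>h. \<Gamma> #>\<^bsub>G\<^esub> h) (J' g v) =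
           J (\<Gamma> #>\<^bsub>G\<^esub> g)
             (pushforward M (quotient_manifold G M \<Gamma>) (\<lambda>h. \<Gamma> #>\<^bsub>G\<^esub> h) v)))"

definition left_invariant_forms ::
  "'g monoid \<Rightarrow> ('g, 'e::euclidean_space) manifold \<Rightarrow> 'g set \<Rightarrow> 'g set form set" where
  "left_invariant_forms G M \<Gamma> =
     {\<omega> \<in> forms (quotient_manifold G M \<Gamma>).
        left_invariant_form_on_group G M
          (form_pullback M (quotient_manifold G M \<Gamma>) (\<lambda>h. \<Gamma> #>\<^bsub>G\<^esub> h) \<omega>)}"

end

theory Submission
  imports Defs "HOL-Computational_Algebra.Polynomial"
begin

text \<open>Left-invariant forms are determined by their value at one point, whereas Dolbeault classes of
  bidegree \<open>(0, 1)\<close> are plentiful when \<open>mubar\<close> has the maximal rank \<open>r\<close> and \<open>r\<close> is also the rank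
  \<open>n choose 2\<close> of the bundle of \<open>(0, 2)\<close>-forms. For \<open>n = 2\<close> and \<open>n = 3\<close> this is the case, with
  \<open>r = 1\<close> and \<open>r = 3\<close>. Hence the map from the invariant to the full cohomology is not surjective.

  Every \<open>(0, 1)\<close>-form \<open>\<alpha>\<close> is annihilated by \<open>mubar\<close>, because there are no forms of bidegree \<open>(-1, 3)\<close>.
  As \<open>mubar\<close> maps the \<open>(1, 0)\<close>-forms onto the \<open>(0, 2)\<close>-forms near a point \<open>p\<close>, the form \<open>delbar \<alpha>\<close>
  lies in the image of \<open>mubar\<close> if \<open>\<alpha>\<close> is concentrated near \<open>p\<close>, and then \<open>\<alpha>\<close> represents a Dolbeault
  class. If that class comes from an invariant form, \<open>\<alpha>\<close> is the sum of \<open>delbar h\<close>, for a function \<open>h\<close>,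
  and of an invariant form \<open>\<omega>\<close>, at least on vectors of type \<open>(0, 1)\<close>
  (\<open>surjective_imp_mem\<close>). It remains to find an \<open>\<alpha>\<close> that is not of this kind.

  Let \<open>Z1\<close> and \<open>Z2\<close> be vector fields of type \<open>(0, 1)\<close> that are independent at \<open>p\<close>, and let
  \<open>W\<^sub>0 = Z2\<close> and \<open>W\<^sub>k\<^sub>+\<^sub>1 = [Z1, W\<^sub>k]\<close>. There are differential operators \<open>D\<^sub>k\<close> in two functions,
  with \<open>D\<^sub>k (0, g) = Z1\<^sup>k g\<close>, such that \<open>D\<^sub>k (Z1 h, Z2 h) = W\<^sub>k h\<close> for every \<open>h\<close>
  (\<open>iter_op_zero\<close>, \<open>iter_op_exact\<close>). Thus, for \<open>\<alpha> = delbar h + \<omega>\<close>, the number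
  \<open>D\<^sub>k (\<alpha> Z1, \<alpha> Z2) (p)\<close> is \<open>(W\<^sub>k h) (p) + D\<^sub>k (\<omega> Z1, \<omega> Z2) (p)\<close>. It depends only on the derivative
  of \<open>h\<close> at \<open>p\<close> and on \<open>\<omega>\<close> at \<open>p\<close>, which together range over a space of finite dimension. Therefore some
  nontrivial relation \<open>c\<^sub>0 D\<^sub>0 + \<dots> + c\<^sub>K D\<^sub>K\<close> vanishes at \<open>p\<close> on all such forms
  (\<open>finite_relation\<close>). Now let \<open>\<alpha>\<close> be \<open>u\<^sup>K \<theta>\<close>, where \<open>\<theta> Z1 = 0\<close>, \<open>\<theta> Z2\<close> does not vanish at \<open>p\<close>, and \<open>u\<close>
  is a function with \<open>u p = 0\<close> and \<open>Z1 u\<close> nonzero at \<open>p\<close>. Then \<open>D\<^sub>k (\<alpha> Z1, \<alpha> Z2) (p)\<close> is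
  \<open>Z1\<^sup>k (u\<^sup>K (\<theta> Z2)) (p)\<close>, which is \<open>0\<close> for \<open>k < K\<close> and not \<open>0\<close> for \<open>k = K\<close>. This contradicts the
  relation (\<open>not_surjective\<close>).

  Two points keep the argument global and elementary. The localization is done by a division-free form of
  Cramer's rule (\<open>adjugate_basis\<close>): there are \<open>(1, 0)\<close>-forms \<open>\<xi>\<^sub>i\<close> and pairs \<open>s\<^sub>j\<close> of fields such that
  \<open>mubar \<xi>\<^sub>i\<close> has the value \<open>d\<close> on \<open>s\<^sub>i\<close> and the value \<open>0\<close> on the other \<open>s\<^sub>j\<close>, for a function \<open>d\<close> with
  \<open>d p\<close> nonzero. Multiplication of \<open>\<alpha>\<close> by a power of \<open>d\<close> makes the solution of \<open>delbar \<alpha> = mubar \<xi>\<close>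
  smooth everywhere. And the forms are treated as alternating function-multilinear maps on lists of
  global vector fields, on which \<open>d\<close> is given by Cartan's formula; local frames enter through the
  identity in \<open>frame\<close>. That Dolbeault cohomology is a quotient in the expected way needs
  \<open>delbar (mubar \<omega>) = - mubar (delbar \<omega>)\<close>, which is the component of \<open>d\<^sup>2 = 0\<close> of bidegree \<open>(-1, 3)\<close>
  (\<open>delbc_mubc\<close>).\<close>

section \<open>Calculus of smooth functions on open sets\<close>

lemma C_k_on_transfer:
  assumes "open S"
  shows "(\<And>x. x \<in> S \<Longrightarrow> f x = g x) \<Longrightarrow> C_k_on k S f \<Longrightarrow> C_k_on k S g"
proof (induction k arbitrary: f g)
  case 0
  then show ?case by (simp cong: continuous_on_cong)
next
  case (Suc k)
  have d: "g differentiable (at x)" if "x \<in> S" for x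
    using Suc.prems that assms unfolding differentiable_def
    by (metis C_k_on.simps(2) differentiable_def has_derivative_transform_within_open)
  have e: "frechet_derivative f (at x) = frechet_derivative g (at x)" if "x \<in> S" for x
    using Suc.prems that assms frechet_derivative_transform_within_open[of f x S g] by simp
  show ?case
    unfolding C_k_on.simps
  proof (intro conjI ballI allI)
    fix v
    show "C_k_on k S (\<lambda>x. frechet_derivative g (at x) v)"
      by (rule Suc.IH[of "\<lambda>x. frechet_derivative f (at x) v"]) (use Suc.prems e in auto)
  qed (rule d)
qed

lemma C_k_on_subset: "T \<subseteq> S \<Longrightarrow> C_k_on k S f \<Longrightarrow> C_k_on k T f"
  by (induction k arbitrary: f) (auto intro: continuous_on_subset)

lemma C_k_on_local:
  assumes "\<And>x. x \<in> S \<Longrightarrow> \<exists>T. open T \<and> x \<in> T \<and> C_k_on k T f"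
  shows "C_k_on k S f"
  using assms
proof (induction k arbitrary: f)
  case 0
  have "isCont f x" if "x \<in> S" for x
    using 0[OF that] by (auto simp: continuous_on_eq_continuous_at)
  then show ?case by (simp add: continuous_at_imp_continuous_on)
next
  case (Suc k)
  show ?case
    unfolding C_k_on.simps
  proof (intro conjI ballI allI)
    fix x assume "x \<in> S"
    then show "f differentiable at x" using Suc.prems by (metis C_k_on.simps(2))
  next
    fix v
    show "C_k_on k S (\<lambda>x. frechet_derivative f (at x) v)"
    proof (rule Suc.IH)
      fix x assume "x \<in> S"
      then obtain T where "open T" "x \<in> T" "C_k_on (Suc k) T f" using Suc.prems by blast
      then show "\<exists>T. open T \<and> x \<in> T \<and> C_k_on k T (\<lambda>x. frechet_derivative f (at x) v)"
        by (intro exI[of _ T]) simp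
    qed
  qed
qed

lemma C_k_on_Suc_imp: "C_k_on (Suc k) S f \<Longrightarrow> C_k_on k S f"
proof (induction k arbitrary: f)
  case 0
  then show ?case
    by (auto intro!: continuous_at_imp_continuous_on differentiable_imp_continuous_within)
next
  case (Suc k)
  then show ?case by (metis C_k_on.simps(2))
qed

lemma C_k_on_const: "C_k_on k S (\<lambda>x. c)"
  by (induction k arbitrary: c) auto

lemma C_k_on_ident: "C_k_on k S (\<lambda>x. x)"
  by (cases k) (auto simp: C_k_on_const)

lemma C_k_on_bounded_linear:
  assumes L: "bounded_linear L" and S: "open S"
  shows "C_k_on k S f \<Longrightarrow> C_k_on k S (\<lambda>x. L (f x))"
proof (induction k arbitrary: f)
  case 0
  then show ?case using L by (auto intro: bounded_linear.continuous_on)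
next
  case (Suc k)
  have h: "((\<lambda>x. L (f x)) has_derivative (\<lambda>v. L (frechet_derivative f (at x) v))) (at x)"
    if "x \<in> S" for x
    using Suc.prems that
    by (intro bounded_linear.has_derivative[OF L]) (simp add: frechet_derivative_works)
  show ?case
    unfolding C_k_on.simps
  proof (intro conjI ballI allI)
    fix x assume "x \<in> S"
    then show "(\<lambda>x. L (f x)) differentiable at x" using h by (auto simp: differentiable_def)
  next
    fix v
    show "C_k_on k S (\<lambda>x. frechet_derivative (\<lambda>x. L (f x)) (at x) v)"
      by (rule C_k_on_transfer[OF S, of "\<lambda>x. L (frechet_derivative f (at x) v)"])
        (use Suc frechet_derivative_at[OF h] in \<open>auto simp: fun_eq_iff\<close>)
  qed
qed

lemma C_k_on_add:
  assumes S: "open S"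
  shows "C_k_on k S f \<Longrightarrow> C_k_on k S g \<Longrightarrow> C_k_on k S (\<lambda>x. f x + g x)"
proof (induction k arbitrary: f g)
  case 0
  then show ?case by (auto intro: continuous_on_add)
next
  case (Suc k)
  have h: "((\<lambda>x. f x + g x) has_derivative
      (\<lambda>v. frechet_derivative f (at x) v + frechet_derivative g (at x) v)) (at x)"
    if "x \<in> S" for x
    using Suc.prems that by (intro has_derivative_add) (simp_all add: frechet_derivative_works)
  show ?case
    unfolding C_k_on.simps
  proof (intro conjI ballI allI)
    fix x assume "x \<in> S"
    then show "(\<lambda>x. f x + g x) differentiable at x" using h by (auto simp: differentiable_def)
  next
    fix v
    show "C_k_on k S (\<lambda>x. frechet_derivative (\<lambda>x. f x + g x) (at x) v)"
      by (rule C_k_on_transfer[OF S, of "\<lambda>x. frechet_derivative f (at x) v + frechet_derivative g (at x) v"])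
        (use Suc frechet_derivative_at[OF h] in \<open>auto simp: fun_eq_iff\<close>)
  qed
qed

lemma C_k_on_bounded_bilinear:
  assumes B: "bounded_bilinear B" and S: "open S"
  shows "C_k_on k S f \<Longrightarrow> C_k_on k S g \<Longrightarrow> C_k_on k S (\<lambda>x. B (f x) (g x))"
proof (induction k arbitrary: f g)
  case 0
  then show ?case using B by (auto intro: bounded_bilinear.continuous_on)
next
  case (Suc k)
  have h: "((\<lambda>x. B (f x) (g x)) has_derivative
      (\<lambda>v. B (f x) (frechet_derivative g (at x) v) + B (frechet_derivative f (at x) v) (g x))) (at x)"
    if "x \<in> S" for x
    using Suc.prems that
    by (intro bounded_bilinear.FDERIV[OF B]) (simp_all add: frechet_derivative_works)
  show ?case
    unfolding C_k_on.simps
  proof (intro conjI ballI allI)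
    fix x assume "x \<in> S"
    then show "(\<lambda>x. B (f x) (g x)) differentiable at x" using h by (auto simp: differentiable_def)
  next
    fix v
    have "C_k_on k S (\<lambda>x. B (f x) (frechet_derivative g (at x) v) + B (frechet_derivative f (at x) v) (g x))"
      using C_k_on_Suc_imp[OF Suc.prems(1)] C_k_on_Suc_imp[OF Suc.prems(2)] Suc.prems
      by (intro C_k_on_add[OF S] Suc.IH) auto
    then show "C_k_on k S (\<lambda>x. frechet_derivative (\<lambda>x. B (f x) (g x)) (at x) v)"
      by (rule C_k_on_transfer[OF S, rotated]) (use frechet_derivative_at[OF h] in \<open>auto simp: fun_eq_iff\<close>)
  qed
qed

lemma C_k_on_sum:
  assumes S: "open S" and "finite I" "\<And>i. i \<in> I \<Longrightarrow> C_k_on k S (f i)"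
  shows "C_k_on k S (\<lambda>x. \<Sum>i\<in>I. f i x)"
  using assms(2,3) by (induction I rule: finite_induct) (auto intro: C_k_on_const C_k_on_add[OF S])

text \<open>The chain rule in coordinates expresses the derivative of the composition by sums of products, so
  that the closure properties of the class of order \<open>k\<close> apply.\<close>

lemma C_k_on_compose:
  fixes f :: "'e::euclidean_space \<Rightarrow> 'b::real_normed_vector" and g :: "'d::euclidean_space \<Rightarrow> 'e"
  assumes S: "open S" and T: "open T"
  shows "g ` S \<subseteq> T \<Longrightarrow> C_k_on k T f \<Longrightarrow> C_k_on k S g \<Longrightarrow> C_k_on k S (\<lambda>x. f (g x))"
proof (induction k arbitrary: f)
  case 0
  then show ?case by (auto intro: continuous_on_compose2)
next
  case (Suc k)
  have h: "((\<lambda>x. f (g x)) has_derivative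
      (\<lambda>v. \<Sum>i\<in>Basis. (frechet_derivative g (at x) v \<bullet> i) *\<^sub>R frechet_derivative f (at (g x)) i)) (at x)"
    if x: "x \<in> S" for x
  proof -
    have f: "(f has_derivative frechet_derivative f (at (g x))) (at (g x))"
      using Suc.prems x by (subst frechet_derivative_works[symmetric]) auto
    have g: "(g has_derivative frechet_derivative g (at x)) (at x)"
      using Suc.prems x by (subst frechet_derivative_works[symmetric]) auto
    have lin: "linear (frechet_derivative f (at (g x)))" using f by (rule has_derivative_linear)
    have rep: "frechet_derivative f (at (g x)) w = (\<Sum>i\<in>Basis. (w \<bullet> i) *\<^sub>R frechet_derivative f (at (g x)) i)" for w
      by (subst (1) euclidean_representation[of w, symmetric])
        (simp add: linear_sum[OF lin] linear_scale[OF lin])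
    have "(\<lambda>v. frechet_derivative f (at (g x)) (frechet_derivative g (at x) v)) =
        (\<lambda>v. \<Sum>i\<in>Basis. (frechet_derivative g (at x) v \<bullet> i) *\<^sub>R frechet_derivative f (at (g x)) i)"
      by (rule ext) (rule rep)
    then show ?thesis
      using diff_chain_at[OF g f] by (simp only: o_def)
  qed
  show ?case
    unfolding C_k_on.simps
  proof (intro conjI ballI allI)
    fix x assume "x \<in> S"
    then show "(\<lambda>x. f (g x)) differentiable at x" using h by (auto simp: differentiable_def)
  next
    fix v
    have "C_k_on k S (\<lambda>x. \<Sum>i\<in>Basis. (frechet_derivative g (at x) v \<bullet> i) *\<^sub>R frechet_derivative f (at (g x)) i)"
    proof (rule C_k_on_sum[OF S finite_Basis])
      fix i :: 'e
      have "C_k_on k S (\<lambda>x. frechet_derivative g (at x) v \<bullet> i)"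
        by (rule C_k_on_bounded_linear[OF bounded_linear_inner_left S]) (use Suc.prems in auto)
      moreover have "C_k_on k S (\<lambda>x. frechet_derivative f (at (g x)) i)"
        by (rule Suc.IH) (use Suc.prems C_k_on_Suc_imp[OF Suc.prems(3)] in auto)
      ultimately show "C_k_on k S (\<lambda>x. (frechet_derivative g (at x) v \<bullet> i) *\<^sub>R frechet_derivative f (at (g x)) i)"
        by (rule C_k_on_bounded_bilinear[OF bounded_bilinear_scaleR S])
    qed
    then show "C_k_on k S (\<lambda>x. frechet_derivative (\<lambda>x. f (g x)) (at x) v)"
      by (rule C_k_on_transfer[OF S, rotated]) (use frechet_derivative_at[OF h] in \<open>auto simp: fun_eq_iff\<close>)
  qed
qed

lemma smooth_on_transfer:
  "open S \<Longrightarrow> smooth_on S f \<Longrightarrow> (\<And>x. x \<in> S \<Longrightarrow> f x = g x) \<Longrightarrow> smooth_on S g"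
  unfolding smooth_on_def using C_k_on_transfer by metis

lemma smooth_on_subset: "smooth_on S f \<Longrightarrow> T \<subseteq> S \<Longrightarrow> smooth_on T f"
  unfolding smooth_on_def using C_k_on_subset by metis

lemma smooth_on_local:
  assumes "\<And>x. x \<in> S \<Longrightarrow> \<exists>T. open T \<and> x \<in> T \<and> smooth_on T f"
  shows "smooth_on S f"
  unfolding smooth_on_def
proof
  fix k show "C_k_on k S f"
  proof (rule C_k_on_local)
    fix x assume "x \<in> S"
    then obtain T where "open T" "x \<in> T" "smooth_on T f" using assms by blast
    then show "\<exists>T. open T \<and> x \<in> T \<and> C_k_on k T f" unfolding smooth_on_def by blast
  qed
qed

lemma smooth_on_const: "smooth_on S (\<lambda>x. c)"
  by (simp add: smooth_on_def C_k_on_const)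

lemma smooth_on_ident: "smooth_on S (\<lambda>x. x)"
  by (simp add: smooth_on_def C_k_on_ident)

lemma smooth_on_bounded_linear:
  "bounded_linear L \<Longrightarrow> open S \<Longrightarrow> smooth_on S f \<Longrightarrow> smooth_on S (\<lambda>x. L (f x))"
  by (simp add: smooth_on_def C_k_on_bounded_linear)

lemma smooth_on_add: "open S \<Longrightarrow> smooth_on S f \<Longrightarrow> smooth_on S g \<Longrightarrow> smooth_on S (\<lambda>x. f x + g x)"
  by (simp add: smooth_on_def C_k_on_add)

lemma smooth_on_bounded_bilinear:
  "bounded_bilinear B \<Longrightarrow> open S \<Longrightarrow> smooth_on S f \<Longrightarrow> smooth_on S g \<Longrightarrow> smooth_on S (\<lambda>x. B (f x) (g x))"
  by (simp add: smooth_on_def C_k_on_bounded_bilinear)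

lemmas smooth_on_mult = smooth_on_bounded_bilinear[OF bounded_bilinear_mult]

lemma smooth_on_compose:
  "open S \<Longrightarrow> open T \<Longrightarrow> g ` S \<subseteq> T \<Longrightarrow> smooth_on T f \<Longrightarrow> smooth_on S g \<Longrightarrow> smooth_on S (\<lambda>x. f (g x))"
  by (simp add: smooth_on_def C_k_on_compose)

lemma smooth_on_derivative: "smooth_on S f \<Longrightarrow> smooth_on S (\<lambda>x. frechet_derivative f (at x) v)"
  by (metis C_k_on.simps(2) smooth_on_def)

lemma smooth_on_differentiable: "smooth_on S f \<Longrightarrow> x \<in> S \<Longrightarrow> f differentiable (at x)"
  by (metis C_k_on.simps(2) smooth_on_def)

lemma smooth_on_extend_by_zero:
  assumes "open B" "closed K" "K \<subseteq> B" "smooth_on B f" "\<And>y. y \<in> B - K \<Longrightarrow> f y = 0"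
  shows "smooth_on UNIV (\<lambda>y. if y \<in> B then f y else 0)"
proof (rule smooth_on_local)
  fix x :: 'a
  show "\<exists>T. open T \<and> x \<in> T \<and> smooth_on T (\<lambda>y. if y \<in> B then f y else 0)"
  proof (cases "x \<in> B")
    case True
    then show ?thesis
      using assms by (intro exI[of _ B]) (auto intro: smooth_on_transfer[of B f])
  next
    case False
    have "smooth_on (- K) (\<lambda>y. if y \<in> B then f y else 0)"
      by (rule smooth_on_transfer[of "- K" "\<lambda>_. 0"]) (use assms in \<open>auto intro: smooth_on_const\<close>)
    then show ?thesis
      using assms False by (intro exI[of _ "- K"]) auto
  qed
qed

section \<open>A smooth function supported in a ball\<close>

text \<open>The functions \<open>p (1/x) exp (-1/x)\<close>, continued by zero to \<open>x \<le> 0\<close>, are closed under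
  differentiation; hence all of them are smooth.\<close>

definition flat_fun :: "real poly \<Rightarrow> real \<Rightarrow> real" where
  "flat_fun p x = (if x \<le> 0 then 0 else poly p (inverse x) * exp (- inverse x))"

lemma poly_times_exp_tendsto_0: "((\<lambda>y::real. poly p y * exp (- y)) \<longlongrightarrow> 0) at_top"
proof -
  have "((\<lambda>y::real. \<Sum>i\<le>degree p. coeff p i * (y ^ i / exp y)) \<longlongrightarrow> (\<Sum>i\<le>degree p. coeff p i * 0)) at_top"
    by (rule tendsto_sum) (rule tendsto_mult[OF tendsto_const tendsto_power_div_exp_0])
  then show ?thesis
    by (simp add: poly_altdef sum_distrib_right exp_minus divide_inverse mult.assoc)
qed

lemma flat_fun_deriv:
  "(flat_fun p has_real_derivative flat_fun ([:0, 0, 1:] * (p - pderiv p)) x) (at x)"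
proof -
  consider "x < 0" | "x > 0" | "x = 0" by linarith
  then show ?thesis
  proof cases
    case 1
    have "((\<lambda>_. 0) has_real_derivative 0) (at x)" by simp
    then have "(flat_fun p has_real_derivative 0) (at x)"
      by (rule has_field_derivative_transform_within_open[of _ _ _ "{..<0}"])
        (use 1 in \<open>auto simp: flat_fun_def\<close>)
    then show ?thesis using 1 by (simp add: flat_fun_def)
  next
    case 2
    have "((\<lambda>x. poly p (inverse x) * exp (- inverse x)) has_real_derivative
        flat_fun ([:0, 0, 1:] * (p - pderiv p)) x) (at x)"
      using 2
      by (auto intro!: derivative_eq_intros DERIV_chain2[OF poly_DERIV] simp: flat_fun_def field_simps power2_eq_square)
    then show ?thesis
      by (rule has_field_derivative_transform_within_open[of _ _ _ "{0<..}"])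
        (use 2 in \<open>auto simp: flat_fun_def\<close>)
  next
    case 3
    have "((\<lambda>h. flat_fun p h / h) \<longlongrightarrow> 0) (at 0)"
      unfolding filterlim_at_split
    proof
      show "((\<lambda>h. flat_fun p h / h) \<longlongrightarrow> 0) (at_left 0)"
        by (rule tendsto_eventually) (auto simp: eventually_at flat_fun_def intro!: exI[of _ 1])
      have "((\<lambda>h. poly (pCons 0 p) (inverse h) * exp (- inverse h)) \<longlongrightarrow> 0) (at_right (0::real))"
        using filterlim_compose[OF poly_times_exp_tendsto_0 filterlim_inverse_at_top_right] .
      moreover have "\<forall>\<^sub>F h in at_right 0. poly (pCons 0 p) (inverse h) * exp (- inverse h) = flat_fun p h / h"
        by (auto simp: eventually_at flat_fun_def field_simps intro!: exI[of _ 1])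
      ultimately show "((\<lambda>h. flat_fun p h / h) \<longlongrightarrow> 0) (at_right 0)"
        by (rule Lim_transform_eventually)
    qed
    then show ?thesis using 3 by (simp add: has_field_derivative_iff flat_fun_def)
  qed
qed

lemma smooth_on_flat_fun: "smooth_on UNIV (flat_fun p)"
  unfolding smooth_on_def
proof
  fix k show "C_k_on k UNIV (flat_fun p)"
  proof (induction k arbitrary: p)
    case 0
    then show ?case
      using flat_fun_deriv by (auto intro!: continuous_at_imp_continuous_on DERIV_isCont)
  next
    case (Suc k)
    have h: "(flat_fun p has_derivative (\<lambda>v. flat_fun ([:0, 0, 1:] * (p - pderiv p)) x * v)) (at x)" for x
      using flat_fun_deriv[of p x] by (simp add: has_field_derivative_def)
    have e: "frechet_derivative (flat_fun p) (at x) v = flat_fun ([:0, 0, 1:] * (p - pderiv p)) x * v" for x v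
      by (simp add: frechet_derivative_at[OF h, symmetric])
    have "C_k_on k UNIV (\<lambda>x. flat_fun ([:0, 0, 1:] * (p - pderiv p)) x * v)" for v
      by (rule C_k_on_bounded_linear[OF bounded_linear_mult_left open_UNIV Suc])
    then show ?case
      unfolding C_k_on.simps e using h by (auto simp: differentiable_def)
  qed
qed

lemma smooth_bump_exists:
  fixes a :: "'e::euclidean_space"
  assumes "r > 0"
  obtains \<beta> :: "'e \<Rightarrow> real" where "smooth_on UNIV \<beta>" "\<beta> a \<noteq> 0" "\<And>y. y \<notin> cball a r \<Longrightarrow> \<beta> y = 0"
proof
  let ?\<beta> = "\<lambda>y. flat_fun 1 (r\<^sup>2 + - 1 * ((y - a) \<bullet> (y - a)))"
  have s: "smooth_on UNIV (\<lambda>y. y + - a)"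
    by (intro smooth_on_add smooth_on_ident smooth_on_const open_UNIV)
  have "smooth_on UNIV (\<lambda>y. r\<^sup>2 + - 1 * ((y + - a) \<bullet> (y + - a)))"
    by (intro smooth_on_add smooth_on_mult smooth_on_const open_UNIV
        smooth_on_bounded_bilinear[OF bounded_bilinear_inner] s)
  from smooth_on_compose[OF open_UNIV open_UNIV subset_UNIV smooth_on_flat_fun this]
  show "smooth_on UNIV ?\<beta>" by simp
  show "?\<beta> a \<noteq> 0" using assms by (simp add: flat_fun_def)
  fix y assume "y \<notin> cball a r"
  then have "r < norm (y - a)" by (simp add: dist_norm norm_minus_commute)
  then have "r\<^sup>2 < (norm (y - a))\<^sup>2" using assms by (intro power_strict_mono) auto
  then show "?\<beta> y = 0" by (simp add: flat_fun_def power2_norm_eq_inner)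
qed

section \<open>Hadamard's lemma\<close>

text \<open>Differentiation under the integral sign multiplies the integrand by \<open>t\<close> and replaces \<open>h\<close> by a
  partial derivative; the power \<open>t ^ m\<close> makes the statement stable under this.\<close>

lemma smooth_on_averaged:
  fixes h :: "'e::euclidean_space \<Rightarrow> real"
  assumes S: "open S" "convex S" "a \<in> S"
  shows "smooth_on S h \<Longrightarrow> C_k_on k S (\<lambda>y. integral (cbox 0 1) (\<lambda>t. t ^ m * h (a + t *\<^sub>R (y - a))))"
proof (induction k arbitrary: h m)
  have seg: "a + t *\<^sub>R (y - a) \<in> S" if "y \<in> S" "t \<in> cbox 0 1" for y t
    using convexD_alt[OF S(2,3) that(1), of t] that by (simp add: algebra_simps)
  have cont: "continuous_on (S \<times> cbox 0 1) (\<lambda>(y, t). t ^ m * h (a + t *\<^sub>R (y - a)))"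
    if "smooth_on S h" for h :: "'e \<Rightarrow> real" and m
  proof -
    have "continuous_on S h" using that by (metis C_k_on.simps(1) smooth_on_def)
    then have "continuous_on (S \<times> cbox 0 1) (\<lambda>z. h (a + snd z *\<^sub>R (fst z - a)))"
      by (rule continuous_on_compose2) (use seg in \<open>auto intro!: continuous_intros\<close>)
    then show ?thesis by (auto intro!: continuous_intros simp: split_beta)
  qed
  have int: "(\<lambda>t. t ^ m * h (a + t *\<^sub>R (y - a))) integrable_on cbox 0 1"
    if "smooth_on S h" "y \<in> S" for h :: "'e \<Rightarrow> real" and m y
  proof (rule integrable_continuous)
    have "continuous_on (cbox 0 1) ((\<lambda>(y, t). t ^ m * h (a + t *\<^sub>R (y - a))) \<circ> Pair y)"
      by (intro continuous_on_compose continuous_intros continuous_on_subset[OF cont[OF that(1)]])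
        (use that in auto)
    then show "continuous_on (cbox 0 1) (\<lambda>t. t ^ m * h (a + t *\<^sub>R (y - a)))" by (simp add: o_def)
  qed
  {
    case 0
    show ?case
      unfolding C_k_on.simps by (rule integral_continuous_on_param[OF cont[OF 0]])
  next
    case (Suc k)
    define D where "D i = (\<lambda>x. frechet_derivative h (at x) i)" for i
    have Ds: "smooth_on S (D i)" for i unfolding D_def by (rule smooth_on_derivative[OF Suc.prems])
    define fx where "fx y t = (\<Sum>i\<in>Basis. (t ^ Suc m * D i (a + t *\<^sub>R (y - a))) *\<^sub>R blinfun_inner_left i)"
      for y t
    have h: "(h has_derivative (\<lambda>v. \<Sum>i\<in>Basis. D i x * (v \<bullet> i))) (at x)" if "x \<in> S" for x
    proof -
      have d: "(h has_derivative frechet_derivative h (at x)) (at x)"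
        using smooth_on_differentiable[OF Suc.prems that] frechet_derivative_works by blast
      have lin: "linear (frechet_derivative h (at x))" using d by (rule has_derivative_linear)
      have "frechet_derivative h (at x) w = (\<Sum>i\<in>Basis. D i x * (w \<bullet> i))" for w
        by (subst (1) euclidean_representation[of w, symmetric])
          (simp add: linear_sum[OF lin] linear_scale[OF lin] D_def mult.commute)
      then show ?thesis using d by (metis (no_types, lifting) ext)
    qed
    have der: "((\<lambda>y. integral (cbox 0 1) (\<lambda>t. t ^ m * h (a + t *\<^sub>R (y - a)))) has_derivative
        integral (cbox 0 1) (fx y)) (at y within S)" if y: "y \<in> S" for y
    proof (rule leibniz_rule)
      fix x t assume xt: "x \<in> S" "t \<in> cbox 0 (1::real)"
      have "((\<lambda>x. a + t *\<^sub>R (x - a)) has_derivative (\<lambda>v. t *\<^sub>R v)) (at x)"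
        by (auto intro!: derivative_eq_intros)
      from has_derivative_compose[OF this h[OF seg[OF xt]]]
      have "((\<lambda>x. t ^ m * h (a + t *\<^sub>R (x - a))) has_derivative
        (\<lambda>v. t ^ m * (\<Sum>i\<in>Basis. D i (a + t *\<^sub>R (x - a)) * (t *\<^sub>R v \<bullet> i)))) (at x)"
        by (rule has_derivative_mult_right)
      moreover have "(\<lambda>v. t ^ m * (\<Sum>i\<in>Basis. D i (a + t *\<^sub>R (x - a)) * (t *\<^sub>R v \<bullet> i))) = blinfun_apply (fx x t)"
        by (auto simp: fx_def fun_eq_iff blinfun.sum_left blinfun.scaleR_left sum_distrib_left algebra_simps)
      ultimately show "((\<lambda>x. t ^ m * h (a + t *\<^sub>R (x - a))) has_derivative blinfun_apply (fx x t)) (at x within S)"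
        by (simp add: has_derivative_at_withinI)
    next
      show "continuous_on (S \<times> cbox 0 1) (\<lambda>(x, t). fx x t)"
        unfolding fx_def split_beta
        by (intro continuous_intros) (use cont[OF Ds, of 0] in \<open>auto simp: split_beta\<close>)
    qed (use int[OF Suc.prems] y S in auto)
    have fxint: "blinfun_apply (integral (cbox 0 1) (fx y)) v =
        (\<Sum>i\<in>Basis. integral (cbox 0 1) (\<lambda>t. t ^ Suc m * D i (a + t *\<^sub>R (y - a))) * (v \<bullet> i))"
      if y: "y \<in> S" for y v
    proof -
      have i: "(\<lambda>t. (t ^ Suc m * D i (a + t *\<^sub>R (y - a))) *\<^sub>R blinfun_inner_left i) integrable_on cbox 0 1" for i :: 'e
        by (rule integrable_linear[OF int[OF Ds y] bounded_linear_scaleR_left, unfolded o_def])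
      then have "integral (cbox 0 1) (fx y) =
         (\<Sum>i\<in>Basis. integral (cbox 0 1) (\<lambda>t. (t ^ Suc m * D i (a + t *\<^sub>R (y - a))) *\<^sub>R blinfun_inner_left i))"
        unfolding fx_def by (intro integral_sum) auto
      also have "\<dots> = (\<Sum>i\<in>Basis. integral (cbox 0 1) (\<lambda>t. t ^ Suc m * D i (a + t *\<^sub>R (y - a))) *\<^sub>R blinfun_inner_left i)"
        by (rule sum.cong[OF refl], rule integral_linear[OF int[OF Ds y] bounded_linear_scaleR_left, unfolded o_def])
      finally show ?thesis by (simp add: blinfun.sum_left blinfun.scaleR_left inner_commute)
    qed
    have der': "((\<lambda>y. integral (cbox 0 1) (\<lambda>t. t ^ m * h (a + t *\<^sub>R (y - a)))) has_derivative
       (\<lambda>v. \<Sum>i\<in>Basis. integral (cbox 0 1) (\<lambda>t. t ^ Suc m * D i (a + t *\<^sub>R (y - a))) * (v \<bullet> i))) (at y)"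
      if y: "y \<in> S" for y
      using der[OF y] fxint[OF y] at_within_open[OF y S(1)] by (metis (no_types, lifting) ext)
    show ?case
      unfolding C_k_on.simps
    proof (intro conjI ballI allI)
      fix v
      have "C_k_on k S (\<lambda>y. \<Sum>i\<in>Basis. integral (cbox 0 1) (\<lambda>t. t ^ Suc m * D i (a + t *\<^sub>R (y - a))) * (v \<bullet> i))"
        by (intro C_k_on_sum S finite_Basis C_k_on_bounded_linear[OF bounded_linear_mult_left] Suc.IH Ds)
      then show "C_k_on k S (\<lambda>x. frechet_derivative (\<lambda>y. integral (cbox 0 1) (\<lambda>t. t ^ m * h (a + t *\<^sub>R (y - a)))) (at x) v)"
        by (rule C_k_on_transfer[OF S(1), rotated]) (use frechet_derivative_at[OF der'] in \<open>auto simp: fun_eq_iff\<close>)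
    qed (use der' in \<open>auto simp: differentiable_def\<close>)
  }
qed

text \<open>The functions \<open>g i\<close> are the averages of the partial derivatives of \<open>f\<close> along the segments from \<open>a\<close>,
  by the fundamental theorem of calculus. They determine the effect of a derivation on \<open>f\<close>.\<close>

lemma hadamard:
  fixes f :: "'e::euclidean_space \<Rightarrow> real"
  assumes S: "open S" "convex S" "a \<in> S" and f: "smooth_on S f"
  obtains g where "\<And>i. smooth_on S (g i)"
    "\<And>y. y \<in> S \<Longrightarrow> f y = f a + (\<Sum>i\<in>Basis. ((y - a) \<bullet> i) * g i y)"
    "\<And>i. g i a = frechet_derivative f (at a) i"
proof
  define D where "D i = (\<lambda>x. frechet_derivative f (at x) i)" for i
  have Ds: "smooth_on S (D i)" for i unfolding D_def by (rule smooth_on_derivative[OF f])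
  let ?g = "\<lambda>i y. integral (cbox 0 1) (\<lambda>t::real. t ^ 0 * D i (a + t *\<^sub>R (y - a)))"
  show "smooth_on S (?g i)" for i
    unfolding smooth_on_def using smooth_on_averaged[OF S Ds] by blast
  show "?g i a = frechet_derivative f (at a) i" for i
    by (simp add: D_def)
  fix y assume y: "y \<in> S"
  have seg: "a + t *\<^sub>R (y - a) \<in> S" if "t \<in> {0..1}" for t
    using convexD_alt[OF S(2,3) y, of t] that by (simp add: algebra_simps)
  have d: "((\<lambda>t. f (a + t *\<^sub>R (y - a))) has_vector_derivative (\<Sum>i\<in>Basis. ((y - a) \<bullet> i) * D i (a + t *\<^sub>R (y - a)))) (at t within {0..1})"
    if t: "t \<in> {0..1}" for t
  proof -
    let ?x = "a + t *\<^sub>R (y - a)"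
    have h: "(f has_derivative frechet_derivative f (at ?x)) (at ?x)"
      using smooth_on_differentiable[OF f seg[OF t]] frechet_derivative_works by blast
    have lin: "linear (frechet_derivative f (at ?x))" using h by (rule has_derivative_linear)
    have e: "frechet_derivative f (at ?x) (y - a) = (\<Sum>i\<in>Basis. ((y - a) \<bullet> i) * D i ?x)"
      by (subst (2) euclidean_representation[of "y - a", symmetric])
        (simp only: linear_sum[OF lin] linear_scale[OF lin] D_def, simp)
    have "((\<lambda>t. a + t *\<^sub>R (y - a)) has_derivative (\<lambda>s. s *\<^sub>R (y - a))) (at t within {0..1})"
      by (auto intro!: derivative_eq_intros)
    from has_derivative_compose[OF this h]
    have "((\<lambda>t. f (a + t *\<^sub>R (y - a))) has_derivative (\<lambda>s. frechet_derivative f (at ?x) (s *\<^sub>R (y - a)))) (at t within {0..1})"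
      .
    then show ?thesis
      unfolding has_vector_derivative_def linear_scale[OF lin] e .
  qed
  have "((\<lambda>t. \<Sum>i\<in>Basis. ((y - a) \<bullet> i) * D i (a + t *\<^sub>R (y - a))) has_integral
      f (a + 1 *\<^sub>R (y - a)) - f (a + 0 *\<^sub>R (y - a))) {0..1}"
    by (rule fundamental_theorem_of_calculus[OF _ d]) simp_all
  moreover have "(\<lambda>t. D i (a + t *\<^sub>R (y - a))) integrable_on {0..1}" for i
  proof (rule integrable_continuous_interval)
    have "continuous_on S (D i)" using Ds[of i] by (metis C_k_on.simps(1) smooth_on_def)
    then show "continuous_on {0..1} (\<lambda>t. D i (a + t *\<^sub>R (y - a)))"
      by (rule continuous_on_compose2) (use seg in \<open>auto intro!: continuous_intros\<close>)
  qed
  then have "((\<lambda>t. \<Sum>i\<in>Basis. ((y - a) \<bullet> i) * D i (a + t *\<^sub>R (y - a))) has_integral (\<Sum>i\<in>Basis. ((y - a) \<bullet> i) * ?g i y)) {0..1}"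
    by (intro has_integral_sum has_integral_mult_right) (auto intro: integrable_integral)
  ultimately show "f y = f a + (\<Sum>i\<in>Basis. ((y - a) \<bullet> i) * ?g i y)"
    by (metis (no_types, lifting) add_diff_cancel_left' diff_add_cancel add.commute
        has_integral_unique scaleR_one scaleR_zero_left add.right_neutral)
qed

section \<open>Charts, smooth functions and tangent vectors\<close>

locale charted =
  fixes M :: "('a, 'e::euclidean_space) manifold"
  assumes hausdorff: "Hausdorff_space (mtop M)"
    and cover: "(\<Union>(U, \<phi>)\<in>atlas M. U) = points M"
    and chart_open: "(U, \<phi>) \<in> atlas M \<Longrightarrow> openin (mtop M) U"
    and chart_open_image: "(U, \<phi>) \<in> atlas M \<Longrightarrow> open (\<phi> ` U)"
    and chart_homeo: "(U, \<phi>) \<in> atlas M \<Longrightarrow>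
      homeomorphic_map (subtopology (mtop M) U) (top_of_set (\<phi> ` U)) \<phi>"
    and transition: "(U, \<phi>) \<in> atlas M \<Longrightarrow> (V, \<psi>) \<in> atlas M \<Longrightarrow>
      smooth_on (\<phi> ` (U \<inter> V)) (\<psi> \<circ> inv_into U \<phi>)"

lemma smooth_manifold_charted: "smooth_manifold M \<Longrightarrow> charted M"
  unfolding smooth_manifold_def charted_def by fast

context charted
begin

abbreviation "S \<equiv> (smooth_fun M :: ('a \<Rightarrow> real) set)"
abbreviation "SC \<equiv> (smooth_fun M :: ('a \<Rightarrow> complex) set)"
abbreviation "T x \<equiv> (tangent_space M x :: ('a, complex) tvec set)"
abbreviation "VF \<equiv> (vector_fields M :: ('a \<Rightarrow> ('a, complex) tvec) set)"

lemma chart_subset: "(U, \<phi>) \<in> atlas M \<Longrightarrow> U \<subseteq> points M"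
  using chart_open openin_subset by blast

lemma chart_at:
  assumes "x \<in> points M" obtains U \<phi> where "(U, \<phi>) \<in> atlas M" "x \<in> U"
  using assms cover by blast

lemma chart_inj: "(U, \<phi>) \<in> atlas M \<Longrightarrow> inj_on \<phi> U"
  using homeomorphic_imp_injective_map[OF chart_homeo[of U \<phi>]] chart_subset[of U \<phi>]
  by (simp add: inf.absorb2)

lemma chart_open_map:
  assumes "(U, \<phi>) \<in> atlas M" "openin (mtop M) W" "W \<subseteq> U"
  shows "open (\<phi> ` W)"
proof -
  have "openin (top_of_set (\<phi> ` U)) (\<phi> ` W)"
    using homeomorphic_imp_open_map[OF chart_homeo[OF assms(1)]] assms
    by (auto simp: open_map_def openin_open_subtopology chart_open)
  then show ?thesis
    using openin_open_trans chart_open_image[OF assms(1)] by blast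
qed

lemma chart_compact_closed:
  assumes "(U, \<phi>) \<in> atlas M" "compact K" "K \<subseteq> \<phi> ` U"
  shows "closedin (mtop M) (inv_into U \<phi> ` K)"
proof -
  have e: "\<phi> ` inv_into U \<phi> ` K = K" using assms(3) by (simp add: image_inv_into_cancel)
  have s: "inv_into U \<phi> ` K \<subseteq> U" using assms(3) by (auto intro: inv_into_into)
  have "compactin (top_of_set (\<phi> ` U)) K"
    using assms by (simp add: compactin_subtopology)
  then have "compactin (subtopology (mtop M) U) (inv_into U \<phi> ` K)"
    using homeomorphic_map_compactness[OF chart_homeo[OF assms(1)], of "inv_into U \<phi> ` K"] s e
      chart_subset[OF assms(1)] by auto
  then show ?thesis
    using compactin_imp_closedin[OF hausdorff] by (simp add: compactin_subtopology)
qed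

lemma smooth_fun_outside: "f \<in> smooth_fun M \<Longrightarrow> x \<notin> points M \<Longrightarrow> f x = 0"
  by (simp add: smooth_fun_def)

lemma smooth_fun_chart:
  "f \<in> smooth_fun M \<Longrightarrow> (U, \<phi>) \<in> atlas M \<Longrightarrow> smooth_on (\<phi> ` U) (\<lambda>y. f (inv_into U \<phi> y))"
  by (auto simp: smooth_fun_def o_def)

lemma smooth_funI:
  assumes "\<And>x. x \<notin> points M \<Longrightarrow> f x = 0"
    and "\<And>U \<phi>. (U, \<phi>) \<in> atlas M \<Longrightarrow> smooth_on (\<phi> ` U) (\<lambda>y. f (inv_into U \<phi> y))"
  shows "f \<in> smooth_fun M"
  using assms by (auto simp: smooth_fun_def o_def)

lemma smooth_fun_add [intro]: "f \<in> smooth_fun M \<Longrightarrow> g \<in> smooth_fun M \<Longrightarrow> (\<lambda>x. f x + g x) \<in> smooth_fun M"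
  by (rule smooth_funI, simp add: smooth_fun_outside,
      rule smooth_on_add[OF chart_open_image smooth_fun_chart smooth_fun_chart])

lemma smooth_fun_bounded_linear:
  "bounded_linear L \<Longrightarrow> f \<in> smooth_fun M \<Longrightarrow> (\<lambda>x. L (f x)) \<in> smooth_fun M"
  by (rule smooth_funI, simp add: smooth_fun_outside linear_0 bounded_linear.linear,
      rule smooth_on_bounded_linear[OF _ chart_open_image smooth_fun_chart])

lemma smooth_fun_bounded_bilinear:
  "bounded_bilinear B \<Longrightarrow> f \<in> smooth_fun M \<Longrightarrow> g \<in> smooth_fun M \<Longrightarrow> (\<lambda>x. B (f x) (g x)) \<in> smooth_fun M"
  by (rule smooth_funI, simp add: smooth_fun_outside bounded_bilinear.zero_left,
      rule smooth_on_bounded_bilinear[OF _ chart_open_image smooth_fun_chart smooth_fun_chart])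

lemma smooth_fun_mult [intro]:
  fixes f g :: "'a \<Rightarrow> 'b::real_normed_algebra"
  shows "f \<in> smooth_fun M \<Longrightarrow> g \<in> smooth_fun M \<Longrightarrow> (\<lambda>x. f x * g x) \<in> smooth_fun M"
  by (rule smooth_fun_bounded_bilinear[OF bounded_bilinear_mult])

lemma smooth_fun_cmult [intro]:
  fixes f :: "'a \<Rightarrow> 'b::real_normed_algebra"
  shows "f \<in> smooth_fun M \<Longrightarrow> (\<lambda>x. c * f x) \<in> smooth_fun M"
  by (rule smooth_fun_bounded_linear[OF bounded_linear_mult_right])

lemma smooth_fun_zero [intro, simp]: "(\<lambda>x. 0) \<in> smooth_fun M"
  by (rule smooth_funI) (auto intro: smooth_on_const)

lemma smooth_fun_uminus [intro]: "f \<in> smooth_fun M \<Longrightarrow> (\<lambda>x. - f x) \<in> smooth_fun M"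
  by (rule smooth_fun_bounded_linear[OF bounded_linear_minus[OF bounded_linear_ident]])

lemma smooth_fun_diff [intro]: "f \<in> smooth_fun M \<Longrightarrow> g \<in> smooth_fun M \<Longrightarrow> (\<lambda>x. f x - g x) \<in> smooth_fun M"
  using smooth_fun_add[OF _ smooth_fun_uminus, of f g] by simp

lemma smooth_fun_sum [intro]:
  "(\<And>i. i \<in> I \<Longrightarrow> f i \<in> smooth_fun M) \<Longrightarrow> (\<lambda>x. \<Sum>i\<in>I. f i x) \<in> smooth_fun M"
  by (induction I rule: infinite_finite_induct) auto

lemma smooth_fun_const: "(\<lambda>x. if x \<in> points M then c else 0) \<in> smooth_fun M"
proof (rule smooth_funI)
  fix U \<phi> assume c: "(U, \<phi>) \<in> atlas M"
  show "smooth_on (\<phi> ` U) (\<lambda>y. if inv_into U \<phi> y \<in> points M then c else 0)"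
    by (rule smooth_on_transfer[OF chart_open_image[OF c] smooth_on_const[of _ c]])
      (use chart_subset[OF c] in \<open>auto simp: inv_into_f_f chart_inj[OF c]\<close>)
qed auto

lemma SC_of_real [intro]: "f \<in> S \<Longrightarrow> (\<lambda>x. complex_of_real (f x)) \<in> SC"
  by (rule smooth_fun_bounded_linear[OF bounded_linear_of_real])

lemma SC_Re [intro]: "h \<in> SC \<Longrightarrow> (\<lambda>x. Re (h x)) \<in> S"
  by (rule smooth_fun_bounded_linear[OF bounded_linear_Re])

lemma SC_Im [intro]: "h \<in> SC \<Longrightarrow> (\<lambda>x. Im (h x)) \<in> S"
  by (rule smooth_fun_bounded_linear[OF bounded_linear_Im])

text \<open>The image of the compact set \<open>K\<close> in \<open>M\<close> is closed because \<open>M\<close> is a Hausdorff space, so the function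
  vanishes in a neighbourhood of every point outside the domain of the chart.\<close>

lemma smooth_fun_extend_by_zero:
  assumes c: "(U, \<phi>) \<in> atlas M" and K: "compact K" "K \<subseteq> \<phi> ` U"
    and f: "smooth_on (\<phi> ` U) f" "\<And>y. y \<in> \<phi> ` U - K \<Longrightarrow> f y = 0"
  shows "(\<lambda>q. if q \<in> U then f (\<phi> q) else 0) \<in> smooth_fun M" (is "?g \<in> _")
proof (rule smooth_funI)
  fix V \<psi> assume d: "(V, \<psi>) \<in> atlas M"
  let ?K = "inv_into U \<phi> ` K"
  show "smooth_on (\<psi> ` V) (\<lambda>y. ?g (inv_into V \<psi> y))"
  proof (rule smooth_on_local)
    fix y assume "y \<in> \<psi> ` V"
    then obtain q where q: "q \<in> V" "y = \<psi> q" by blast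
    show "\<exists>W. open W \<and> y \<in> W \<and> smooth_on W (\<lambda>y. ?g (inv_into V \<psi> y))"
    proof (cases "q \<in> U")
      case True
      have o: "open (\<psi> ` (V \<inter> U))"
        by (rule chart_open_map[OF d]) (auto intro: chart_open c d)
      have t: "smooth_on (\<psi> ` (V \<inter> U)) (\<lambda>y. \<phi> (inv_into V \<psi> y))"
        using transition[OF d c] by (simp add: o_def)
      have "(\<lambda>y. \<phi> (inv_into V \<psi> y)) ` \<psi> ` (V \<inter> U) \<subseteq> \<phi> ` U"
        using chart_inj[OF d] by auto
      from smooth_on_compose[OF o chart_open_image[OF c] this f(1) t]
      have "smooth_on (\<psi> ` (V \<inter> U)) (\<lambda>y. ?g (inv_into V \<psi> y))"
        by (rule smooth_on_transfer[OF o]) (use chart_inj[OF d] in auto)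
      then show ?thesis using o q True by auto
    next
      case False
      have o: "open (\<psi> ` (V - ?K))"
        by (rule chart_open_map[OF d])
          (auto intro: openin_diff chart_open d chart_compact_closed[OF c K])
      have "smooth_on (\<psi> ` (V - ?K)) (\<lambda>y. ?g (inv_into V \<psi> y))"
      proof (rule smooth_on_transfer[OF o smooth_on_const[of _ 0]])
        fix z assume "z \<in> \<psi> ` (V - ?K)"
        then obtain s where s: "s \<in> V" "s \<notin> ?K" "z = \<psi> s" by blast
        have "f (\<phi> s) = 0" if "s \<in> U"
        proof (rule f(2))
          have "\<phi> s \<notin> K"
            using s(2) that chart_inj[OF c] by (metis image_eqI inv_into_f_f)
          then show "\<phi> s \<in> \<phi> ` U - K" using that by auto
        qed
        then show "0 = ?g (inv_into V \<psi> z)" using s chart_inj[OF d] by auto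
      qed
      moreover have "q \<notin> ?K" using False K(2) by (auto intro: inv_into_into)
      ultimately show ?thesis using o q by (intro exI[of _ "\<psi> ` (V - ?K)"]) auto
    qed
  qed
qed (use chart_subset[OF c] in auto)

lemma tangent_add:
  "v \<in> tangent_space M x \<Longrightarrow> f \<in> S \<Longrightarrow> g \<in> S \<Longrightarrow> v (\<lambda>y. f y + g y) = v f + v g"
  by (simp add: tangent_space_def)

lemma tangent_mult:
  "v \<in> tangent_space M x \<Longrightarrow> f \<in> S \<Longrightarrow> g \<in> S \<Longrightarrow> v (\<lambda>y. f y * g y) = f x *\<^sub>R v g + g x *\<^sub>R v f"
  by (simp add: tangent_space_def)

lemma tangent_cmult: "v \<in> tangent_space M x \<Longrightarrow> f \<in> S \<Longrightarrow> v (\<lambda>y. c * f y) = c *\<^sub>R v f"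
  by (simp add: tangent_space_def)

lemma tangent_outside: "v \<in> tangent_space M x \<Longrightarrow> f \<notin> S \<Longrightarrow> v f = 0"
  by (simp add: tangent_space_def)

lemma tangent_zero: "v \<in> tangent_space M x \<Longrightarrow> v (\<lambda>y. 0) = 0"
  using tangent_cmult[of v x "\<lambda>y. 0" 0] by simp

lemma tangent_uminus: "v \<in> tangent_space M x \<Longrightarrow> f \<in> S \<Longrightarrow> v (\<lambda>y. - f y) = - v f"
  using tangent_cmult[of v x f "-1"] by simp

lemma tangent_diff:
  "v \<in> tangent_space M x \<Longrightarrow> f \<in> S \<Longrightarrow> g \<in> S \<Longrightarrow> v (\<lambda>y. f y - g y) = v f - v g"
  using tangent_add[of v x f "\<lambda>y. - g y"] tangent_uminus[of v x g] by auto

lemma tangent_sum: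
  "v \<in> tangent_space M x \<Longrightarrow> (\<And>i. i \<in> I \<Longrightarrow> f i \<in> S) \<Longrightarrow> v (\<lambda>y. \<Sum>i\<in>I. f i y) = (\<Sum>i\<in>I. v (f i))"
proof (induction I rule: infinite_finite_induct)
  case (insert i I)
  then show ?case
    using tangent_add[of v x "f i" "\<lambda>y. \<Sum>i\<in>I. f i y"] smooth_fun_sum[of I f] by auto
qed (auto simp: tangent_zero)

lemma tangent_eqI:
  "v \<in> tangent_space M x \<Longrightarrow> w \<in> tangent_space M y \<Longrightarrow> (\<And>f. f \<in> S \<Longrightarrow> v f = w f) \<Longrightarrow> v = w"
  by (rule ext) (metis tangent_outside)

lemma T_add [intro]: "v \<in> T x \<Longrightarrow> w \<in> T x \<Longrightarrow> v + w \<in> T x"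
  by (auto simp: tangent_space_def algebra_simps scaleR_conv_of_real)

lemma T_cmult [intro]: "v \<in> T x \<Longrightarrow> (\<lambda>f. c * v f) \<in> T x"
  by (auto simp: tangent_space_def algebra_simps scaleR_conv_of_real)

lemma T_zero [intro, simp]: "0 \<in> T x" "(\<lambda>f. 0) \<in> T x"
  by (auto simp: tangent_space_def)

section \<open>Local frames\<close>

definition coord_deriv :: "'a set \<Rightarrow> ('a \<Rightarrow> 'e) \<Rightarrow> 'a \<Rightarrow> 'e \<Rightarrow> ('a \<Rightarrow> real) \<Rightarrow> real" where
  "coord_deriv U \<phi> q i f = frechet_derivative (\<lambda>y. f (inv_into U \<phi> y)) (at (\<phi> q)) i"

lemma coord_deriv_tangent:
  assumes c: "(U, \<phi>) \<in> atlas M" and q: "q \<in> U"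
  shows "(\<lambda>f. if f \<in> S then \<Sum>i\<in>Basis. k i * complex_of_real (coord_deriv U \<phi> q i f) else 0) \<in> T q"
proof -
  have d: "((\<lambda>y. f (inv_into U \<phi> y)) has_derivative
      frechet_derivative (\<lambda>y. f (inv_into U \<phi> y)) (at (\<phi> q))) (at (\<phi> q))" if "f \<in> S" for f
    using smooth_on_differentiable[OF smooth_fun_chart[OF that c]] q frechet_derivative_works by blast
  have i: "inv_into U \<phi> (\<phi> q) = q" using chart_inj[OF c] q by simp
  have add: "coord_deriv U \<phi> q i (\<lambda>y. f y + g y) = coord_deriv U \<phi> q i f + coord_deriv U \<phi> q i g"
    if "f \<in> S" "g \<in> S" for f g i
    unfolding coord_deriv_def
    by (simp add: frechet_derivative_at[OF has_derivative_add[OF d[OF that(1)] d[OF that(2)]], symmetric])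
  have mult: "coord_deriv U \<phi> q i (\<lambda>y. f y * g y) = f q * coord_deriv U \<phi> q i g + g q * coord_deriv U \<phi> q i f"
    if "f \<in> S" "g \<in> S" for f g i
    unfolding coord_deriv_def
    by (simp add: frechet_derivative_at[OF has_derivative_mult[OF d[OF that(1)] d[OF that(2)]], symmetric] i)
  have cmult: "coord_deriv U \<phi> q i (\<lambda>y. a * f y) = a * coord_deriv U \<phi> q i f"
    if "f \<in> S" for f i a
    unfolding coord_deriv_def
    by (simp add: frechet_derivative_at[OF has_derivative_mult_right[OF d[OF that]], symmetric])
  show ?thesis
    unfolding tangent_space_def
    by (auto simp: add mult cmult smooth_fun_add smooth_fun_mult smooth_fun_cmult scaleR_conv_of_real
        sum.distrib sum_distrib_left algebra_simps)
qed

text \<open>The products of the coordinate functions with a bump function \<open>b\<close> are global, and the Leibniz rule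
  recovers the derivatives of the coordinates from them, up to a factor \<open>b x ^ 2\<close>. By Hadamard's
  lemma these derivatives determine the vector.\<close>

lemma chart_bump:
  assumes c: "(U, \<phi>) \<in> atlas M" and p: "p \<in> U"
  obtains b where "b \<in> S" "b p \<noteq> 0" "\<And>q. q \<notin> U \<Longrightarrow> b q = 0"
    "\<And>i. (\<lambda>q. b q * (\<phi> q \<bullet> i)) \<in> S"
    "\<And>i f. f \<in> S \<Longrightarrow> (\<lambda>q. b q * coord_deriv U \<phi> q i f) \<in> S"
    "\<And>x (v::('a, complex) tvec) f. x \<in> points M \<Longrightarrow> v \<in> T x \<Longrightarrow> f \<in> S \<Longrightarrow>
       complex_of_real (b x) ^ 2 * v f = (\<Sum>i\<in>Basis.
         (b x * v (\<lambda>q. b q * (\<phi> q \<bullet> i)) - b x * (\<phi> x \<bullet> i) * v b) * coord_deriv U \<phi> x i f)"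
proof -
  note inj = chart_inj[OF c]
  obtain r where r: "r > 0" "ball (\<phi> p) r \<subseteq> \<phi> ` U"
    using chart_open_image[OF c] p open_contains_ball by blast
  define B where "B = ball (\<phi> p) r"
  define K where "K = cball (\<phi> p) (r / 2)"
  have KB: "K \<subseteq> B" and BU: "B \<subseteq> \<phi> ` U" and Bo: "open B" "convex B" and Kc: "compact K" "closed K"
    using r by (auto simp: K_def B_def)
  have KU: "K \<subseteq> \<phi> ` U" using KB BU by blast
  obtain \<beta> :: "'e \<Rightarrow> real" where \<beta>: "smooth_on UNIV \<beta>" "\<beta> (\<phi> p) \<noteq> 0" "\<And>y. y \<notin> K \<Longrightarrow> \<beta> y = 0"
    using smooth_bump_exists[of "r / 2" "\<phi> p"] r unfolding K_def by auto
  note oU = chart_open_image[OF c]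
  have ext: "(\<lambda>q. if q \<in> U then \<beta> (\<phi> q) * h (\<phi> q) else 0) \<in> S" if "smooth_on (\<phi> ` U) h" for h
    by (rule smooth_fun_extend_by_zero[OF c Kc(1) KU, of "\<lambda>y. \<beta> y * h y"])
      (auto intro!: smooth_on_mult oU that smooth_on_subset[OF \<beta>(1)] simp: \<beta>(3))
  have extB: "(\<lambda>q. if q \<in> U \<and> \<phi> q \<in> B then \<beta> (\<phi> q) * h (\<phi> q) else 0) \<in> S" if "smooth_on B h" for h
  proof -
    have "smooth_on UNIV (\<lambda>y. if y \<in> B then \<beta> y * h y else 0)"
      by (rule smooth_on_extend_by_zero[OF Bo(1) Kc(2) KB])
        (auto intro!: smooth_on_mult Bo that smooth_on_subset[OF \<beta>(1)] simp: \<beta>(3))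
    from smooth_fun_extend_by_zero[OF c Kc(1) KU smooth_on_subset[OF this subset_UNIV]]
    have "(\<lambda>q. if q \<in> U then if \<phi> q \<in> B then \<beta> (\<phi> q) * h (\<phi> q) else 0 else 0) \<in> S"
      using \<beta>(3) by auto
    then show ?thesis by (simp add: if_if_eq_conj)
  qed
  define b where "b q = (if q \<in> U then \<beta> (\<phi> q) else 0)" for q
  define X where "X i q = b q * (\<phi> q \<bullet> i)" for i q
  have bS: "b \<in> S" using ext[OF smooth_on_const[of _ 1]] by (simp only: mult_1_right b_def[abs_def])
  have XS: "X i \<in> S" for i
    using ext[OF smooth_on_bounded_linear[OF bounded_linear_inner_left oU smooth_on_ident, of i]]
    by (simp add: X_def[abs_def] b_def if_distrib[of "\<lambda>z. z * _"] cong: if_cong)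
  have DS: "(\<lambda>q. b q * coord_deriv U \<phi> q i f) \<in> S" if "f \<in> S" for i f
    using ext[OF smooth_on_derivative[OF smooth_fun_chart[OF that c], of i]]
    by (simp add: b_def coord_deriv_def if_distrib[of "\<lambda>z. z * _"] cong: if_cong)
  have key: "complex_of_real (b x) ^ 2 * v f = (\<Sum>i\<in>Basis.
         (b x * v (X i) - b x * (\<phi> x \<bullet> i) * v b) * coord_deriv U \<phi> x i f)"
    if x: "x \<in> points M" and v: "v \<in> T x" and f: "f \<in> S" for x f and v :: "('a, complex) tvec"
  proof (cases "b x = 0")
    case True
    then show ?thesis by simp
  next
    case False
    then have xU: "x \<in> U" by (auto simp: b_def split: if_splits)
    have "\<beta> (\<phi> x) \<noteq> 0" using False xU by (simp add: b_def)
    then have xB: "\<phi> x \<in> B" using \<beta>(3) KB by blast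
    obtain g where g: "\<And>i. smooth_on B (g i)"
      "\<And>y. y \<in> B \<Longrightarrow> f (inv_into U \<phi> y) = f (inv_into U \<phi> (\<phi> x)) + (\<Sum>i\<in>Basis. ((y - \<phi> x) \<bullet> i) * g i y)"
      "\<And>i. g i (\<phi> x) = frechet_derivative (\<lambda>y. f (inv_into U \<phi> y)) (at (\<phi> x)) i"
      using hadamard[OF Bo xB smooth_on_subset[OF smooth_fun_chart[OF f c] BU]] by blast
    define G where "G i q = (if q \<in> U \<and> \<phi> q \<in> B then \<beta> (\<phi> q) * g i (\<phi> q) else 0)" for i q
    have GS: "G i \<in> S" for i using extB[OF g(1)] by (simp add: G_def[abs_def])
    have Gx: "G i x = b x * coord_deriv U \<phi> x i f" for i
      using xU xB by (simp add: G_def b_def g(3) coord_deriv_def)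
    have id: "(\<lambda>q. b q * (b q * f q)) = (\<lambda>q. f x * (b q * b q) + (\<Sum>i\<in>Basis. (X i q - (\<phi> x \<bullet> i) * b q) * G i q))"
    proof
      fix q
      show "b q * (b q * f q) = f x * (b q * b q) + (\<Sum>i\<in>Basis. (X i q - (\<phi> x \<bullet> i) * b q) * G i q)"
      proof (cases "q \<in> U \<and> \<phi> q \<in> B")
        case True
        have "f q = f x + (\<Sum>i\<in>Basis. ((\<phi> q - \<phi> x) \<bullet> i) * g i (\<phi> q))"
          using g(2)[of "\<phi> q"] True inj xU by simp
        then have "b q * (b q * f q) = f x * (b q * b q) + (\<Sum>i\<in>Basis. b q * (b q * (((\<phi> q - \<phi> x) \<bullet> i) * g i (\<phi> q))))"
          by (simp add: algebra_simps sum_distrib_left)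
        also have "(\<Sum>i\<in>Basis. b q * (b q * (((\<phi> q - \<phi> x) \<bullet> i) * g i (\<phi> q)))) = (\<Sum>i\<in>Basis. (X i q - (\<phi> x \<bullet> i) * b q) * G i q)"
          using True by (intro sum.cong) (auto simp: X_def G_def b_def algebra_simps inner_diff_left)
        finally show ?thesis .
      next
        case False
        then have "b q = 0" using \<beta>(3) KB by (auto simp: b_def)
        then show ?thesis by (simp add: X_def)
      qed
    qed
    have d: "(\<lambda>q. X i q - (\<phi> x \<bullet> i) * b q) \<in> S" for i using XS bS by auto
    have "v (\<lambda>q. b q * f q) = b x * v f + f x * v b"
      using tangent_mult[OF v bS f] by (simp add: scaleR_conv_of_real)
    then have "v (\<lambda>q. b q * (b q * f q)) = b x * (b x * v f + f x * v b) + b x * f x * v b"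
      using tangent_mult[OF v bS smooth_fun_mult[OF bS f]] by (simp add: scaleR_conv_of_real)
    moreover have "v (\<lambda>q. f x * (b q * b q) + (\<Sum>i\<in>Basis. (X i q - (\<phi> x \<bullet> i) * b q) * G i q)) =
        f x * (2 * b x * v b) + (\<Sum>i\<in>Basis. G i x * (v (X i) - (\<phi> x \<bullet> i) * v b))"
    proof -
      have "v (\<lambda>q. f x * (b q * b q) + (\<Sum>i\<in>Basis. (X i q - (\<phi> x \<bullet> i) * b q) * G i q)) =
         v (\<lambda>q. f x * (b q * b q)) + (\<Sum>i\<in>Basis. v (\<lambda>q. (X i q - (\<phi> x \<bullet> i) * b q) * G i q))"
        by (rule trans[OF tangent_add[OF v smooth_fun_cmult[OF smooth_fun_mult[OF bS bS]]
                smooth_fun_sum[OF smooth_fun_mult[OF d GS]]]],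
            rule arg_cong2[of _ _ _ _ "(+)", OF refl], rule tangent_sum[OF v smooth_fun_mult[OF d GS]])
      moreover have "v (\<lambda>q. f x * (b q * b q)) = f x * (2 * b x * v b)"
        using tangent_cmult[OF v smooth_fun_mult[OF bS bS]] tangent_mult[OF v bS bS]
        by (simp add: scaleR_conv_of_real)
      moreover have "v (\<lambda>q. (X i q - (\<phi> x \<bullet> i) * b q) * G i q) = G i x * (v (X i) - (\<phi> x \<bullet> i) * v b)" for i
      proof -
        have "v (\<lambda>q. (X i q - (\<phi> x \<bullet> i) * b q) * G i q) = G i x * v (\<lambda>q. X i q - (\<phi> x \<bullet> i) * b q)"
          unfolding tangent_mult[OF v d GS] by (simp add: X_def scaleR_conv_of_real)
        also have "v (\<lambda>q. X i q - (\<phi> x \<bullet> i) * b q) = v (X i) - (\<phi> x \<bullet> i) * v b"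
          using tangent_diff[OF v XS smooth_fun_cmult[OF bS]] tangent_cmult[OF v bS]
          by (simp add: scaleR_conv_of_real)
        finally show ?thesis .
      qed
      ultimately show ?thesis by simp
    qed
    ultimately have "complex_of_real (b x) ^ 2 * v f = (\<Sum>i\<in>Basis. G i x * (v (X i) - (\<phi> x \<bullet> i) * v b))"
      unfolding id by (simp add: algebra_simps power2_eq_square)
    also have "\<dots> = (\<Sum>i\<in>Basis. (b x * v (X i) - b x * (\<phi> x \<bullet> i) * v b) * coord_deriv U \<phi> x i f)"
      by (intro sum.cong) (auto simp: Gx algebra_simps)
    finally show ?thesis .
  qed
  show ?thesis
  proof (rule that[of b])
    show "b p \<noteq> 0" using \<beta>(2) p by (simp add: b_def)
  qed (use bS XS DS key in \<open>auto simp: X_def[abs_def] b_def\<close>)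
qed

text \<open>Every tangent vector is a combination of the coordinate derivations. The identity below
  holds at all points at once, with the cutoff function \<open>b\<close> on both sides, so that its terms are
  globally defined and smooth; this replaces localization in the sequel.\<close>

lemma frame:
  assumes p: "p \<in> points M"
  obtains b E l where "b \<in> SC" "b p \<noteq> 0" "\<And>i. E i \<in> VF"
    "\<And>V i. V \<in> VF \<Longrightarrow> (\<lambda>x. l i x (V x)) \<in> SC"
    "\<And>i x (v::('a, complex) tvec) w. l i x (v + w) = l i x v + l i x w"
    "\<And>i x c (v::('a, complex) tvec). l i x (\<lambda>f. c * v f) = c * l i x v"
    "\<And>x (v::('a, complex) tvec) f. x \<in> points M \<Longrightarrow> v \<in> T x \<Longrightarrow> f \<in> S \<Longrightarrow>
        b x * v f = (\<Sum>i\<in>(Basis::'e set). l i x v * E i x f)"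
proof -
  obtain U \<phi> where c: "(U, \<phi>) \<in> atlas M" and pU: "p \<in> U" using p cover by blast
  obtain b where b: "b \<in> S" "b p \<noteq> 0" "\<And>q. q \<notin> U \<Longrightarrow> b q = 0"
    "\<And>i. (\<lambda>q. b q * (\<phi> q \<bullet> i)) \<in> S"
    "\<And>i f. f \<in> S \<Longrightarrow> (\<lambda>q. b q * coord_deriv U \<phi> q i f) \<in> S"
    "\<And>x (v::('a, complex) tvec) f. x \<in> points M \<Longrightarrow> v \<in> T x \<Longrightarrow> f \<in> S \<Longrightarrow>
       complex_of_real (b x) ^ 2 * v f = (\<Sum>i\<in>Basis.
         (b x * v (\<lambda>q. b q * (\<phi> q \<bullet> i)) - b x * (\<phi> x \<bullet> i) * v b) * coord_deriv U \<phi> x i f)"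
    using chart_bump[OF c pU] by blast
  define E where "E i x f = (if i \<in> Basis \<and> f \<in> S then complex_of_real (b x * coord_deriv U \<phi> x i f) else 0)" for i x f
  define l where "l i x v = b x * v (\<lambda>q. b q * (\<phi> q \<bullet> i)) - b x * (\<phi> x \<bullet> i) * v b"
    for i x and v :: "('a, complex) tvec"
  have ET: "E i x \<in> T x" if "x \<in> points M" for i x
  proof (cases "x \<in> U \<and> i \<in> Basis")
    case True
    have "E i x = (\<lambda>f. if f \<in> S then \<Sum>j\<in>Basis. (if j = i then complex_of_real (b x) else 0) * complex_of_real (coord_deriv U \<phi> x j f) else 0)"
      using True by (auto simp: E_def fun_eq_iff if_distrib[of "\<lambda>z. z * _"] sum.delta cong: if_cong)
    then show ?thesis using coord_deriv_tangent[OF c, of x] True by (simp only:)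
  next
    case False
    then have "E i x = (\<lambda>f. 0)" using b(3) by (auto simp: E_def fun_eq_iff)
    then show ?thesis by simp
  qed
  have b0: "b x = 0" if "x \<notin> points M" for x using b(1) that smooth_fun_outside by blast
  show ?thesis
  proof (rule that[of "\<lambda>x. complex_of_real (b x) ^ 3" E l])
    show "(\<lambda>x. complex_of_real (b x) ^ 3) \<in> SC"
      unfolding power3_eq_cube using SC_of_real[OF b(1)] by (intro smooth_fun_mult)
    show "E i \<in> VF" for i
      unfolding vector_fields_def
    proof (intro CollectI conjI ballI allI impI)
      fix f assume "f \<in> S"
      then show "(\<lambda>x. E i x f) \<in> SC"
        using SC_of_real[OF b(5)[of f i]] by (cases "i \<in> Basis") (simp_all add: E_def)
    qed (auto simp: ET E_def b0 fun_eq_iff)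
    show "(\<lambda>x. l i x (V x)) \<in> SC" if V: "V \<in> VF" for V i
    proof -
      have "(\<lambda>x. V x f) \<in> SC" if "f \<in> S" for f using V that by (simp add: vector_fields_def)
      then show ?thesis
        using smooth_fun_diff[OF smooth_fun_mult[OF SC_of_real[OF b(1)]] smooth_fun_mult[OF SC_of_real[OF b(4)]]] b(1,4)
        unfolding l_def by fast
    qed
    fix x f and v :: "('a, complex) tvec" assume a: "x \<in> points M" "v \<in> T x" "f \<in> S"
    show "complex_of_real (b x) ^ 3 * v f = (\<Sum>i\<in>Basis. l i x v * E i x f)"
    proof -
      have "complex_of_real (b x) ^ 3 * v f = b x * (complex_of_real (b x) ^ 2 * v f)"
        by (simp add: power3_eq_cube power2_eq_square)
      also have "\<dots> = (\<Sum>i\<in>Basis. l i x v * E i x f)"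
        unfolding b(6)[OF a] using a(3) by (simp add: l_def E_def sum_distrib_left mult_ac)
      finally show ?thesis .
    qed
  qed (use b(2) in \<open>auto simp: l_def algebra_simps\<close>)
qed

lemma tangent_coord_deriv:
  assumes c: "(U, \<phi>) \<in> atlas M" and q: "q \<in> U" and v: "v \<in> T q"
  obtains k where "\<And>f. f \<in> S \<Longrightarrow> v f = (\<Sum>i\<in>Basis. k i * complex_of_real (coord_deriv U \<phi> q i f))"
proof (rule chart_bump[OF c q])
  fix b :: "'a \<Rightarrow> real"
  assume b: "b q \<noteq> 0"
    "\<And>x (v::('a, complex) tvec) f. x \<in> points M \<Longrightarrow> v \<in> T x \<Longrightarrow> f \<in> S \<Longrightarrow>
       complex_of_real (b x) ^ 2 * v f = (\<Sum>i\<in>Basis.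
         (b x * v (\<lambda>q. b q * (\<phi> q \<bullet> i)) - b x * (\<phi> x \<bullet> i) * v b) * coord_deriv U \<phi> x i f)"
  show thesis
  proof (rule that[of "\<lambda>i. (b q * v (\<lambda>q. b q * (\<phi> q \<bullet> i)) - b q * (\<phi> q \<bullet> i) * v b) / complex_of_real (b q) ^ 2"])
    fix f assume "f \<in> S"
    from b(2)[OF _ v this] chart_subset[OF c] q
    have "complex_of_real (b q) ^ 2 * v f = (\<Sum>i\<in>Basis.
         (b q * v (\<lambda>q. b q * (\<phi> q \<bullet> i)) - b q * (\<phi> q \<bullet> i) * v b) * coord_deriv U \<phi> q i f)" by blast
    then have "v f = (\<Sum>i\<in>Basis.
         (b q * v (\<lambda>q. b q * (\<phi> q \<bullet> i)) - b q * (\<phi> q \<bullet> i) * v b) * coord_deriv U \<phi> q i f) / complex_of_real (b q) ^ 2"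
      using b(1) by (simp add: field_simps)
    then show "v f = (\<Sum>i\<in>Basis. (b q * v (\<lambda>q. b q * (\<phi> q \<bullet> i)) - b q * (\<phi> q \<bullet> i) * v b) / complex_of_real (b q) ^ 2
         * complex_of_real (coord_deriv U \<phi> q i f))"
      by (simp add: sum_divide_distrib)
  qed
qed

end

section \<open>The quotient of a Lie group by a discrete subgroup\<close>

locale lie_quotient =
  fixes G :: "'g monoid" (structure) and M :: "('g, 'e::euclidean_space) manifold" and \<Gamma> :: "'g set"
  assumes lie: "lie_group G M" and discrete: "discrete_subgroup G M \<Gamma>"
begin

sublocale group G using lie by (simp add: lie_group_def)

sublocale M: charted M
  using lie by (intro smooth_manifold_charted) (simp add: lie_group_def)

lemma points_M: "points M = carrier G" using lie by (simp add: lie_group_def)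

lemma subgroup_Gamma: "subgroup \<Gamma> G" using discrete by (simp add: discrete_subgroup_def)

abbreviation Q where "Q \<equiv> quotient_manifold G M \<Gamma>"
abbreviation proj (\<open>\<pi>\<close>) where "\<pi> \<equiv> (\<lambda>g. \<Gamma> #> g)"

lemma Gamma_carrier: "\<gamma> \<in> \<Gamma> \<Longrightarrow> \<gamma> \<in> carrier G"
  using subgroup.mem_carrier[OF subgroup_Gamma] .

lemma proj_mult: "\<gamma> \<in> \<Gamma> \<Longrightarrow> g \<in> carrier G \<Longrightarrow> \<pi> (\<gamma> \<otimes> g) = \<pi> g"
  using subgroup_Gamma
  by (metis coset_mult_assoc coset_join2 Gamma_carrier subgroup.subset)

lemma proj_eqD:
  assumes "\<pi> a = \<pi> b" "a \<in> carrier G" "b \<in> carrier G"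
  shows "a \<otimes> inv b \<in> \<Gamma>"
proof -
  have "a \<in> \<Gamma> #> b" using rcos_self[OF assms(2) subgroup_Gamma] assms(1) by simp
  then show ?thesis
    using subgroup.rcos_module_imp[OF subgroup_Gamma is_group] assms by auto
qed

lemma proj_eqE:
  assumes "\<pi> a = \<pi> b" "a \<in> carrier G" "b \<in> carrier G"
  obtains \<gamma> where "\<gamma> \<in> \<Gamma>" "a = \<gamma> \<otimes> b"
  using proj_eqD[OF assms] assms(2,3) that[of "a \<otimes> inv b"] by (simp add: m_assoc)

lemma continuous_mult: "continuous_map (prod_topology (mtop M) (mtop M)) (mtop M) (\<lambda>(a, b). a \<otimes> b)"
  using lie by (simp add: lie_group_def smooth_map_def prod_manifold_def)

lemma continuous_inv: "continuous_map (mtop M) (mtop M) (\<lambda>a. inv a)"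
  using lie by (simp add: lie_group_def smooth_map_def)

lemma continuous_mult_inv:
  "continuous_map (prod_topology (mtop M) (mtop M)) (mtop M) (\<lambda>z. fst z \<otimes> inv (snd z))"
proof -
  have "continuous_map (prod_topology (mtop M) (mtop M)) (prod_topology (mtop M) (mtop M)) (\<lambda>z. (fst z, inv (snd z)))"
    by (auto simp: continuous_map_pairwise o_def intro: continuous_map_fst
        continuous_map_compose[OF continuous_map_snd continuous_inv, unfolded o_def])
  from continuous_map_compose[OF this continuous_mult] show ?thesis by (simp add: o_def)
qed

lemma continuous_left_mult:
  assumes "a \<in> carrier G" shows "continuous_map (mtop M) (mtop M) (\<lambda>g. a \<otimes> g)"
proof -
  have "continuous_map (mtop M) (prod_topology (mtop M) (mtop M)) (\<lambda>g. (a, g))"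
    using assms by (auto simp: continuous_map_pairwise o_def points_M)
  from continuous_map_compose[OF this continuous_mult] show ?thesis by (simp add: o_def)
qed

lemma mult_inv_nbhds:
  assumes "openin (mtop M) U" "g \<in> carrier G" "h \<in> carrier G" "g \<otimes> inv h \<in> U"
  obtains A B where "openin (mtop M) A" "openin (mtop M) B" "g \<in> A" "h \<in> B"
    "\<And>a b. a \<in> A \<Longrightarrow> b \<in> B \<Longrightarrow> a \<otimes> inv b \<in> U"
proof -
  let ?P = "{z \<in> points M \<times> points M. fst z \<otimes> inv (snd z) \<in> U}"
  have "openin (prod_topology (mtop M) (mtop M)) ?P"
    using openin_continuous_map_preimage[OF continuous_mult_inv assms(1)] by simp
  moreover have "(g, h) \<in> ?P" using assms by (simp add: points_M)
  ultimately obtain A B where "openin (mtop M) A" "openin (mtop M) B" "g \<in> A" "h \<in> B" "A \<times> B \<subseteq> ?P"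
    unfolding openin_prod_topology_alt by meson
  then show ?thesis by (intro that[of A B]) auto
qed

lemma unit_nbhd: obtains U where "openin (mtop M) U" "U \<inter> \<Gamma> = {\<one>}"
proof -
  have "openin (subtopology (mtop M) \<Gamma>) {\<one>}"
    using discrete subgroup.one_closed[OF subgroup_Gamma] by (simp add: discrete_subgroup_def)
  then show ?thesis using that unfolding openin_subtopology by (metis inf_commute)
qed

text \<open>Translates of a neighbourhood of \<open>\<one>\<close> that meets the discrete group \<open>\<Gamma>\<close> only in \<open>\<one>\<close> give the domains of
  the charts of the quotient.\<close>

lemma injective_nbhd:
  assumes g: "g \<in> carrier G"
  obtains A where "openin (mtop M) A" "g \<in> A" "inj_on \<pi> A"
proof -
  obtain U where U: "openin (mtop M) U" "U \<inter> \<Gamma> = {\<one>}" by (rule unit_nbhd)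
  obtain A B where AB: "openin (mtop M) A" "openin (mtop M) B" "g \<in> A" "g \<in> B"
    "\<And>a b. a \<in> A \<Longrightarrow> b \<in> B \<Longrightarrow> a \<otimes> inv b \<in> U"
    using mult_inv_nbhds[OF U(1) g g] U(2) g by auto
  have "inj_on \<pi> (A \<inter> B)"
  proof (rule inj_onI)
    fix a b assume ab: "a \<in> A \<inter> B" "b \<in> A \<inter> B" "\<pi> a = \<pi> b"
    have c: "a \<in> carrier G" "b \<in> carrier G"
      using ab AB(1) openin_subset points_M by blast+
    have "a \<otimes> inv b \<in> U \<inter> \<Gamma>" using AB(5) ab proj_eqD[OF ab(3) c] by auto
    then have "a \<otimes> inv b = \<one>" using U(2) by blast
    then show "a = b" using c by (metis inv_closed inv_equality inv_inv)
  qed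
  then show ?thesis using AB by (intro that[of "A \<inter> B"]) auto
qed

text \<open>A point outside \<open>\<Gamma>\<close> has a neighbourhood that contains at most one element of the discrete group \<open>\<Gamma>\<close>,
  which may be removed from it since points are closed.\<close>

lemma closed_Gamma: "closedin (mtop M) \<Gamma>"
proof -
  obtain U where U: "openin (mtop M) U" "U \<inter> \<Gamma> = {\<one>}" by (rule unit_nbhd)
  have "openin (mtop M) (points M - \<Gamma>)"
  proof (subst openin_subopen, intro ballI)
    fix g assume g: "g \<in> points M - \<Gamma>"
    then have gc: "g \<in> carrier G" by (simp add: points_M)
    obtain A B where AB: "openin (mtop M) A" "openin (mtop M) B" "g \<in> A" "g \<in> B"
      "\<And>a b. a \<in> A \<Longrightarrow> b \<in> B \<Longrightarrow> a \<otimes> inv b \<in> U"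
      using mult_inv_nbhds[OF U(1) gc gc] U(2) gc by auto
    have one: "a = b" if "a \<in> A \<inter> B \<inter> \<Gamma>" "b \<in> A \<inter> B \<inter> \<Gamma>" for a b
    proof -
      have c: "a \<in> carrier G" "b \<in> carrier G" using that Gamma_carrier by auto
      have "a \<otimes> inv b \<in> U \<inter> \<Gamma>"
        using AB(5) that subgroup.m_closed[OF subgroup_Gamma] subgroup.m_inv_closed[OF subgroup_Gamma] by auto
      then have "a \<otimes> inv b = \<one>" using U(2) by blast
      then show "a = b" using c by (metis inv_closed inv_equality inv_inv)
    qed
    have fin: "finite (A \<inter> B \<inter> \<Gamma>)"
    proof (cases "A \<inter> B \<inter> \<Gamma> = {}")
      case False
      then obtain a where "a \<in> A \<inter> B \<inter> \<Gamma>" by blast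
      then have "A \<inter> B \<inter> \<Gamma> = {a}" using one by blast
      then show ?thesis by simp
    qed simp
    have "closedin (mtop M) (A \<inter> B \<inter> \<Gamma>)"
      by (rule closedin_Hausdorff_finite[OF M.hausdorff _ fin]) (use AB(1) openin_subset in blast)
    then have "openin (mtop M) (A \<inter> B - A \<inter> B \<inter> \<Gamma>)"
      using AB by (intro openin_diff openin_Int)
    moreover have "A \<inter> B - A \<inter> B \<inter> \<Gamma> \<subseteq> points M - \<Gamma>"
      using AB(1) openin_subset by blast
    ultimately show "\<exists>W. openin (mtop M) W \<and> g \<in> W \<and> W \<subseteq> points M - \<Gamma>"
      using AB g by (intro exI[of _ "A \<inter> B - A \<inter> B \<inter> \<Gamma>"]) auto
  qed
  then show ?thesis
    using subgroup.subset[OF subgroup_Gamma] by (simp add: closedin_def points_M)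
qed

lemma openin_quotient:
  "openin (mtop Q) U \<longleftrightarrow> U \<subseteq> rcosets \<Gamma> \<and> openin (mtop M) {g \<in> carrier G. \<pi> g \<in> U}"
proof -
  let ?P = "\<lambda>U. U \<subseteq> rcosets \<Gamma> \<and> openin (mtop M) {g \<in> carrier G. \<pi> g \<in> U}"
  have "istopology ?P"
    unfolding istopology_def
  proof (intro conjI allI impI)
    fix A B assume "?P A" "?P B"
    moreover have "{g \<in> carrier G. \<pi> g \<in> A \<inter> B} = {g \<in> carrier G. \<pi> g \<in> A} \<inter> {g \<in> carrier G. \<pi> g \<in> B}" by auto
    ultimately show "A \<inter> B \<subseteq> rcosets \<Gamma>" "openin (mtop M) {g \<in> carrier G. \<pi> g \<in> A \<inter> B}" by auto
  next
    fix \<K> assume K: "\<forall>A\<in>\<K>. ?P A"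
    then show "\<Union>\<K> \<subseteq> rcosets \<Gamma>" by blast
    have "{g \<in> carrier G. \<pi> g \<in> \<Union>\<K>} = (\<Union>A\<in>\<K>. {g \<in> carrier G. \<pi> g \<in> A})" by auto
    then show "openin (mtop M) {g \<in> carrier G. \<pi> g \<in> \<Union>\<K>}" using K by auto
  qed
  then show ?thesis by (simp add: quotient_manifold_def)
qed

lemma points_Q: "points Q = rcosets \<Gamma>"
proof -
  have "{g \<in> carrier G. \<pi> g \<in> rcosets \<Gamma>} = points M"
    by (auto simp: points_M rcosetsI subgroup.subset[OF subgroup_Gamma])
  then have "openin (mtop Q) (rcosets \<Gamma>)" by (simp add: openin_quotient)
  then show ?thesis using openin_quotient openin_topspace openin_subset by (metis subset_antisym)
qed

lemma proj_in_points: "g \<in> carrier G \<Longrightarrow> \<pi> g \<in> points Q"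
  by (simp add: points_Q rcosetsI subgroup.subset[OF subgroup_Gamma])

lemma points_QE: assumes "q \<in> points Q" obtains g where "g \<in> carrier G" "q = \<pi> g"
  using assms by (auto simp: points_Q RCOSETS_def)

lemma open_proj:
  assumes A: "openin (mtop M) A" shows "openin (mtop Q) (\<pi> ` A)"
proof -
  have Ac: "A \<subseteq> carrier G" using openin_subset[OF A] by (simp add: points_M)
  have "{g \<in> carrier G. \<pi> g \<in> \<pi> ` A} = (\<Union>\<gamma>\<in>\<Gamma>. {g \<in> points M. \<gamma> \<otimes> g \<in> A})"
  proof (intro subset_antisym subsetI)
    fix g assume "g \<in> {g \<in> carrier G. \<pi> g \<in> \<pi> ` A}"
    then obtain a where a: "a \<in> A" "\<pi> a = \<pi> g" "g \<in> carrier G" by auto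
    with Ac obtain \<gamma> where "\<gamma> \<in> \<Gamma>" "a = \<gamma> \<otimes> g" using proj_eqE[of a g] by blast
    then show "g \<in> (\<Union>\<gamma>\<in>\<Gamma>. {g \<in> points M. \<gamma> \<otimes> g \<in> A})" using a by (auto simp: points_M)
  next
    fix g assume "g \<in> (\<Union>\<gamma>\<in>\<Gamma>. {g \<in> points M. \<gamma> \<otimes> g \<in> A})"
    then obtain \<gamma> where "\<gamma> \<in> \<Gamma>" "g \<in> carrier G" "\<gamma> \<otimes> g \<in> A" by (auto simp: points_M)
    then show "g \<in> {g \<in> carrier G. \<pi> g \<in> \<pi> ` A}" using proj_mult[of \<gamma> g] by (metis (mono_tags, lifting) image_eqI mem_Collect_eq)
  qed
  moreover have "openin (mtop M) (\<Union>\<gamma>\<in>\<Gamma>. {g \<in> points M. \<gamma> \<otimes> g \<in> A})"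
    by (intro openin_Union ballI)
      (auto intro: openin_continuous_map_preimage[OF continuous_left_mult A] Gamma_carrier)
  moreover have "\<pi> ` A \<subseteq> rcosets \<Gamma>"
    using Ac rcosetsI[OF subgroup.subset[OF subgroup_Gamma]] by blast
  ultimately show ?thesis by (simp add: openin_quotient)
qed

text \<open>Two orbits \<open>\<pi> a\<close> and \<open>\<pi> b\<close> are distinct iff \<open>a \<otimes> inv b\<close> lies in the complement of \<open>\<Gamma>\<close>, which is open.\<close>

lemma hausdorff_Q: "Hausdorff_space (mtop Q)"
  unfolding Hausdorff_space_def
proof (intro allI impI)
  fix x y assume xy: "x \<in> points Q \<and> y \<in> points Q \<and> x \<noteq> y"
  obtain a where a: "a \<in> carrier G" "x = \<pi> a" using xy points_QE by blast
  obtain b where b: "b \<in> carrier G" "y = \<pi> b" using xy points_QE by blast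
  have nG: "a \<otimes> inv b \<notin> \<Gamma>"
  proof
    assume "a \<otimes> inv b \<in> \<Gamma>"
    then have "\<pi> ((a \<otimes> inv b) \<otimes> b) = \<pi> b" using proj_mult b by blast
    then show False using a b xy by (simp add: m_assoc)
  qed
  have o: "openin (mtop M) (points M - \<Gamma>)" using closed_Gamma by (simp add: closedin_def)
  obtain A B where AB: "openin (mtop M) A" "openin (mtop M) B" "a \<in> A" "b \<in> B"
    "\<And>a b. a \<in> A \<Longrightarrow> b \<in> B \<Longrightarrow> a \<otimes> inv b \<in> points M - \<Gamma>"
    using mult_inv_nbhds[OF o a(1) b(1)] nG a b by (auto simp: points_M)
  have "disjnt (\<pi> ` A) (\<pi> ` B)"
  proof -
    have False if "a \<in> A" "b \<in> B" "\<pi> a = \<pi> b" for a b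
      using AB(5)[OF that(1,2)] proj_eqD[OF that(3)] that openin_subset[OF AB(1)] openin_subset[OF AB(2)]
      by (auto simp: points_M)
    then show ?thesis by (auto simp: disjnt_def)
  qed
  then show "\<exists>U V. openin (mtop Q) U \<and> openin (mtop Q) V \<and> x \<in> U \<and> y \<in> V \<and> disjnt U V"
    using open_proj[OF AB(1)] open_proj[OF AB(2)] AB a b by blast
qed

lemma smooth_left_mult:
  assumes c: "(U, \<phi>) \<in> atlas M" and d: "(V, \<psi>) \<in> atlas M" and a: "a \<in> carrier G"
  shows "smooth_on (\<phi> ` {g \<in> U. a \<otimes> g \<in> V}) (\<lambda>y. \<psi> (a \<otimes> inv_into U \<phi> y))"
proof (rule smooth_on_local)
  fix y assume "y \<in> \<phi> ` {g \<in> U. a \<otimes> g \<in> V}"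
  then obtain g where g: "g \<in> U" "a \<otimes> g \<in> V" "y = \<phi> g" by blast
  obtain U0 \<phi>0 where c0: "(U0, \<phi>0) \<in> atlas M" "a \<in> U0"
    using a M.chart_at[of a] unfolding points_M by blast
  let ?P = "{z \<in> points M \<times> points M. (case z of (a, b) \<Rightarrow> a \<otimes> b) \<in> V}"
  have "openin (prod_topology (mtop M) (mtop M)) (?P \<inter> U0 \<times> U)"
    using openin_continuous_map_preimage[OF continuous_mult M.chart_open[OF d]]
      M.chart_open[OF c] M.chart_open[OF c0(1)]
    by (intro openin_Int) (auto simp: openin_prod_Times_iff)
  moreover have "(a, g) \<in> ?P \<inter> U0 \<times> U"
    using g c0 M.chart_subset[OF c] a by (auto simp: points_M)
  ultimately obtain A B where AB: "openin (mtop M) A" "openin (mtop M) B" "a \<in> A" "g \<in> B" "A \<times> B \<subseteq> ?P \<inter> U0 \<times> U"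
    unfolding openin_prod_topology_alt by meson
  have A: "A \<subseteq> U0" and B: "B \<subseteq> U" using AB by auto
  let ?m = "map_prod \<phi>0 \<phi>"
  have inj: "inj_on ?m (U0 \<times> U)"
    using M.chart_inj[OF c] M.chart_inj[OF c0(1)] by (auto simp: inj_on_def)
  have "(U0 \<times> U, ?m) \<in> atlas (prod_manifold M M)"
    using c c0 by (auto simp: prod_manifold_def)
  moreover have "smooth_map (prod_manifold M M) M (\<lambda>(a, b). a \<otimes> b)"
    using lie by (simp add: lie_group_def)
  ultimately have "smooth_on (?m ` (U0 \<times> U \<inter> (\<lambda>(a, b). a \<otimes> b) -` V)) (\<psi> \<circ> (\<lambda>(a, b). a \<otimes> b) \<circ> inv_into (U0 \<times> U) ?m)"
    using d unfolding smooth_map_def by fast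
  moreover have "\<phi>0 ` A \<times> \<phi> ` B \<subseteq> ?m ` (U0 \<times> U \<inter> (\<lambda>(a, b). a \<otimes> b) -` V)"
  proof clarify
    fix a b assume "a \<in> A" "b \<in> B"
    then have "(a, b) \<in> U0 \<times> U \<inter> (\<lambda>(a, b). a \<otimes> b) -` V" using AB(5) by auto
    from imageI[OF this, of ?m] show "(\<phi>0 a, \<phi> b) \<in> ?m ` (U0 \<times> U \<inter> (\<lambda>(a, b). a \<otimes> b) -` V)" by simp
  qed
  ultimately have s1: "smooth_on (\<phi>0 ` A \<times> \<phi> ` B) (\<psi> \<circ> (\<lambda>(a, b). a \<otimes> b) \<circ> inv_into (U0 \<times> U) ?m)"
    by (rule smooth_on_subset)
  have oB: "open (\<phi> ` B)" by (rule M.chart_open_map[OF c AB(2) B])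
  have oAB: "open (\<phi>0 ` A \<times> \<phi> ` B)"
    using M.chart_open_map[OF c0(1) AB(1) A] oB by (rule open_Times)
  have "smooth_on (\<phi> ` B) (\<lambda>y. (\<phi>0 a, 0) + (0, y))"
    by (intro smooth_on_add smooth_on_const oB smooth_on_bounded_linear[OF _ oB smooth_on_ident]
        bounded_linear_Pair bounded_linear_zero bounded_linear_ident)
  then have s2: "smooth_on (\<phi> ` B) (\<lambda>y. (\<phi>0 a, y))" by simp
  have im: "(\<lambda>y. (\<phi>0 a, y)) ` \<phi> ` B \<subseteq> \<phi>0 ` A \<times> \<phi> ` B" using AB(3) by auto
  from smooth_on_compose[OF oB oAB im s1 s2] have "smooth_on (\<phi> ` B) (\<lambda>y. \<psi> (a \<otimes> inv_into U \<phi> y))"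
  proof (rule smooth_on_transfer[OF oB])
    fix y assume "y \<in> \<phi> ` B"
    then obtain b where b: "b \<in> B" "y = \<phi> b" by blast
    have "inv_into (U0 \<times> U) ?m (?m (a, b)) = (a, b)"
      using b B c0 by (intro inv_into_f_f inj) auto
    then show "(\<psi> \<circ> (\<lambda>(a, b). a \<otimes> b) \<circ> inv_into (U0 \<times> U) ?m) (\<phi>0 a, y) = \<psi> (a \<otimes> inv_into U \<phi> y)"
      using b B M.chart_inj[OF c] by (auto simp: subset_iff)
  qed
  then show "\<exists>T. open T \<and> y \<in> T \<and> smooth_on T (\<lambda>y. \<psi> (a \<otimes> inv_into U \<phi> y))"
    using oB g AB by blast
qed

lemma atlas_Q:
  "(W, \<theta>) \<in> atlas Q \<longleftrightarrow> (\<exists>U V \<phi>. W = \<pi> ` V \<and> \<theta> = \<phi> \<circ> inv_into V \<pi> \<and>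
     (U, \<phi>) \<in> atlas M \<and> openin (mtop M) V \<and> V \<subseteq> U \<and> inj_on \<pi> V)"
  by (simp add: quotient_manifold_def)

text \<open>Two local inverses of the projection differ locally by the left translation by an element of \<open>\<Gamma>\<close>.
  Transition functions of the quotient are therefore composed of left translations and of
  transition functions of \<open>M\<close>.\<close>

lemma charted_Q: "charted Q"
proof
  show "Hausdorff_space (mtop Q)" by (rule hausdorff_Q)
  show "(\<Union>(U, \<phi>)\<in>atlas Q. U) = points Q"
  proof (intro subset_antisym subsetI)
    fix q assume "q \<in> (\<Union>(U, \<phi>)\<in>atlas Q. U)"
    then obtain W \<theta> where w: "(W, \<theta>) \<in> atlas Q" "q \<in> W" by blast
    then obtain V where V: "W = \<pi> ` V" "openin (mtop M) V" unfolding atlas_Q by blast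
    then show "q \<in> points Q"
      using w openin_subset[OF open_proj[OF V(2)]] by blast
  next
    fix q assume "q \<in> points Q"
    then obtain g where g: "g \<in> carrier G" "q = \<pi> g" by (rule points_QE)
    obtain A where A: "openin (mtop M) A" "g \<in> A" "inj_on \<pi> A" by (rule injective_nbhd[OF g(1)])
    obtain U \<phi> where c: "(U, \<phi>) \<in> atlas M" "g \<in> U" using g M.chart_at[of g] unfolding points_M by blast
    have "(\<pi> ` (A \<inter> U), \<phi> \<circ> inv_into (A \<inter> U) \<pi>) \<in> atlas Q"
      unfolding atlas_Q using A c M.chart_open[OF c(1)]
      by (intro exI[of _ U] exI[of _ "A \<inter> U"] exI[of _ \<phi>]) (auto intro: inj_on_subset)
    then show "q \<in> (\<Union>(U, \<phi>)\<in>atlas Q. U)" using g A c by blast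
  qed
next
  fix W \<theta> assume "(W, \<theta>) \<in> atlas Q"
  then obtain U V \<phi> where v: "W = \<pi> ` V" "\<theta> = \<phi> \<circ> inv_into V \<pi>" "(U, \<phi>) \<in> atlas M"
    "openin (mtop M) V" "V \<subseteq> U" "inj_on \<pi> V" unfolding atlas_Q by blast
  have im: "\<theta> ` (\<pi> ` Y) = \<phi> ` Y" if "Y \<subseteq> V" for Y
    using v(6) that unfolding v(2) image_image by (intro image_cong) (auto simp: subset_iff)
  show oW: "openin (mtop Q) W" using v open_proj by simp
  have imW: "\<theta> ` W = \<phi> ` V" using im v by simp
  show oI: "open (\<theta> ` W)" unfolding imW by (rule M.chart_open_map[OF v(3-5)])
  have tW: "topspace (subtopology (mtop Q) W) = W" using openin_subset[OF oW] by auto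
  have injW: "inj_on \<theta> W"
    unfolding v(1,2) by (rule comp_inj_on[OF inj_on_inv_into[OF subset_refl]])
      (use inj_on_subset[OF M.chart_inj[OF v(3)] v(5)] inv_into_image_cancel[OF v(6) subset_refl] in simp)
  show "homeomorphic_map (subtopology (mtop Q) W) (top_of_set (\<theta> ` W)) \<theta>"
  proof (rule bijective_open_imp_homeomorphic_map)
    show "\<theta> ` topspace (subtopology (mtop Q) W) = topspace (top_of_set (\<theta> ` W))"
      unfolding tW by simp
    show "inj_on \<theta> (topspace (subtopology (mtop Q) W))"
      unfolding tW by (rule injW)
    show "continuous_map (subtopology (mtop Q) W) (top_of_set (\<theta> ` W)) \<theta>"
      unfolding continuous_map_def tW
    proof (intro conjI allI impI)
      fix Y assume Y: "openin (top_of_set (\<theta> ` W)) Y"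
      have "openin (subtopology (mtop M) U) {g \<in> topspace (subtopology (mtop M) U). \<phi> g \<in> Y}"
      proof (rule openin_continuous_map_preimage[OF homeomorphic_imp_continuous_map[OF M.chart_homeo[OF v(3)]]])
        have "open Y" using Y oI by (simp add: openin_open_eq)
        moreover have "Y \<subseteq> \<phi> ` U" using openin_subset[OF Y] v(5) imW by auto
        ultimately show "openin (top_of_set (\<phi> ` U)) Y" by (simp add: open_subset)
      qed
      then have "openin (mtop M) {g \<in> topspace (subtopology (mtop M) U). \<phi> g \<in> Y}"
        using M.chart_open[OF v(3)] openin_trans_full by blast
      then have "openin (mtop M) (V \<inter> {g \<in> topspace (subtopology (mtop M) U). \<phi> g \<in> Y})"
        using v(4) by blast
      moreover have "V \<inter> {g \<in> topspace (subtopology (mtop M) U). \<phi> g \<in> Y} = {g \<in> V. \<phi> g \<in> Y}"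
        using v(5) M.chart_subset[OF v(3)] by auto
      ultimately have "openin (mtop Q) (\<pi> ` {g \<in> V. \<phi> g \<in> Y})" using open_proj by simp
      moreover have "\<pi> ` {g \<in> V. \<phi> g \<in> Y} = {q \<in> W. \<theta> q \<in> Y}"
        unfolding v(1,2) using v(6) by (auto simp: image_iff)
      ultimately show "openin (subtopology (mtop Q) W) {q \<in> W. \<theta> q \<in> Y}"
        unfolding openin_subtopology by (intro exI[of _ "{q \<in> W. \<theta> q \<in> Y}"]) auto
    qed auto
    show "open_map (subtopology (mtop Q) W) (top_of_set (\<theta> ` W)) \<theta>"
      unfolding open_map_def
    proof (intro allI impI)
      fix Y assume "openin (subtopology (mtop Q) W) Y"
      then have Y: "openin (mtop Q) Y" "Y \<subseteq> W"
        using oW openin_trans_full openin_subset[of "subtopology (mtop Q) W" Y] by auto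
      let ?Y = "V \<inter> {g \<in> carrier G. \<pi> g \<in> Y}"
      have "openin (mtop M) ?Y" using v(4) Y by (auto simp: openin_quotient)
      then have "open (\<phi> ` ?Y)" using v(5) by (intro M.chart_open_map[OF v(3)]) auto
      moreover have "Y = \<pi> ` ?Y"
        using Y(2) v(1) openin_subset[OF v(4)] by (auto simp: points_M)
      then have "\<theta> ` Y = \<phi> ` ?Y" using im[of ?Y] by auto
      ultimately show "openin (top_of_set (\<theta> ` W)) (\<theta> ` Y)"
        using image_mono[OF Y(2), of \<theta>] by (simp only: open_subset)
    qed
  qed
next
  fix W \<theta> W' \<theta>' assume "(W, \<theta>) \<in> atlas Q" and "(W', \<theta>') \<in> atlas Q"
  then obtain U V \<phi> U' V' \<psi> where v: "W = \<pi> ` V" "\<theta> = \<phi> \<circ> inv_into V \<pi>" "(U, \<phi>) \<in> atlas M"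
    "openin (mtop M) V" "V \<subseteq> U" "inj_on \<pi> V"
    and v': "W' = \<pi> ` V'" "\<theta>' = \<psi> \<circ> inv_into V' \<pi>" "(U', \<psi>) \<in> atlas M"
    "openin (mtop M) V'" "V' \<subseteq> U'" "inj_on \<pi> V'" unfolding atlas_Q by metis
  have injW: "inj_on \<theta> W"
    unfolding v(1,2) by (rule comp_inj_on[OF inj_on_inv_into[OF subset_refl]])
      (use inj_on_subset[OF M.chart_inj[OF v(3)] v(5)] inv_into_image_cancel[OF v(6) subset_refl] in simp)
  show "smooth_on (\<theta> ` (W \<inter> W')) (\<theta>' \<circ> inv_into W \<theta>)"
  proof (rule smooth_on_local)
    fix y assume "y \<in> \<theta> ` (W \<inter> W')"
    then obtain q where q: "q \<in> \<pi> ` V" "q \<in> \<pi> ` V'" "y = \<theta> q" unfolding v(1) v'(1) by blast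
    then obtain g h where gh: "g \<in> V" "h \<in> V'" "q = \<pi> g" "q = \<pi> h" by blast
    then have g: "g \<in> V" "h \<in> V'" "\<pi> h = \<pi> g" "y = \<phi> g"
      using q(3) v(2) inv_into_f_f[OF v(6) gh(1)] by auto
    have gc: "g \<in> carrier G" "h \<in> carrier G"
      using g openin_subset[OF v(4)] openin_subset[OF v'(4)] by (auto simp: points_M)
    obtain \<gamma> where \<gamma>: "\<gamma> \<in> \<Gamma>" "h = \<gamma> \<otimes> g" using proj_eqE[OF g(3) gc(2,1)] by blast
    let ?B = "{k \<in> V. \<gamma> \<otimes> k \<in> V'}"
    have "openin (mtop M) (V \<inter> {k \<in> points M. \<gamma> \<otimes> k \<in> V'})"
      using v(4) openin_continuous_map_preimage[OF continuous_left_mult[OF Gamma_carrier[OF \<gamma>(1)]] v'(4)] by blast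
    moreover have "V \<inter> {k \<in> points M. \<gamma> \<otimes> k \<in> V'} = ?B" using openin_subset[OF v(4)] by auto
    ultimately have oB: "open (\<phi> ` ?B)" using v(5) by (intro M.chart_open_map[OF v(3)]) auto
    have "smooth_on (\<phi> ` ?B) (\<lambda>y. \<psi> (\<gamma> \<otimes> inv_into U \<phi> y))"
      by (rule smooth_on_subset[OF smooth_left_mult[OF v(3) v'(3) Gamma_carrier[OF \<gamma>(1)]]])
        (use v(5) v'(5) in auto)
    then have "smooth_on (\<phi> ` ?B) (\<theta>' \<circ> inv_into W \<theta>)"
    proof (rule smooth_on_transfer[OF oB])
      fix z assume "z \<in> \<phi> ` ?B"
      then obtain k where k: "k \<in> V" "\<gamma> \<otimes> k \<in> V'" "z = \<phi> k" by blast
      have kc: "k \<in> carrier G" using k openin_subset[OF v(4)] by (auto simp: points_M)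
      have "\<theta> (\<pi> k) = z" using k v by simp
      then have "inv_into W \<theta> z = \<pi> k"
        using inv_into_f_f[OF injW, of "\<pi> k"] k v(1) by auto
      moreover have "inv_into V' \<pi> (\<pi> k) = \<gamma> \<otimes> k"
        using inv_into_f_f[OF v'(6) k(2)] proj_mult[OF \<gamma>(1) kc] by simp
      moreover have "inv_into U \<phi> z = k" using k v(5) M.chart_inj[OF v(3)] by (auto simp: subset_iff)
      ultimately show "\<psi> (\<gamma> \<otimes> inv_into U \<phi> z) = (\<theta>' \<circ> inv_into W \<theta>) z" by (simp add: v')
    qed
    then show "\<exists>T. open T \<and> y \<in> T \<and> smooth_on T (\<theta>' \<circ> inv_into W \<theta>)"
      using oB g \<gamma> by blast
  qed
qed

sublocale Q: charted Q by (rule charted_Q)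

lemma proj_chart:
  assumes c: "(U, \<phi>) \<in> atlas M" and g: "g \<in> U"
  obtains V where "openin (mtop M) V" "V \<subseteq> U" "g \<in> V" "(\<pi> ` V, \<phi> \<circ> inv_into V \<pi>) \<in> atlas Q"
    "\<And>y. y \<in> \<phi> ` V \<Longrightarrow> inv_into (\<pi> ` V) (\<phi> \<circ> inv_into V \<pi>) y = \<pi> (inv_into U \<phi> y)"
    "(\<phi> \<circ> inv_into V \<pi>) (\<pi> g) = \<phi> g" "(\<phi> \<circ> inv_into V \<pi>) ` \<pi> ` V = \<phi> ` V"
proof -
  have gc: "g \<in> carrier G" using M.chart_subset[OF c] g by (auto simp: points_M)
  obtain A where A: "openin (mtop M) A" "g \<in> A" "inj_on \<pi> A" by (rule injective_nbhd[OF gc])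
  let ?V = "A \<inter> U"
  have inj: "inj_on \<pi> ?V" using A(3) by (auto intro: inj_on_subset)
  have at: "(\<pi> ` ?V, \<phi> \<circ> inv_into ?V \<pi>) \<in> atlas Q"
    unfolding atlas_Q using A c M.chart_open[OF c(1)] inj
    by (intro exI[of _ U] exI[of _ ?V] exI[of _ \<phi>]) auto
  show ?thesis
  proof (rule that[of ?V])
    fix y assume "y \<in> \<phi> ` ?V"
    then obtain k where k: "k \<in> ?V" "y = \<phi> k" by blast
    have "(\<phi> \<circ> inv_into ?V \<pi>) (\<pi> k) = y" using inv_into_f_f[OF inj k(1)] k(2) by simp
    then have "inv_into (\<pi> ` ?V) (\<phi> \<circ> inv_into ?V \<pi>) y = \<pi> k"
      using inv_into_f_f[OF Q.chart_inj[OF at], of "\<pi> k"] k(1) by auto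
    moreover have "inv_into U \<phi> y = k" using k inv_into_f_f[OF M.chart_inj[OF c]] by simp
    ultimately show "inv_into (\<pi> ` ?V) (\<phi> \<circ> inv_into ?V \<pi>) y = \<pi> (inv_into U \<phi> y)" by simp
  next
    show "(\<phi> \<circ> inv_into ?V \<pi>) (\<pi> g) = \<phi> g" using inv_into_f_f[OF inj, of g] A g by simp
    show "(\<phi> \<circ> inv_into ?V \<pi>) ` \<pi> ` ?V = \<phi> ` ?V"
      unfolding image_image using inv_into_f_f[OF inj] by (intro image_cong) auto
  qed (use A g at M.chart_open[OF c] in auto)
qed

lemma smooth_fun_proj:
  assumes h: "h \<in> smooth_fun Q" shows "(\<lambda>x. if x \<in> points M then h (\<pi> x) else 0) \<in> smooth_fun M"
proof (rule M.smooth_funI)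
  fix U \<phi> assume c: "(U, \<phi>) \<in> atlas M"
  show "smooth_on (\<phi> ` U) (\<lambda>y. if inv_into U \<phi> y \<in> points M then h (\<pi> (inv_into U \<phi> y)) else 0)"
  proof (rule smooth_on_local)
    fix y assume "y \<in> \<phi> ` U"
    then obtain g where g: "g \<in> U" "y = \<phi> g" by blast
    obtain V where V: "openin (mtop M) V" "V \<subseteq> U" "g \<in> V" "(\<pi> ` V, \<phi> \<circ> inv_into V \<pi>) \<in> atlas Q"
      "\<And>y. y \<in> \<phi> ` V \<Longrightarrow> inv_into (\<pi> ` V) (\<phi> \<circ> inv_into V \<pi>) y = \<pi> (inv_into U \<phi> y)"
      "(\<phi> \<circ> inv_into V \<pi>) ` \<pi> ` V = \<phi> ` V"
      using proj_chart[OF c g(1)] by metis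
    have o: "open (\<phi> ` V)" by (rule M.chart_open_map[OF c V(1,2)])
    have "smooth_on (\<phi> ` V) (\<lambda>y. h (inv_into (\<pi> ` V) (\<phi> \<circ> inv_into V \<pi>) y))"
      using Q.smooth_fun_chart[OF h V(4)] unfolding V(6) .
    then have "smooth_on (\<phi> ` V) (\<lambda>y. if inv_into U \<phi> y \<in> points M then h (\<pi> (inv_into U \<phi> y)) else 0)"
    proof (rule smooth_on_transfer[OF o])
      fix z assume z: "z \<in> \<phi> ` V"
      then have "inv_into U \<phi> z \<in> U" using V(2) by (auto intro: inv_into_into)
      then show "h (inv_into (\<pi> ` V) (\<phi> \<circ> inv_into V \<pi>) z) =
          (if inv_into U \<phi> z \<in> points M then h (\<pi> (inv_into U \<phi> z)) else 0)"
        using V(5)[OF z] M.chart_subset[OF c] by auto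
    qed
    then show "\<exists>T. open T \<and> y \<in> T \<and> smooth_on T (\<lambda>y. if inv_into U \<phi> y \<in> points M then h (\<pi> (inv_into U \<phi> y)) else 0)"
      using o V(3) g by blast
  qed
qed auto

text \<open>The projection is a chart-preserving local bijection, so a vector of the quotient is lifted by taking
  the same coefficients with respect to the coordinate derivations.\<close>

lemma pushforward_proj_surj:
  assumes g: "g \<in> carrier G" and v: "v \<in> (tangent_space Q (\<pi> g) :: ('g set, complex) tvec set)"
  obtains w where "w \<in> tangent_space M g" "pushforward M Q \<pi> w = v"
proof -
  obtain U \<phi> where c: "(U, \<phi>) \<in> atlas M" "g \<in> U" using g M.chart_at[of g] unfolding points_M by blast
  obtain V where V: "openin (mtop M) V" "V \<subseteq> U" "g \<in> V" "(\<pi> ` V, \<phi> \<circ> inv_into V \<pi>) \<in> atlas Q"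
    "\<And>y. y \<in> \<phi> ` V \<Longrightarrow> inv_into (\<pi> ` V) (\<phi> \<circ> inv_into V \<pi>) y = \<pi> (inv_into U \<phi> y)"
    "(\<phi> \<circ> inv_into V \<pi>) (\<pi> g) = \<phi> g"
    using proj_chart[OF c] by metis
  obtain k where k: "\<And>f. f \<in> smooth_fun Q \<Longrightarrow> v f = (\<Sum>i\<in>Basis. k i *
      complex_of_real (Q.coord_deriv (\<pi> ` V) (\<phi> \<circ> inv_into V \<pi>) (\<pi> g) i f))"
    using Q.tangent_coord_deriv[OF V(4) _ v] V(3) by blast
  define w where "w = (\<lambda>f. if f \<in> smooth_fun M then
      \<Sum>i\<in>Basis. k i * complex_of_real (M.coord_deriv U \<phi> g i f) else 0)"
  have wT: "w \<in> tangent_space M g" unfolding w_def by (rule M.coord_deriv_tangent[OF c])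
  have "pushforward M Q \<pi> w h = v h" for h
  proof (cases "h \<in> smooth_fun Q")
    case True
    let ?h = "\<lambda>x. if x \<in> points M then h (\<pi> x) else 0"
    have o: "open (\<phi> ` V)" by (rule M.chart_open_map[OF c(1) V(1,2)])
    have "M.coord_deriv U \<phi> g i ?h = Q.coord_deriv (\<pi> ` V) (\<phi> \<circ> inv_into V \<pi>) (\<pi> g) i h" for i
      unfolding M.coord_deriv_def Q.coord_deriv_def V(6)
    proof (rule fun_cong[of _ _ i], rule frechet_derivative_transform_within_open[OF _ o])
      show "(\<lambda>y. ?h (inv_into U \<phi> y)) differentiable at (\<phi> g)"
        using M.smooth_fun_chart[OF smooth_fun_proj[OF True] c(1)] c(2)
        by (intro smooth_on_differentiable) auto
      fix z assume z: "z \<in> \<phi> ` V"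
      then have "inv_into U \<phi> z \<in> U" using V(2) by (auto intro: inv_into_into)
      then show "?h (inv_into U \<phi> z) = h (inv_into (\<pi> ` V) (\<phi> \<circ> inv_into V \<pi>) z)"
        using V(5)[OF z] M.chart_subset[OF c(1)] by auto
    qed (use V in auto)
    then show ?thesis
      using smooth_fun_proj[OF True] True k by (simp add: pushforward_def w_def)
  next
    case False
    then show ?thesis using Q.tangent_outside[OF v] by (simp add: pushforward_def)
  qed
  then show ?thesis using that[OF wT] by blast
qed

text \<open>Left translations act transitively, so an invariant form is determined by its value at one
  point.\<close>

lemma left_invariant_form_eq_0:
  assumes \<omega>: "\<omega> \<in> left_invariant_forms G M \<Gamma>"
    and 0: "\<And>v. v \<in> tangent_space Q (\<pi> \<one>) \<Longrightarrow> \<omega> (\<pi> \<one>) [v] = 0"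
    and q: "q \<in> points Q" and v: "v \<in> tangent_space Q q"
  shows "\<omega> q [v] = 0"
proof -
  obtain g where g: "g \<in> carrier G" "q = \<pi> g" by (rule points_QE[OF q])
  obtain w where w: "w \<in> tangent_space M g" "pushforward M Q \<pi> w = v"
    using pushforward_proj_surj[OF g(1)] v g by blast
  have \<omega>Q: "\<omega> \<in> forms Q" using \<omega> by (simp add: left_invariant_forms_def)
  have 00: "\<omega> (\<pi> \<one>) [u] = 0" for u
    using 0[of u] \<omega>Q by (cases "u \<in> tangent_space Q (\<pi> \<one>)") (auto simp: forms_def)
  let ?\<eta> = "form_pullback M Q \<pi> \<omega>"
  have "form_pullback M M (\<lambda>h. inv g \<otimes> h) ?\<eta> = ?\<eta>"
    using \<omega> g by (auto simp: left_invariant_forms_def left_invariant_form_on_group_def)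
  then have "?\<eta> g [w] = form_pullback M M (\<lambda>h. inv g \<otimes> h) ?\<eta> g [w]" by simp
  also have "\<dots> = ?\<eta> \<one> [pushforward M M (\<lambda>h. inv g \<otimes> h) w]"
    using g w by (simp add: form_pullback_def[of M M] points_M)
  also have "\<dots> = 0" using 00 by (simp add: form_pullback_def)
  finally have "?\<eta> g [w] = 0" .
  moreover have "?\<eta> g [w] = \<omega> q [v]" using g w by (simp add: form_pullback_def points_M)
  ultimately show ?thesis by simp
qed

end

section \<open>Complex vector fields\<close>

definition smul :: "('a \<Rightarrow> complex) \<Rightarrow> ('a \<Rightarrow> ('a, complex) tvec) \<Rightarrow> 'a \<Rightarrow> ('a, complex) tvec" where
  "smul h V = (\<lambda>x f. h x * V x f)"

definition vadd :: "('a \<Rightarrow> ('a, complex) tvec) \<Rightarrow> ('a \<Rightarrow> ('a, complex) tvec) \<Rightarrow> 'a \<Rightarrow> ('a, complex) tvec" where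
  "vadd V W = V + W"

context charted
begin

lemma ac_of_real: "v \<in> T x \<Longrightarrow> apply_complex v (\<lambda>y. complex_of_real (f y)) = v f"
  by (simp add: apply_complex_def tangent_zero)

lemma ac_add:
  assumes "v \<in> T x" "h \<in> SC" "k \<in> SC"
  shows "apply_complex v (\<lambda>y. h y + k y) = apply_complex v h + apply_complex v k"
  using tangent_add[OF assms(1) SC_Re[OF assms(2)] SC_Re[OF assms(3)]]
    tangent_add[OF assms(1) SC_Im[OF assms(2)] SC_Im[OF assms(3)]]
  by (simp add: apply_complex_def algebra_simps)

lemma ac_mult:
  assumes v: "v \<in> T x" and h: "h \<in> SC" and k: "k \<in> SC"
  shows "apply_complex v (\<lambda>y. h y * k y) = h x * apply_complex v k + k x * apply_complex v h"
proof -
  note S = SC_Re[OF h] SC_Im[OF h] SC_Re[OF k] SC_Im[OF k]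
  have e1: "v (\<lambda>y. Re (h y * k y)) = Re (h x) * v (\<lambda>y. Re (k y)) + Re (k x) * v (\<lambda>y. Re (h y))
      - (Im (h x) * v (\<lambda>y. Im (k y)) + Im (k x) * v (\<lambda>y. Im (h y)))"
    using tangent_diff[OF v smooth_fun_mult[OF S(1,3)] smooth_fun_mult[OF S(2,4)]]
      tangent_mult[OF v S(1,3)] tangent_mult[OF v S(2,4)]
    by (simp add: scaleR_conv_of_real)
  have e2: "v (\<lambda>y. Im (h y * k y)) = Re (h x) * v (\<lambda>y. Im (k y)) + Im (k x) * v (\<lambda>y. Re (h y))
      + (Im (h x) * v (\<lambda>y. Re (k y)) + Re (k x) * v (\<lambda>y. Im (h y)))"
    using tangent_add[OF v smooth_fun_mult[OF S(1,4)] smooth_fun_mult[OF S(2,3)]]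
      tangent_mult[OF v S(1,4)] tangent_mult[OF v S(2,3)]
    by (simp add: scaleR_conv_of_real)
  have "h x = Re (h x) + \<i> * Im (h x)" "k x = Re (k x) + \<i> * Im (k x)"
    by (simp_all add: complex_eq_iff)
  then have e3: "h x * apply_complex v k + k x * apply_complex v h =
      (Re (h x) + \<i> * Im (h x)) * apply_complex v k + (Re (k x) + \<i> * Im (k x)) * apply_complex v h"
    by metis
  show ?thesis
    unfolding e3 unfolding apply_complex_def e1 e2 by (simp add: algebra_simps)
qed

lemma ac_cmult:
  assumes v: "v \<in> T x" and h: "h \<in> SC"
  shows "apply_complex v (\<lambda>y. c * h y) = c * apply_complex v h"
proof -
  note S = SC_Re[OF h] SC_Im[OF h]
  have e1: "v (\<lambda>y. Re (c * h y)) = Re c * v (\<lambda>y. Re (h y)) - Im c * v (\<lambda>y. Im (h y))"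
    using tangent_diff[OF v smooth_fun_cmult[OF S(1)] smooth_fun_cmult[OF S(2)]]
      tangent_cmult[OF v S(1)] tangent_cmult[OF v S(2)] by (simp add: scaleR_conv_of_real)
  have e2: "v (\<lambda>y. Im (c * h y)) = Re c * v (\<lambda>y. Im (h y)) + Im c * v (\<lambda>y. Re (h y))"
    using tangent_add[OF v smooth_fun_cmult[OF S(2)] smooth_fun_cmult[OF S(1)]]
      tangent_cmult[OF v S(1)] tangent_cmult[OF v S(2)] by (simp add: scaleR_conv_of_real)
  have "c = Re c + \<i> * Im c" by (simp add: complex_eq_iff)
  then have e3: "c * apply_complex v h = (Re c + \<i> * Im c) * apply_complex v h" by metis
  show ?thesis unfolding e3 unfolding apply_complex_def e1 e2 by (simp add: algebra_simps)
qed

lemma ac_zero: "v \<in> T x \<Longrightarrow> apply_complex v (\<lambda>y. 0) = 0"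
  by (simp add: apply_complex_def tangent_zero)

lemma ac_uminus: "v \<in> T x \<Longrightarrow> h \<in> SC \<Longrightarrow> apply_complex v (\<lambda>y. - h y) = - apply_complex v h"
  using ac_cmult[of v x h "-1"] by simp

lemma ac_diff:
  "v \<in> T x \<Longrightarrow> h \<in> SC \<Longrightarrow> k \<in> SC \<Longrightarrow> apply_complex v (\<lambda>y. h y - k y) = apply_complex v h - apply_complex v k"
  using ac_add[of v x h "\<lambda>y. - k y"] ac_uminus[of v x k] by auto

lemma ac_vec_zero [simp]: "apply_complex 0 h = 0" "apply_complex (\<lambda>f. 0) h = 0"
  by (simp_all add: apply_complex_def)

lemma ac_vec_add: "apply_complex (v + w) h = apply_complex v h + apply_complex w h"
  by (simp add: apply_complex_def algebra_simps)

lemma ac_vec_cmult: "apply_complex (\<lambda>f. c * v f) h = c * apply_complex v h"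
  by (simp add: apply_complex_def algebra_simps)

lemma VF_tangent: "V \<in> VF \<Longrightarrow> x \<in> points M \<Longrightarrow> V x \<in> T x"
  by (simp add: vector_fields_def)

lemma VF_outside: "V \<in> VF \<Longrightarrow> x \<notin> points M \<Longrightarrow> V x = 0"
  by (simp add: vector_fields_def)

lemma VF_smooth: "V \<in> VF \<Longrightarrow> f \<in> S \<Longrightarrow> (\<lambda>x. V x f) \<in> SC"
  by (simp add: vector_fields_def)

lemma VF_nonsmooth: "V \<in> VF \<Longrightarrow> f \<notin> S \<Longrightarrow> V x f = 0"
  by (cases "x \<in> points M") (auto simp: VF_outside dest: VF_tangent tangent_outside)

lemma VF_I:
  assumes "\<And>x. x \<in> points M \<Longrightarrow> V x \<in> T x" "\<And>x. x \<notin> points M \<Longrightarrow> V x = 0"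
    "\<And>f. f \<in> S \<Longrightarrow> (\<lambda>x. V x f) \<in> SC"
  shows "V \<in> VF"
  using assms by (simp add: vector_fields_def)

lemma VF_eqI:
  "V \<in> VF \<Longrightarrow> W \<in> VF \<Longrightarrow> (\<And>x f. x \<in> points M \<Longrightarrow> f \<in> S \<Longrightarrow> V x f = W x f) \<Longrightarrow> V = W"
  by (intro ext) (metis VF_nonsmooth VF_outside)

lemma act_smooth: "V \<in> VF \<Longrightarrow> h \<in> SC \<Longrightarrow> (\<lambda>x. apply_complex (V x) h) \<in> SC"
  unfolding apply_complex_def
  by (rule smooth_fun_add[OF VF_smooth[OF _ SC_Re] smooth_fun_cmult[OF VF_smooth[OF _ SC_Im]]])

lemma VF_add: "V \<in> VF \<Longrightarrow> W \<in> VF \<Longrightarrow> V + W \<in> VF"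
  by (rule VF_I) (auto simp: VF_tangent VF_outside VF_smooth intro: T_add smooth_fun_add)

lemma VF_vadd: "V \<in> VF \<Longrightarrow> W \<in> VF \<Longrightarrow> vadd V W \<in> VF"
  unfolding vadd_def by (rule VF_add)

lemma VF_smul: "h \<in> SC \<Longrightarrow> V \<in> VF \<Longrightarrow> smul h V \<in> VF"
  by (rule VF_I) (auto simp: smul_def VF_tangent VF_outside VF_smooth fun_eq_iff intro: T_cmult smooth_fun_mult)

lemma VF_zero: "0 \<in> VF"
  by (rule VF_I) auto

lemma act_add:
  assumes "V \<in> VF" "h \<in> SC" "k \<in> SC"
  shows "apply_complex (V x) (\<lambda>y. h y + k y) = apply_complex (V x) h + apply_complex (V x) k"
  using assms ac_add[OF VF_tangent] by (cases "x \<in> points M") (simp_all add: VF_outside)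

lemma act_diff:
  assumes "V \<in> VF" "h \<in> SC" "k \<in> SC"
  shows "apply_complex (V x) (\<lambda>y. h y - k y) = apply_complex (V x) h - apply_complex (V x) k"
  using assms ac_diff[OF VF_tangent] by (cases "x \<in> points M") (simp_all add: VF_outside)

lemma act_uminus:
  assumes "V \<in> VF" "h \<in> SC"
  shows "apply_complex (V x) (\<lambda>y. - h y) = - apply_complex (V x) h"
  using assms ac_uminus[OF VF_tangent] by (cases "x \<in> points M") (simp_all add: VF_outside)

lemma act_zero: assumes "V \<in> VF" shows "apply_complex (V x) (\<lambda>y. 0) = 0"
  using assms ac_zero[OF VF_tangent] by (cases "x \<in> points M") (simp_all add: VF_outside)

lemma act_cmult:
  assumes "V \<in> VF" "h \<in> SC"
  shows "apply_complex (V x) (\<lambda>y. c * h y) = c * apply_complex (V x) h"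
  using assms ac_cmult[OF VF_tangent] by (cases "x \<in> points M") (simp_all add: VF_outside)

lemma act_mult:
  assumes "V \<in> VF" "h \<in> SC" "k \<in> SC"
  shows "apply_complex (V x) (\<lambda>y. h y * k y) = h x * apply_complex (V x) k + k x * apply_complex (V x) h"
  using assms ac_mult[OF VF_tangent] by (cases "x \<in> points M") (simp_all add: VF_outside)

lemma VF_field_add: "V \<in> VF \<Longrightarrow> f \<in> S \<Longrightarrow> g \<in> S \<Longrightarrow> V x (\<lambda>y. f y + g y) = V x f + V x g"
  by (cases "x \<in> points M") (auto simp: VF_outside dest: VF_tangent tangent_add)

lemma VF_field_mult:
  "V \<in> VF \<Longrightarrow> f \<in> S \<Longrightarrow> g \<in> S \<Longrightarrow> V x (\<lambda>y. f y * g y) = complex_of_real (f x) * V x g + complex_of_real (g x) * V x f"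
  by (cases "x \<in> points M") (auto simp: VF_outside scaleR_conv_of_real tangent_mult[OF VF_tangent])

lemma VF_field_cmult: "V \<in> VF \<Longrightarrow> f \<in> S \<Longrightarrow> V x (\<lambda>y. c * f y) = complex_of_real c * V x f"
  by (cases "x \<in> points M") (auto simp: VF_outside scaleR_conv_of_real tangent_cmult[OF VF_tangent])

lemma act_of_real: "V \<in> VF \<Longrightarrow> apply_complex (V x) (\<lambda>y. complex_of_real (f y)) = V x f"
  by (cases "x \<in> points M") (auto simp: VF_outside ac_of_real[OF VF_tangent])

lemma bracket_VF:
  assumes V: "V \<in> VF" and W: "W \<in> VF" shows "lie_bracket V W \<in> VF"
proof (rule VF_I)
  fix x assume x: "x \<in> points M"
  note s = VF_smooth[OF V] VF_smooth[OF W]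
  show "lie_bracket V W x \<in> T x"
    unfolding tangent_space_def
  proof (intro CollectI conjI ballI allI impI)
    fix f g assume f: "f \<in> S" and g: "g \<in> S"
    show "lie_bracket V W x (\<lambda>y. f y + g y) = lie_bracket V W x f + lie_bracket V W x g"
      unfolding lie_bracket_def VF_field_add[OF V f g] VF_field_add[OF W f g]
      using act_add[OF V s(2)[OF f] s(2)[OF g]] act_add[OF W s(1)[OF f] s(1)[OF g]] by simp
    have e: "apply_complex (V x) (\<lambda>y. W y (\<lambda>z. f z * g z)) =
        f x * apply_complex (V x) (\<lambda>y. W y g) + W x g * V x f + (g x * apply_complex (V x) (\<lambda>y. W y f) + W x f * V x g)"
      if V: "V \<in> VF" and W: "W \<in> VF" for V W
      unfolding VF_field_mult[OF W f g]
      using act_add[OF V smooth_fun_mult[OF SC_of_real[OF f] VF_smooth[OF W g]] smooth_fun_mult[OF SC_of_real[OF g] VF_smooth[OF W f]]]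
        act_mult[OF V SC_of_real[OF f] VF_smooth[OF W g]] act_mult[OF V SC_of_real[OF g] VF_smooth[OF W f]]
      by (simp add: act_of_real[OF V])
    show "lie_bracket V W x (\<lambda>y. f y * g y) = f x *\<^sub>R lie_bracket V W x g + g x *\<^sub>R lie_bracket V W x f"
      unfolding lie_bracket_def e[OF V W] e[OF W V]
      by (simp add: scaleR_conv_of_real algebra_simps)
  next
    fix f and c :: real assume f: "f \<in> S"
    show "lie_bracket V W x (\<lambda>y. c * f y) = c *\<^sub>R lie_bracket V W x f"
      unfolding lie_bracket_def VF_field_cmult[OF V f] VF_field_cmult[OF W f]
      using act_cmult[OF V s(2)[OF f], of x c] act_cmult[OF W s(1)[OF f], of x c]
      by (simp add: scaleR_conv_of_real algebra_simps)
  next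
    fix f assume "f \<notin> S"
    then show "lie_bracket V W x f = 0"
      by (simp add: lie_bracket_def VF_nonsmooth[OF V] VF_nonsmooth[OF W] act_zero V W)
  qed
next
  fix x assume "x \<notin> points M"
  then show "lie_bracket V W x = 0"
    by (simp add: lie_bracket_def fun_eq_iff VF_outside V W)
next
  fix f assume "f \<in> S"
  then show "(\<lambda>x. lie_bracket V W x f) \<in> SC"
    unfolding lie_bracket_def
    by (intro smooth_fun_diff[OF act_smooth[OF V VF_smooth[OF W]] act_smooth[OF W VF_smooth[OF V]]])
qed

lemma act_bracket:
  assumes V: "V \<in> VF" and W: "W \<in> VF" and h: "h \<in> SC"
  shows "apply_complex (lie_bracket V W x) h =
    apply_complex (V x) (\<lambda>y. apply_complex (W y) h) - apply_complex (W x) (\<lambda>y. apply_complex (V y) h)"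
proof -
  have e: "apply_complex (V x) (\<lambda>y. apply_complex (W y) h) =
      apply_complex (V x) (\<lambda>y. W y (\<lambda>z. Re (h z))) + \<i> * apply_complex (V x) (\<lambda>y. W y (\<lambda>z. Im (h z)))"
    if V: "V \<in> VF" and W: "W \<in> VF" for V W
    unfolding apply_complex_def[of "W _"]
    using act_add[OF V VF_smooth[OF W SC_Re[OF h]] smooth_fun_cmult[OF VF_smooth[OF W SC_Im[OF h]]], of x \<i>]
      act_cmult[OF V VF_smooth[OF W SC_Im[OF h]], of x \<i>] by simp
  show ?thesis
    unfolding e[OF V W] e[OF W V] apply_complex_def[of "lie_bracket V W x"] lie_bracket_def
    by (simp add: algebra_simps)
qed

lemma bracket_add_right:
  assumes "V \<in> VF" "W \<in> VF" "U \<in> VF"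
  shows "lie_bracket V (vadd W U) = vadd (lie_bracket V W) (lie_bracket V U)"
proof (rule VF_eqI)
  fix x f assume "f \<in> S"
  then show "lie_bracket V (vadd W U) x f = vadd (lie_bracket V W) (lie_bracket V U) x f"
    using act_add[OF assms(1) VF_smooth[OF assms(2)] VF_smooth[OF assms(3)], of f f x]
    by (simp add: vadd_def lie_bracket_def ac_vec_add)
qed (auto intro: bracket_VF VF_vadd assms)

lemma bracket_smul_right:
  assumes "V \<in> VF" "W \<in> VF" "h \<in> SC"
  shows "lie_bracket V (smul h W) = vadd (smul (\<lambda>x. apply_complex (V x) h) W) (smul h (lie_bracket V W))"
proof (rule VF_eqI)
  fix x f assume "f \<in> S"
  then show "lie_bracket V (smul h W) x f = vadd (smul (\<lambda>x. apply_complex (V x) h) W) (smul h (lie_bracket V W)) x f"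
    using act_mult[OF assms(1,3) VF_smooth[OF assms(2)], of f x]
    by (simp add: vadd_def lie_bracket_def smul_def ac_vec_cmult algebra_simps)
qed (auto intro!: bracket_VF VF_vadd VF_smul act_smooth assms)

lemma bracket_antisym: "lie_bracket W V = smul (\<lambda>x. -1) (lie_bracket V W)"
  by (simp add: lie_bracket_def smul_def fun_eq_iff)

text \<open>In this form the Jacobi identity says that the bracket with \<open>V\<close> is a derivation; it makes the Lie
  derivatives of cochains a representation of the Lie algebra of vector fields.\<close>

lemma jacobi:
  assumes V: "V \<in> VF" and W: "W \<in> VF" and U: "U \<in> VF"
  shows "lie_bracket V (lie_bracket W U) = vadd (lie_bracket (lie_bracket V W) U) (lie_bracket W (lie_bracket V U))"
proof (rule VF_eqI)
  fix x f assume f: "f \<in> S"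
  have e: "apply_complex (V x) (\<lambda>y. lie_bracket W U y f) =
      apply_complex (V x) (\<lambda>y. apply_complex (W y) (\<lambda>y. U y f)) - apply_complex (V x) (\<lambda>y. apply_complex (U y) (\<lambda>y. W y f))"
    if "V \<in> VF" "W \<in> VF" "U \<in> VF" for V W U
    unfolding lie_bracket_def
    by (rule act_diff[OF that(1) act_smooth[OF that(2) VF_smooth[OF that(3) f]] act_smooth[OF that(3) VF_smooth[OF that(2) f]]])
  show "lie_bracket V (lie_bracket W U) x f = vadd (lie_bracket (lie_bracket V W) U) (lie_bracket W (lie_bracket V U)) x f"
    unfolding vadd_def plus_fun_apply lie_bracket_def[of V "lie_bracket W U"] lie_bracket_def[of W "lie_bracket V U"]
      lie_bracket_def[of "lie_bracket V W"] e[OF V W U] e[OF U V W] e[OF W V U]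
      act_bracket[OF V W VF_smooth[OF U f]] act_bracket[OF W U VF_smooth[OF V f]] act_bracket[OF V U VF_smooth[OF W f]]
    by simp
qed (intro bracket_VF VF_vadd V W U)+

section \<open>Extension of tangent vectors\<close>

lemma VF_lincomb:
  assumes "\<And>i. i \<in> I \<Longrightarrow> h i \<in> SC" "\<And>i. i \<in> I \<Longrightarrow> E i \<in> VF"
  shows "(\<lambda>x f. \<Sum>i\<in>I. h i x * E i x f) \<in> VF"
  using assms
proof (induction I rule: infinite_finite_induct)
  case (insert i I)
  then have "smul (h i) (E i) + (\<lambda>x f. \<Sum>i\<in>I. h i x * E i x f) \<in> VF"
    by (intro VF_add VF_smul) auto
  moreover have "smul (h i) (E i) + (\<lambda>x f. \<Sum>i\<in>I. h i x * E i x f) = (\<lambda>x f. \<Sum>i\<in>insert i I. h i x * E i x f)"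
    using insert by (auto simp: fun_eq_iff smul_def)
  ultimately show ?case by simp
qed (use VF_zero in \<open>auto simp: zero_fun_def\<close>)

text \<open>A combination of a frame with constant coefficients extends the vector \<open>v\<close>, so that the choice in the
  definition of \<open>field_extension\<close> is made from a nonempty set.\<close>

lemma field_extension:
  assumes x: "x \<in> points M" and v: "v \<in> T x"
  shows "field_extension M x v \<in> VF" "field_extension M x v x = v"
proof -
  obtain b E l where b: "b \<in> SC" "b x \<noteq> 0" "\<And>i. E i \<in> VF"
    "\<And>x (v :: ('a, complex) tvec) f. x \<in> points M \<Longrightarrow> v \<in> T x \<Longrightarrow> f \<in> S \<Longrightarrow>
        b x * v f = (\<Sum>i\<in>(Basis::'e set). l i x v * E i x f)"
    by (rule frame[OF x]) blast
  define V where "V = (\<lambda>y f. \<Sum>i\<in>(Basis::'e set). (if y \<in> points M then l i x v / b x else 0) * E i y f)"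
  have V: "V \<in> VF" unfolding V_def by (intro VF_lincomb smooth_fun_const b)
  have "V x f = v f" if "f \<in> S" for f
  proof -
    have "b x * V x f = (\<Sum>i\<in>Basis. l i x v * E i x f)"
      using x b(2) by (simp add: V_def sum_distrib_left)
    then show ?thesis using b(4)[OF x v that] b(2) by (metis mult_left_cancel)
  qed
  then have "V x = v" by (rule tangent_eqI[OF VF_tangent[OF V x] v])
  then have "\<exists>V. V \<in> VF \<and> V x = v" using V by blast
  then show "field_extension M x v \<in> VF" "field_extension M x v x = v"
    unfolding field_extension_def by (metis (mono_tags, lifting) someI_ex)+
qed

end

section \<open>Cochains and the exterior derivative\<close>

text \<open>A form is handled as the function that it induces on lists of global vector fields. On such
  cochains, the Lie derivative and the exterior derivative are defined by recursion over the list,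
  the latter by Cartan's formula \<open>i\<^sub>V d = L\<^sub>V - d i\<^sub>V\<close>.\<close>

type_synonym 'a cochain = "('a \<Rightarrow> ('a, complex) tvec) list \<Rightarrow> 'a \<Rightarrow> complex"

definition ins :: "('a \<Rightarrow> ('a, complex) tvec) \<Rightarrow> 'a cochain \<Rightarrow> 'a cochain" where
  "ins V c = (\<lambda>Vs. c (V # Vs))"

primrec LD :: "('a \<Rightarrow> ('a, complex) tvec) \<Rightarrow> ('a \<Rightarrow> ('a, complex) tvec) list \<Rightarrow> 'a cochain \<Rightarrow> 'a \<Rightarrow> complex" where
  "LD V [] c = (\<lambda>x. apply_complex (V x) (c []))"
| "LD V (W # Ws) c = (\<lambda>x. LD V Ws (ins W c) x - c (lie_bracket V W # Ws) x)"

primrec dce :: "('a \<Rightarrow> ('a, complex) tvec) list \<Rightarrow> 'a cochain \<Rightarrow> 'a \<Rightarrow> complex" where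
  "dce [] c = (\<lambda>x. 0)"
| "dce (V # Vs) c = (\<lambda>x. LD V Vs c x - dce Vs (ins V c) x)"

context charted
begin

definition smooth_values :: "'a cochain \<Rightarrow> bool" where "smooth_values c \<longleftrightarrow> (\<forall>Vs\<in>lists VF. c Vs \<in> SC)"

text \<open>The cochains that come from differential forms: those that are alternating and multilinear over the
  smooth functions.\<close>

definition tensorial :: "'a cochain \<Rightarrow> bool" where
  "tensorial c \<longleftrightarrow> smooth_values c \<and>
    (\<forall>Us\<in>lists VF. \<forall>Vs\<in>lists VF. \<forall>V\<in>VF. \<forall>W\<in>VF.
       c (Us @ vadd V W # Vs) = (\<lambda>x. c (Us @ V # Vs) x + c (Us @ W # Vs) x) \<and>
       c (Us @ V # W # Vs) = (\<lambda>x. - c (Us @ W # V # Vs) x) \<and>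
       (\<forall>h\<in>SC. c (Us @ smul h V # Vs) = (\<lambda>x. h x * c (Us @ V # Vs) x)))"

lemma tens_smooth_values: "tensorial c \<Longrightarrow> smooth_values c" by (simp add: tensorial_def)
lemma smooth_valuesD: "smooth_values c \<Longrightarrow> Vs \<in> lists VF \<Longrightarrow> c Vs \<in> SC" by (simp add: smooth_values_def)
lemma tens_SC: "tensorial c \<Longrightarrow> Vs \<in> lists VF \<Longrightarrow> c Vs \<in> SC" by (simp add: tensorial_def smooth_values_def)

lemma tens_add:
  "tensorial c \<Longrightarrow> Us \<in> lists VF \<Longrightarrow> Vs \<in> lists VF \<Longrightarrow> V \<in> VF \<Longrightarrow> W \<in> VF \<Longrightarrow>
    c (Us @ vadd V W # Vs) = (\<lambda>x. c (Us @ V # Vs) x + c (Us @ W # Vs) x)"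
  by (simp add: tensorial_def)

lemma tens_swap:
  "tensorial c \<Longrightarrow> Us \<in> lists VF \<Longrightarrow> Vs \<in> lists VF \<Longrightarrow> V \<in> VF \<Longrightarrow> W \<in> VF \<Longrightarrow>
    c (Us @ V # W # Vs) = (\<lambda>x. - c (Us @ W # V # Vs) x)"
  unfolding tensorial_def by blast

lemma tens_smul:
  "tensorial c \<Longrightarrow> Us \<in> lists VF \<Longrightarrow> Vs \<in> lists VF \<Longrightarrow> V \<in> VF \<Longrightarrow> h \<in> SC \<Longrightarrow>
    c (Us @ smul h V # Vs) = (\<lambda>x. h x * c (Us @ V # Vs) x)"
  by (simp add: tensorial_def)

lemmas tens_add0 = tens_add[where Us = "[]", simplified]
lemmas tens_swap0 = tens_swap[where Us = "[]", simplified]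
lemmas tens_smul0 = tens_smul[where Us = "[]", simplified]

lemma tensI:
  assumes "\<And>Vs. Vs \<in> lists VF \<Longrightarrow> c Vs \<in> SC"
    "\<And>Us Vs V W x. Us \<in> lists VF \<Longrightarrow> Vs \<in> lists VF \<Longrightarrow> V \<in> VF \<Longrightarrow> W \<in> VF \<Longrightarrow>
       c (Us @ vadd V W # Vs) x = c (Us @ V # Vs) x + c (Us @ W # Vs) x"
    "\<And>Us Vs V h x. Us \<in> lists VF \<Longrightarrow> Vs \<in> lists VF \<Longrightarrow> V \<in> VF \<Longrightarrow> h \<in> SC \<Longrightarrow>
       c (Us @ smul h V # Vs) x = h x * c (Us @ V # Vs) x"
    "\<And>Us Vs V W x. Us \<in> lists VF \<Longrightarrow> Vs \<in> lists VF \<Longrightarrow> V \<in> VF \<Longrightarrow> W \<in> VF \<Longrightarrow>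
       c (Us @ V # W # Vs) x = - c (Us @ W # V # Vs) x"
  shows "tensorial c"
  unfolding tensorial_def smooth_values_def by (intro conjI ballI ext) (rule assms; assumption)+

lemma tens_ins: "tensorial c \<Longrightarrow> V \<in> VF \<Longrightarrow> tensorial (ins V c)"
proof (rule tensI)
  fix Us Vs U W x assume t: "tensorial c" "V \<in> VF" "Us \<in> lists VF" "Vs \<in> lists VF" "U \<in> VF" "W \<in> VF"
  then have V: "V # Us \<in> lists VF" by simp
  show "ins V c (Us @ vadd U W # Vs) x = ins V c (Us @ U # Vs) x + ins V c (Us @ W # Vs) x"
    using tens_add[OF t(1) V t(4-6)] by (simp add: ins_def)
  show "ins V c (Us @ U # W # Vs) x = - ins V c (Us @ W # U # Vs) x"
    using fun_cong[OF tens_swap[OF t(1) V t(4-6)], of x] by (simp add: ins_def)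
next
  fix Us Vs U h x assume t: "tensorial c" "V \<in> VF" "Us \<in> lists VF" "Vs \<in> lists VF" "U \<in> VF" "h \<in> SC"
  then have V: "V # Us \<in> lists VF" by simp
  show "ins V c (Us @ smul h U # Vs) x = h x * ins V c (Us @ U # Vs) x"
    using tens_smul[OF t(1) V t(4-6)] by (simp add: ins_def)
qed (simp add: ins_def tens_SC)

lemma smooth_values_ins: "smooth_values c \<Longrightarrow> V \<in> VF \<Longrightarrow> smooth_values (ins V c)"
  by (simp add: smooth_values_def ins_def)

lemma smooth_values_uminus: "smooth_values c \<Longrightarrow> smooth_values (\<lambda>Vs x. - c Vs x)" by (auto simp: smooth_values_def)

lemma tens_sum2:
  assumes "tensorial c" "tensorial d" shows "tensorial (\<lambda>Vs x. c Vs x + d Vs x)"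
proof (rule tensI)
  fix Us Vs V W x assume t: "Us \<in> lists VF" "Vs \<in> lists VF" "V \<in> VF" "W \<in> VF"
  show "c (Us @ vadd V W # Vs) x + d (Us @ vadd V W # Vs) x =
      c (Us @ V # Vs) x + d (Us @ V # Vs) x + (c (Us @ W # Vs) x + d (Us @ W # Vs) x)"
    using tens_add[OF assms(1) t] tens_add[OF assms(2) t] by simp
  show "c (Us @ V # W # Vs) x + d (Us @ V # W # Vs) x = - (c (Us @ W # V # Vs) x + d (Us @ W # V # Vs) x)"
    using fun_cong[OF tens_swap[OF assms(1) t], of x] fun_cong[OF tens_swap[OF assms(2) t], of x] by simp
next
  fix Us Vs V h x assume t: "Us \<in> lists VF" "Vs \<in> lists VF" "V \<in> VF" "h \<in> SC"
  show "c (Us @ smul h V # Vs) x + d (Us @ smul h V # Vs) x = h x * (c (Us @ V # Vs) x + d (Us @ V # Vs) x)"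
    using tens_smul[OF assms(1) t] tens_smul[OF assms(2) t] by (simp add: algebra_simps)
qed (intro smooth_fun_add tens_SC assms)

lemma LD_cong:
  "(\<And>Ws. Ws \<in> lists VF \<Longrightarrow> length Ws = length Vs \<Longrightarrow> c Ws = d Ws) \<Longrightarrow> V \<in> VF \<Longrightarrow> Vs \<in> lists VF \<Longrightarrow> LD V Vs c = LD V Vs d"
proof (induction Vs arbitrary: c d)
  case (Cons W Ws)
  have "LD V Ws (ins W c) = LD V Ws (ins W d)"
    by (rule Cons.IH) (use Cons.prems in \<open>auto simp: ins_def\<close>)
  moreover have "c (lie_bracket V W # Ws) = d (lie_bracket V W # Ws)"
    using Cons.prems bracket_VF by auto
  ultimately show ?case by simp
qed simp

lemma dce_cong:
  "(\<And>Ws. Ws \<in> lists VF \<Longrightarrow> Suc (length Ws) = length Vs \<Longrightarrow> c Ws = d Ws) \<Longrightarrow> Vs \<in> lists VF \<Longrightarrow> dce Vs c = dce Vs d"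
proof (induction Vs arbitrary: c d)
  case (Cons W Ws)
  have "LD W Ws c = LD W Ws d" by (rule LD_cong) (use Cons.prems in auto)
  moreover have "dce Ws (ins W c) = dce Ws (ins W d)"
    by (rule Cons.IH) (use Cons.prems in \<open>auto simp: ins_def\<close>)
  ultimately show ?case by simp
qed simp

lemma LD_SC: "smooth_values c \<Longrightarrow> V \<in> VF \<Longrightarrow> Vs \<in> lists VF \<Longrightarrow> LD V Vs c \<in> SC"
proof (induction Vs arbitrary: c)
  case Nil then show ?case using act_smooth[OF Nil(2) smooth_valuesD[OF Nil(1) Nil(3)]] by simp
next
  case (Cons W Ws)
  then have W: "W \<in> VF" "Ws \<in> lists VF" "lie_bracket V W # Ws \<in> lists VF"
    using bracket_VF by auto
  show ?case
    unfolding LD.simps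
    by (rule smooth_fun_diff[OF Cons.IH[OF smooth_values_ins[OF Cons.prems(1) W(1)] Cons.prems(2) W(2)] smooth_valuesD[OF Cons.prems(1) W(3)]])
qed

lemma smooth_values_LD: "smooth_values c \<Longrightarrow> V \<in> VF \<Longrightarrow> smooth_values (\<lambda>Vs. LD V Vs c)"
  by (rule smooth_values_def[THEN iffD2]) (blast intro: LD_SC)

lemma dce_SC: "smooth_values c \<Longrightarrow> Vs \<in> lists VF \<Longrightarrow> dce Vs c \<in> SC"
proof (induction Vs arbitrary: c)
  case (Cons W Ws)
  then show ?case
    unfolding dce.simps by (intro smooth_fun_diff[OF LD_SC Cons.IH[OF smooth_values_ins]]) auto
qed simp

lemma smooth_values_dce: "smooth_values c \<Longrightarrow> smooth_values (\<lambda>Vs. dce Vs c)"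
  by (rule smooth_values_def[THEN iffD2]) (blast intro: dce_SC)

lemma LD_add:
  "smooth_values c \<Longrightarrow> smooth_values d \<Longrightarrow> V \<in> VF \<Longrightarrow> Vs \<in> lists VF \<Longrightarrow>
    LD V Vs (\<lambda>Vs x. c Vs x + d Vs x) x = LD V Vs c x + LD V Vs d x"
proof (induction Vs arbitrary: c d)
  case Nil then show ?case by (simp add: act_add smooth_valuesD)
next
  case (Cons W Ws)
  have "LD V Ws (\<lambda>Vs x. ins W c Vs x + ins W d Vs x) x = LD V Ws (ins W c) x + LD V Ws (ins W d) x"
    by (rule Cons.IH) (use Cons.prems in \<open>auto intro: smooth_values_ins\<close>)
  then show ?case by (simp add: ins_def)
qed

lemma LD_smul:
  "smooth_values c \<Longrightarrow> h \<in> SC \<Longrightarrow> V \<in> VF \<Longrightarrow> Vs \<in> lists VF \<Longrightarrow>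
    LD V Vs (\<lambda>Vs x. h x * c Vs x) x = h x * LD V Vs c x + apply_complex (V x) h * c Vs x"
proof (induction Vs arbitrary: c)
  case Nil then show ?case by (simp add: act_mult smooth_valuesD)
next
  case (Cons W Ws)
  have "LD V Ws (\<lambda>Vs x. h x * ins W c Vs x) x = h x * LD V Ws (ins W c) x + apply_complex (V x) h * ins W c Ws x"
    by (rule Cons.IH) (use Cons.prems in \<open>auto intro: smooth_values_ins\<close>)
  then show ?case by (simp add: ins_def algebra_simps)
qed

lemma LD_uminus:
  "smooth_values c \<Longrightarrow> V \<in> VF \<Longrightarrow> Vs \<in> lists VF \<Longrightarrow> LD V Vs (\<lambda>Vs x. - c Vs x) x = - LD V Vs c x"
proof (induction Vs arbitrary: c)
  case Nil then show ?case by (simp add: act_uminus smooth_valuesD)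
next
  case (Cons W Ws)
  have "LD V Ws (\<lambda>Vs x. - ins W c Vs x) x = - LD V Ws (ins W c) x"
    by (rule Cons.IH) (use Cons.prems in \<open>auto intro: smooth_values_ins\<close>)
  then show ?case by (simp add: ins_def)
qed

lemma LD_diff:
  "smooth_values c \<Longrightarrow> smooth_values d \<Longrightarrow> V \<in> VF \<Longrightarrow> Vs \<in> lists VF \<Longrightarrow>
    LD V Vs (\<lambda>Vs x. c Vs x - d Vs x) x = LD V Vs c x - LD V Vs d x"
  using LD_add[of c "\<lambda>Vs x. - d Vs x" V Vs x] LD_uminus[of d V Vs x] smooth_values_uminus[of d] by simp

lemma dce_add:
  "smooth_values c \<Longrightarrow> smooth_values d \<Longrightarrow> Vs \<in> lists VF \<Longrightarrow>
    dce Vs (\<lambda>Vs x. c Vs x + d Vs x) x = dce Vs c x + dce Vs d x"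
proof (induction Vs arbitrary: c d)
  case (Cons W Ws)
  have "dce Ws (\<lambda>Vs x. ins W c Vs x + ins W d Vs x) x = dce Ws (ins W c) x + dce Ws (ins W d) x"
    by (rule Cons.IH) (use Cons.prems in \<open>auto intro: smooth_values_ins\<close>)
  then show ?case using Cons.prems by (simp add: ins_def LD_add)
qed simp

lemma dce_uminus:
  "smooth_values c \<Longrightarrow> Vs \<in> lists VF \<Longrightarrow> dce Vs (\<lambda>Vs x. - c Vs x) x = - dce Vs c x"
proof (induction Vs arbitrary: c)
  case (Cons W Ws)
  have "dce Ws (\<lambda>Vs x. - ins W c Vs x) x = - dce Ws (ins W c) x"
    by (rule Cons.IH) (use Cons.prems in \<open>auto intro: smooth_values_ins\<close>)
  then show ?case using Cons.prems by (simp add: ins_def LD_uminus)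
qed simp

lemma dce_diff:
  "smooth_values c \<Longrightarrow> smooth_values d \<Longrightarrow> Vs \<in> lists VF \<Longrightarrow>
    dce Vs (\<lambda>Vs x. c Vs x - d Vs x) x = dce Vs c x - dce Vs d x"
  using dce_add[of c "\<lambda>Vs x. - d Vs x" Vs x] dce_uminus[of d Vs x] smooth_values_uminus[of d] by simp

lemma dce_zero: "Vs \<in> lists VF \<Longrightarrow> dce Vs (\<lambda>Vs x. 0) x = 0"
  using dce_diff[of "\<lambda>Vs x. 0" "\<lambda>Vs x. 0" Vs x] by (simp add: smooth_values_def)

lemma LD_commute:
  "tensorial c \<Longrightarrow> V \<in> VF \<Longrightarrow> W \<in> VF \<Longrightarrow> Us \<in> lists VF \<Longrightarrow>
    LD V Us (\<lambda>Ws. LD W Ws c) x - LD W Us (\<lambda>Ws. LD V Ws c) x = LD (lie_bracket V W) Us c x"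
proof (induction Us arbitrary: c)
  case Nil
  then show ?case by (simp add: act_bracket tens_SC)
next
  case (Cons U Us)
  note p = Cons.prems(1-3)
  have U: "U \<in> VF" "Us \<in> lists VF" using Cons.prems by auto
  note sc = tens_smooth_values[OF p(1)]
  have step: "LD V (U # Us) (\<lambda>Ws. LD W Ws c) x = LD V Us (\<lambda>Ws. LD W Ws (ins U c)) x
      - LD V Us (ins (lie_bracket W U) c) x - (LD W Us (ins (lie_bracket V U) c) x - c (lie_bracket W (lie_bracket V U) # Us) x)"
    if "V \<in> VF" "W \<in> VF" for V W
  proof -
    have "ins U (\<lambda>Ws. LD W Ws c) = (\<lambda>Ws x. LD W Ws (ins U c) x - ins (lie_bracket W U) c Ws x)"
      by (simp add: ins_def fun_eq_iff)
    then show ?thesis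
      using LD_diff[OF smooth_values_LD[OF smooth_values_ins[OF sc U(1)] that(2)] smooth_values_ins[OF sc bracket_VF[OF that(2) U(1)]] that(1) U(2)]
      by simp
  qed
  have "c (lie_bracket V (lie_bracket W U) # Us) x =
      c (lie_bracket (lie_bracket V W) U # Us) x + c (lie_bracket W (lie_bracket V U) # Us) x"
    unfolding jacobi[OF p(2,3) U(1)] using tens_add0[OF p(1)] by (simp add: bracket_VF p U)
  then show ?case
    unfolding step[OF p(2,3)] step[OF p(3,2)] using Cons.IH[OF tens_ins[OF p(1) U(1)] p(2,3) U(2)]
    by simp
qed

text \<open>By Cartan's formula, contraction with a field reduces the claim to \<open>LD_commute\<close> and to the
  case of fewer arguments.\<close>

lemma LD_dce_commute:
  "tensorial c \<Longrightarrow> V \<in> VF \<Longrightarrow> Vs \<in> lists VF \<Longrightarrow> LD V Vs (\<lambda>Ws. dce Ws c) x = dce Vs (\<lambda>Ws. LD V Ws c) x"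
proof (induction Vs arbitrary: c)
  case Nil then show ?case by (simp add: act_zero)
next
  case (Cons W Ws)
  have W: "W \<in> VF" "Ws \<in> lists VF" using Cons.prems by auto
  note p = Cons.prems(1,2) and sc = tens_smooth_values[OF Cons.prems(1)]
  have "ins W (\<lambda>Ws. dce Ws c) = (\<lambda>Xs x. LD W Xs c x - dce Xs (ins W c) x)"
    by (simp add: ins_def)
  then have 1: "LD V (W # Ws) (\<lambda>Ws. dce Ws c) x = LD V Ws (\<lambda>Xs. LD W Xs c) x - LD V Ws (\<lambda>Xs. dce Xs (ins W c)) x
     - LD (lie_bracket V W) Ws c x + dce Ws (ins (lie_bracket V W) c) x"
    using LD_diff[OF smooth_values_LD[OF sc W(1)] smooth_values_dce[OF smooth_values_ins[OF sc W(1)]] p(2) W(2)] by simp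
  have "ins W (\<lambda>Ws. LD V Ws c) = (\<lambda>Xs x. LD V Xs (ins W c) x - ins (lie_bracket V W) c Xs x)"
    by (simp add: ins_def)
  then have 2: "dce (W # Ws) (\<lambda>Ws. LD V Ws c) x = LD W Ws (\<lambda>Xs. LD V Xs c) x
     - dce Ws (\<lambda>Xs. LD V Xs (ins W c)) x + dce Ws (ins (lie_bracket V W) c) x"
    using dce_diff[OF smooth_values_LD[OF smooth_values_ins[OF sc W(1)] p(2)] smooth_values_ins[OF sc bracket_VF[OF p(2) W(1)]] W(2)] by simp
  show ?case
    unfolding 1 2 using LD_commute[OF p W, of x] Cons.IH[OF tens_ins[OF p(1) W(1)] p(2) W(2)]
    by (simp add: algebra_simps)
qed

text \<open>With \<open>i\<^sub>V d = L\<^sub>V - d i\<^sub>V\<close>, contraction of \<open>d d c\<close> with \<open>V\<close> gives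
  \<open>L\<^sub>V d c - d L\<^sub>V c + d d (i\<^sub>V c)\<close>. The first two terms cancel and the last one vanishes by induction.\<close>

theorem dce_dce: "tensorial c \<Longrightarrow> Vs \<in> lists VF \<Longrightarrow> dce Vs (\<lambda>Ws. dce Ws c) x = 0"
proof (induction Vs arbitrary: c)
  case (Cons V Vs)
  have V: "V \<in> VF" "Vs \<in> lists VF" using Cons.prems by auto
  note p = Cons.prems(1) and sc = tens_smooth_values[OF Cons.prems(1)]
  have "ins V (\<lambda>Ws. dce Ws c) = (\<lambda>Xs x. LD V Xs c x - dce Xs (ins V c) x)"
    by (simp add: ins_def)
  then have "dce Vs (ins V (\<lambda>Ws. dce Ws c)) x = dce Vs (\<lambda>Xs. LD V Xs c) x - dce Vs (\<lambda>Xs. dce Xs (ins V c)) x"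
    using dce_diff[OF smooth_values_LD[OF sc V(1)] smooth_values_dce[OF smooth_values_ins[OF sc V(1)]] V(2)] by simp
  then show ?case
    using LD_dce_commute[OF p V, of x] Cons.IH[OF tens_ins[OF p V(1)] V(2)] by simp
qed simp

section \<open>Function-linearity of the exterior derivative\<close>

lemma LD_slot_add:
  "tensorial c \<Longrightarrow> Y \<in> VF \<Longrightarrow> V \<in> VF \<Longrightarrow> W \<in> VF \<Longrightarrow> Us \<in> lists VF \<Longrightarrow> Vs \<in> lists VF \<Longrightarrow>
    LD Y (Us @ vadd V W # Vs) c x = LD Y (Us @ V # Vs) c x + LD Y (Us @ W # Vs) c x"
proof (induction Us arbitrary: c)
  case Nil
  note sc = tens_smooth_values[OF Nil(1)]
  have "LD Y Vs (ins (vadd V W) c) = LD Y Vs (\<lambda>Vs x. ins V c Vs x + ins W c Vs x)"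
    by (rule LD_cong) (use Nil in \<open>auto simp: ins_def tens_add0\<close>)
  then show ?case
    using LD_add[OF smooth_values_ins[OF sc Nil(3)] smooth_values_ins[OF sc Nil(4)] Nil(2,6), of x]
      tens_add0[OF Nil(1,6) bracket_VF[OF Nil(2,3)] bracket_VF[OF Nil(2,4)]]
    by (simp add: bracket_add_right Nil)
next
  case (Cons Z Us)
  then have Z: "Z \<in> VF" "Us \<in> lists VF" "lie_bracket Y Z # Us \<in> lists VF" using bracket_VF by auto
  show ?case
    using Cons.IH[OF tens_ins[OF Cons.prems(1) Z(1)] Cons.prems(2-4) Z(2) Cons.prems(6)]
      tens_add[OF Cons.prems(1) Z(3) Cons.prems(6,3,4)]
    by simp
qed

lemma LD_slot_smul:
  "tensorial c \<Longrightarrow> Y \<in> VF \<Longrightarrow> V \<in> VF \<Longrightarrow> h \<in> SC \<Longrightarrow> Us \<in> lists VF \<Longrightarrow> Vs \<in> lists VF \<Longrightarrow>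
    LD Y (Us @ smul h V # Vs) c x = h x * LD Y (Us @ V # Vs) c x"
proof (induction Us arbitrary: c)
  case Nil
  note sc = tens_smooth_values[OF Nil(1)]
  have "LD Y Vs (ins (smul h V) c) = LD Y Vs (\<lambda>Vs x. h x * ins V c Vs x)"
    by (rule LD_cong) (use Nil in \<open>auto simp: ins_def tens_smul0\<close>)
  moreover have "c (lie_bracket Y (smul h V) # Vs) x = apply_complex (Y x) h * c (V # Vs) x + h x * c (lie_bracket Y V # Vs) x"
    unfolding bracket_smul_right[OF Nil(2-4)]
    using tens_add0[OF Nil(1,6) VF_smul[OF act_smooth[OF Nil(2,4)] Nil(3)] VF_smul[OF Nil(4) bracket_VF[OF Nil(2,3)]]]
      tens_smul0[OF Nil(1,6,3) act_smooth[OF Nil(2,4)]] tens_smul0[OF Nil(1,6) bracket_VF[OF Nil(2,3)] Nil(4)]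
    by simp
  ultimately show ?case
    using LD_smul[OF smooth_values_ins[OF sc Nil(3)] Nil(4,2,6), of x]
    by (simp add: ins_def algebra_simps)
next
  case (Cons Z Us)
  then have Z: "Z \<in> VF" "Us \<in> lists VF" "lie_bracket Y Z # Us \<in> lists VF" using bracket_VF by auto
  show ?case
    using Cons.IH[OF tens_ins[OF Cons.prems(1) Z(1)] Cons.prems(2-4) Z(2) Cons.prems(6)]
      tens_smul[OF Cons.prems(1) Z(3) Cons.prems(6,3,4)]
    by (simp add: algebra_simps)
qed

lemma LD_slot_swap:
  "tensorial c \<Longrightarrow> Y \<in> VF \<Longrightarrow> V \<in> VF \<Longrightarrow> W \<in> VF \<Longrightarrow> Us \<in> lists VF \<Longrightarrow> Vs \<in> lists VF \<Longrightarrow>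
    LD Y (Us @ V # W # Vs) c x = - LD Y (Us @ W # V # Vs) c x"
proof (induction Us arbitrary: c)
  case Nil
  note sc = tens_smooth_values[OF Nil(1)]
  have "LD Y Vs (ins W (ins V c)) = LD Y Vs (\<lambda>Vs x. - ins V (ins W c) Vs x)"
    by (rule LD_cong) (use Nil tens_swap0[OF Nil(1) _ Nil(3,4)] in \<open>auto simp: ins_def\<close>)
  then show ?case
    using LD_uminus[OF smooth_values_ins[OF smooth_values_ins[OF sc Nil(4)] Nil(3)] Nil(2,6), of x]
      fun_cong[OF tens_swap0[OF Nil(1,6) Nil(3) bracket_VF[OF Nil(2,4)]], of x]
      fun_cong[OF tens_swap0[OF Nil(1,6) bracket_VF[OF Nil(2,3)] Nil(4)], of x]
    by (simp add: ins_def)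
next
  case (Cons Z Us)
  then have Z: "Z \<in> VF" "Us \<in> lists VF" "lie_bracket Y Z # Us \<in> lists VF" using bracket_VF by auto
  show ?case
    using Cons.IH[OF tens_ins[OF Cons.prems(1) Z(1)] Cons.prems(2-4) Z(2) Cons.prems(6)]
      fun_cong[OF tens_swap[OF Cons.prems(1) Z(3) Cons.prems(6,3,4)], of x]
    by simp
qed

lemma smul_minus1: "V \<in> VF \<Longrightarrow> smul (\<lambda>x. -1) V = smul (\<lambda>x. if x \<in> points M then -1 else 0) V"
  by (auto simp: smul_def fun_eq_iff VF_outside)

lemma tens_outside: "tensorial c \<Longrightarrow> Vs \<in> lists VF \<Longrightarrow> x \<notin> points M \<Longrightarrow> c Vs x = 0"
  using tens_SC smooth_fun_outside by blast

lemma tens_cscale: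
  assumes "tensorial c" "Us \<in> lists VF" "Vs \<in> lists VF" "V \<in> VF"
  shows "c (Us @ smul (\<lambda>x. -1) V # Vs) x = - c (Us @ V # Vs) x"
  unfolding smul_minus1[OF assms(4)]
  using tens_smul[OF assms smooth_fun_const[of "-1"]] tens_outside[OF assms(1), of "Us @ V # Vs" x] assms
  by auto

lemma dce_swap:
  "tensorial c \<Longrightarrow> V \<in> VF \<Longrightarrow> W \<in> VF \<Longrightarrow> Us \<in> lists VF \<Longrightarrow> Vs \<in> lists VF \<Longrightarrow>
    dce (Us @ V # W # Vs) c x = - dce (Us @ W # V # Vs) c x"
proof (induction Us arbitrary: c)
  case Nil
  note sc = tens_smooth_values[OF Nil(1)]
  have "dce Vs (ins W (ins V c)) = dce Vs (\<lambda>Vs x. - ins V (ins W c) Vs x)"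
    by (rule dce_cong) (use Nil tens_swap0[OF Nil(1) _ Nil(2,3)] in \<open>auto simp: ins_def\<close>)
  then have "dce Vs (ins W (ins V c)) x = - dce Vs (ins V (ins W c)) x"
    using dce_uminus[OF smooth_values_ins[OF smooth_values_ins[OF sc Nil(3)] Nil(2)] Nil(5), of x] by simp
  moreover have "c (lie_bracket W V # Vs) x = - c (lie_bracket V W # Vs) x"
    unfolding bracket_antisym[of W V]
    using tens_cscale[OF Nil(1), of "[]", OF _ Nil(5) bracket_VF[OF Nil(2,3)]] by simp
  ultimately show ?case by simp
next
  case (Cons Z Us)
  then have Z: "Z \<in> VF" "Us \<in> lists VF" by auto
  show ?case
    using Cons.IH[OF tens_ins[OF Cons.prems(1) Z(1)] Cons.prems(2,3) Z(2) Cons.prems(5)]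
      LD_slot_swap[OF Cons.prems(1) Z(1) Cons.prems(2,3) Z(2) Cons.prems(5), of x]
    by simp
qed

lemmas dce_swap0 = dce_swap[where Us = "[]", simplified append_Nil]

lemma dce_front_add:
  "tensorial c \<Longrightarrow> V \<in> VF \<Longrightarrow> W \<in> VF \<Longrightarrow> Vs \<in> lists VF \<Longrightarrow>
    dce (vadd V W # Vs) c x = dce (V # Vs) c x + dce (W # Vs) c x"
proof (induction Vs arbitrary: c)
  case Nil
  have "apply_complex (vadd V W x) (c []) = apply_complex (V x) (c []) + apply_complex (W x) (c [])"
    by (simp add: vadd_def apply_complex_def algebra_simps)
  then show ?case by simp
next
  case (Cons U Vs)
  then have U: "U \<in> VF" "Vs \<in> lists VF" by auto
  note p = Cons.prems(1-3)
  show ?case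
    unfolding dce_swap0[OF p(1) VF_vadd[OF p(2,3)] U(1) lists.Nil U(2)]
      dce_swap0[OF p(1,2) U(1) lists.Nil U(2)] dce_swap0[OF p(1,3) U(1) lists.Nil U(2)]
    using Cons.IH[OF tens_ins[OF p(1) U(1)] p(2,3) U(2)]
      LD_slot_add[OF p(1) U(1) p(2,3), of "[]" Vs x] U(2)
    by (simp del: LD.simps dce.simps add: dce.simps(2)[of U])
qed

text \<open>Cartan's formula does not show linearity in the first field, in whose direction it differentiates.
  An exchange with the second field turns it into an argument of the Lie derivative along the
  latter, which is function-linear in its arguments.\<close>

lemma dce_front_smul:
  "tensorial c \<Longrightarrow> V \<in> VF \<Longrightarrow> h \<in> SC \<Longrightarrow> Vs \<in> lists VF \<Longrightarrow>
    dce (smul h V # Vs) c x = h x * dce (V # Vs) c x"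
proof (induction Vs arbitrary: c)
  case Nil then show ?case by (simp add: smul_def ac_vec_cmult)
next
  case (Cons U Vs)
  then have U: "U \<in> VF" "Vs \<in> lists VF" by auto
  note p = Cons.prems(1-3)
  show ?case
    unfolding dce_swap0[OF p(1) VF_smul[OF p(3,2)] U(1) lists.Nil U(2)]
      dce_swap0[OF p(1,2) U(1) lists.Nil U(2)]
    using Cons.IH[OF tens_ins[OF p(1) U(1)] p(2,3) U(2)]
      LD_slot_smul[OF p(1) U(1) p(2,3), of "[]" Vs x] U(2)
    by (simp del: LD.simps dce.simps add: dce.simps(2)[of U] algebra_simps)
qed

lemma dce_slot_add:
  "tensorial c \<Longrightarrow> V \<in> VF \<Longrightarrow> W \<in> VF \<Longrightarrow> Us \<in> lists VF \<Longrightarrow> Vs \<in> lists VF \<Longrightarrow>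
    dce (Us @ vadd V W # Vs) c x = dce (Us @ V # Vs) c x + dce (Us @ W # Vs) c x"
proof (induction Us arbitrary: c)
  case Nil then show ?case using dce_front_add[OF Nil(1-3,5)] by (simp only: append_Nil)
next
  case (Cons Z Us)
  then have Z: "Z \<in> VF" "Us \<in> lists VF" by auto
  show ?case
    using Cons.IH[OF tens_ins[OF Cons.prems(1) Z(1)] Cons.prems(2,3) Z(2) Cons.prems(5)]
      LD_slot_add[OF Cons.prems(1) Z(1) Cons.prems(2,3) Z(2) Cons.prems(5), of x]
    by simp
qed

lemma dce_slot_smul:
  "tensorial c \<Longrightarrow> V \<in> VF \<Longrightarrow> h \<in> SC \<Longrightarrow> Us \<in> lists VF \<Longrightarrow> Vs \<in> lists VF \<Longrightarrow>
    dce (Us @ smul h V # Vs) c x = h x * dce (Us @ V # Vs) c x"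
proof (induction Us arbitrary: c)
  case Nil then show ?case using dce_front_smul[OF Nil(1-3,5)] by (simp only: append_Nil)
next
  case (Cons Z Us)
  then have Z: "Z \<in> VF" "Us \<in> lists VF" by auto
  show ?case
    using Cons.IH[OF tens_ins[OF Cons.prems(1) Z(1)] Cons.prems(2,3) Z(2) Cons.prems(5)]
      LD_slot_smul[OF Cons.prems(1) Z(1) Cons.prems(2,3) Z(2) Cons.prems(5), of x]
    by (simp add: algebra_simps)
qed

lemma tens_dce: "tensorial c \<Longrightarrow> tensorial (\<lambda>Vs. dce Vs c)"
  by (rule tensI) (rule dce_SC dce_slot_add dce_slot_smul dce_swap; simp add: tens_smooth_values)+

lemma tens_zero: "tensorial (\<lambda>Vs x. 0)"
  by (rule tensI) auto

lemma tens_mult: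
  assumes h: "h \<in> SC" and c: "tensorial c" shows "tensorial (\<lambda>Vs x. h x * c Vs x)"
proof (rule tensI)
  fix Us Vs V W x assume t: "Us \<in> lists VF" "Vs \<in> lists VF" "V \<in> VF" "W \<in> VF"
  show "h x * c (Us @ vadd V W # Vs) x = h x * c (Us @ V # Vs) x + h x * c (Us @ W # Vs) x"
    using tens_add[OF c t] by (simp add: algebra_simps)
  show "h x * c (Us @ V # W # Vs) x = - (h x * c (Us @ W # V # Vs) x)"
    using fun_cong[OF tens_swap[OF c t], of x] by simp
next
  fix Us Vs V k x assume t: "Us \<in> lists VF" "Vs \<in> lists VF" "V \<in> VF" "k \<in> SC"
  show "h x * c (Us @ smul k V # Vs) x = k x * (h x * c (Us @ V # Vs) x)"
    using tens_smul[OF c t] by (simp add: algebra_simps)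
qed (rule smooth_fun_mult[OF h tens_SC[OF c]])

lemma tens_cmult: assumes c: "tensorial c" shows "tensorial (\<lambda>Vs x. a * c Vs x)"
proof (rule tensI)
  fix Us Vs V W x assume t: "Us \<in> lists VF" "Vs \<in> lists VF" "V \<in> VF" "W \<in> VF"
  show "a * c (Us @ vadd V W # Vs) x = a * c (Us @ V # Vs) x + a * c (Us @ W # Vs) x"
    using tens_add[OF c t] by (simp add: algebra_simps)
  show "a * c (Us @ V # W # Vs) x = - (a * c (Us @ W # V # Vs) x)"
    using fun_cong[OF tens_swap[OF c t], of x] by simp
next
  fix Us Vs V k x assume t: "Us \<in> lists VF" "Vs \<in> lists VF" "V \<in> VF" "k \<in> SC"
  show "a * c (Us @ smul k V # Vs) x = k x * (a * c (Us @ V # Vs) x)"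
    using tens_smul[OF c t] by (simp add: algebra_simps)
qed (rule smooth_fun_cmult[OF tens_SC[OF c]])

lemma tens_Sum:
  "(\<And>i. i \<in> I \<Longrightarrow> tensorial (c i)) \<Longrightarrow> tensorial (\<lambda>Vs x. \<Sum>i\<in>I. c i Vs x)"
  by (induction I rule: infinite_finite_induct) (auto intro: tens_zero tens_sum2)

lemma tens_lincomb:
  assumes c: "tensorial c" and U: "Us \<in> lists VF" "Vs \<in> lists VF"
  shows "(\<And>i. i \<in> I \<Longrightarrow> h i \<in> SC) \<Longrightarrow> (\<And>i. i \<in> I \<Longrightarrow> E i \<in> VF) \<Longrightarrow>
    c (Us @ (\<lambda>x f. \<Sum>i\<in>I. h i x * E i x f) # Vs) x = (\<Sum>i\<in>I. h i x * c (Us @ E i # Vs) x)"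
proof (induction I rule: infinite_finite_induct)
  case (insert i I)
  have e: "(\<lambda>x f. \<Sum>i\<in>insert i I. h i x * E i x f) = vadd (smul (h i) (E i)) (\<lambda>x f. \<Sum>i\<in>I. h i x * E i x f)"
    using insert by (auto simp: fun_eq_iff smul_def vadd_def)
  show ?case
    unfolding e using insert tens_add[OF c U VF_smul[of "h i" "E i"] VF_lincomb[of I h E]] tens_smul[OF c U, of "E i" "h i"]
    by simp
next
  have "c (Us @ smul (\<lambda>x. 0) 0 # Vs) x = 0"
    using tens_smul[OF c U VF_zero smooth_fun_zero] by simp
  moreover have "(smul (\<lambda>x. 0) 0 :: 'a \<Rightarrow> ('a, complex) tvec) = (\<lambda>x f. 0)" by (simp add: smul_def)
  ultimately have 0: "c (Us @ (\<lambda>x f. 0) # Vs) x = 0" by (simp only:)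
  { case infinite then show ?case using 0 by simp
  next case empty then show ?case using 0 by simp }
qed

text \<open>The frame identity expresses \<open>b V\<close> by a frame, with coefficients that vanish where \<open>V\<close> does.\<close>

lemma tens_local:
  assumes c: "tensorial c" and U: "Us \<in> lists VF" "Vs \<in> lists VF" and V: "V \<in> VF" and x: "x \<in> points M"
    and 0: "V x = 0"
  shows "c (Us @ V # Vs) x = 0"
proof -
  obtain b E l where b: "b \<in> SC" "b x \<noteq> 0" "\<And>i. E i \<in> VF"
    "\<And>V i. V \<in> VF \<Longrightarrow> (\<lambda>x. l i x (V x)) \<in> SC"
    "\<And>i x c (v :: ('a, complex) tvec). l i x (\<lambda>f. c * v f) = c * l i x v"
    "\<And>x (v :: ('a, complex) tvec) f. x \<in> points M \<Longrightarrow> v \<in> T x \<Longrightarrow> f \<in> S \<Longrightarrow>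
        b x * v f = (\<Sum>i\<in>(Basis::'e set). l i x v * E i x f)"
    by (rule frame[OF x]) blast
  have "smul b V = (\<lambda>x f. \<Sum>i\<in>(Basis::'e set). l i x (V x) * E i x f)"
    by (rule VF_eqI) (auto simp: smul_def b(6) VF_tangent V intro!: VF_lincomb b VF_smul[OF b(1) V, unfolded smul_def])
  then have "b x * c (Us @ V # Vs) x = c (Us @ (\<lambda>x f. \<Sum>i\<in>(Basis::'e set). l i x (V x) * E i x f) # Vs) x"
    using tens_smul[OF c U V b(1)] by simp
  also have "\<dots> = (\<Sum>i\<in>Basis. l i x (V x) * c (Us @ E i # Vs) x)"
    by (rule tens_lincomb[OF c U]) (auto intro: b V)
  also have "\<dots> = 0"
    using b(5)[of _ x 0 "\<lambda>f. 0"] 0 by (simp add: zero_fun_def)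
  finally show ?thesis using b(2) by simp
qed

lemma tens_cong1:
  assumes c: "tensorial c" and U: "Us \<in> lists VF" "Vs \<in> lists VF" and V: "V \<in> VF" "W \<in> VF" and x: "x \<in> points M"
    and e: "V x = W x"
  shows "c (Us @ V # Vs) x = c (Us @ W # Vs) x"
proof -
  let ?W = "smul (\<lambda>x. -1) W"
  have W: "?W \<in> VF" unfolding smul_minus1[OF V(2)] by (intro VF_smul smooth_fun_const V)
  have "c (Us @ vadd V ?W # Vs) x = 0"
    by (rule tens_local[OF c U VF_vadd[OF V(1) W] x]) (simp add: e smul_def vadd_def fun_eq_iff)
  then show ?thesis
    using tens_add[OF c U V(1) W] tens_cscale[OF c U V(2)] by simp
qed

lemma tens_cong:
  "tensorial c \<Longrightarrow> Vs \<in> lists VF \<Longrightarrow> Ws \<in> lists VF \<Longrightarrow> x \<in> points M \<Longrightarrow>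
    map (\<lambda>V. V x) Vs = map (\<lambda>V. V x) Ws \<Longrightarrow> c Vs x = c Ws x"
proof (induction Vs arbitrary: Ws c)
  case (Cons V Vs)
  then obtain W Ws' where W: "Ws = W # Ws'" "V x = W x" "map (\<lambda>V. V x) Vs = map (\<lambda>V. V x) Ws'" by (cases Ws) auto
  have "c (V # Vs) x = c (W # Vs) x"
    using tens_cong1[OF Cons.prems(1), of "[]" Vs V W x] Cons.prems W by simp
  also have "\<dots> = c (W # Ws') x"
    using Cons.IH[OF tens_ins[OF Cons.prems(1), of W], of Ws'] Cons.prems W by (simp add: ins_def)
  finally show ?case using W by simp
qed simp

lemma tens_repeated:
  "tensorial c \<Longrightarrow> Us \<in> lists VF \<Longrightarrow> Ws \<in> lists VF \<Longrightarrow> Vs \<in> lists VF \<Longrightarrow> V \<in> VF \<Longrightarrow> c (Us @ V # Ws @ V # Vs) x = 0"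
proof (induction Ws arbitrary: Us)
  case Nil
  have "c (Us @ V # V # Vs) x = - c (Us @ V # V # Vs) x"
    using fun_cong[OF tens_swap[OF Nil(1,2,4,5,5)], of x] .
  then show ?case by simp
next
  case (Cons W Ws)
  have "c (Us @ V # W # (Ws @ V # Vs)) x = - c (Us @ W # V # (Ws @ V # Vs)) x"
    by (rule fun_cong[OF tens_swap]) (use Cons.prems in auto)
  also have "c (Us @ W # V # (Ws @ V # Vs)) x = c ((Us @ [W]) @ V # Ws @ V # Vs) x" by simp
  also have "\<dots> = 0" by (rule Cons.IH) (use Cons.prems in auto)
  finally show ?case by simp
qed

lemma tens_not_distinct:
  assumes c: "tensorial c" and V: "Vs \<in> lists VF" and n: "\<not> distinct Vs"
  shows "c Vs x = 0"
proof -
  obtain xs ys zs y where e: "Vs = xs @ [y] @ ys @ [y] @ zs" using not_distinct_decomp[OF n] by blast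
  show ?thesis unfolding e using tens_repeated[OF c, of xs ys zs y x] V e by auto
qed

lemma tens_span:
  assumes x: "x \<in> points M" and b: "b x \<noteq> 0"
    and E: "\<And>i. i \<in> I \<Longrightarrow> E i \<in> VF" and b1: "b \<in> SC"
    and l: "\<And>V i. V \<in> VF \<Longrightarrow> (\<lambda>x. l i x (V x)) \<in> SC"
    and sp: "\<And>V. V \<in> VF \<Longrightarrow> smul b V = (\<lambda>x f. \<Sum>i\<in>I. l i x (V x) * E i x f)"
  shows "tensorial c \<Longrightarrow> Vs \<in> lists VF \<Longrightarrow> (\<And>Ws. Ws \<in> lists (E ` I) \<Longrightarrow> length Ws = length Vs \<Longrightarrow> c Ws x = 0) \<Longrightarrow> c Vs x = 0"
proof (induction Vs arbitrary: c)
  case (Cons V Vs)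
  then have V: "V \<in> VF" "Vs \<in> lists VF" by auto
  have "b x * c (V # Vs) x = c ((\<lambda>x f. \<Sum>i\<in>I. l i x (V x) * E i x f) # Vs) x"
    using tens_smul0[OF Cons.prems(1) V(2,1) b1] sp[OF V(1)] by simp
  also have "\<dots> = (\<Sum>i\<in>I. l i x (V x) * c (E i # Vs) x)"
    using tens_lincomb[OF Cons.prems(1), of "[]" Vs I "\<lambda>i x. l i x (V x)" E x] V E l by simp
  also have "\<dots> = 0"
  proof (rule sum.neutral, rule ballI)
    fix i assume i: "i \<in> I"
    have "ins (E i) c Vs x = 0"
      by (rule Cons.IH[OF tens_ins[OF Cons.prems(1) E[OF i]] V(2)]) (use Cons.prems(3) i in \<open>auto simp: ins_def\<close>)
    then show "l i x (V x) * c (E i # Vs) x = 0" by (simp add: ins_def)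
  qed
  finally show ?case using b by simp
qed auto

text \<open>At a point, all fields may be replaced by members of a frame, of which two must then coincide. This
  makes the finite ranges of summation in the components of \<open>d\<close> sufficient.\<close>

lemma tens_long:
  assumes c: "tensorial c" and V: "Vs \<in> lists VF" and len: "length Vs > DIM('e)"
  shows "c Vs x = 0"
proof (cases "x \<in> points M")
  case True
  obtain b E l where b: "b \<in> SC" "b x \<noteq> 0" "\<And>i. E i \<in> VF"
    "\<And>V i. V \<in> VF \<Longrightarrow> (\<lambda>x. l i x (V x)) \<in> SC"
    "\<And>x (v :: ('a, complex) tvec) f. x \<in> points M \<Longrightarrow> v \<in> T x \<Longrightarrow> f \<in> S \<Longrightarrow>
        b x * v f = (\<Sum>i\<in>(Basis::'e set). l i x v * E i x f)"
    by (rule frame[OF True]) blast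
  show ?thesis
  proof (rule tens_span[where b = b and I = Basis and E = E and l = l and x = x, OF True b(2)])
    fix V assume V: "V \<in> VF"
    show "smul b V = (\<lambda>x f. \<Sum>i\<in>(Basis::'e set). l i x (V x) * E i x f)"
      by (rule VF_eqI) (auto simp: smul_def b(5) VF_tangent V intro!: VF_lincomb b VF_smul[OF b(1) V, unfolded smul_def])
  next
    fix Ws assume Ws: "Ws \<in> lists (E ` Basis)" "length Ws = length Vs"
    have "card (set Ws) \<le> card (E ` Basis)" using Ws by (intro card_mono) auto
    also have "\<dots> \<le> DIM('e)" by (rule card_image_le) simp
    finally have "\<not> distinct Ws" using len Ws(2) distinct_card[of Ws] by linarith
    then show "c Ws x = 0" by (rule tens_not_distinct[OF c, rotated]) (use Ws b(3) in auto)
  qed (use b c V in auto)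
next
  case False
  then show ?thesis using tens_outside c V by blast
qed

section \<open>Forms and cochains\<close>

definition coch :: "'a form \<Rightarrow> 'a cochain" where
  "coch \<omega> = (\<lambda>Vs x. \<omega> x (map (\<lambda>V. V x) Vs))"

text \<open>The cochain is evaluated on some extension of the vectors to global fields; for a tensorial cochain,
  the value does not depend on the extension (\<open>tens_cong\<close>). On tensorial cochains and on forms,
  \<open>frm\<close> and \<open>coch\<close> are inverse to each other.\<close>

definition frm :: "'a cochain \<Rightarrow> 'a form" where
  "frm c x vs = (if x \<in> points M \<and> vs \<in> lists (T x) then c (map (field_extension M x) vs) x else 0)"

lemma formsD:
  assumes "\<omega> \<in> forms M"
  shows "\<not> (x \<in> points M \<and> vs \<in> lists (T x)) \<Longrightarrow> \<omega> x vs = 0"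
    and "x \<in> points M \<Longrightarrow> vs \<in> lists (T x) \<Longrightarrow> i < length vs \<Longrightarrow> v \<in> T x \<Longrightarrow> w \<in> T x \<Longrightarrow>
      \<omega> x (vs[i := v + w]) = \<omega> x (vs[i := v]) + \<omega> x (vs[i := w])"
    and "x \<in> points M \<Longrightarrow> vs \<in> lists (T x) \<Longrightarrow> i < length vs \<Longrightarrow> v \<in> T x \<Longrightarrow>
      \<omega> x (vs[i := (\<lambda>f. c * v f)]) = c * \<omega> x (vs[i := v])"
    and "\<not> distinct vs \<Longrightarrow> \<omega> x vs = 0"
    and "Vs \<in> lists VF \<Longrightarrow> (\<lambda>x. \<omega> x (map (\<lambda>V. V x) Vs)) \<in> SC"
  using assms unfolding forms_def by blast+

lemma form_add:
  assumes "\<omega> \<in> forms M" "x \<in> points M" "us \<in> lists (T x)" "vs \<in> lists (T x)" "v \<in> T x" "w \<in> T x"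
  shows "\<omega> x (us @ (v + w) # vs) = \<omega> x (us @ v # vs) + \<omega> x (us @ w # vs)"
  using formsD(2)[OF assms(1,2), of "us @ v # vs" "length us" v w] assms by simp

lemma form_cmult:
  assumes "\<omega> \<in> forms M" "x \<in> points M" "us \<in> lists (T x)" "vs \<in> lists (T x)" "v \<in> T x"
  shows "\<omega> x (us @ (\<lambda>f. c * v f) # vs) = c * \<omega> x (us @ v # vs)"
  using formsD(3)[OF assms(1,2), of "us @ v # vs" "length us" v c] assms by simp

lemma form_swap:
  assumes \<omega>: "\<omega> \<in> forms M" "x \<in> points M" and u: "us \<in> lists (T x)" "vs \<in> lists (T x)" "v \<in> T x" "w \<in> T x"
  shows "\<omega> x (us @ v # w # vs) = - \<omega> x (us @ w # v # vs)"
proof -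
  have "0 = \<omega> x (us @ (v + w) # (v + w) # vs)" by (rule formsD(4)[OF \<omega>(1), symmetric]) simp
  also have "\<dots> = \<omega> x (us @ v # (v + w) # vs) + \<omega> x (us @ w # (v + w) # vs)"
    using form_add[OF \<omega> u(1) _ u(3,4), of "(v + w) # vs"] T_add[OF u(3,4)] u by simp
  also have "\<omega> x (us @ v # (v + w) # vs) = \<omega> x (us @ v # v # vs) + \<omega> x (us @ v # w # vs)"
    using form_add[OF \<omega> _ u(2,3,4), of "us @ [v]"] u by simp
  also have "\<omega> x (us @ w # (v + w) # vs) = \<omega> x (us @ w # v # vs) + \<omega> x (us @ w # w # vs)"
    using form_add[OF \<omega> _ u(2,3,4), of "us @ [w]"] u by simp
  also have "\<omega> x (us @ v # v # vs) = 0" by (rule formsD(4)[OF \<omega>(1)]) simp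
  also have "\<omega> x (us @ w # w # vs) = 0" by (rule formsD(4)[OF \<omega>(1)]) simp
  finally show ?thesis by (simp add: eq_neg_iff_add_eq_0)
qed

lemma map_field_lists: "Vs \<in> lists VF \<Longrightarrow> x \<in> points M \<Longrightarrow> map (\<lambda>V. V x) Vs \<in> lists (T x)"
  using VF_tangent by auto

lemma tens_coch: assumes \<omega>: "\<omega> \<in> forms M" shows "tensorial (coch \<omega>)"
proof (rule tensI)
  show "coch \<omega> Vs \<in> SC" if "Vs \<in> lists VF" for Vs
    using formsD(5)[OF \<omega> that] by (simp add: coch_def)
  have out: "coch \<omega> Vs x = 0" if "x \<notin> points M" for Vs x
    using formsD(1)[OF \<omega>] that by (simp add: coch_def)
  fix Us Vs V x assume t: "Us \<in> lists VF" "Vs \<in> lists VF" "V \<in> VF"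
  {
    fix W assume W: "W \<in> VF"
    show "coch \<omega> (Us @ vadd V W # Vs) x = coch \<omega> (Us @ V # Vs) x + coch \<omega> (Us @ W # Vs) x"
      using form_add[OF \<omega> _ map_field_lists[OF t(1)] map_field_lists[OF t(2)] VF_tangent[OF t(3)] VF_tangent[OF W], of x]
      by (cases "x \<in> points M") (simp_all add: out, simp add: coch_def vadd_def)
    show "coch \<omega> (Us @ V # W # Vs) x = - coch \<omega> (Us @ W # V # Vs) x"
      using form_swap[OF \<omega> _ map_field_lists[OF t(1)] map_field_lists[OF t(2)] VF_tangent[OF t(3)] VF_tangent[OF W], of x]
      by (cases "x \<in> points M") (simp_all add: out, simp add: coch_def)
  }
  fix h assume "h \<in> SC"
  show "coch \<omega> (Us @ smul h V # Vs) x = h x * coch \<omega> (Us @ V # Vs) x"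
    using form_cmult[OF \<omega> _ map_field_lists[OF t(1)] map_field_lists[OF t(2)] VF_tangent[OF t(3)], of x]
    by (cases "x \<in> points M") (simp_all add: out, simp add: coch_def smul_def)
qed

lemma ext_lists: "x \<in> points M \<Longrightarrow> vs \<in> lists (T x) \<Longrightarrow> map (field_extension M x) vs \<in> lists VF"
  using field_extension by auto

lemma ext_values: "x \<in> points M \<Longrightarrow> vs \<in> lists (T x) \<Longrightarrow> map (\<lambda>V. V x) (map (field_extension M x) vs) = vs"
  using field_extension(2) by (induction vs) auto

lemma frm_values:
  assumes "tensorial c" "Vs \<in> lists VF" shows "frm c x (map (\<lambda>V. V x) Vs) = c Vs x"
proof (cases "x \<in> points M")
  case True
  note l = map_field_lists[OF assms(2) True]
  show ?thesis
    using tens_cong[OF assms(1) ext_lists[OF True l] assms(2) True ext_values[OF True l]] True l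
    by (simp add: frm_def)
next
  case False
  then show ?thesis using tens_outside[OF assms] by (simp add: frm_def)
qed

lemma frm_values':
  assumes "tensorial c" "Vs \<in> lists VF" "x \<in> points M" "map (\<lambda>V. V x) Vs = vs" shows "frm c x vs = c Vs x"
  using frm_values[OF assms(1,2)] assms(4) by blast

lemma frm_forms: assumes c: "tensorial c" shows "frm c \<in> forms M"
  unfolding forms_def
proof (intro CollectI conjI allI impI ballI)
  fix x vs assume "\<not> (x \<in> points M \<and> vs \<in> lists (T x))"
  then show "frm c x vs = 0" unfolding frm_def by (rule if_not_P)
next
  fix x vs i v w and a :: complex assume a: "x \<in> points M" "vs \<in> lists (T x)" "i < length vs" "v \<in> T x" "w \<in> T x"
  let ?e = "field_extension M x"
  let ?U = "map ?e (take i vs)" and ?V = "map ?e (drop (Suc i) vs)"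
  have tk: "take i vs \<in> lists (T x)" "drop (Suc i) vs \<in> lists (T x)"
    using a(2) by (auto dest: in_set_takeD in_set_dropD)
  note U = ext_lists[OF a(1) tk(1)] ext_lists[OF a(1) tk(2)]
  note e = field_extension[OF a(1) a(4)] field_extension[OF a(1) a(5)]
  have r: "frm c x (vs[i := W x]) = c (?U @ W # ?V) x" if "W \<in> VF" for W
    unfolding upd_conv_take_nth_drop[OF a(3)]
    by (rule frm_values'[OF c _ a(1)]) (use U that ext_values[OF a(1) tk(1)] ext_values[OF a(1) tk(2)] in \<open>auto simp del: map_map\<close>)
  show "frm c x (vs[i := v + w]) = frm c x (vs[i := v]) + frm c x (vs[i := w])"
    using r[OF e(1)] r[OF e(3)] r[OF VF_vadd[OF e(1,3)]] tens_add[OF c U e(1,3)] e by (simp add: vadd_def)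
  let ?h = "\<lambda>x. if x \<in> points M then a else 0"
  show "frm c x (vs[i := \<lambda>f. a * v f]) = a * frm c x (vs[i := v])"
    using r[OF e(1)] r[OF VF_smul[OF smooth_fun_const[of a] e(1)]] tens_smul[OF c U e(1) smooth_fun_const[of a]] e a(1)
    by (simp add: smul_def)
next
  fix x and vs :: "('a, complex) tvec list" assume n: "\<not> distinct vs"
  show "frm c x vs = 0"
    unfolding frm_def using tens_not_distinct[OF c ext_lists, of x vs x] n by (auto simp: distinct_map)
next
  fix Vs assume "Vs \<in> lists VF"
  then show "(\<lambda>x. frm c x (map (\<lambda>V. V x) Vs)) \<in> SC"
    using tens_SC[OF c] frm_values[OF c] by simp
qed

lemma coch_frm: "tensorial c \<Longrightarrow> Vs \<in> lists VF \<Longrightarrow> coch (frm c) Vs = c Vs"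
  by (simp add: coch_def frm_values fun_eq_iff)

lemma form_eqI:
  assumes "\<omega> \<in> forms M" "\<eta> \<in> forms M" "\<And>Vs. Vs \<in> lists VF \<Longrightarrow> coch \<omega> Vs = coch \<eta> Vs"
  shows "\<omega> = \<eta>"
proof (intro ext)
  fix x vs
  show "\<omega> x vs = \<eta> x vs"
  proof (cases "x \<in> points M \<and> vs \<in> lists (T x)")
    case True
    then show ?thesis
      using assms(3)[OF ext_lists, of x vs] ext_values[of x vs] by (auto simp: coch_def fun_eq_iff simp del: map_map dest!: spec[of _ x])
  next
    case False
    then show ?thesis using formsD(1)[OF assms(1)] formsD(1)[OF assms(2)] by metis
  qed
qed

section \<open>The Koszul formula\<close>

lemma LD_expand:
  "tensorial c \<Longrightarrow> V \<in> VF \<Longrightarrow> Vs \<in> lists VF \<Longrightarrow>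
    LD V Vs c x = apply_complex (V x) (c Vs)
      - (\<Sum>j<length Vs. (-1) ^ j * c (lie_bracket V (Vs ! j) # nths Vs (- {j})) x)"
proof (induction Vs arbitrary: c)
  case (Cons W Ws)
  then have W: "W \<in> VF" "Ws \<in> lists VF" by auto
  note p = Cons.prems(1,2)
  have nW: "nths Ws A \<in> lists VF" for A using W(2) by (auto dest: in_set_nthsD)
  have s: "{j. j \<noteq> i} = - {i}" for i :: nat by auto
  have "LD V (W # Ws) c x = LD V Ws (ins W c) x - c (lie_bracket V W # Ws) x" by simp
  also have "LD V Ws (ins W c) x = apply_complex (V x) (c (W # Ws))
      - (\<Sum>j<length Ws. (-1) ^ j * c (W # lie_bracket V (Ws ! j) # nths Ws (- {j})) x)"
    using Cons.IH[OF tens_ins[OF p(1) W(1)] p(2) W(2)] by (simp add: ins_def)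
  also have "(\<Sum>j<length Ws. (-1) ^ j * c (W # lie_bracket V (Ws ! j) # nths Ws (- {j})) x)
     = (\<Sum>j<length Ws. (-1) ^ Suc j * c (lie_bracket V (Ws ! j) # W # nths Ws (- {j})) x)"
  proof (rule sum.cong[OF refl])
    fix j assume "j \<in> {..<length Ws}"
    then have "lie_bracket V (Ws ! j) \<in> VF" using W(2) by (intro bracket_VF p(2)) auto
    then show "(-1) ^ j * c (W # lie_bracket V (Ws ! j) # nths Ws (- {j})) x =
        (-1) ^ Suc j * c (lie_bracket V (Ws ! j) # W # nths Ws (- {j})) x"
      using fun_cong[OF tens_swap0[OF p(1) nW W(1)], of "lie_bracket V (Ws ! j)" "- {j}" x] by simp
  qed
  finally show ?case
    by (simp add: sum.lessThan_Suc_shift nths_Cons s nths_all algebra_simps del: sum.lessThan_Suc)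
qed simp

definition koszul_coch :: "'a cochain \<Rightarrow> ('a \<Rightarrow> ('a, complex) tvec) list \<Rightarrow> 'a \<Rightarrow> complex" where
  "koszul_coch c Vs x =
     (\<Sum>i<length Vs. (-1) ^ i * apply_complex ((Vs ! i) x) (c (nths Vs (- {i})))) +
     (\<Sum>j<length Vs. \<Sum>i<j. (-1) ^ (i + j) * c (lie_bracket (Vs ! i) (Vs ! j) # nths Vs (- {i, j})) x)"

text \<open>Unfolding Cartan's formula along the list of arguments: the Lie derivative along the entry number
  \<open>i\<close> contributes the terms with the derivative in that direction and the brackets with later entries.\<close>

lemma koszul_coch_eq_dce: "tensorial c \<Longrightarrow> Vs \<in> lists VF \<Longrightarrow> koszul_coch c Vs x = dce Vs c x"
proof (induction Vs arbitrary: c)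
  case Nil then show ?case by (simp add: koszul_coch_def)
next
  case (Cons V Vs)
  then have V: "V \<in> VF" "Vs \<in> lists VF" by auto
  note p = Cons.prems(1)
  have nV: "nths Vs A \<in> lists VF" for A using V(2) by (auto dest: in_set_nthsD)
  have s: "{j. j \<noteq> i} = - {i}" "{k. k \<noteq> i \<and> k \<noteq> j} = - {i, j}" for i j :: nat by auto
  have 1: "(\<Sum>i<length (V # Vs). (-1) ^ i * apply_complex (((V # Vs) ! i) x) (c (nths (V # Vs) (- {i})))) =
      apply_complex (V x) (c Vs) - (\<Sum>i<length Vs. (-1) ^ i * apply_complex ((Vs ! i) x) (ins V c (nths Vs (- {i}))))"
    by (simp add: sum.lessThan_Suc_shift nths_Cons s nths_all ins_def sum_negf del: sum.lessThan_Suc)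
  have 2: "(-1) ^ (Suc i + Suc j) * c (lie_bracket (Vs ! i) (Vs ! j) # V # nths Vs (- {i, j})) x =
      - ((-1) ^ (i + j) * ins V c (lie_bracket (Vs ! i) (Vs ! j) # nths Vs (- {i, j})) x)"
    if "j < length Vs" "i < j" for i j
  proof -
    have "lie_bracket (Vs ! i) (Vs ! j) \<in> VF" using V(2) that by (intro bracket_VF) auto
    then show ?thesis
      using fun_cong[OF tens_swap0[OF p nV V(1)], of "lie_bracket (Vs ! i) (Vs ! j)" "- {i, j}" x] by (simp add: ins_def)
  qed
  have 3: "(\<Sum>j<length (V # Vs). \<Sum>i<j. (-1) ^ (i + j) * c (lie_bracket ((V # Vs) ! i) ((V # Vs) ! j) # nths (V # Vs) (- {i, j})) x)
    = (\<Sum>j<length Vs. (-1) ^ Suc j * c (lie_bracket V (Vs ! j) # nths Vs (- {j})) x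
        + (\<Sum>i<j. (-1) ^ (Suc i + Suc j) * c (lie_bracket (Vs ! i) (Vs ! j) # V # nths Vs (- {i, j})) x))"
    by (simp add: sum.lessThan_Suc_shift nths_Cons s del: sum.lessThan_Suc)
  also have "\<dots> = (\<Sum>j<length Vs. (-1) ^ Suc j * c (lie_bracket V (Vs ! j) # nths Vs (- {j})) x
        - (\<Sum>i<j. (-1) ^ (i + j) * ins V c (lie_bracket (Vs ! i) (Vs ! j) # nths Vs (- {i, j})) x))"
  proof (rule sum.cong[OF refl])
    fix j assume "j \<in> {..<length Vs}"
    then have "(\<Sum>i<j. (-1) ^ (Suc i + Suc j) * c (lie_bracket (Vs ! i) (Vs ! j) # V # nths Vs (- {i, j})) x) =
        (\<Sum>i<j. - ((-1) ^ (i + j) * ins V c (lie_bracket (Vs ! i) (Vs ! j) # nths Vs (- {i, j})) x))"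
      by (intro sum.cong[OF refl] 2) auto
    then show "(-1) ^ Suc j * c (lie_bracket V (Vs ! j) # nths Vs (- {j})) x
        + (\<Sum>i<j. (-1) ^ (Suc i + Suc j) * c (lie_bracket (Vs ! i) (Vs ! j) # V # nths Vs (- {i, j})) x) =
      (-1) ^ Suc j * c (lie_bracket V (Vs ! j) # nths Vs (- {j})) x
        - (\<Sum>i<j. (-1) ^ (i + j) * ins V c (lie_bracket (Vs ! i) (Vs ! j) # nths Vs (- {i, j})) x)"
      by (simp only: sum_negf diff_conv_add_uminus)
  qed
  also have "\<dots> = - (\<Sum>j<length Vs. (-1) ^ j * c (lie_bracket V (Vs ! j) # nths Vs (- {j})) x)
        - (\<Sum>j<length Vs. \<Sum>i<j. (-1) ^ (i + j) * ins V c (lie_bracket (Vs ! i) (Vs ! j) # nths Vs (- {i, j})) x)"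
    by (simp add: sum_subtractf sum_negf)
  finally have "koszul_coch c (V # Vs) x = LD V Vs c x - koszul_coch (ins V c) Vs x"
    unfolding koszul_coch_def[of c] 1 LD_expand[OF p V] by (simp add: koszul_coch_def)
  then show ?case using Cons.IH[OF tens_ins[OF p V(1)] V(2)] by simp
qed

lemma koszul_eq_dce:
  assumes "\<omega> \<in> forms M" "Vs \<in> lists VF" shows "koszul \<omega> Vs x = dce Vs (coch \<omega>) x"
proof -
  have "koszul \<omega> Vs x = koszul_coch (coch \<omega>) Vs x" by (simp add: koszul_def koszul_coch_def coch_def)
  then show ?thesis using koszul_coch_eq_dce[OF tens_coch[OF assms(1)] assms(2)] by simp
qed

lemma ext_deriv_frm: "\<omega> \<in> forms M \<Longrightarrow> ext_deriv M \<omega> = frm (\<lambda>Vs. dce Vs (coch \<omega>))"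
  by (intro ext) (auto simp: ext_deriv_def frm_def koszul_eq_dce[OF _ ext_lists])

lemma frm_cong:
  assumes "\<And>Vs. Vs \<in> lists VF \<Longrightarrow> c Vs = d Vs" shows "frm c = frm d"
  by (intro ext) (auto simp: frm_def assms ext_lists)

lemma frm_coch: "\<omega> \<in> forms M \<Longrightarrow> frm (coch \<omega>) = \<omega>"
  by (rule form_eqI) (auto intro: frm_forms tens_coch coch_frm)

lemma form_sum_apply: "(\<Sum>i\<in>I. (f i :: 'a form)) x vs = (\<Sum>i\<in>I. f i x vs)"
  by (induction I rule: infinite_finite_induct) auto

lemma frm_Sum: "(\<Sum>i\<in>I. frm (c i)) = frm (\<lambda>Vs x. \<Sum>i\<in>I. c i Vs x)"
proof (intro ext)
  fix x vs
  show "(\<Sum>i\<in>I. frm (c i)) x vs = frm (\<lambda>Vs x. \<Sum>i\<in>I. c i Vs x) x vs"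
  proof (cases "x \<in> points M \<and> vs \<in> lists (T x)")
    case True
    then show ?thesis by (simp add: form_sum_apply frm_def)
  next
    case False
    show ?thesis unfolding form_sum_apply frm_def if_not_P[OF False] by simp
  qed
qed

end

section \<open>Almost complex structures and bidegrees\<close>

locale almost_complex_manifold = charted M for M :: "('a, 'e::euclidean_space) manifold" +
  fixes J :: "'a acs"
  assumes ac: "almost_complex M J"
begin

abbreviation "TR x \<equiv> (tangent_space M x :: ('a, real) tvec set)"

lemma TR_lin: "u \<in> TR x \<Longrightarrow> w \<in> TR x \<Longrightarrow> (\<lambda>f. a * u f + b * w f) \<in> TR x"
  by (auto simp: tangent_space_def algebra_simps)

lemma TR_Re: "v \<in> T x \<Longrightarrow> Re \<circ> v \<in> TR x"
  by (auto simp: tangent_space_def)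

lemma TR_Im: "v \<in> T x \<Longrightarrow> Im \<circ> v \<in> TR x"
  by (auto simp: tangent_space_def)

lemma T_complex: "u \<in> TR x \<Longrightarrow> w \<in> TR x \<Longrightarrow> (\<lambda>f. complex_of_real (u f) + \<i> * complex_of_real (w f)) \<in> T x"
  by (auto simp: tangent_space_def algebra_simps scaleR_conv_of_real)

lemma J_TR: "x \<in> points M \<Longrightarrow> u \<in> TR x \<Longrightarrow> J x u \<in> TR x"
  using ac by (simp add: almost_complex_def)

lemma J_J: "x \<in> points M \<Longrightarrow> u \<in> TR x \<Longrightarrow> J x (J x u) f = - u f"
  using ac by (simp add: almost_complex_def)

lemma J_lin:
  assumes x: "x \<in> points M" and u: "u \<in> TR x" "w \<in> TR x"
  shows "J x (\<lambda>f. a * u f + b * w f) = (\<lambda>f. a * J x u f + b * J x w f)"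
proof -
  have s: "(\<lambda>f. a * u f) \<in> TR x" if "u \<in> TR x" for a u using TR_lin[OF that that, of a 0] by simp
  have e: "(\<lambda>f. a * u f + b * w f) = (\<lambda>f. a * u f) + (\<lambda>f. b * w f)" by (simp add: fun_eq_iff)
  have "J x ((\<lambda>f. a * u f) + (\<lambda>f. b * w f)) = J x (\<lambda>f. a * u f) + J x (\<lambda>f. b * w f)"
    using ac x s[OF u(1), of a] s[OF u(2), of b] unfolding almost_complex_def by blast
  also have "J x (\<lambda>f. a * u f) = (\<lambda>f. a * J x u f)"
    using ac x u(1) unfolding almost_complex_def by blast
  also have "J x (\<lambda>f. b * w f) = (\<lambda>f. b * J x w f)"
    using ac x u(2) unfolding almost_complex_def by blast
  finally show ?thesis unfolding e[symmetric] by (simp add: plus_fun_def)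
qed

abbreviation "JC \<equiv> J_cplx J"

lemma JC_T: "x \<in> points M \<Longrightarrow> v \<in> T x \<Longrightarrow> JC x v \<in> T x"
  unfolding J_cplx_def by (intro T_complex J_TR TR_Re TR_Im)

lemma JC_JC:
  assumes "x \<in> points M" "v \<in> T x" shows "JC x (JC x v) = (\<lambda>f. - v f)"
proof -
  have "Re \<circ> JC x v = J x (Re \<circ> v)" "Im \<circ> JC x v = J x (Im \<circ> v)" by (auto simp: J_cplx_def fun_eq_iff)
  then have "JC x (JC x v) f = complex_of_real (J x (J x (Re \<circ> v)) f) + \<i> * complex_of_real (J x (J x (Im \<circ> v)) f)" for f
    unfolding J_cplx_def[of J x "JC x v"] by simp
  then show ?thesis using assms by (simp add: J_J TR_Re TR_Im fun_eq_iff complex_eq_iff)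
qed

lemma JC_add:
  assumes "x \<in> points M" "v \<in> T x" "w \<in> T x" shows "JC x (\<lambda>f. v f + w f) = (\<lambda>f. JC x v f + JC x w f)"
proof -
  have "Re \<circ> (\<lambda>f. v f + w f) = (\<lambda>f. 1 * (Re \<circ> v) f + 1 * (Re \<circ> w) f)"
    "Im \<circ> (\<lambda>f. v f + w f) = (\<lambda>f. 1 * (Im \<circ> v) f + 1 * (Im \<circ> w) f)" by (auto simp: fun_eq_iff)
  then show ?thesis
    unfolding J_cplx_def using J_lin[OF assms(1) TR_Re[OF assms(2)] TR_Re[OF assms(3)], of 1 1]
      J_lin[OF assms(1) TR_Im[OF assms(2)] TR_Im[OF assms(3)], of 1 1]
    by (simp add: algebra_simps)
qed

lemma JC_cmult:
  assumes "x \<in> points M" "v \<in> T x" shows "JC x (\<lambda>f. c * v f) = (\<lambda>f. c * JC x v f)"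
proof -
  have e: "Re \<circ> (\<lambda>f. c * v f) = (\<lambda>f. Re c * (Re \<circ> v) f + (- Im c) * (Im \<circ> v) f)"
    "Im \<circ> (\<lambda>f. c * v f) = (\<lambda>f. Im c * (Re \<circ> v) f + Re c * (Im \<circ> v) f)" by (auto simp: fun_eq_iff)
  show ?thesis
    unfolding J_cplx_def e J_lin[OF assms(1) TR_Re[OF assms(2)] TR_Im[OF assms(2)]]
    by (auto simp: fun_eq_iff complex_eq_iff algebra_simps)
qed

text \<open>The projections to the two eigenbundles, indexed by a truth value: \<open>True\<close> stands for
  the type \<open>(1, 0)\<close>.\<close>

definition pr :: "bool \<Rightarrow> 'a \<Rightarrow> ('a, complex) tvec \<Rightarrow> ('a, complex) tvec" where
  "pr b x v = (\<lambda>f. (v f + (if b then - \<i> else \<i>) * JC x v f) / 2)"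

definition P :: "bool \<Rightarrow> ('a \<Rightarrow> ('a, complex) tvec) \<Rightarrow> 'a \<Rightarrow> ('a, complex) tvec" where
  "P b V = (\<lambda>x. if x \<in> points M then pr b x (V x) else (\<lambda>f. 0))"

lemma pr_proj: "pr True x v = proj10 J x v" "pr False x v = proj01 J x v"
  by (simp_all add: pr_def proj10_def proj01_def)

lemma JC_pr:
  assumes "x \<in> points M" "v \<in> T x"
  shows "JC x (pr b x v) = (\<lambda>f. (if b then \<i> else - \<i>) * pr b x v f)"
proof -
  let ?s = "if b then - \<i> else \<i>"
  have "pr b x v = (\<lambda>f. (\<lambda>f. (1/2) * v f) f + (\<lambda>f. (?s/2) * JC x v f) f)"
    by (auto simp: pr_def fun_eq_iff field_simps)
  then have "JC x (pr b x v) = (\<lambda>f. JC x (\<lambda>f. (1/2) * v f) f + JC x (\<lambda>f. (?s/2) * JC x v f) f)"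
    using JC_add[OF assms(1) T_cmult[OF assms(2), of "1/2"] T_cmult[OF JC_T[OF assms], of "?s/2"]] by (simp only:)
  also have "\<dots> = (\<lambda>f. (if b then \<i> else - \<i>) * pr b x v f)"
    unfolding JC_cmult[OF assms] JC_cmult[OF assms(1) JC_T[OF assms]] JC_JC[OF assms]
    by (auto simp: pr_def fun_eq_iff field_simps)
  finally show ?thesis .
qed

lemma pr_T: "x \<in> points M \<Longrightarrow> v \<in> T x \<Longrightarrow> pr b x v \<in> T x"
proof -
  assume a: "x \<in> points M" "v \<in> T x"
  have "pr b x v = (\<lambda>f. (1/2) * v f) + (\<lambda>f. ((if b then - \<i> else \<i>)/2) * JC x v f)"
    by (auto simp: pr_def fun_eq_iff field_simps)
  then show ?thesis using T_add[OF T_cmult[OF a(2), of "1/2"] T_cmult[OF JC_T[OF a], of "(if b then - \<i> else \<i>)/2"]] by (simp only:)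
qed

lemma pr_split: "pr True x v f + pr False x v f = v f"
  by (simp add: pr_def field_simps)

lemma pr_pr:
  assumes "x \<in> points M" "v \<in> T x"
  shows "pr b x (pr b' x v) = (if b = b' then pr b x v else (\<lambda>f. 0))"
  unfolding pr_def[of b x "pr b' x v"] JC_pr[OF assms]
  by (cases b; cases b') (auto simp: pr_def fun_eq_iff diff_divide_distrib add_divide_distrib algebra_simps)

lemma pr_lin:
  assumes "x \<in> points M" "v \<in> T x" "w \<in> T x"
  shows "pr b x (\<lambda>f. v f + w f) = (\<lambda>f. pr b x v f + pr b x w f)"
    "pr b x (\<lambda>f. c * v f) = (\<lambda>f. c * pr b x v f)"
  unfolding pr_def JC_add[OF assms] JC_cmult[OF assms(1,2)] by (auto simp: field_simps)

lemma J_field: "V \<in> vector_fields M \<Longrightarrow> (\<lambda>x. if x \<in> points M then J x (V x) else 0) \<in> vector_fields M"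
  using ac by (simp add: almost_complex_def)

lemma JC_field:
  assumes V: "V \<in> VF" shows "(\<lambda>x. if x \<in> points M then JC x (V x) else (\<lambda>f. 0)) \<in> VF"
proof (rule VF_I)
  fix f assume f: "f \<in> S"
  have "(\<lambda>x. Re \<circ> V x) \<in> vector_fields M" "(\<lambda>x. Im \<circ> V x) \<in> vector_fields M"
    using V TR_Re TR_Im SC_Re[OF VF_smooth[OF V]] SC_Im[OF VF_smooth[OF V]]
    by (auto simp: vector_fields_def fun_eq_iff)
  from J_field[OF this(1)] J_field[OF this(2)] have "(\<lambda>x. (if x \<in> points M then J x (Re \<circ> V x) else 0) f) \<in> S"
    "(\<lambda>x. (if x \<in> points M then J x (Im \<circ> V x) else 0) f) \<in> S"
    using f unfolding vector_fields_def by blast+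
  from smooth_fun_add[OF SC_of_real[OF this(1)] smooth_fun_cmult[OF SC_of_real[OF this(2)]], of \<i>]
  show "(\<lambda>x. (if x \<in> points M then JC x (V x) else (\<lambda>f. 0)) f) \<in> SC"
    by (rule back_subst[of "\<lambda>h. h \<in> SC"]) (auto simp: J_cplx_def fun_eq_iff)
qed (auto simp: JC_T VF_tangent V zero_fun_def)

lemma P_VF: assumes V: "V \<in> VF" shows "P b V \<in> VF"
proof (rule VF_I)
  fix f assume f: "f \<in> S"
  let ?s = "if b then - \<i> else \<i>"
  from smooth_fun_add[OF smooth_fun_cmult[OF VF_smooth[OF V f], of "1/2"]
    smooth_fun_cmult[OF VF_smooth[OF JC_field[OF V] f], of "?s/2"]]
  show "(\<lambda>x. P b V x f) \<in> SC"
    by (rule back_subst[of "\<lambda>h. h \<in> SC"]) (auto simp: P_def pr_def fun_eq_iff VF_outside V field_simps)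
qed (auto simp: P_def pr_T VF_tangent V zero_fun_def)

lemma P_at: "x \<in> points M \<Longrightarrow> P b V x = pr b x (V x)"
  by (simp add: P_def)

lemma P_split: assumes V: "V \<in> VF" shows "vadd (P True V) (P False V) = V"
  by (rule VF_eqI) (auto simp: vadd_def P_at pr_split intro: V P_VF VF_vadd[unfolded vadd_def])

lemma P_vadd: assumes V: "V \<in> VF" "W \<in> VF" shows "P b (vadd V W) = vadd (P b V) (P b W)"
proof (rule VF_eqI)
  fix x f assume x: "x \<in> points M"
  have "vadd V W x = (\<lambda>f. V x f + W x f)" by (simp add: vadd_def fun_eq_iff)
  then show "P b (vadd V W) x f = vadd (P b V) (P b W) x f"
    using pr_lin(1)[OF x VF_tangent[OF V(1) x] VF_tangent[OF V(2) x]]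
    by (simp add: P_at x vadd_def)
qed (auto intro: P_VF VF_vadd V)

lemma P_smul: assumes V: "V \<in> VF" "h \<in> SC" shows "P b (smul h V) = smul h (P b V)"
proof (rule VF_eqI)
  fix x f assume x: "x \<in> points M"
  show "P b (smul h V) x f = smul h (P b V) x f"
    using pr_lin(2)[OF x VF_tangent[OF V(1) x] VF_tangent[OF V(1) x]]
    by (simp add: P_at x smul_def)
qed (auto intro: P_VF VF_smul V)

lemma P_P: assumes V: "V \<in> VF" shows "P b (P b' V) = (if b = b' then P b V else (\<lambda>x f. 0))"
proof (rule VF_eqI)
  fix x f assume x: "x \<in> points M"
  show "P b (P b' V) x f = (if b = b' then P b V else (\<lambda>x f. 0)) x f"
    using pr_pr[OF x VF_tangent[OF V x]] by (auto simp: P_at x)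
qed (use P_VF[OF P_VF[OF V]] P_VF[OF V] VF_zero in \<open>auto simp: zero_fun_def\<close>)

definition pure :: "bool \<Rightarrow> ('a \<Rightarrow> ('a, complex) tvec) \<Rightarrow> bool" where
  "pure b V \<longleftrightarrow> V \<in> VF \<and> P b V = V"

lemma pure_VF: "pure b V \<Longrightarrow> V \<in> VF" by (simp add: pure_def)
lemma pure_P: "V \<in> VF \<Longrightarrow> pure b (P b V)" by (simp add: pure_def P_VF P_P)
lemma pure_same: "pure b V \<Longrightarrow> P b V = V" by (simp add: pure_def)
lemma pure_other: "pure b V \<Longrightarrow> P (\<not> b) V = (\<lambda>x f. 0)" using P_P[of V "\<not> b" b] by (auto simp: pure_def)

inductive ptype :: "('a \<Rightarrow> ('a, complex) tvec) list \<Rightarrow> nat \<Rightarrow> nat \<Rightarrow> bool" where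
  Nil: "ptype [] 0 0"
| True: "pure True V \<Longrightarrow> ptype Vs a b \<Longrightarrow> ptype (V # Vs) (Suc a) b"
| False: "pure False V \<Longrightarrow> ptype Vs a b \<Longrightarrow> ptype (V # Vs) a (Suc b)"

lemma ptype_VF: "ptype Vs a b \<Longrightarrow> Vs \<in> lists VF"
  by (induction rule: ptype.induct) (auto dest: pure_VF)

lemma ptype_length: "ptype Vs a b \<Longrightarrow> length Vs = a + b"
  by (induction rule: ptype.induct) auto

lemma tens_field_zero: "tensorial c \<Longrightarrow> Us \<in> lists VF \<Longrightarrow> Vs \<in> lists VF \<Longrightarrow> c (Us @ (\<lambda>x f. 0) # Vs) x = 0"
  using tens_lincomb[of c Us Vs "{}"] by simp

text \<open>Forms are determined by their values on vectors of pure type.\<close>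

lemma tens_pure_eq_0:
  "tensorial c \<Longrightarrow> Vs \<in> lists VF \<Longrightarrow> (\<And>Ws a b. ptype Ws a b \<Longrightarrow> length Ws = length Vs \<Longrightarrow> c Ws x = 0) \<Longrightarrow> c Vs x = 0"
proof (induction Vs arbitrary: c)
  case Nil then show ?case using ptype.Nil by auto
next
  case (Cons V Vs)
  then have V: "V \<in> VF" "Vs \<in> lists VF" by auto
  have "ins (P b V) c Vs x = 0" for b
  proof (rule Cons.IH[OF tens_ins[OF Cons.prems(1) P_VF[OF V(1)]] V(2)])
    fix Ws a d assume W: "ptype Ws a d" "length Ws = length Vs"
    have "\<exists>a d. ptype (P b V # Ws) a d"
      using ptype.True[OF pure_P[OF V(1)] W(1)] ptype.False[OF pure_P[OF V(1)] W(1)] by (cases b) auto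
    then show "ins (P b V) c Ws x = 0" using Cons.prems(3) W by (auto simp: ins_def)
  qed
  then show ?case
    using tens_add0[OF Cons.prems(1) V(2) P_VF[OF V(1), of True] P_VF[OF V(1), of False]] P_split[OF V(1)]
    by (simp add: ins_def)
qed

lemma tens_uminus: "tensorial c \<Longrightarrow> tensorial (\<lambda>Vs x. - c Vs x)"
  using tens_cmult[of c "-1"] by simp

lemma tens_diff: "tensorial c \<Longrightarrow> tensorial d \<Longrightarrow> tensorial (\<lambda>Vs x. c Vs x - d Vs x)"
  using tens_sum2[OF _ tens_uminus, of c d] by simp

lemma tens_pure_eqI:
  assumes "tensorial c" "tensorial d" "Vs \<in> lists VF" "\<And>Ws a b. ptype Ws a b \<Longrightarrow> length Ws = length Vs \<Longrightarrow> c Ws x = d Ws x"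
  shows "c Vs x = d Vs x"
  using tens_pure_eq_0[OF tens_diff[OF assms(1,2)] assms(3), of x] assms(4) by simp

text \<open>The component of a cochain of bidegree \<open>(p, q)\<close>. The recursion distributes the two types over the
  arguments one by one, instead of summing over the sets of positions of type \<open>(1, 0)\<close> as in
  \<open>bideg_comp\<close>.\<close>

primrec bideg_coch :: "('a \<Rightarrow> ('a, complex) tvec) list \<Rightarrow> nat \<Rightarrow> nat \<Rightarrow> 'a cochain \<Rightarrow> 'a \<Rightarrow> complex" where
  "bideg_coch [] p q c = (\<lambda>x. if p = 0 \<and> q = 0 then c [] x else 0)"
| "bideg_coch (V # Vs) p q c = (\<lambda>x.
     (if p = 0 then 0 else bideg_coch Vs (p - 1) q (ins (P True V) c) x) +
     (if q = 0 then 0 else bideg_coch Vs p (q - 1) (ins (P False V) c) x))"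

lemma bideg_coch_cong: "(\<And>Ws. Ws \<in> lists VF \<Longrightarrow> length Ws = length Vs \<Longrightarrow> c Ws = d Ws) \<Longrightarrow> Vs \<in> lists VF \<Longrightarrow> bideg_coch Vs p q c = bideg_coch Vs p q d"
proof (induction Vs arbitrary: c d p q)
  case (Cons V Vs)
  have "bideg_coch Vs p q (ins (P b V) c) = bideg_coch Vs p q (ins (P b V) d)" for b p q
    by (rule Cons.IH) (use Cons.prems P_VF in \<open>auto simp: ins_def\<close>)
  then show ?case by (simp cong: if_cong)
qed auto

lemma bideg_coch_add: "bideg_coch Vs p q (\<lambda>Vs x. c Vs x + d Vs x) x = bideg_coch Vs p q c x + bideg_coch Vs p q d x"
proof (induction Vs arbitrary: c d p q)
  case (Cons V Vs)
  have "ins U (\<lambda>Vs x. c Vs x + d Vs x) = (\<lambda>Vs x. ins U c Vs x + ins U d Vs x)" for U by (simp add: ins_def)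
  then show ?case by (simp add: Cons.IH)
qed auto

lemma bideg_coch_smul: "bideg_coch Vs p q (\<lambda>Vs x. h x * c Vs x) x = h x * bideg_coch Vs p q c x"
proof (induction Vs arbitrary: c p q)
  case (Cons V Vs)
  have "ins U (\<lambda>Vs x. h x * c Vs x) = (\<lambda>Vs x. h x * ins U c Vs x)" for U by (simp add: ins_def)
  then show ?case by (simp add: Cons.IH algebra_simps)
qed auto

lemma bideg_coch_uminus: "bideg_coch Vs p q (\<lambda>Vs x. - c Vs x) x = - bideg_coch Vs p q c x"
  using bideg_coch_smul[of Vs p q "\<lambda>x. -1" c x] by simp

lemma bideg_coch_zero: "bideg_coch Vs p q (\<lambda>Vs x. 0) x = 0"
  using bideg_coch_smul[of Vs p q "\<lambda>x. 0" "\<lambda>Vs x. 0" x] by simp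

lemma bideg_coch_SC: "smooth_values c \<Longrightarrow> Vs \<in> lists VF \<Longrightarrow> bideg_coch Vs p q c \<in> SC"
proof (induction Vs arbitrary: c p q)
  case Nil
  then show ?case using smooth_valuesD[of c "[]"] by (cases "p = 0 \<and> q = 0") auto
next
  case (Cons V Vs)
  then have V: "V \<in> VF" "Vs \<in> lists VF" by auto
  have "(\<lambda>x. if p = 0 then 0 else bideg_coch Vs (p - 1) q (ins (P True V) c) x) \<in> SC"
    using Cons.IH[OF smooth_values_ins[OF Cons.prems(1) P_VF[OF V(1)]] V(2)] by (cases "p = 0") auto
  moreover have "(\<lambda>x. if q = 0 then 0 else bideg_coch Vs p (q - 1) (ins (P False V) c) x) \<in> SC"
    using Cons.IH[OF smooth_values_ins[OF Cons.prems(1) P_VF[OF V(1)]] V(2)] by (cases "q = 0") auto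
  ultimately show ?case unfolding bideg_coch.simps by (rule smooth_fun_add)
qed

lemma tens_bideg_coch: assumes "tensorial c" shows "tensorial (\<lambda>Vs. bideg_coch Vs p q c)"
proof (rule tensI)
  show "bideg_coch Vs p q c \<in> SC" if "Vs \<in> lists VF" for Vs by (rule bideg_coch_SC[OF tens_smooth_values[OF assms] that])
next
  fix Us Vs V W x assume t: "Us \<in> lists VF" "Vs \<in> lists VF" "V \<in> VF" "W \<in> VF"
  show "bideg_coch (Us @ vadd V W # Vs) p q c x = bideg_coch (Us @ V # Vs) p q c x + bideg_coch (Us @ W # Vs) p q c x"
    using assms t(1)
  proof (induction Us arbitrary: c p q)
    case Nil
    have "bideg_coch Vs p q (ins (P b (vadd V W)) c) = bideg_coch Vs p q (\<lambda>Vs x. ins (P b V) c Vs x + ins (P b W) c Vs x)" for b p q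
      by (rule bideg_coch_cong) (use Nil t in \<open>auto simp: ins_def P_vadd tens_add0 P_VF\<close>)
    then show ?case by (simp add: bideg_coch_add)
  next
    case (Cons Z Us)
    then show ?case by (simp add: tens_ins P_VF)
  qed
  show "bideg_coch (Us @ V # W # Vs) p q c x = - bideg_coch (Us @ W # V # Vs) p q c x"
    using assms t(1)
  proof (induction Us arbitrary: c p q)
    case Nil
    have "bideg_coch Vs p q (ins (P b' W) (ins (P b V) c)) = bideg_coch Vs p q (\<lambda>Vs x. - ins (P b V) (ins (P b' W) c) Vs x)" for b b' p q
      by (rule bideg_coch_cong) (use t tens_swap0[OF Nil(1) _ P_VF[OF t(3)] P_VF[OF t(4)]] in \<open>auto simp: ins_def\<close>)
    then have "bideg_coch Vs p q (ins (P b' W) (ins (P b V) c)) x = - bideg_coch Vs p q (ins (P b V) (ins (P b' W) c)) x" for b b' p q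
      by (simp only: bideg_coch_uminus)
    then show ?case by simp
  next
    case (Cons Z Us)
    then have "bideg_coch (Us @ V # W # Vs) p q (ins (P b Z) c) x = - bideg_coch (Us @ W # V # Vs) p q (ins (P b Z) c) x" for b p q
      using Cons.IH[OF tens_ins[OF Cons.prems(1) P_VF]] by auto
    then show ?case by simp
  qed
next
  fix Us Vs V h x assume t: "Us \<in> lists VF" "Vs \<in> lists VF" "V \<in> VF" "h \<in> SC"
  show "bideg_coch (Us @ smul h V # Vs) p q c x = h x * bideg_coch (Us @ V # Vs) p q c x"
    using assms t(1)
  proof (induction Us arbitrary: c p q)
    case Nil
    have "bideg_coch Vs p q (ins (P b (smul h V)) c) = bideg_coch Vs p q (\<lambda>Vs x. h x * ins (P b V) c Vs x)" for b p q
      by (rule bideg_coch_cong) (use Nil t in \<open>auto simp: ins_def P_smul tens_smul0 P_VF\<close>)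
    then show ?case by (simp add: bideg_coch_smul algebra_simps)
  next
    case (Cons Z Us)
    then show ?case by (simp add: tens_ins P_VF algebra_simps)
  qed
qed

lemma bideg_coch_pure:
  "ptype Vs a b \<Longrightarrow> tensorial c \<Longrightarrow> bideg_coch Vs p q c x = (if p = a \<and> q = b then c Vs x else 0)"
proof (induction arbitrary: c p q rule: ptype.induct)
  case Nil then show ?case by auto
next
  case (True V Vs a b)
  have e: "P False V = (\<lambda>x f. 0)" using pure_other[OF True(1)] by simp
  have "bideg_coch Vs p q (ins (P False V) c) = bideg_coch Vs p q (\<lambda>Vs x. 0)" for p q
    unfolding e
    by (rule bideg_coch_cong) (use ptype_VF[OF True(2)] tens_field_zero[OF True(4), of "[]"] in \<open>auto simp: ins_def fun_eq_iff\<close>)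
  then show ?case
    using True.IH[OF tens_ins[OF True(4) pure_VF[OF True(1)]]] pure_same[OF True(1)]
    by (auto simp: bideg_coch_zero ins_def)
next
  case (False V Vs a b)
  have e: "P True V = (\<lambda>x f. 0)" using pure_other[OF False(1)] by simp
  have "bideg_coch Vs p q (ins (P True V) c) = bideg_coch Vs p q (\<lambda>Vs x. 0)" for p q
    unfolding e
    by (rule bideg_coch_cong) (use ptype_VF[OF False(2)] tens_field_zero[OF False(4), of "[]"] in \<open>auto simp: ins_def fun_eq_iff\<close>)
  then show ?case
    using False.IH[OF tens_ins[OF False(4) pure_VF[OF False(1)]]] pure_same[OF False(1)]
    by (auto simp: bideg_coch_zero ins_def)
qed

end

section \<open>The components of the exterior derivative\<close>

text \<open>The recursion satisfied by sums over the subsets of \<open>{..<Suc n}\<close> according to whether they contain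
  \<open>0\<close>; it matches the recursion of \<open>bideg_coch\<close>.\<close>

lemma sum_subsets_Suc:
  fixes F :: "nat set \<Rightarrow> 'b::comm_monoid_add"
  shows "(\<Sum>S | S \<subseteq> {..<Suc n} \<and> card S = p. F S) =
    (if p = 0 then 0 else \<Sum>S | S \<subseteq> {..<n} \<and> card S = p - 1. F (insert 0 (Suc ` S))) +
    (\<Sum>S | S \<subseteq> {..<n} \<and> card S = p. F (Suc ` S))"
proof -
  let ?A = "\<lambda>(n::nat) p. {S. S \<subseteq> {..<n} \<and> card S = p}"
  have fin: "finite (?A n p)" for n p by (rule finite_subset[of _ "Pow {..<n}"]) auto
  have finS: "finite S" if "S \<subseteq> {..<n}" for S :: "nat set" and n using finite_subset[OF that finite_lessThan] .
  let ?B = "{S \<in> ?A (Suc n) p. 0 \<in> S}" and ?C = "{S \<in> ?A (Suc n) p. 0 \<notin> S}"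
  have pre: "S = (if 0 \<in> S then insert 0 (Suc ` {i. Suc i \<in> S}) else Suc ` {i. Suc i \<in> S})" for S
  proof (rule Set.set_eqI)
    fix i show "i \<in> S \<longleftrightarrow> i \<in> (if 0 \<in> S then insert 0 (Suc ` {i. Suc i \<in> S}) else Suc ` {i. Suc i \<in> S})"
      by (cases i) auto
  qed
  have C: "?C = (`) Suc ` ?A n p"
  proof (intro equalityI subsetI)
    fix S assume S: "S \<in> ?C"
    then have e: "S = Suc ` {i. Suc i \<in> S}" using pre[of S] by auto
    have "card S = card {i. Suc i \<in> S}" by (subst e) (simp add: card_image)
    moreover have "{i. Suc i \<in> S} \<subseteq> {..<n}" using S by auto
    ultimately have "{i. Suc i \<in> S} \<in> ?A n p" using S by simp
    from imageI[OF this, of "(`) Suc"] show "S \<in> (`) Suc ` ?A n p" unfolding e[symmetric] .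
  qed (auto simp: card_image)
  have B: "?B = (if p = 0 then {} else (\<lambda>S. insert 0 (Suc ` S)) ` ?A n (p - 1))"
  proof (cases "p = 0")
    case True
    then show ?thesis using finS by (auto simp: card_eq_0_iff)
  next
    case False
    have "?B = (\<lambda>S. insert 0 (Suc ` S)) ` ?A n (p - 1)"
    proof (intro equalityI subsetI)
      fix S assume S: "S \<in> ?B"
      then have e: "S = insert 0 (Suc ` {i. Suc i \<in> S})" using pre[of S] by auto
      have "finite {i. Suc i \<in> S}" using S finS[of S "Suc n"] by (auto intro: finite_vimageI[of S Suc, unfolded vimage_def])
      then have "card S = Suc (card {i. Suc i \<in> S})" by (subst e) (simp add: card_image)
      moreover have "{i. Suc i \<in> S} \<subseteq> {..<n}" using S by auto
      ultimately have "{i. Suc i \<in> S} \<in> ?A n (p - 1)" using S by auto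
      from imageI[OF this, of "\<lambda>S. insert 0 (Suc ` S)"]
      show "S \<in> (\<lambda>S. insert 0 (Suc ` S)) ` ?A n (p - 1)" unfolding e[symmetric] .
    next
      fix S assume "S \<in> (\<lambda>S. insert 0 (Suc ` S)) ` ?A n (p - 1)"
      then obtain S' where S': "S = insert 0 (Suc ` S')" "S' \<subseteq> {..<n}" "card S' = p - 1" by blast
      then have "card S = Suc (card S')" using finS[OF S'(2)] by (simp add: card_image)
      then show "S \<in> ?B" using S' False by auto
    qed
    then show ?thesis using False by simp
  qed
  have i1: "inj_on (\<lambda>S. insert 0 (Suc ` S)) X" for X
  proof (rule inj_onI)
    fix S S' :: "nat set" assume "insert 0 (Suc ` S) = insert 0 (Suc ` S')"
    then have "Suc i \<in> insert 0 (Suc ` S) \<longleftrightarrow> Suc i \<in> insert 0 (Suc ` S')" for i by simp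
    then show "S = S'" by auto
  qed
  have i2: "inj_on ((`) Suc) X" for X by (auto simp: inj_on_def inj_image_eq_iff)
  have "?A (Suc n) p = ?B \<union> ?C" by auto
  then have "(\<Sum>S\<in>?A (Suc n) p. F S) = sum F (?B \<union> ?C)" by (rule arg_cong[where f = "sum F"])
  also have "\<dots> = (\<Sum>S\<in>?B. F S) + (\<Sum>S\<in>?C. F S)"
    by (rule sum.union_disjoint) (use fin[of "Suc n" p] in auto)
  finally have "(\<Sum>S\<in>?A (Suc n) p. F S) = (\<Sum>S\<in>?B. F S) + (\<Sum>S\<in>?C. F S)" .
  moreover have "(\<Sum>S\<in>?C. F S) = (\<Sum>S\<in>?A n p. F (Suc ` S))"
    unfolding C by (simp add: sum.reindex[OF i2])
  moreover have "(\<Sum>S\<in>?B. F S) = (if p = 0 then 0 else \<Sum>S\<in>?A n (p - 1). F (insert 0 (Suc ` S)))"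
    unfolding B by (simp add: sum.reindex[OF i1])
  ultimately show ?thesis by (simp only:)
qed

context almost_complex_manifold
begin

lemma bideg_coch_length: "length Vs \<noteq> p + q \<Longrightarrow> bideg_coch Vs p q c x = 0"
  by (induction Vs arbitrary: p q c) auto

lemma bideg_coch_sum:
  "length Vs = p + q \<Longrightarrow> bideg_coch Vs p q c x =
    (\<Sum>S | S \<subseteq> {..<p + q} \<and> card S = p. c (map (\<lambda>i. P (i \<in> S) (Vs ! i)) [0..<p + q]) x)"
proof (induction Vs arbitrary: p q c)
  case Nil
  then have "{S. S \<subseteq> {..<p + q} \<and> card S = p} = {{}}" by auto
  then show ?case using Nil by simp
next
  case (Cons V Vs)
  define n where "n = length Vs"
  have pq: "p + q = Suc n" using Cons.prems by (simp add: n_def)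
  have upt: "[0..<Suc n] = 0 # map Suc [0..<n]" by (simp only: map_Suc_upt upt_conv_Cons zero_less_Suc)
  have F1: "map (\<lambda>i. P (i \<in> insert 0 (Suc ` S)) ((V # Vs) ! i)) [0..<Suc n] = P True V # map (\<lambda>i. P (i \<in> S) (Vs ! i)) [0..<n]"
    and F2: "map (\<lambda>i. P (i \<in> Suc ` S) ((V # Vs) ! i)) [0..<Suc n] = P False V # map (\<lambda>i. P (i \<in> S) (Vs ! i)) [0..<n]" for S
    unfolding upt by (auto simp: o_def inj_image_mem_iff)
  have 1: "(if p = 0 then 0 else bideg_coch Vs (p - 1) q (ins (P True V) c) x) =
      (if p = 0 then 0 else \<Sum>S | S \<subseteq> {..<n} \<and> card S = p - 1. c (P True V # map (\<lambda>i. P (i \<in> S) (Vs ! i)) [0..<n]) x)"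
  proof (cases "p = 0")
    case False
    then have "p - 1 + q = n" using pq by simp
    then show ?thesis using Cons.IH[of "p - 1" q "ins (P True V) c"] False by (simp add: ins_def n_def)
  qed simp
  have 2: "(if q = 0 then 0 else bideg_coch Vs p (q - 1) (ins (P False V) c) x) =
      (\<Sum>S | S \<subseteq> {..<n} \<and> card S = p. c (P False V # map (\<lambda>i. P (i \<in> S) (Vs ! i)) [0..<n]) x)"
  proof (cases "q = 0")
    case False
    then have "p + (q - 1) = n" using pq by simp
    then show ?thesis using Cons.IH[of p "q - 1" "ins (P False V) c"] False by (simp add: ins_def n_def)
  next
    case True
    have "card S \<noteq> p" if "S \<subseteq> {..<n}" for S
      using card_mono[OF finite_lessThan that] pq True by simp
    then have "{S. S \<subseteq> {..<n} \<and> card S = p} = {}" by blast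
    then show ?thesis using True by (simp only: sum.empty if_True refl)
  qed
  have "bideg_coch (V # Vs) p q c x = (if p = 0 then 0 else bideg_coch Vs (p - 1) q (ins (P True V) c) x) +
     (if q = 0 then 0 else bideg_coch Vs p (q - 1) (ins (P False V) c) x)" by simp
  also have "\<dots> = (\<Sum>S | S \<subseteq> {..<Suc n} \<and> card S = p. c (map (\<lambda>i. P (i \<in> S) ((V # Vs) ! i)) [0..<Suc n]) x)"
    unfolding 1 2 by (subst sum_subsets_Suc) (simp only: F1 F2)
  finally show ?case unfolding pq .
qed

lemma bideg_comp_frm:
  assumes \<omega>: "\<omega> \<in> forms M" shows "bideg_comp M J p q \<omega> = frm (\<lambda>Vs. bideg_coch Vs p q (coch \<omega>))"
proof (intro ext)
  fix x vs
  show "bideg_comp M J p q \<omega> x vs = frm (\<lambda>Vs. bideg_coch Vs p q (coch \<omega>)) x vs"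
  proof (cases "x \<in> points M \<and> vs \<in> lists (T x) \<and> length vs = p + q")
    case True
    then have x: "x \<in> points M" and vs: "vs \<in> lists (T x)" and len: "length vs = p + q" by auto
    let ?Ws = "map (field_extension M x) vs"
    have "frm (\<lambda>Vs. bideg_coch Vs p q (coch \<omega>)) x vs = bideg_coch ?Ws p q (coch \<omega>) x"
      using x vs by (simp add: frm_def)
    also have "\<dots> = (\<Sum>S | S \<subseteq> {..<p + q} \<and> card S = p. coch \<omega> (map (\<lambda>i. P (i \<in> S) (?Ws ! i)) [0..<p + q]) x)"
      by (rule bideg_coch_sum) (simp add: len)
    also have "\<dots> = (\<Sum>S | S \<subseteq> {..<p + q} \<and> card S = p. \<omega> x (map (\<lambda>i. if i \<in> S then proj10 J x (vs ! i) else proj01 J x (vs ! i)) [0..<p + q]))"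
    proof (rule sum.cong[OF refl])
      fix S
      have "P (i \<in> S) (?Ws ! i) x = (if i \<in> S then proj10 J x (vs ! i) else proj01 J x (vs ! i))" if "i < p + q" for i
        using that len vs field_extension(2)[OF x, of "vs ! i"] by (auto simp: P_at x pr_proj in_lists_conv_set)
      then show "coch \<omega> (map (\<lambda>i. P (i \<in> S) (?Ws ! i)) [0..<p + q]) x =
          \<omega> x (map (\<lambda>i. if i \<in> S then proj10 J x (vs ! i) else proj01 J x (vs ! i)) [0..<p + q])"
        unfolding coch_def by (intro arg_cong[of _ _ "\<omega> x"]) (auto simp del: map_map simp: map_map[unfolded o_def])
    qed
    finally show ?thesis using x vs len by (simp add: bideg_comp_def)
  next
    case False
    have "frm (\<lambda>Vs. bideg_coch Vs p q (coch \<omega>)) x vs = 0"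
      unfolding frm_def using False bideg_coch_length[of "map (field_extension M x) vs" p q] by auto
    then show ?thesis unfolding bideg_comp_def if_not_P[OF False] by simp
  qed
qed

definition mubc :: "'a cochain \<Rightarrow> 'a cochain" where
  "mubc c Vs x = (\<Sum>p\<le>DIM('e). \<Sum>q\<le>DIM('e). bideg_coch Vs p (q + 2) (\<lambda>Ws. dce Ws (\<lambda>Xs. bideg_coch Xs (p + 1) q c)) x)"

definition delbc :: "'a cochain \<Rightarrow> 'a cochain" where
  "delbc c Vs x = (\<Sum>p\<le>DIM('e). \<Sum>q\<le>DIM('e). bideg_coch Vs p (q + 1) (\<lambda>Ws. dce Ws (\<lambda>Xs. bideg_coch Xs p q c)) x)"

lemma tens_mubc: "tensorial c \<Longrightarrow> tensorial (mubc c)"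
  unfolding mubc_def[abs_def] by (intro tens_Sum tens_bideg_coch tens_dce)

lemma tens_delbc: "tensorial c \<Longrightarrow> tensorial (delbc c)"
  unfolding delbc_def[abs_def] by (intro tens_Sum tens_bideg_coch tens_dce)

lemma comp_d_comp:
  assumes \<omega>: "\<omega> \<in> forms M"
  shows "bideg_comp M J p q (ext_deriv M (bideg_comp M J p' q' \<omega>)) =
    frm (\<lambda>Vs. bideg_coch Vs p q (\<lambda>Ws. dce Ws (\<lambda>Xs. bideg_coch Xs p' q' (coch \<omega>))))"
proof -
  let ?c = "\<lambda>Xs. bideg_coch Xs p' q' (coch \<omega>)"
  have t: "tensorial ?c" by (rule tens_bideg_coch[OF tens_coch[OF \<omega>]])
  have "ext_deriv M (frm ?c) = frm (\<lambda>Vs. dce Vs (coch (frm ?c)))"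
    by (rule ext_deriv_frm[OF frm_forms[OF t]])
  also have "\<dots> = frm (\<lambda>Vs. dce Vs ?c)"
    by (intro frm_cong dce_cong) (auto simp: coch_frm[OF t])
  finally have e: "ext_deriv M (frm ?c) = frm (\<lambda>Vs. dce Vs ?c)" .
  have "bideg_comp M J p q (frm (\<lambda>Vs. dce Vs ?c)) = frm (\<lambda>Vs. bideg_coch Vs p q (coch (frm (\<lambda>Vs. dce Vs ?c))))"
    by (rule bideg_comp_frm[OF frm_forms[OF tens_dce[OF t]]])
  also have "\<dots> = frm (\<lambda>Vs. bideg_coch Vs p q (\<lambda>Vs. dce Vs ?c))"
    by (intro frm_cong bideg_coch_cong) (auto simp: coch_frm[OF tens_dce[OF t]])
  finally show ?thesis unfolding bideg_comp_frm[OF \<omega>] e .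
qed

lemma mubar_frm: "\<omega> \<in> forms M \<Longrightarrow> mubar M J \<omega> = frm (mubc (coch \<omega>))"
  unfolding mubar_def comp_d_comp frm_Sum mubc_def[abs_def] ..

lemma delbar_frm: "\<omega> \<in> forms M \<Longrightarrow> delbar M J \<omega> = frm (delbc (coch \<omega>))"
  unfolding delbar_def comp_d_comp frm_Sum delbc_def[abs_def] ..

lemma sum_delta2:
  fixes f :: "nat \<Rightarrow> nat \<Rightarrow> complex"
  shows "(\<Sum>p\<le>n. \<Sum>q\<le>n. if p = a \<and> q = b then f p q else 0) = (if a \<le> n \<and> b \<le> n then f a b else 0)"
proof -
  have "(\<Sum>p\<le>n. \<Sum>q\<le>n. if p = a \<and> q = b then f p q else 0) = (\<Sum>p\<le>n. if p = a then (\<Sum>q\<le>n. if q = b then f p q else 0) else 0)"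
    by (intro sum.cong) auto
  also have "\<dots> = (if a \<le> n \<and> b \<le> n then f a b else 0)" by (simp add: sum.delta)
  finally show ?thesis .
qed

text \<open>On arguments of pure type all but one of the summands vanish: both the outer and the inner bidegree are
  prescribed. The remaining one is within the range of summation unless there are more arguments than
  the dimension of the manifold, and then it vanishes.\<close>

lemma mubc_pure:
  assumes V: "ptype Vs a b" and c: "tensorial c"
  shows "mubc c Vs x = (if b \<ge> 2 then dce Vs (\<lambda>Xs. bideg_coch Xs (a + 1) (b - 2) c) x else 0)"
proof -
  have t: "tensorial (\<lambda>Ws. dce Ws (\<lambda>Xs. bideg_coch Xs p q c))" for p q by (intro tens_dce tens_bideg_coch c)
  have e: "mubc c Vs x = (\<Sum>p\<le>DIM('e). \<Sum>q\<le>DIM('e). if p = a \<and> q + 2 = b then dce Vs (\<lambda>Xs. bideg_coch Xs (p + 1) q c) x else 0)"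
    unfolding mubc_def bideg_coch_pure[OF V t] ..
  show ?thesis
  proof (cases "b \<ge> 2")
    case True
    then have "q + 2 = b \<longleftrightarrow> q = b - 2" for q by auto
    then have "mubc c Vs x = (if a \<le> DIM('e) \<and> b - 2 \<le> DIM('e) then dce Vs (\<lambda>Xs. bideg_coch Xs (a + 1) (b - 2) c) x else 0)"
      unfolding e using sum_delta2[where n = "DIM('e)" and a = a and b = "b - 2" and f = "\<lambda>p q. dce Vs (\<lambda>Xs. bideg_coch Xs (p + 1) q c) x"]
      by (simp only:)
    moreover have "dce Vs (\<lambda>Xs. bideg_coch Xs (a + 1) (b - 2) c) x = 0" if "\<not> (a \<le> DIM('e) \<and> b - 2 \<le> DIM('e))"
      by (rule tens_long[OF t ptype_VF[OF V]]) (use that ptype_length[OF V] in auto)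
    ultimately show ?thesis using True by auto
  next
    case False
    then show ?thesis unfolding e by (auto intro!: sum.neutral)
  qed
qed

lemma delbc_pure:
  assumes V: "ptype Vs a b" and c: "tensorial c"
  shows "delbc c Vs x = (if b \<ge> 1 then dce Vs (\<lambda>Xs. bideg_coch Xs a (b - 1) c) x else 0)"
proof -
  have t: "tensorial (\<lambda>Ws. dce Ws (\<lambda>Xs. bideg_coch Xs p q c))" for p q by (intro tens_dce tens_bideg_coch c)
  have e: "delbc c Vs x = (\<Sum>p\<le>DIM('e). \<Sum>q\<le>DIM('e). if p = a \<and> q + 1 = b then dce Vs (\<lambda>Xs. bideg_coch Xs p q c) x else 0)"
    unfolding delbc_def bideg_coch_pure[OF V t] ..
  show ?thesis
  proof (cases "b \<ge> 1")
    case True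
    then have "q + 1 = b \<longleftrightarrow> q = b - 1" for q by auto
    then have "delbc c Vs x = (if a \<le> DIM('e) \<and> b - 1 \<le> DIM('e) then dce Vs (\<lambda>Xs. bideg_coch Xs a (b - 1) c) x else 0)"
      unfolding e using sum_delta2[where n = "DIM('e)" and a = a and b = "b - 1" and f = "\<lambda>p q. dce Vs (\<lambda>Xs. bideg_coch Xs p q c) x"]
      by (simp only:)
    moreover have "dce Vs (\<lambda>Xs. bideg_coch Xs a (b - 1) c) x = 0" if "\<not> (a \<le> DIM('e) \<and> b - 1 \<le> DIM('e))"
      by (rule tens_long[OF t ptype_VF[OF V]]) (use that ptype_length[OF V] in auto)
    ultimately show ?thesis using True by auto
  next
    case False
    then show ?thesis unfolding e by (auto intro!: sum.neutral)
  qed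
qed

text \<open>The decreasing filtration of the cochains of degree \<open>n\<close> by the number of arguments of type
  \<open>(1, 0)\<close>. Since \<open>d\<close> has no component of bidegree \<open>(-2, 3)\<close>, it lowers the filtration by one at
  most.\<close>

definition vanishes_below :: "'a cochain \<Rightarrow> nat \<Rightarrow> int \<Rightarrow> bool" where
  "vanishes_below c n m \<longleftrightarrow> (\<forall>Ws a b x. ptype Ws a b \<longrightarrow> length Ws = n \<longrightarrow> int a < m \<longrightarrow> c Ws x = 0)"

lemma vanishes_below_ins_True: "vanishes_below c (Suc n) m \<Longrightarrow> pure True V \<Longrightarrow> vanishes_below (ins V c) n (m - 1)"
  unfolding vanishes_below_def ins_def using ptype.True by fastforce

lemma vanishes_below_ins_False: "vanishes_below c (Suc n) m \<Longrightarrow> pure False V \<Longrightarrow> vanishes_below (ins V c) n m"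
  unfolding vanishes_below_def ins_def using ptype.False by fastforce

lemma vanishes_below_front:
  assumes c: "tensorial c" "vanishes_below c (Suc n) m" and W: "ptype Ws a b" "length Ws = n" "int a + 1 < m" and U: "U \<in> VF"
  shows "c (U # Ws) x = 0"
proof -
  have "c (P True U # Ws) x = 0" "c (P False U # Ws) x = 0"
    using c(2) W ptype.True[OF pure_P[OF U] W(1)] ptype.False[OF pure_P[OF U] W(1)] unfolding vanishes_below_def by fastforce+
  then show ?thesis
    using tens_add0[OF c(1) ptype_VF[OF W(1)] P_VF[OF U, of True] P_VF[OF U, of False]] P_split[OF U] by simp
qed

lemma LD_vanishes_below:
  "ptype Vs a b \<Longrightarrow> tensorial c \<Longrightarrow> vanishes_below c (length Vs) m \<Longrightarrow> int a + 1 < m \<Longrightarrow> V \<in> VF \<Longrightarrow> LD V Vs c x = 0"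
proof (induction arbitrary: c m rule: ptype.induct)
  case Nil
  then have "c [] = (\<lambda>x. 0)" unfolding vanishes_below_def using ptype.Nil by fastforce
  then show ?case using Nil by (simp add: act_zero)
next
  case (True W Ws a b)
  have "LD V Ws (ins W c) x = 0"
    by (rule True.IH[OF tens_ins[OF True.prems(1) pure_VF[OF True(1)]] vanishes_below_ins_True[OF _ True(1)]])
      (use True.prems in auto)
  moreover have "c (lie_bracket V W # Ws) x = 0"
    by (rule vanishes_below_front[OF True.prems(1) _ True(2) refl]) (use True.prems True(1) in \<open>auto intro: bracket_VF pure_VF\<close>)
  ultimately show ?case by simp
next
  case (False W Ws a b)
  have "LD V Ws (ins W c) x = 0"
    by (rule False.IH[OF tens_ins[OF False.prems(1) pure_VF[OF False(1)]] vanishes_below_ins_False[OF _ False(1)]])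
      (use False.prems in auto)
  moreover have "c (lie_bracket V W # Ws) x = 0"
    by (rule vanishes_below_front[OF False.prems(1) _ False(2) refl]) (use False.prems False(1) in \<open>auto intro: bracket_VF pure_VF\<close>)
  ultimately show ?case by simp
qed

lemma dce_vanishes_below:
  "ptype Vs a b \<Longrightarrow> tensorial c \<Longrightarrow> length Vs = Suc n \<Longrightarrow> vanishes_below c n m \<Longrightarrow> int a + 1 < m \<Longrightarrow> dce Vs c x = 0"
proof (induction arbitrary: c m n rule: ptype.induct)
  case Nil then show ?case by simp
next
  case (True W Ws a b)
  have "LD W Ws c x = 0"
    by (rule LD_vanishes_below[OF True(2)]) (use True.prems pure_VF[OF True(1)] in auto)
  moreover have "dce Ws (ins W c) x = 0"
  proof (cases Ws)
    case (Cons U Us)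
    then show ?thesis
      by (intro True.IH[OF tens_ins[OF True.prems(1) pure_VF[OF True(1)]] _ vanishes_below_ins_True[OF _ True(1)], of "length Us" m])
        (use True.prems in auto)
  qed simp
  ultimately show ?case by simp
next
  case (False W Ws a b)
  have "LD W Ws c x = 0"
    by (rule LD_vanishes_below[OF False(2)]) (use False.prems pure_VF[OF False(1)] in auto)
  moreover have "dce Ws (ins W c) x = 0"
  proof (cases Ws)
    case (Cons U Us)
    then show ?thesis
      by (intro False.IH[OF tens_ins[OF False.prems(1) pure_VF[OF False(1)]] _ vanishes_below_ins_False[OF _ False(1)], of "length Us" m])
        (use False.prems in auto)
  qed simp
  ultimately show ?case by simp
qed

text \<open>On arguments of type \<open>(a, b)\<close>, both sides depend only on the component \<open>\<eta>\<close> of \<open>c\<close> of bidegree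
  \<open>(a + 1, b - 3)\<close>. Of the components of \<open>d \<eta>\<close>, only those of bidegrees \<open>(a, b - 1)\<close> and \<open>(a + 1, b - 2)\<close>
  contribute to \<open>d (d \<eta>)\<close> on these arguments, by the filtration; these contributions are the two
  sides of the equation, and their sum is \<open>0\<close>.\<close>

lemma delbc_mubc:
  assumes c: "tensorial c" and V: "Vs \<in> lists VF"
  shows "delbc (mubc c) Vs x = - mubc (delbc c) Vs x"
proof (rule tens_pure_eqI[OF tens_delbc[OF tens_mubc[OF c]] tens_uminus[OF tens_mubc[OF tens_delbc[OF c]]] V])
  fix Ws a b assume W: "ptype Ws a b"
  note L = delbc_pure[OF W tens_mubc[OF c], of x] and R = mubc_pure[OF W tens_delbc[OF c], of x]
  note Wl = ptype_VF[OF W]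
  show "delbc (mubc c) Ws x = - mubc (delbc c) Ws x"
  proof (cases "b \<ge> 3")
    case False
    have "dce Ws (\<lambda>Xs. bideg_coch Xs a (b - 1) (mubc c)) = dce Ws (\<lambda>Xs x. 0)"
    proof (rule dce_cong[OF _ Wl], rule ext)
      fix Xs x assume X: "Xs \<in> lists VF"
      show "bideg_coch Xs a (b - 1) (mubc c) x = 0"
        by (rule tens_pure_eq_0[OF tens_bideg_coch[OF tens_mubc[OF c]] X])
          (use False in \<open>auto simp: bideg_coch_pure tens_mubc c mubc_pure\<close>)
    qed
    moreover have "dce Ws (\<lambda>Xs. bideg_coch Xs (a + 1) (b - 2) (delbc c)) = dce Ws (\<lambda>Xs x. 0)"
    proof (rule dce_cong[OF _ Wl], rule ext)
      fix Xs x assume X: "Xs \<in> lists VF"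
      show "bideg_coch Xs (a + 1) (b - 2) (delbc c) x = 0"
        by (rule tens_pure_eq_0[OF tens_bideg_coch[OF tens_delbc[OF c]] X])
          (use False in \<open>auto simp: bideg_coch_pure tens_delbc c delbc_pure\<close>)
    qed
    ultimately show ?thesis unfolding L R by (simp add: dce_zero Wl)
  next
    case True
    define \<eta> where "\<eta> = (\<lambda>Xs. bideg_coch Xs (a + 1) (b - 3) c)"
    define d\<eta> where "d\<eta> = (\<lambda>Xs. dce Xs \<eta>)"
    have t\<eta>: "tensorial \<eta>" unfolding \<eta>_def by (rule tens_bideg_coch[OF c])
    have td: "tensorial d\<eta>" unfolding d\<eta>_def by (rule tens_dce[OF t\<eta>])
    define E0 where "E0 = (\<lambda>Xs. bideg_coch Xs a (b - 1) d\<eta>)"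
    define E1 where "E1 = (\<lambda>Xs. bideg_coch Xs (a + 1) (b - 2) d\<eta>)"
    have tE: "tensorial E0" "tensorial E1" unfolding E0_def E1_def by (rule tens_bideg_coch[OF td])+

    have "dce Ws (\<lambda>Xs. bideg_coch Xs a (b - 1) (mubc c)) = dce Ws E0"
    proof (rule dce_cong[OF _ Wl], rule ext)
      fix Xs x assume X: "Xs \<in> lists VF"
      show "bideg_coch Xs a (b - 1) (mubc c) x = E0 Xs x"
      proof (rule tens_pure_eqI[OF tens_bideg_coch[OF tens_mubc[OF c]] tE(1) X])
        fix Zs a' b' assume Z: "ptype Zs a' b'"
        show "bideg_coch Zs a (b - 1) (mubc c) x = E0 Zs x"
        proof (cases "a = a' \<and> b - 1 = b'")
          case eq: True
          then have e: "b' - 2 = b - 3" "b' \<ge> 2" "a' = a" using True by auto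
          show ?thesis
            unfolding E0_def bideg_coch_pure[OF Z tens_mubc[OF c]] bideg_coch_pure[OF Z td] mubc_pure[OF Z c] e(1)
            unfolding d\<eta>_def \<eta>_def using e eq by simp
        next
          case False
          then show ?thesis unfolding E0_def bideg_coch_pure[OF Z tens_mubc[OF c]] bideg_coch_pure[OF Z td] by auto
        qed
      qed
    qed
    then have l: "delbc (mubc c) Ws x = dce Ws E0 x" unfolding L using True by simp
    have "dce Ws (\<lambda>Xs. bideg_coch Xs (a + 1) (b - 2) (delbc c)) = dce Ws E1"
    proof (rule dce_cong[OF _ Wl], rule ext)
      fix Xs x assume X: "Xs \<in> lists VF"
      show "bideg_coch Xs (a + 1) (b - 2) (delbc c) x = E1 Xs x"
      proof (rule tens_pure_eqI[OF tens_bideg_coch[OF tens_delbc[OF c]] tE(2) X])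
        fix Zs a' b' assume Z: "ptype Zs a' b'"
        show "bideg_coch Zs (a + 1) (b - 2) (delbc c) x = E1 Zs x"
        proof (cases "a + 1 = a' \<and> b - 2 = b'")
          case eq: True
          then have e: "b' - 1 = b - 3" "b' \<ge> 1" "a' = a + 1" using True by auto
          show ?thesis
            unfolding E1_def bideg_coch_pure[OF Z tens_delbc[OF c]] bideg_coch_pure[OF Z td] delbc_pure[OF Z c] e(1)
            unfolding d\<eta>_def \<eta>_def using e eq by simp
        next
          case False
          then show ?thesis unfolding E1_def bideg_coch_pure[OF Z tens_delbc[OF c]] bideg_coch_pure[OF Z td] by auto
        qed
      qed
    qed
    then have r: "mubc (delbc c) Ws x = dce Ws E1 x" unfolding R using True by simp
    define R' where "R' = (\<lambda>Xs x. d\<eta> Xs x - (E0 Xs x + E1 Xs x))"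
    have tR: "tensorial R'" unfolding R'_def by (intro tens_diff td tens_sum2 tE)
    have vanishes_below\<eta>: "vanishes_below \<eta> (a + b - 2) (int a + 1)"
      unfolding vanishes_below_def by (auto simp: \<eta>_def bideg_coch_pure c)
    have "vanishes_below R' (a + b - 1) (int a + 2)"
      unfolding vanishes_below_def
    proof (intro allI impI)
      fix Xs a' b' x assume X: "ptype Xs a' b'" "length Xs = a + b - 1" "int a' < int a + 2"
      have l: "a' + b' = a + b - 1" using ptype_length[OF X(1)] X(2) by simp
      consider "a' = a" "b' = b - 1" | "a' = a + 1" "b' = b - 2" | "a' < a" using X(3) l True by linarith
      then show "R' Xs x = 0"
      proof cases
        case 3
        have "d\<eta> Xs x = 0"
          unfolding d\<eta>_def by (rule dce_vanishes_below[OF X(1) t\<eta> _ vanishes_below\<eta>]) (use X l True 3 in auto)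
        then show ?thesis using 3 by (simp add: R'_def E0_def E1_def bideg_coch_pure[OF X(1) td])
      qed (simp_all add: R'_def E0_def E1_def bideg_coch_pure[OF X(1) td])
    qed
    then have "dce Ws R' x = 0"
      by (intro dce_vanishes_below[OF W tR]) (use ptype_length[OF W] True in auto)
    moreover have "dce Ws R' x = dce Ws d\<eta> x - (dce Ws E0 x + dce Ws E1 x)"
      unfolding R'_def using dce_diff[OF tens_smooth_values[OF td] tens_smooth_values[OF tens_sum2[OF tE]] Wl, of x]
        dce_add[OF tens_smooth_values[OF tE(1)] tens_smooth_values[OF tE(2)] Wl, of x] by simp
    moreover have "dce Ws d\<eta> x = 0" unfolding d\<eta>_def by (rule dce_dce[OF t\<eta> Wl])
    ultimately show ?thesis unfolding l r by algebra
  qed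
qed

end

context charted
begin

lemma forms_zero: "0 \<in> forms M"
proof -
  have "frm (\<lambda>Vs x. 0) \<in> forms M" by (intro frm_forms tens_zero)
  moreover have "frm (\<lambda>Vs x. 0) = 0" by (intro ext) (simp add: frm_def)
  ultimately show ?thesis by simp
qed

end

context almost_complex_manifold
begin

lemma frm_add: "frm (\<lambda>Vs x. c Vs x + d Vs x) = frm c + frm d"
  by (intro ext) (simp add: frm_def)

lemma frm_diff: "frm (\<lambda>Vs x. c Vs x - d Vs x) = frm c - frm d"
  by (intro ext) (simp add: frm_def)

lemma coch_add: "coch (\<omega> + \<eta>) = (\<lambda>Vs x. coch \<omega> Vs x + coch \<eta> Vs x)"
  by (simp add: coch_def)

lemma forms_add: assumes "\<omega> \<in> forms M" "\<eta> \<in> forms M" shows "\<omega> + \<eta> \<in> forms M"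
proof -
  have "frm (\<lambda>Vs x. coch \<omega> Vs x + coch \<eta> Vs x) \<in> forms M"
    by (intro frm_forms tens_sum2 tens_coch assms)
  then show ?thesis by (simp only: frm_add frm_coch assms)
qed

lemma forms_diff: assumes "\<omega> \<in> forms M" "\<eta> \<in> forms M" shows "\<omega> - \<eta> \<in> forms M"
proof -
  have "frm (\<lambda>Vs x. coch \<omega> Vs x - coch \<eta> Vs x) \<in> forms M"
    by (intro frm_forms tens_diff tens_coch assms)
  then show ?thesis by (simp only: frm_diff frm_coch assms)
qed

lemma mubc_cong: "(\<And>Ws. Ws \<in> lists VF \<Longrightarrow> c Ws = d Ws) \<Longrightarrow> Vs \<in> lists VF \<Longrightarrow> mubc c Vs = mubc d Vs"
  unfolding mubc_def[abs_def] by (intro ext sum.cong refl fun_cong[OF bideg_coch_cong] dce_cong bideg_coch_cong) auto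

lemma delbc_cong: "(\<And>Ws. Ws \<in> lists VF \<Longrightarrow> c Ws = d Ws) \<Longrightarrow> Vs \<in> lists VF \<Longrightarrow> delbc c Vs = delbc d Vs"
  unfolding delbc_def[abs_def] by (intro ext sum.cong refl fun_cong[OF bideg_coch_cong] dce_cong bideg_coch_cong) auto

lemma dce_bideg_coch_add:
  assumes "tensorial c" "tensorial d" "Vs \<in> lists VF"
  shows "dce Vs (\<lambda>Xs. bideg_coch Xs p q (\<lambda>Vs x. c Vs x + d Vs x)) x = dce Vs (\<lambda>Xs. bideg_coch Xs p q c) x + dce Vs (\<lambda>Xs. bideg_coch Xs p q d) x"
proof -
  have "(\<lambda>Xs. bideg_coch Xs p q (\<lambda>Vs x. c Vs x + d Vs x)) = (\<lambda>Xs x. bideg_coch Xs p q c x + bideg_coch Xs p q d x)"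
    by (intro ext bideg_coch_add)
  then show ?thesis
    using dce_add[OF tens_smooth_values[OF tens_bideg_coch[OF assms(1)]] tens_smooth_values[OF tens_bideg_coch[OF assms(2)]] assms(3)] by simp
qed

lemma mubc_add:
  assumes c: "tensorial c" and d: "tensorial d" and V: "Vs \<in> lists VF"
  shows "mubc (\<lambda>Vs x. c Vs x + d Vs x) Vs x = mubc c Vs x + mubc d Vs x"
proof (rule tens_pure_eqI[OF tens_mubc[OF tens_sum2[OF c d]] tens_sum2[OF tens_mubc[OF c] tens_mubc[OF d]] V])
  fix Ws a b assume W: "ptype Ws a b"
  show "mubc (\<lambda>Vs x. c Vs x + d Vs x) Ws x = mubc c Ws x + mubc d Ws x"
    unfolding mubc_pure[OF W c] mubc_pure[OF W d] mubc_pure[OF W tens_sum2[OF c d]]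
    using dce_bideg_coch_add[OF c d ptype_VF[OF W]] by simp
qed

lemma delbc_add:
  assumes c: "tensorial c" and d: "tensorial d" and V: "Vs \<in> lists VF"
  shows "delbc (\<lambda>Vs x. c Vs x + d Vs x) Vs x = delbc c Vs x + delbc d Vs x"
proof (rule tens_pure_eqI[OF tens_delbc[OF tens_sum2[OF c d]] tens_sum2[OF tens_delbc[OF c] tens_delbc[OF d]] V])
  fix Ws a b assume W: "ptype Ws a b"
  show "delbc (\<lambda>Vs x. c Vs x + d Vs x) Ws x = delbc c Ws x + delbc d Ws x"
    unfolding delbc_pure[OF W c] delbc_pure[OF W d] delbc_pure[OF W tens_sum2[OF c d]]
    using dce_bideg_coch_add[OF c d ptype_VF[OF W]] by simp
qed

lemma mubar_forms: "\<omega> \<in> forms M \<Longrightarrow> mubar M J \<omega> \<in> forms M"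
  by (simp add: mubar_frm frm_forms tens_mubc tens_coch)

lemma delbar_forms: "\<omega> \<in> forms M \<Longrightarrow> delbar M J \<omega> \<in> forms M"
  by (simp add: delbar_frm frm_forms tens_delbc tens_coch)

lemma mubar_add:
  assumes "\<omega> \<in> forms M" "\<eta> \<in> forms M" shows "mubar M J (\<omega> + \<eta>) = mubar M J \<omega> + mubar M J \<eta>"
  unfolding mubar_frm[OF forms_add[OF assms]] mubar_frm[OF assms(1)] mubar_frm[OF assms(2)] frm_add[symmetric] coch_add
  by (intro frm_cong ext mubc_add tens_coch assms)

lemma delbar_add:
  assumes "\<omega> \<in> forms M" "\<eta> \<in> forms M" shows "delbar M J (\<omega> + \<eta>) = delbar M J \<omega> + delbar M J \<eta>"
  unfolding delbar_frm[OF forms_add[OF assms]] delbar_frm[OF assms(1)] delbar_frm[OF assms(2)] frm_add[symmetric] coch_add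
  by (intro frm_cong ext delbc_add tens_coch assms)

lemma delbar_mubar:
  assumes \<omega>: "\<omega> \<in> forms M"
  shows "\<exists>\<xi>\<in>forms M. delbar M J (mubar M J \<omega>) = mubar M J \<xi>"
proof
  let ?c = "coch \<omega>" let ?e = "\<lambda>Vs x. - delbc ?c Vs x"
  have c: "tensorial ?c" by (rule tens_coch[OF \<omega>])
  have e: "tensorial ?e" by (rule tens_uminus[OF tens_delbc[OF c]])
  show "frm ?e \<in> forms M" by (rule frm_forms[OF e])
  have "delbar M J (mubar M J \<omega>) = frm (delbc (coch (frm (mubc ?c))))"
    unfolding mubar_frm[OF \<omega>] by (rule delbar_frm[OF frm_forms[OF tens_mubc[OF c]]])
  also have "\<dots> = frm (mubc (coch (frm ?e)))"
  proof (intro frm_cong ext)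
    fix Vs x assume V: "Vs \<in> lists VF"
    have "delbc (coch (frm (mubc ?c))) Vs x = delbc (mubc ?c) Vs x"
      by (rule fun_cong[OF delbc_cong[OF coch_frm[OF tens_mubc[OF c]] V]])
    also have "\<dots> = - mubc (delbc ?c) Vs x" by (rule delbc_mubc[OF c V])
    also have "\<dots> = mubc ?e Vs x"
    proof -
      have "mubc (\<lambda>Vs x. delbc ?c Vs x + ?e Vs x) Vs x = mubc (delbc ?c) Vs x + mubc ?e Vs x"
        by (rule mubc_add[OF tens_delbc[OF c] e V])
      moreover have "mubc (\<lambda>Vs x. delbc ?c Vs x + ?e Vs x) Vs x = 0"
      proof -
        have "mubc (\<lambda>Vs x. 0 + 0) Vs x = mubc (\<lambda>Vs x. 0) Vs x + mubc (\<lambda>Vs x. 0) Vs x"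
          by (rule mubc_add[OF tens_zero tens_zero V])
        then show ?thesis by simp
      qed
      ultimately show ?thesis by (simp add: eq_neg_iff_add_eq_0 neg_eq_iff_add_eq_0)
    qed
    also have "\<dots> = mubc (coch (frm ?e)) Vs x"
      by (rule fun_cong[OF mubc_cong[OF coch_frm[OF e] V], symmetric])
    finally show "delbc (coch (frm (mubc ?c))) Vs x = mubc (coch (frm ?e)) Vs x" .
  qed
  also have "\<dots> = mubar M J (frm ?e)" by (rule mubar_frm[OF frm_forms[OF e], symmetric])
  finally show "delbar M J (mubar M J \<omega>) = mubar M J (frm ?e)" .
qed

section \<open>Unfolding surjectivity in Dolbeault cohomology\<close>

lemma carrier_mubar_cohomology:
  "carrier (mubar_cohomology M J \<Omega>) = {{h + a | h. h \<in> mubar M J ` \<Omega>} | a. a \<in> \<Omega> \<and> mubar M J a = 0}"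
  by (auto simp: mubar_cohomology_def cohomology_def additive_group_def kernel_def FactGroup_def RCOSETS_def r_coset_def)

lemma one_mubar_cohomology: "\<one>\<^bsub>mubar_cohomology M J \<Omega>\<^esub> = mubar M J ` \<Omega>"
  by (simp add: mubar_cohomology_def cohomology_def additive_group_def FactGroup_def)

lemma mult_mubar_cohomology: "A \<otimes>\<^bsub>mubar_cohomology M J \<Omega>\<^esub> B = {a + b | a b. a \<in> A \<and> b \<in> B}"
  by (auto simp: mubar_cohomology_def cohomology_def additive_group_def FactGroup_def set_mult_def)

lemma delbar_induced_eq:
  "delbar_induced M J \<Omega> C = {m + delbar M J c | m c. m \<in> mubar M J ` \<Omega> \<and> c \<in> C}"
  by (auto simp: delbar_induced_def cohomology_map_def additive_group_def set_mult_def)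

lemma carrier_dolbeault:
  "carrier (dolbeault M J \<Omega>) = {{x \<otimes>\<^bsub>mubar_cohomology M J \<Omega>\<^esub> a | x. x \<in> delbar_induced M J \<Omega> ` carrier (mubar_cohomology M J \<Omega>)} | a.
     a \<in> carrier (mubar_cohomology M J \<Omega>) \<and> delbar_induced M J \<Omega> a = mubar M J ` \<Omega>}"
  by (auto simp: dolbeault_def cohomology_def[of "mubar_cohomology M J \<Omega>"] kernel_def FactGroup_def RCOSETS_def r_coset_def one_mubar_cohomology)

lemma dolbeault_inclusion_eq:
  "dolbeault_inclusion M J \<Omega> D = {x \<otimes>\<^bsub>mubar_cohomology M J \<Omega>\<^esub> {m + b | m b. m \<in> mubar M J ` \<Omega> \<and> b \<in> B} | x B.
     x \<in> delbar_induced M J \<Omega> ` carrier (mubar_cohomology M J \<Omega>) \<and> B \<in> D}"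
proof -
  have e: "cohomology_map (additive_group \<Omega>) (mubar M J) (\<lambda>\<omega>. \<omega>) = (\<lambda>B. {m + b | m b. m \<in> mubar M J ` \<Omega> \<and> b \<in> B})"
    by (rule ext) (simp add: cohomology_map_def additive_group_def set_mult_def, blast)
  show ?thesis
    unfolding dolbeault_inclusion_def e cohomology_map_def[of "mubar_cohomology M J \<Omega>"] set_mult_def by blast
qed

text \<open>The hypotheses on \<open>\<alpha>\<close> say that it represents a Dolbeault class. If the class comes from \<open>\<Omega>0\<close>, then \<open>\<alpha>\<close>
  is obtained from an element of \<open>\<Omega>0\<close> by adding elements of the images of \<open>mubar\<close> and \<open>delbar\<close>, so
  it belongs to every additive set \<open>R\<close> that contains all of these.\<close>

lemma surjective_imp_mem:
  assumes surj: "carrier (dolbeault M J (forms M)) \<subseteq> dolbeault_inclusion M J (forms M) ` carrier (dolbeault M J \<Omega>0)"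
    and \<Omega>0: "\<Omega>0 \<subseteq> forms M" "\<Omega>0 \<subseteq> R"
    and \<alpha>: "\<alpha> \<in> forms M" "mubar M J \<alpha> = 0" "delbar M J \<alpha> \<in> mubar M J ` forms M"
    and R: "\<And>\<beta>. \<beta> \<in> forms M \<Longrightarrow> mubar M J \<beta> \<in> R" "\<And>\<beta>. \<beta> \<in> forms M \<Longrightarrow> delbar M J \<beta> \<in> R"
      "\<And>\<beta> \<gamma>. \<beta> \<in> R \<Longrightarrow> \<gamma> \<in> R \<Longrightarrow> \<beta> + \<gamma> \<in> R" "\<And>\<beta> \<gamma>. \<beta> \<in> R \<Longrightarrow> \<gamma> \<in> R \<Longrightarrow> \<beta> - \<gamma> \<in> R"
  shows "\<alpha> \<in> R"
proof -
  let ?\<Omega> = "forms M" and ?m = "mubar M J" and ?d = "delbar M J"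
  let ?H = "mubar_cohomology M J ?\<Omega>"
  define a where "a = {h + \<alpha> | h. h \<in> ?m ` ?\<Omega>}"
  have aH: "a \<in> carrier ?H" unfolding carrier_mubar_cohomology a_def using \<alpha> by blast
  have da: "delbar_induced M J ?\<Omega> a = ?m ` ?\<Omega>"
  proof (intro subset_antisym subsetI)
    fix y assume "y \<in> delbar_induced M J ?\<Omega> a"
    then obtain \<beta> \<beta>' where b: "\<beta> \<in> ?\<Omega>" "\<beta>' \<in> ?\<Omega>" "y = ?m \<beta> + ?d (?m \<beta>' + \<alpha>)"
      unfolding delbar_induced_eq a_def by blast
    obtain \<xi> where \<xi>: "\<xi> \<in> ?\<Omega>" "?d (?m \<beta>') = ?m \<xi>" using delbar_mubar[OF b(2)] by blast
    obtain \<zeta> where \<zeta>: "\<zeta> \<in> ?\<Omega>" "?d \<alpha> = ?m \<zeta>" using \<alpha>(3) by blast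
    have "y = ?m (\<beta> + (\<xi> + \<zeta>))"
      using b \<xi> \<zeta> \<alpha> by (simp add: delbar_add mubar_forms mubar_add forms_add)
    then show "y \<in> ?m ` ?\<Omega>" using forms_add[OF b(1) forms_add[OF \<xi>(1) \<zeta>(1)]] by blast
  next
    fix y assume "y \<in> ?m ` ?\<Omega>"
    then obtain \<beta> where \<beta>: "\<beta> \<in> ?\<Omega>" "y = ?m \<beta>" by blast
    obtain \<xi> where \<xi>: "\<xi> \<in> ?\<Omega>" "?d (?m 0 + \<alpha>) = ?m \<xi>"
    proof -
      obtain \<xi> where \<xi>: "\<xi> \<in> ?\<Omega>" "?d (?m 0) = ?m \<xi>" using delbar_mubar[OF forms_zero] by blast
      obtain \<zeta> where \<zeta>: "\<zeta> \<in> ?\<Omega>" "?d \<alpha> = ?m \<zeta>" using \<alpha>(3) by blast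
      have "?d (?m 0 + \<alpha>) = ?m (\<xi> + \<zeta>)"
        using \<xi> \<zeta> \<alpha> by (simp add: delbar_add mubar_forms mubar_add forms_zero)
      then show ?thesis using that forms_add[OF \<xi>(1) \<zeta>(1)] by blast
    qed
    have "y = ?m (\<beta> - \<xi>) + ?d (?m 0 + \<alpha>)"
      using mubar_add[OF forms_diff[OF \<beta>(1) \<xi>(1)] \<xi>(1)] \<beta> \<xi> by simp
    then show "y \<in> delbar_induced M J ?\<Omega> a"
      unfolding delbar_induced_eq a_def using forms_diff[OF \<beta>(1) \<xi>(1)] forms_zero by blast
  qed
  define aa where "aa = {x \<otimes>\<^bsub>?H\<^esub> a | x. x \<in> delbar_induced M J ?\<Omega> ` carrier ?H}"
  have "aa \<in> carrier (dolbeault M J ?\<Omega>)" unfolding carrier_dolbeault aa_def using aH da by blast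
  then obtain D where D: "D \<in> carrier (dolbeault M J \<Omega>0)" "aa = dolbeault_inclusion M J ?\<Omega> D" using surj by blast
  have "delbar_induced M J ?\<Omega> a \<otimes>\<^bsub>?H\<^esub> a \<in> aa" unfolding aa_def using aH by blast
  then obtain C B where CB: "C \<in> carrier ?H" "B \<in> D"
    "?m ` ?\<Omega> \<otimes>\<^bsub>?H\<^esub> a = delbar_induced M J ?\<Omega> C \<otimes>\<^bsub>?H\<^esub> {m + b | m b. m \<in> ?m ` ?\<Omega> \<and> b \<in> B}"
    unfolding D(2) dolbeault_inclusion_eq da by blast
  have mem: "?m 0 + (?m 0 + \<alpha>) \<in> ?m ` ?\<Omega> \<otimes>\<^bsub>?H\<^esub> a"
    unfolding mult_mubar_cohomology a_def using forms_zero by blast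
  obtain u \<beta>2 b where y: "?m 0 + (?m 0 + \<alpha>) = u + (?m \<beta>2 + b)" "u \<in> delbar_induced M J ?\<Omega> C" "\<beta>2 \<in> ?\<Omega>" "b \<in> B"
    using mem[unfolded CB(3), unfolded mult_mubar_cohomology] by blast
  have CF: "C \<subseteq> forms M" if "C \<in> carrier (mubar_cohomology M J \<Omega>')" "\<Omega>' \<subseteq> forms M" for C \<Omega>'
    using that unfolding carrier_mubar_cohomology by (auto intro!: forms_add mubar_forms)
  have ind: "delbar_induced M J \<Omega>' C \<subseteq> R" if "C \<in> carrier (mubar_cohomology M J \<Omega>')" "\<Omega>' \<subseteq> forms M" for C \<Omega>'
    unfolding delbar_induced_eq using CF[OF that] that(2) R(1,2,3) by blast
  have uR: "u \<in> R" using ind[OF CB(1)] y(2) by blast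
  obtain C0 B0 where B: "B = delbar_induced M J \<Omega>0 C0 \<otimes>\<^bsub>mubar_cohomology M J \<Omega>0\<^esub> B0"
    "C0 \<in> carrier (mubar_cohomology M J \<Omega>0)" "B0 \<in> carrier (mubar_cohomology M J \<Omega>0)"
    using D(1) CB(2) unfolding carrier_dolbeault by blast
  have "B0 \<subseteq> R" using B(3) \<Omega>0 R(1,3) unfolding carrier_mubar_cohomology by blast
  then have "B \<subseteq> R" unfolding B(1) mult_mubar_cohomology using ind[OF B(2) \<Omega>0(1)] R(3) by blast
  then have "u + (?m \<beta>2 + b) \<in> R" using uR R(1,3) y(3,4) by blast
  then have "?m 0 + (?m 0 + \<alpha>) \<in> R" using y(1) by simp
  then have "?m 0 + (?m 0 + \<alpha>) - ?m 0 - ?m 0 \<in> R" using R(1)[OF forms_zero] R(4) by blast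
  then show ?thesis by simp
qed

end

section \<open>Linear algebra\<close>

lemma dependent_family:
  fixes u :: "'j \<Rightarrow> 'i \<Rightarrow> complex"
  shows "finite I \<Longrightarrow> finite J \<Longrightarrow> card I < card J \<Longrightarrow>
    \<exists>a. (\<exists>j\<in>J. a j \<noteq> 0) \<and> (\<forall>i\<in>I. (\<Sum>j\<in>J. a j * u j i) = 0)"
proof (induction I arbitrary: J u rule: finite_induct)
  case empty
  then have "J \<noteq> {}" by auto
  then show ?case by (intro exI[of _ "\<lambda>_. 1"]) auto
next
  case (insert i I)
  show ?case
  proof (cases "\<forall>j\<in>J. u j i = 0")
    case True
    have "card I < card J" using insert by simp
    from insert.IH[OF insert.prems(1) this, of u] obtain a where
      "\<exists>j\<in>J. a j \<noteq> 0" "\<forall>i\<in>I. (\<Sum>j\<in>J. a j * u j i) = 0" by blast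
    then show ?thesis using True by (intro exI[of _ a]) auto
  next
    case False
    then obtain k where k: "k \<in> J" "u k i \<noteq> 0" by blast
    let ?v = "\<lambda>j l. u j l - u j i / u k i * u k l"
    have "card I < card (J - {k})" using insert k by simp
    from insert.IH[OF _ this, of ?v] insert.prems(1) obtain a where
      a: "\<exists>j\<in>J - {k}. a j \<noteq> 0" "\<forall>l\<in>I. (\<Sum>j\<in>J - {k}. a j * ?v j l) = 0" by blast
    define a' where "a' = a(k := - (\<Sum>j\<in>J - {k}. a j * (u j i / u k i)))"
    have e: "(\<Sum>j\<in>J. a' j * u j l) = (\<Sum>j\<in>J - {k}. a j * ?v j l)" for l
    proof -
      have "(\<Sum>j\<in>J. a' j * u j l) = a' k * u k l + (\<Sum>j\<in>J - {k}. a' j * u j l)"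
        by (rule sum.remove[OF insert.prems(1) k(1)])
      also have "(\<Sum>j\<in>J - {k}. a' j * u j l) = (\<Sum>j\<in>J - {k}. a j * u j l)"
        by (rule sum.cong) (auto simp: a'_def)
      also have "a' k * u k l = - (\<Sum>j\<in>J - {k}. a j * (u j i / u k i) * u k l)"
        by (simp add: a'_def sum_distrib_right)
      finally show ?thesis by (simp add: sum_subtractf[symmetric] algebra_simps sum_negf[symmetric] sum.distrib[symmetric])
    qed
    have "\<exists>j\<in>J. a' j \<noteq> 0" using a(1) by (auto simp: a'_def)
    moreover have "(\<Sum>j\<in>J - {k}. a j * ?v j i) = 0" using k(2) by simp
    ultimately show ?thesis using a(2) by (intro exI[of _ a']) (simp add: e)
  qed
qed

text \<open>A sequence of functionals that vanish wherever finitely many given functionals vanish is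
  linearly dependent. The induction eliminates one of the given functionals by combining two relations
  with disjoint supports.\<close>

lemma finite_relation:
  fixes Y :: "((nat \<Rightarrow> complex) \<times> ('i \<Rightarrow> complex)) set"
  shows "finite I \<Longrightarrow>
    (\<And>l e l' e' a. (l, e) \<in> Y \<Longrightarrow> (l', e') \<in> Y \<Longrightarrow> (\<lambda>k. l k - a * l' k, \<lambda>i. e i - a * e' i) \<in> Y) \<Longrightarrow>
    (\<And>l e k. (l, e) \<in> Y \<Longrightarrow> (\<forall>i\<in>I. e i = 0) \<Longrightarrow> l k = 0) \<Longrightarrow>
    \<exists>c N. (\<forall>k. c k \<noteq> 0 \<longrightarrow> n \<le> k \<and> k < N) \<and> (\<exists>k. c k \<noteq> 0) \<and>
      (\<forall>N'\<ge>N. \<forall>(l, e)\<in>Y. (\<Sum>k<N'. c k * l k) = (0::complex))"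
proof (induction I arbitrary: Y n rule: finite_induct)
  case empty
  then have "l k = 0" if "(l, e) \<in> Y" for l e k using that by auto
  then have "(\<Sum>k<N'. (if k = n then 1 else 0) * l k) = (0::complex)" if "(l, e) \<in> Y" for l e N'
    using that by (intro sum.neutral) auto
  then show ?case by (intro exI[of _ "\<lambda>k. if k = n then 1 else 0"] exI[of _ "Suc n"]) auto
next
  case (insert i I)
  note cl = insert.prems(1) and z = insert.prems(2)
  show ?case
  proof (cases "\<forall>(l, e)\<in>Y. e i = 0")
    case True
    show ?thesis
      by (rule insert.IH[OF cl]) (use z True in auto)
  next
    case False
    then obtain l0 e0 where y0: "(l0, e0) \<in> Y" "e0 i \<noteq> 0" by blast
    define Y' where "Y' = {(l, e). (l, e) \<in> Y \<and> e i = 0}"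
    have red: "(\<lambda>k. l k - e i / e0 i * l0 k, \<lambda>j. e j - e i / e0 i * e0 j) \<in> Y'" if "(l, e) \<in> Y" for l e
      using cl[OF that y0(1), of "e i / e0 i"] y0(2) by (simp add: Y'_def)
    have cl': "(\<lambda>k. l k - a * l' k, \<lambda>i. e i - a * e' i) \<in> Y'" if "(l, e) \<in> Y'" "(l', e') \<in> Y'" for l e l' e' a
      using that cl by (auto simp: Y'_def)
    have z': "l k = 0" if "(l, e) \<in> Y'" "\<forall>j\<in>I. e j = 0" for l e k
      using z[of l e k] that by (auto simp: Y'_def)
    have IH: "\<exists>c N. (\<forall>k. c k \<noteq> 0 \<longrightarrow> n \<le> k \<and> k < N) \<and> (\<exists>k. c k \<noteq> 0) \<and>
      (\<forall>N'\<ge>N. \<forall>(l, e)\<in>Y'. (\<Sum>k<N'. c k * l k) = 0)" for n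
      by (rule insert.IH; (rule cl' | rule z'); assumption)
    obtain A N where A: "\<forall>k. A k \<noteq> 0 \<longrightarrow> n \<le> k \<and> k < N" "\<exists>k. A k \<noteq> 0"
      "\<forall>N'\<ge>N. \<forall>(l, e)\<in>Y'. (\<Sum>k<N'. A k * l k) = 0"
      using IH[of n] by blast
    obtain B L where B: "\<forall>k. B k \<noteq> 0 \<longrightarrow> N \<le> k \<and> k < L" "\<exists>k. B k \<noteq> 0"
      "\<forall>N'\<ge>L. \<forall>(l, e)\<in>Y'. (\<Sum>k<N'. B k * l k) = 0"
      using IH[of N] by blast
    have NL: "n \<le> N" "N \<le> L" using A B by (meson le_trans less_imp_le)+
    have lin: "(\<Sum>k<N'. C k * l k) = e i / e0 i * (\<Sum>k<N'. C k * l0 k)"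
      if "\<forall>(l, e)\<in>Y'. (\<Sum>k<N'. C k * l k) = 0" "(l, e) \<in> Y" for C l e N'
    proof -
      have "0 = (\<Sum>k<N'. C k * (l k - e i / e0 i * l0 k))" using that(1) red[OF that(2)] by auto
      also have "\<dots> = (\<Sum>k<N'. C k * l k) - e i / e0 i * (\<Sum>k<N'. C k * l0 k)"
        by (simp add: algebra_simps sum_subtractf sum_distrib_left)
      finally show ?thesis by simp
    qed
    have ext: "(\<Sum>k<N'. C k * l0 k) = (\<Sum>k<K. C k * l0 k)" if "\<forall>k. C k \<noteq> 0 \<longrightarrow> k < K" "K \<le> N'" for C N' K
      by (rule sum.mono_neutral_right) (use that in \<open>auto simp: not_less\<close>)
    define s where "s = (\<Sum>k<N. A k * l0 k)"
    define t where "t = (\<Sum>k<L. B k * l0 k)"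
    show ?thesis
    proof (cases "s = 0")
      case True
      have "(\<Sum>k<N'. A k * l k) = 0" if "N \<le> N'" "(l, e) \<in> Y" for l e N'
        using lin[of A N' l e] that A(3) ext[of A N N'] A(1) True by (auto simp: s_def)
      then show ?thesis using A(1,2) by (intro exI[of _ A] exI[of _ N]) auto
    next
      case False
      let ?C = "\<lambda>k. s * B k - t * A k"
      have "(\<Sum>k<N'. ?C k * l k) = 0" if "L \<le> N'" "(l, e) \<in> Y" for l e N'
      proof -
        have 1: "(\<Sum>k<N'. A k * l k) = e i / e0 i * s"
          using lin[of A N' l e] that A(3) ext[of A N N'] A(1) NL by (auto simp: s_def)
        have 2: "(\<Sum>k<N'. B k * l k) = e i / e0 i * t"
          using lin[of B N' l e] that B(3) ext[of B L N'] B(1) by (auto simp: t_def)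
        have "(\<Sum>k<N'. ?C k * l k) = s * (\<Sum>k<N'. B k * l k) - t * (\<Sum>k<N'. A k * l k)"
          by (simp add: algebra_simps sum_subtractf sum_distrib_left)
        then show ?thesis unfolding 1 2 by simp
      qed
      moreover have "\<exists>k. ?C k \<noteq> 0"
      proof -
        obtain k where k: "B k \<noteq> 0" using B(2) by blast
        then have "A k = 0" using A(1) B(1) by (meson leD)
        then show ?thesis using k False by (intro exI[of _ k]) simp
      qed
      moreover have "n \<le> k \<and> k < L" if "?C k \<noteq> 0" for k
      proof -
        have "A k \<noteq> 0 \<or> B k \<noteq> 0" using that by auto
        then show ?thesis using A(1) B(1) NL by (meson le_trans less_le_trans)
      qed
      ultimately show ?thesis by (intro exI[of _ ?C] exI[of _ L]) auto
    qed
  qed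
qed

context charted
begin

lemma frame_VF:
  assumes p: "p \<in> points M"
  obtains b E l where "b \<in> SC" "b p \<noteq> 0" "\<And>i. E i \<in> VF"
    "\<And>V i. V \<in> VF \<Longrightarrow> (\<lambda>x. l i x (V x)) \<in> SC"
    "\<And>i x (v::('a, complex) tvec) w. l i x (\<lambda>f. v f + w f) = l i x v + l i x w"
    "\<And>i x c (v::('a, complex) tvec). l i x (\<lambda>f. c * v f) = c * l i x v"
    "\<And>x (v::('a, complex) tvec) f. x \<in> points M \<Longrightarrow> v \<in> T x \<Longrightarrow> f \<in> S \<Longrightarrow>
        b x * v f = (\<Sum>i\<in>(Basis::'e set). l i x v * E i x f)"
    "\<And>c V Us Vs x. tensorial c \<Longrightarrow> V \<in> VF \<Longrightarrow> Us \<in> lists VF \<Longrightarrow> Vs \<in> lists VF \<Longrightarrow>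
        b x * c (Us @ V # Vs) x = (\<Sum>i\<in>Basis. l i x (V x) * c (Us @ E i # Vs) x)"
proof (rule frame[OF p])
  fix b E and l :: "'e \<Rightarrow> 'a \<Rightarrow> ('a, complex) tvec \<Rightarrow> complex"
  assume b: "b \<in> SC" "b p \<noteq> 0" "\<And>i. E i \<in> VF"
    "\<And>V i. V \<in> VF \<Longrightarrow> (\<lambda>x. l i x (V x)) \<in> SC"
    and l: "\<And>i x v w. l i x (v + w) = l i x v + l i x w" "\<And>i x c v. l i x (\<lambda>f. c * v f) = c * l i x v"
    and fr: "\<And>x v f. x \<in> points M \<Longrightarrow> v \<in> T x \<Longrightarrow> f \<in> S \<Longrightarrow>
        b x * v f = (\<Sum>i\<in>(Basis::'e set). l i x v * E i x f)"
  have "b x * c (Us @ V # Vs) x = (\<Sum>i\<in>Basis. l i x (V x) * c (Us @ E i # Vs) x)"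
    if c: "tensorial c" and V: "V \<in> VF" and U: "Us \<in> lists VF" "Vs \<in> lists VF" for c V Us Vs x
  proof -
    have "smul b V = (\<lambda>x f. \<Sum>i\<in>(Basis::'e set). l i x (V x) * E i x f)"
      by (rule VF_eqI) (auto simp: smul_def fr VF_tangent V intro!: VF_lincomb b VF_smul[OF b(1) V, unfolded smul_def])
    then have "b x * c (Us @ V # Vs) x = c (Us @ (\<lambda>x f. \<Sum>i\<in>(Basis::'e set). l i x (V x) * E i x f) # Vs) x"
      using tens_smul[OF c U V b(1)] by simp
    also have "\<dots> = (\<Sum>i\<in>Basis. l i x (V x) * c (Us @ E i # Vs) x)"
      by (rule tens_lincomb[OF c U]) (auto intro: b V)
    finally show ?thesis .
  qed
  moreover have "l i x (\<lambda>f. v f + w f) = l i x v + l i x w" for i x v w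
    using l(1)[of i x v w] by (simp add: plus_fun_def)
  ultimately show thesis by (intro that[of b E l]) (use b l(2) fr in auto)
qed

lemma T_lincomb: "(\<And>j. j \<in> J \<Longrightarrow> v j \<in> T x) \<Longrightarrow> (\<lambda>f. \<Sum>j\<in>J. a j * v j f) \<in> T x"
proof (induction J rule: infinite_finite_induct)
  case (insert j J)
  then have "(\<lambda>f. a j * v j f) + (\<lambda>f. \<Sum>j\<in>J. a j * v j f) \<in> T x" by (intro T_add T_cmult) auto
  then show ?case using insert by (simp add: plus_fun_def)
qed auto

lemma T_dependent:
  assumes x: "x \<in> points M" and J: "finite J" "DIM('e) < card J" and v: "\<And>j. j \<in> J \<Longrightarrow> v j \<in> T x"
  shows "\<exists>a. (\<exists>j\<in>J. a j \<noteq> 0) \<and> (\<forall>f. (\<Sum>j\<in>J. a j * v j f) = 0)"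
proof (rule frame_VF[OF x])
  fix b E and l :: "'e \<Rightarrow> 'a \<Rightarrow> ('a, complex) tvec \<Rightarrow> complex"
  assume b: "b x \<noteq> 0"
    and l: "\<And>i x v w. l i x (\<lambda>f. v f + w f) = l i x v + l i x w" "\<And>i x c v. l i x (\<lambda>f. c * v f) = c * l i x v"
    and fr: "\<And>x v f. x \<in> points M \<Longrightarrow> v \<in> T x \<Longrightarrow> f \<in> S \<Longrightarrow>
        b x * v f = (\<Sum>i\<in>(Basis::'e set). l i x v * E i x f)"
  obtain a where a: "\<exists>j\<in>J. a j \<noteq> 0" "\<forall>i\<in>(Basis::'e set). (\<Sum>j\<in>J. a j * l i x (v j)) = 0"
    using dependent_family[of "Basis::'e set" J "\<lambda>j i. l i x (v j)"] J by auto
  let ?w = "\<lambda>f. \<Sum>j\<in>J. a j * v j f"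
  have "l i x (\<lambda>f. \<Sum>j\<in>J. a j * v j f) = (\<Sum>j\<in>J. a j * l i x (v j))" for i
    using J(1)
  proof (induction J rule: finite_induct)
    case empty then show ?case using l(2)[of i x 0 "\<lambda>f. 0"] by simp
  qed (simp add: l)
  then have 0: "l i x ?w = 0" if "i \<in> Basis" for i using a(2) that by simp
  have w: "?w \<in> T x" by (rule T_lincomb[OF v])
  have "?w f = 0" for f
  proof (cases "f \<in> S")
    case True
    then show ?thesis using fr[OF x w True] 0 b by simp
  next
    case False
    then show ?thesis using tangent_outside[OF w] by blast
  qed
  then show ?thesis using a(1) by blast
qed

lemma form_lincomb:
  assumes \<omega>: "\<omega> \<in> forms M" "x \<in> points M" and u: "us \<in> lists (T x)" "vs \<in> lists (T x)"
  shows "(\<And>j. j \<in> J \<Longrightarrow> v j \<in> T x) \<Longrightarrow>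
    \<omega> x (us @ (\<lambda>f. \<Sum>j\<in>J. a j * v j f) # vs) = (\<Sum>j\<in>J. a j * \<omega> x (us @ v j # vs))"
proof (induction J rule: infinite_finite_induct)
  case (insert j J)
  have e: "(\<lambda>f. \<Sum>j\<in>insert j J. a j * v j f) = (\<lambda>f. a j * v j f) + (\<lambda>f. \<Sum>j\<in>J. a j * v j f)"
    using insert by (simp add: plus_fun_def)
  have v: "v j \<in> T x" "(\<lambda>f. a j * v j f) \<in> T x" using insert.prems by auto
  have w: "(\<lambda>f. \<Sum>j\<in>J. a j * v j f) \<in> T x" by (rule T_lincomb) (use insert.prems in auto)
  have IH: "\<omega> x (us @ (\<lambda>f. \<Sum>j\<in>J. a j * v j f) # vs) = (\<Sum>j\<in>J. a j * \<omega> x (us @ v j # vs))"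
    by (rule insert.IH) (use insert.prems in auto)
  show ?case
    unfolding e form_add[OF \<omega> u v(2) w] form_cmult[OF \<omega> u v(1)] IH using insert by simp
next
  have 0: "\<omega> x (us @ (\<lambda>f. 0) # vs) = 0"
    using form_cmult[OF \<omega> u, of "\<lambda>f. 0" 0] by simp
  { case infinite then show ?case using 0 by simp
  next case empty then show ?case using 0 by simp }
qed

text \<open>A division-free form of Cramer's rule for functions \<open>\<psi>\<^sub>i\<close> on a set \<open>D\<close> with values in the
  smooth functions: the \<open>\<psi>\<^sub>i\<close> are obtained from functions that are independent at \<open>p\<close> by elimination
  steps in which each pivot is multiplied out.\<close>

lemma adjugate_basis:
  fixes \<Phi> :: "('s \<Rightarrow> 'a \<Rightarrow> complex) set" and r k :: nat
  assumes p: "p \<in> points M"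
    and vals: "\<And>\<psi> s. \<psi> \<in> \<Phi> \<Longrightarrow> s \<in> D \<Longrightarrow> \<psi> s \<in> SC"
    and add: "\<And>\<psi> \<psi>'. \<psi> \<in> \<Phi> \<Longrightarrow> \<psi>' \<in> \<Phi> \<Longrightarrow> (\<lambda>s x. \<psi> s x + \<psi>' s x) \<in> \<Phi>"
    and mult: "\<And>\<psi> h. \<psi> \<in> \<Phi> \<Longrightarrow> h \<in> SC \<Longrightarrow> (\<lambda>s x. h x * \<psi> s x) \<in> \<Phi>"
    and \<phi>: "\<And>j. j < r \<Longrightarrow> \<phi> j \<in> \<Phi>"
    and indep: "\<And>a. (\<And>s. s \<in> D \<Longrightarrow> (\<Sum>j<r. a j * \<phi> j s p) = 0) \<Longrightarrow> \<forall>j<r. a j = 0"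
  shows "k \<le> r \<Longrightarrow> \<exists>\<psi> s d. (\<forall>i<k. \<psi> i \<in> \<Phi> \<and> s i \<in> D) \<and> d \<in> SC \<and> d p \<noteq> 0 \<and>
    (\<forall>i<k. \<forall>j<k. \<forall>x. \<psi> i (s j) x = (if i = j then d x else 0))"
proof (induction k)
  case 0
  then show ?case using smooth_fun_const[of "1::complex"] p by (intro exI[of _ undefined] exI[of _ "\<lambda>x. if x \<in> points M then 1 else 0"]) auto
next
  case (Suc k)
  then obtain \<psi> s d where IH': "\<forall>i<k. \<psi> i \<in> \<Phi> \<and> s i \<in> D" "d \<in> SC" "d p \<noteq> 0"
    "\<forall>i<k. \<forall>j<k. \<forall>x. \<psi> i (s j) x = (if i = j then d x else 0)" using Suc_leD by blast
  then have IH: "\<And>i. i < k \<Longrightarrow> \<psi> i \<in> \<Phi>" "\<And>i. i < k \<Longrightarrow> s i \<in> D" "d \<in> SC" "d p \<noteq> 0"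
    "\<And>i j x. i < k \<Longrightarrow> j < k \<Longrightarrow> \<psi> i (s j) x = (if i = j then d x else 0)" by blast+
  have minus: "(\<lambda>s x. f s x - (\<Sum>i<m. h i x * \<psi> i s x)) \<in> \<Phi>"
    if "f \<in> \<Phi>" "m \<le> k" "\<And>i. i < m \<Longrightarrow> h i \<in> SC" for f m h
    using that(2,3)
  proof (induction m)
    case 0 then show ?case using that(1) by simp
  next
    case (Suc m)
    have "(\<lambda>s x. (f s x - (\<Sum>i<m. h i x * \<psi> i s x)) + (- h m x) * \<psi> m s x) \<in> \<Phi>"
      by (intro add Suc.IH mult IH smooth_fun_uminus) (use Suc.prems in auto)
    then show ?case by (simp add: algebra_simps)
  qed
  define \<phi>' where "\<phi>' j = (\<lambda>t x. d x * \<phi> j t x - (\<Sum>i<k. \<phi> j (s i) x * \<psi> i t x))" for j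
  have \<phi>'\<Phi>: "\<phi>' j \<in> \<Phi>" if "j < r" for j
    unfolding \<phi>'_def by (rule minus) (use that \<phi> vals IH mult in auto)
  have \<phi>'s: "\<phi>' j (s i) x = 0" if "i < k" for i j x
    using that by (simp add: \<phi>'_def IH(5) if_distrib cong: if_cong)
  have "\<exists>j<r. \<exists>t\<in>D. \<phi>' j t p \<noteq> 0"
  proof (rule ccontr)
    assume neg: "\<not> (\<exists>j<r. \<exists>t\<in>D. \<phi>' j t p \<noteq> 0)"
    obtain a where a: "\<exists>j\<in>{..<r}. a j \<noteq> 0" "\<forall>i\<in>{..<k}. (\<Sum>j<r. a j * \<phi> j (s i) p) = 0"
      using dependent_family[of "{..<k}" "{..<r}" "\<lambda>j i. \<phi> j (s i) p"] Suc.prems by auto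
    have "(\<Sum>j<r. a j * \<phi> j t p) = 0" if t: "t \<in> D" for t
    proof -
      have "d p * (\<Sum>j<r. a j * \<phi> j t p) = (\<Sum>j<r. a j * (d p * \<phi> j t p))"
        by (simp add: sum_distrib_left algebra_simps)
      also have "\<dots> = (\<Sum>j<r. a j * (\<Sum>i<k. \<phi> j (s i) p * \<psi> i t p))"
        using neg t by (intro sum.cong) (auto simp: \<phi>'_def)
      also have "\<dots> = (\<Sum>i<k. (\<Sum>j<r. a j * \<phi> j (s i) p) * \<psi> i t p)"
        by (simp add: sum_distrib_left sum_distrib_right mult.assoc) (rule sum.swap)
      also have "\<dots> = 0" using a(2) by simp
      finally show ?thesis using IH(4) by simp
    qed
    then show False using indep[of a] a(1) by auto
  qed
  then obtain j0 t where t: "j0 < r" "t \<in> D" "\<phi>' j0 t p \<noteq> 0" by blast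
  let ?f = "\<phi>' j0" let ?e = "\<phi>' j0 t"
  have e: "?e \<in> SC" by (rule vals[OF \<phi>'\<Phi>[OF t(1)] t(2)])
  define \<psi>' where "\<psi>' i = (if i = k then (\<lambda>u x. d x * ?f u x) else (\<lambda>u x. ?e x * \<psi> i u x + (- \<psi> i t x) * ?f u x))" for i
  have "\<psi>' i \<in> \<Phi>" if "i < Suc k" for i
  proof (cases "i = k")
    case True
    then show ?thesis using mult[OF \<phi>'\<Phi>[OF t(1)] IH(3)] by (simp add: \<psi>'_def)
  next
    case False
    then have i: "i < k" using that by simp
    show ?thesis
      using add[OF mult[OF IH(1)[OF i] e] mult[OF \<phi>'\<Phi>[OF t(1)] smooth_fun_uminus[OF vals[OF IH(1)[OF i] t(2)]]]] False
      by (simp add: \<psi>'_def)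
  qed
  moreover have "(s(k := t)) i \<in> D" if "i < Suc k" for i using that IH(2) t(2) by (auto simp: less_Suc_eq)
  moreover have "(\<lambda>x. d x * ?e x) \<in> SC" by (rule smooth_fun_mult[OF IH(3) e])
  moreover have "d p * ?e p \<noteq> 0" using IH(4) t(3) by simp
  moreover have "\<psi>' i ((s(k := t)) j) x = (if i = j then d x * ?e x else 0)" if "i < Suc k" "j < Suc k" for i j x
    using that by (auto simp: \<psi>'_def less_Suc_eq \<phi>'s IH(5))
  ultimately show ?case
    by (intro exI[of _ \<psi>'] exI[of _ "s(k := t)"] exI[of _ "\<lambda>x. d x * ?e x"]) auto
qed

end

context almost_complex_manifold
begin

section \<open>Vectors and forms of type \<open>(0, 1)\<close>\<close>

definition T01_vectors :: "'a \<Rightarrow> ('a, complex) tvec set" where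
  "T01_vectors x = {v \<in> T x. pr False x v = v}"

lemma pr_sum:
  assumes "x \<in> points M" "finite K"
  shows "(\<And>j. j \<in> K \<Longrightarrow> v j \<in> T x) \<Longrightarrow> pr b x (\<lambda>f. \<Sum>j\<in>K. a j * v j f) = (\<lambda>f. \<Sum>j\<in>K. a j * pr b x (v j) f)"
  using assms(2)
proof (induction K rule: finite_induct)
  case empty
  show ?case using pr_lin(2)[OF assms(1) T_zero(2) T_zero(2), of b 0] by simp
next
  case (insert j K)
  then have "pr b x (\<lambda>f. (\<lambda>f. a j * v j f) f + (\<lambda>f. \<Sum>j\<in>K. a j * v j f) f) =
      (\<lambda>f. pr b x (\<lambda>f. a j * v j f) f + pr b x (\<lambda>f. \<Sum>j\<in>K. a j * v j f) f)"
    by (intro pr_lin(1)[OF assms(1)] T_cmult T_lincomb) auto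
  then show ?case using insert pr_lin(2)[OF assms(1), of "v j" "v j" b "a j"] by simp
qed

lemma T_cnj: "v \<in> T x \<Longrightarrow> (\<lambda>f. cnj (v f)) \<in> T x"
  by (auto simp: tangent_space_def)

lemma pr_cnj:
  assumes "x \<in> points M" "v \<in> T x" shows "pr b x (\<lambda>f. cnj (v f)) = (\<lambda>f. cnj (pr (\<not> b) x v f))"
proof -
  have e: "Re \<circ> (\<lambda>f. cnj (v f)) = Re \<circ> v" "Im \<circ> (\<lambda>f. cnj (v f)) = (\<lambda>f. (-1) * (Im \<circ> v) f + 0 * (Im \<circ> v) f)"
    by (auto simp: fun_eq_iff)
  have "JC x (\<lambda>f. cnj (v f)) = (\<lambda>f. cnj (JC x v f))"
    unfolding J_cplx_def e J_lin[OF assms(1) TR_Im[OF assms(2)] TR_Im[OF assms(2)]] by (simp add: fun_eq_iff)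
  then show ?thesis by (simp add: pr_def)
qed

text \<open>The complexified tangent space is the direct sum of its part of type \<open>(0, 1)\<close> and the
  conjugate of this part.\<close>

lemma T01_dependent:
  assumes x: "x \<in> points M" and K: "finite K" "DIM('e) < 2 * card K" and v: "\<And>j. j \<in> K \<Longrightarrow> v j \<in> T01_vectors x"
  shows "\<exists>a. (\<exists>j\<in>K. a j \<noteq> 0) \<and> (\<forall>f. (\<Sum>j\<in>K. a j * v j f) = 0)"
proof -
  have vT: "v j \<in> T x" "pr False x (v j) = v j" if "j \<in> K" for j using v[OF that] by (auto simp: T01_vectors_def)
  let ?w = "\<lambda>(j, b). if b then v j else (\<lambda>f. cnj (v j f))"
  have "\<exists>a. (\<exists>k\<in>K \<times> (UNIV::bool set). a k \<noteq> 0) \<and> (\<forall>f. (\<Sum>k\<in>K \<times> UNIV. a k * ?w k f) = 0)"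
    by (rule T_dependent[OF x]) (use K vT T_cnj in \<open>auto simp: card_cartesian_product\<close>)
  then obtain a where a: "\<exists>k\<in>K \<times> (UNIV::bool set). a k \<noteq> 0" "\<And>f. (\<Sum>k\<in>K \<times> UNIV. a k * ?w k f) = 0" by blast
  define A where "A = (\<lambda>f. \<Sum>j\<in>K. a (j, True) * v j f)"
  define B where "B = (\<lambda>f. \<Sum>j\<in>K. a (j, False) * cnj (v j f))"
  have AT: "A \<in> T x" and BT: "B \<in> T x" unfolding A_def B_def by (intro T_lincomb T_cnj vT; assumption)+
  have AB: "A f + B f = 0" for f
    using a(2)[of f] by (simp add: A_def B_def sum.cartesian_product' UNIV_bool sum.distrib[symmetric] add.commute)
  have pA: "pr False x A = A" unfolding A_def by (subst pr_sum[OF x K(1)]) (auto simp: vT)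
  have "pr True x (v j) = (\<lambda>f. 0)" if "j \<in> K" for j using pr_pr[OF x vT(1)[OF that], of True False] vT(2)[OF that] by simp
  then have pB: "pr False x B = (\<lambda>f. 0)"
    unfolding B_def by (subst pr_sum[OF x K(1)]) (auto simp: T_cnj vT pr_cnj x)
  have "pr False x (\<lambda>f. A f + B f) = (\<lambda>f. A f + 0)" unfolding pr_lin(1)[OF x AT BT] pA pB ..
  moreover have "pr False x (\<lambda>f. A f + B f) = (\<lambda>f. 0)"
    unfolding AB using pr_lin(2)[OF x T_zero(2) T_zero(2), of False 0] by simp
  ultimately have A0: "A f = 0" for f by (metis add.right_neutral)
  then have B0: "B f = 0" for f using AB[of f] by simp
  show ?thesis
  proof (cases "\<exists>j\<in>K. a (j, True) \<noteq> 0")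
    case True
    then show ?thesis using A0 by (intro exI[of _ "\<lambda>j. a (j, True)"]) (auto simp: A_def)
  next
    case False
    then have "\<exists>j\<in>K. a (j, False) \<noteq> 0" using a(1) by (metis (full_types) SigmaE)
    moreover have "(\<Sum>j\<in>K. cnj (a (j, False)) * v j f) = 0" for f
      using arg_cong[OF B0[of f], of cnj] by (simp add: B_def)
    ultimately show ?thesis by (intro exI[of _ "\<lambda>j. cnj (a (j, False))"]) auto
  qed
qed

text \<open>A maximal independent family of vectors of type \<open>(0, 1)\<close> has at most \<open>n\<close> elements by
  \<open>T01_dependent\<close>; it is padded by zeros.\<close>

lemma T01_span:
  assumes x: "x \<in> points M" and n: "DIM('e) = 2 * n"
  obtains b where "\<And>i. i < n \<Longrightarrow> b i \<in> T01_vectors x" "\<And>v. v \<in> T01_vectors x \<Longrightarrow> \<exists>y. v = (\<lambda>f. \<Sum>i<n. y i * b i f)"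
proof -
  define I where "I m \<longleftrightarrow> (\<exists>b. (\<forall>i<m. b i \<in> T01_vectors x) \<and> (\<forall>a. (\<forall>f. (\<Sum>i<m. a i * b i f) = 0) \<longrightarrow> (\<forall>i<m. a i = 0)))" for m :: nat
  have 0: "I 0" by (simp add: I_def)
  have le: "m \<le> n" if Im: "I m" for m
  proof (rule ccontr)
    assume "\<not> m \<le> n"
    obtain b where b: "\<forall>i<m. b i \<in> T01_vectors x" "\<forall>a. (\<forall>f. (\<Sum>i<m. a i * b i f) = 0) \<longrightarrow> (\<forall>i<m. a i = 0)"
      using Im unfolding I_def by blast
    have "\<exists>a. (\<exists>j\<in>{..<m}. a j \<noteq> 0) \<and> (\<forall>f. (\<Sum>j\<in>{..<m}. a j * b j f) = 0)"
      by (rule T01_dependent[OF x]) (use b n \<open>\<not> m \<le> n\<close> in auto)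
    then show False using b(2) by blast
  qed
  have "\<exists>m. I m \<and> \<not> I (Suc m)"
  proof (rule ccontr)
    assume "\<not> ?thesis"
    then have "I m" for m using 0 by (induction m) auto
    then show False using le[of "Suc n"] by simp
  qed
  then obtain m where m: "I m" "\<not> I (Suc m)" by blast
  obtain b where b: "\<forall>i<m. b i \<in> T01_vectors x" "\<And>a i. (\<And>f. (\<Sum>i<m. a i * b i f) = 0) \<Longrightarrow> i < m \<Longrightarrow> a i = 0"
    using m(1) unfolding I_def by blast
  have mn: "m \<le> n" by (rule le[OF m(1)])
  have z: "(\<lambda>f. 0) \<in> T01_vectors x" using pr_lin(2)[OF x T_zero(2) T_zero(2), of False 0] by (simp add: T01_vectors_def)
  let ?b = "\<lambda>i. if i < m then b i else (\<lambda>f. 0)"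
  show ?thesis
  proof (rule that[of ?b])
    fix v assume v: "v \<in> T01_vectors x"
    have "\<not> (\<forall>a. (\<forall>f. (\<Sum>i<Suc m. a i * (b(m := v)) i f) = 0) \<longrightarrow> (\<forall>i<Suc m. a i = 0))"
    proof
      assume h: "\<forall>a. (\<forall>f. (\<Sum>i<Suc m. a i * (b(m := v)) i f) = 0) \<longrightarrow> (\<forall>i<Suc m. a i = 0)"
      have "\<forall>i<Suc m. (b(m := v)) i \<in> T01_vectors x" using b(1) v by (auto simp: less_Suc_eq)
      then have "I (Suc m)" unfolding I_def using h by blast
      then show False using m(2) by simp
    qed
    then obtain a i where a: "\<And>f. (\<Sum>i<Suc m. a i * (b(m := v)) i f) = 0" "i < Suc m" "a i \<noteq> 0" by blast
    have s: "(\<Sum>i<m. a i * b i f) + a m * v f = 0" for f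
      using a(1)[of f] by simp
    have am: "a m \<noteq> 0"
    proof
      assume "a m = 0"
      then have "(\<Sum>i<m. a i * b i f) = 0" for f using s[of f] by simp
      then show False using b(2)[of a i] a(2,3) \<open>a m = 0\<close> by (auto simp: less_Suc_eq)
    qed
    have "v f = (\<Sum>i<n. (- a i / a m) * ?b i f)" for f
    proof -
      have "(\<Sum>i<n. (- a i / a m) * ?b i f) = (\<Sum>i<m. (- a i / a m) * b i f)"
        using mn by (intro sum.mono_neutral_cong_right) auto
      also have "\<dots> = - (\<Sum>i<m. a i * b i f) / a m"
        by (simp add: sum_divide_distrib sum_negf)
      also have "(\<Sum>i<m. a i * b i f) = - (a m * v f)" using s[of f] by (simp add: eq_neg_iff_add_eq_0)
      also have "- (- (a m * v f)) / a m = v f" using am by simp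
      finally show ?thesis by simp
    qed
    then show "\<exists>y. v = (\<lambda>f. \<Sum>i<n. y i * ?b i f)" by (intro exI[of _ "\<lambda>i. - a i / a m"]) auto
  qed (use b(1) z in auto)
qed

lemma pure_T01v: "pure False Y \<Longrightarrow> x \<in> points M \<Longrightarrow> Y x \<in> T01_vectors x"
  using P_at[of x False Y] by (auto simp: T01_vectors_def pure_def VF_tangent)

lemma two_form_eq_0:
  fixes n :: nat
  assumes x: "x \<in> points M" and c: "tensorial c"
    and b: "\<And>i. i < n \<Longrightarrow> b i \<in> T01_vectors x" "\<And>v. v \<in> T01_vectors x \<Longrightarrow> \<exists>y. v = (\<lambda>f. \<Sum>i<n. y i * b i f)"
    and 0: "\<And>i j. i < j \<Longrightarrow> j < n \<Longrightarrow> frm c x [b i, b j] = 0"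
    and Y: "pure False Y" "pure False Y'"
  shows "c [Y, Y'] x = 0"
proof -
  note \<omega> = frm_forms[OF c] x
  have bT: "b i \<in> T x" if "i < n" for i using b(1)[OF that] by (simp add: T01_vectors_def)
  have all0: "frm c x [b i, b j] = 0" if "i < n" "j < n" for i j
  proof -
    consider "i < j" | "i = j" | "j < i" by linarith
    then show ?thesis
    proof cases
      case 3
      then show ?thesis using form_swap[OF \<omega>, of "[]" "[]" "b i" "b j"] 0 that bT by simp
    qed (use 0 that formsD(4)[OF \<omega>(1)] in auto)
  qed
  obtain y where y: "Y x = (\<lambda>f. \<Sum>i<n. y i * b i f)" using b(2)[OF pure_T01v[OF Y(1) x]] by blast
  obtain y' where y': "Y' x = (\<lambda>f. \<Sum>i<n. y' i * b i f)" using b(2)[OF pure_T01v[OF Y(2) x]] by blast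
  have YT: "Y' x \<in> T x" using pure_T01v[OF Y(2) x] by (simp add: T01_vectors_def)
  have "c [Y, Y'] x = frm c x [Y x, Y' x]"
    using frm_values[OF c, of "[Y, Y']" x] pure_VF[OF Y(1)] pure_VF[OF Y(2)] by simp
  also have "\<dots> = (\<Sum>i<n. y i * frm c x [b i, Y' x])"
    unfolding y using form_lincomb[OF \<omega>, of "[]" "[Y' x]" "{..<n}" b y] YT bT by simp
  also have "\<dots> = 0"
  proof (rule sum.neutral, rule ballI)
    fix i assume i: "i \<in> {..<n}"
    have "frm c x [b i, Y' x] = (\<Sum>j<n. y' j * frm c x [b i, b j])"
      unfolding y' using form_lincomb[OF \<omega>, of "[b i]" "[]" "{..<n}" b y'] bT i by simp
    also have "\<dots> = 0" using all0 i by (intro sum.neutral) auto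
    finally show "y i * frm c x [b i, Y' x] = 0" by simp
  qed
  finally show ?thesis .
qed

text \<open>The \<open>r\<close> forms \<open>\<psi> i\<close> are independent at \<open>x\<close>, and \<open>r\<close> is the dimension of the space of \<open>(0, 2)\<close>-forms.
  Hence \<open>\<beta>\<close> is a combination of them on fields of type \<open>(0, 1)\<close>, with coefficients that are read off
  from its values on the pairs \<open>s j\<close>.\<close>

lemma two_forms_span:
  assumes x: "x \<in> points M" and n: "DIM('e) = 2 * n" and r: "r = card {(i, j). i < j \<and> j < n}"
    and \<psi>: "\<And>i. i < r \<Longrightarrow> tensorial (\<psi> i)" and \<beta>: "tensorial \<beta>"
    and s: "\<And>i j. i < r \<Longrightarrow> j < r \<Longrightarrow> \<psi> i [fst (s j), snd (s j)] x = (if i = j then D else 0)" "D \<noteq> 0"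
    and sp: "\<And>j. j < r \<Longrightarrow> pure False (fst (s j)) \<and> pure False (snd (s j))"
    and \<beta>0: "\<And>j. j < r \<Longrightarrow> \<beta> [fst (s j), snd (s j)] x = 0"
    and Y: "pure False Y" "pure False Y'"
  shows "\<beta> [Y, Y'] x = 0"
proof -
  obtain b where b: "\<And>i. i < n \<Longrightarrow> b i \<in> T01_vectors x" "\<And>v. v \<in> T01_vectors x \<Longrightarrow> \<exists>y. v = (\<lambda>f. \<Sum>i<n. y i * b i f)"
    using T01_span[OF x n] by blast
  let ?I = "{(i, j). i < j \<and> j < n}"
  have fin: "finite ?I" by (rule finite_subset[of _ "{..<n} \<times> {..<n}"]) auto
  define c where "c = \<psi>(r := \<beta>)"
  have c: "tensorial (c k)" if "k \<le> r" for k using that \<psi> \<beta> by (auto simp: c_def)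
  obtain a where a: "\<exists>k\<in>{..r}. a k \<noteq> 0" "\<forall>ij\<in>?I. (\<Sum>k\<le>r. a k * frm (c k) x [b (fst ij), b (snd ij)]) = 0"
    using dependent_family[OF fin, of "{..r}" "\<lambda>k ij. frm (c k) x [b (fst ij), b (snd ij)]"] r by auto
  define \<gamma> where "\<gamma> = (\<lambda>Vs x. \<Sum>k\<le>r. a k * c k Vs x)"
  have t\<gamma>: "tensorial \<gamma>" unfolding \<gamma>_def by (intro tens_Sum tens_cmult c) auto
  have "frm \<gamma> x [b i, b j] = 0" if "i < j" "j < n" for i j
  proof -
    have "b i \<in> T x" "b j \<in> T x" using b(1) that by (auto simp: T01_vectors_def)
    then have "frm \<gamma> x [b i, b j] = (\<Sum>k\<le>r. a k * frm (c k) x [b i, b j])" by (simp add: frm_def \<gamma>_def x)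
    then show ?thesis using a(2) that by auto
  qed
  then have \<gamma>0: "\<gamma> [Z, Z'] x = 0" if "pure False Z" "pure False Z'" for Z Z'
    using two_form_eq_0[OF x t\<gamma> b] that by blast
  have e: "\<gamma> Vs x = (\<Sum>k<r. a k * \<psi> k Vs x) + a r * \<beta> Vs x" for Vs
    by (simp add: \<gamma>_def c_def lessThan_Suc_atMost[symmetric])
  have aj: "a j = 0" if j: "j < r" for j
  proof -
    have "(\<Sum>k<r. a k * \<psi> k [fst (s j), snd (s j)] x) = (\<Sum>k<r. if k = j then a k * D else 0)"
      by (rule sum.cong) (auto simp: s(1) j)
    also have "\<dots> = a j * D" using j by simp
    finally show ?thesis
      using \<gamma>0 sp[OF j] e[of "[fst (s j), snd (s j)]"] \<beta>0[OF j] s(2) by auto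
  qed
  then have "a r \<noteq> 0" using a(1) by (metis atMost_iff le_neq_implies_less)
  then show ?thesis using e[of "[Y, Y']"] \<gamma>0[OF Y] aj by simp
qed

end

section \<open>Iterated brackets\<close>

primrec iter_bracket :: "('a \<Rightarrow> ('a, complex) tvec) \<Rightarrow> ('a \<Rightarrow> ('a, complex) tvec) \<Rightarrow> nat \<Rightarrow> 'a \<Rightarrow> ('a, complex) tvec" where
  "iter_bracket Z Z' 0 = Z'"
| "iter_bracket Z Z' (Suc k) = lie_bracket Z (iter_bracket Z Z' k)"

text \<open>The operators \<open>D\<^sub>k\<close>. Their recursion is modelled on that of the iterated brackets, so that the pair
  \<open>(Z h, Z' h)\<close> is sent to the derivative of \<open>h\<close> along the bracket.\<close>

primrec iter_op :: "('a \<Rightarrow> ('a, complex) tvec) \<Rightarrow> ('a \<Rightarrow> ('a, complex) tvec) \<Rightarrow> nat \<Rightarrow>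
    ('a \<Rightarrow> complex) \<Rightarrow> ('a \<Rightarrow> complex) \<Rightarrow> 'a \<Rightarrow> complex" where
  "iter_op Z Z' 0 g g' = g'"
| "iter_op Z Z' (Suc k) g g' = (\<lambda>x. apply_complex (Z x) (iter_op Z Z' k g g') - apply_complex (iter_bracket Z Z' k x) g)"

definition one_coch :: "(('a \<Rightarrow> ('a, complex) tvec) \<Rightarrow> 'a \<Rightarrow> complex) \<Rightarrow> 'a cochain" where
  "one_coch A = (\<lambda>Vs x. case Vs of [V] \<Rightarrow> A V x | _ \<Rightarrow> 0)"

context charted
begin

lemma iter_bracket_VF: "Z \<in> VF \<Longrightarrow> Z' \<in> VF \<Longrightarrow> iter_bracket Z Z' k \<in> VF"
  by (induction k) (auto intro: bracket_VF)

lemma iter_op_SC: "Z \<in> VF \<Longrightarrow> Z' \<in> VF \<Longrightarrow> g \<in> SC \<Longrightarrow> g' \<in> SC \<Longrightarrow> iter_op Z Z' k g g' \<in> SC"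
proof (induction k)
  case (Suc k)
  then show ?case
    unfolding iter_op.simps
    by (intro smooth_fun_diff[OF act_smooth act_smooth] iter_bracket_VF) auto
qed simp

lemma iter_op_lin:
  assumes Z: "Z \<in> VF" "Z' \<in> VF" and g: "g \<in> SC" "g' \<in> SC" "h \<in> SC" "h' \<in> SC"
  shows "iter_op Z Z' k (\<lambda>x. g x + a * h x) (\<lambda>x. g' x + a * h' x) = (\<lambda>x. iter_op Z Z' k g g' x + a * iter_op Z Z' k h h' x)"
proof (induction k)
  case (Suc k)
  have l: "apply_complex (V x) (\<lambda>x. f x + a * f' x) = apply_complex (V x) f + a * apply_complex (V x) f'"
    if "V \<in> VF" "f \<in> SC" "f' \<in> SC" for V f f' x
    using act_add[OF that(1,2) smooth_fun_cmult[OF that(3)]] act_cmult[OF that(1,3)] by simp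
  show ?case
    unfolding iter_op.simps Suc l[OF Z(1) iter_op_SC[OF Z g(1,2)] iter_op_SC[OF Z g(3,4)]]
      l[OF iter_bracket_VF[OF Z] g(1,3)]
    by (simp add: algebra_simps)
qed simp

lemma iter_op_exact:
  assumes Z: "Z \<in> VF" "Z' \<in> VF" and f: "f \<in> SC"
  shows "iter_op Z Z' k (\<lambda>x. apply_complex (Z x) f) (\<lambda>x. apply_complex (Z' x) f) = (\<lambda>x. apply_complex (iter_bracket Z Z' k x) f)"
  by (induction k) (simp_all add: act_bracket[OF Z(1) iter_bracket_VF[OF Z] f])

lemma iter_op_zero:
  assumes "Z \<in> VF" "Z' \<in> VF"
  shows "iter_op Z Z' k (\<lambda>x. 0) g = ((\<lambda>h x. apply_complex (Z x) h) ^^ k) g"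
  by (induction k) (simp_all add: act_zero[OF iter_bracket_VF[OF assms]])

lemma SC_power: "u \<in> SC \<Longrightarrow> w \<in> SC \<Longrightarrow> (\<lambda>x. u x ^ m * w x) \<in> SC"
  by (induction m) (auto simp: mult.assoc)

lemma act_power:
  assumes Z: "Z \<in> VF" and u: "u \<in> SC" "w \<in> SC"
  shows "apply_complex (Z x) (\<lambda>y. u y ^ Suc m * w y) =
    u x ^ m * (of_nat (Suc m) * apply_complex (Z x) u * w x + u x * apply_complex (Z x) w)"
proof (induction m)
  case 0 show ?case using act_mult[OF Z u] by (simp add: algebra_simps)
next
  case (Suc m)
  have "apply_complex (Z x) (\<lambda>y. u y * (u y ^ Suc m * w y)) =
      u x * apply_complex (Z x) (\<lambda>y. u y ^ Suc m * w y) + u x ^ Suc m * w x * apply_complex (Z x) u"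
    by (rule act_mult[OF Z u(1) SC_power[OF u]])
  then show ?case unfolding Suc by (simp add: algebra_simps)
qed

text \<open>Every application of \<open>Z\<close> lowers the order of vanishing at \<open>p\<close> by at most one; the factor \<open>w\<close> changes
  in the induction.\<close>

lemma iter_act_power:
  assumes Z: "Z \<in> VF" and u: "u \<in> SC" "u p = 0"
  shows "w \<in> SC \<Longrightarrow> k \<le> K \<Longrightarrow> ((\<lambda>h x. apply_complex (Z x) h) ^^ k) (\<lambda>x. u x ^ K * w x) p =
    (if k = K then fact K * apply_complex (Z p) u ^ K * w p else 0)"
proof (induction k arbitrary: K w)
  case 0 then show ?case using u(2) by auto
next
  case (Suc k)
  then obtain L where K: "K = Suc L" by (cases K) auto
  let ?w = "\<lambda>x. of_nat (Suc L) * apply_complex (Z x) u * w x + u x * apply_complex (Z x) w"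
  have w: "?w \<in> SC"
    by (intro smooth_fun_add[OF smooth_fun_mult[OF smooth_fun_cmult[OF act_smooth] ] smooth_fun_mult[OF _ act_smooth]] Z u Suc.prems)
  have "((\<lambda>h x. apply_complex (Z x) h) ^^ Suc k) (\<lambda>x. u x ^ K * w x) p = ((\<lambda>h x. apply_complex (Z x) h) ^^ k) (\<lambda>x. u x ^ L * ?w x) p"
    unfolding K funpow_Suc_right o_def act_power[OF Z u(1) Suc.prems(1)] ..
  also have "\<dots> = (if k = L then fact L * apply_complex (Z p) u ^ L * ?w p else 0)"
    by (rule Suc.IH[OF w]) (use Suc.prems K in simp)
  finally show ?case using u(2) K by (simp add: algebra_simps)
qed

lemma dce_pair:
  "dce [Y, Y'] c x = apply_complex (Y x) (c [Y']) - apply_complex (Y' x) (c [Y]) - c [lie_bracket Y Y'] x"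
  by (simp add: ins_def)

end

declare dce.simps [simp del]

context charted
begin

lemma dce_pair_mult:
  assumes c: "tensorial c" and Y: "Y \<in> VF" "Y' \<in> VF" and h: "h \<in> SC"
  shows "dce [Y, Y'] (\<lambda>Vs x. h x * c Vs x) x =
    h x * dce [Y, Y'] c x + apply_complex (Y x) h * c [Y'] x - apply_complex (Y' x) h * c [Y] x"
proof -
  have s: "c [Y] \<in> SC" "c [Y'] \<in> SC" using tens_SC[OF c] Y by auto
  show ?thesis
    unfolding dce_pair act_mult[OF Y(1) h s(2)] act_mult[OF Y(2) h s(1)] by (simp add: algebra_simps)
qed

lemma tens_one_coch:
  assumes "\<And>V. V \<in> VF \<Longrightarrow> A V \<in> SC"
    "\<And>V W x. V \<in> VF \<Longrightarrow> W \<in> VF \<Longrightarrow> A (vadd V W) x = A V x + A W x"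
    "\<And>V h x. V \<in> VF \<Longrightarrow> h \<in> SC \<Longrightarrow> A (smul h V) x = h x * A V x"
  shows "tensorial (one_coch A)"
proof (rule tensI)
  fix Vs assume "Vs \<in> lists VF"
  then show "one_coch A Vs \<in> SC"
    using assms(1) by (cases Vs rule: list.exhaust; cases "tl Vs" rule: list.exhaust) (auto simp: one_coch_def)
next
  fix Us Vs V W x assume "V \<in> VF" "W \<in> VF"
  then show "one_coch A (Us @ vadd V W # Vs) x = one_coch A (Us @ V # Vs) x + one_coch A (Us @ W # Vs) x"
    using assms(2) by (cases Us; cases Vs) (auto simp: one_coch_def split: list.split)
  show "one_coch A (Us @ V # W # Vs) x = - one_coch A (Us @ W # V # Vs) x"
    by (cases Us) (auto simp: one_coch_def split: list.split)
next
  fix Us Vs V h x assume "V \<in> VF" "h \<in> SC"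
  then show "one_coch A (Us @ smul h V # Vs) x = h x * one_coch A (Us @ V # Vs) x"
    using assms(3) by (cases Us; cases Vs) (auto simp: one_coch_def split: list.split)
qed

lemma tens_pair_dependent:
  assumes c: "tensorial c" and V: "V \<in> VF" "W \<in> VF" and p: "p \<in> points M" and e: "W p = (\<lambda>f. a * V p f)"
  shows "c [V, W] p = 0"
proof -
  let ?k = "\<lambda>x. if x \<in> points M then a else 0"
  have k: "?k \<in> SC" by (rule smooth_fun_const)
  have "c [V, W] p = c ([V] @ smul ?k V # []) p"
    using tens_cong1[OF c, of "[V]" "[]" W "smul ?k V" p] V p e VF_smul[OF k V(1)] by (simp add: smul_def)
  also have "\<dots> = ?k p * c ([V] @ V # []) p"
    using tens_smul[OF c, of "[V]" "[]" V ?k] V k by simp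
  also have "c ([V] @ V # []) p = 0" by (rule tens_not_distinct[OF c]) (use V in auto)
  finally show ?thesis by simp
qed

text \<open>If all the determinants vanish, the vectors \<open>V p\<close> and \<open>W p\<close> are proportional.\<close>

lemma exists_det:
  assumes c: "tensorial c" and V: "V \<in> VF" "W \<in> VF" and p: "p \<in> points M" and n: "c [V, W] p \<noteq> 0"
  obtains f g where "f \<in> S" "g \<in> S" "V p f * W p g - V p g * W p f \<noteq> 0"
proof (rule ccontr)
  note witness = that
  assume nt: "\<not> thesis"
  have z: "V p f * W p g - V p g * W p f = 0" if fg: "f \<in> S" "g \<in> S" for f g
    using nt witness[OF fg] by blast
  show False
  proof (cases "\<exists>f\<in>S. V p f \<noteq> 0")
    case True
    then obtain f where f: "f \<in> S" "V p f \<noteq> 0" by blast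
    have "W p g = W p f / V p f * V p g" if "g \<in> S" for g
      using z[OF f(1) that] f(2) by (simp add: field_simps)
    then have "W p = (\<lambda>g. W p f / V p f * V p g)"
      by (intro tangent_eqI[OF VF_tangent[OF V(2) p] T_cmult[OF VF_tangent[OF V(1) p]]])
    then show False using tens_pair_dependent[OF c V p] n by blast
  next
    case False
    then have "V p = 0"
      by (intro tangent_eqI[OF VF_tangent[OF V(1) p] T_zero(1)[of p]]) auto
    then show False using tens_local[OF c, of "[]" "[W]" V p] V p n by simp
  qed
qed

lemma vec_const: "v \<in> T x \<Longrightarrow> x \<in> points M \<Longrightarrow> v (\<lambda>y. if y \<in> points M then 1 else 0) = 0"
proof -
  assume v: "v \<in> T x" and x: "x \<in> points M"
  let ?o = "\<lambda>y. if y \<in> points M then 1 else 0 :: real"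
  have o: "?o \<in> S" by (rule smooth_fun_const)
  have "(\<lambda>y. ?o y * ?o y) = ?o" by auto
  then have "v ?o = v ?o + v ?o" using tangent_mult[OF v o o] x by simp
  then show ?thesis by simp
qed

lemma forms_diff_cmult:
  assumes "\<omega> \<in> forms M" "\<eta> \<in> forms M" shows "(\<lambda>x vs. \<omega> x vs - a * \<eta> x vs) \<in> forms M"
proof -
  have "frm (\<lambda>Vs x. coch \<omega> Vs x + (- a) * coch \<eta> Vs x) \<in> forms M"
    by (intro frm_forms tens_sum2 tens_cmult tens_coch assms)
  moreover have "frm (\<lambda>Vs x. coch \<omega> Vs x + (- a) * coch \<eta> Vs x) = (\<lambda>x vs. frm (coch \<omega>) x vs - a * frm (coch \<eta>) x vs)"
    by (intro ext) (simp add: frm_def)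
  ultimately show ?thesis by (simp add: frm_coch assms)
qed

end

section \<open>Failure of surjectivity\<close>

context almost_complex_manifold
begin

text \<open>A cochain is of bidegree \<open>(p, q)\<close> if it vanishes on fields of every other pure type; in particular it
  vanishes on lists whose length is not \<open>p + q\<close>.\<close>

definition of_bidegree :: "'a cochain \<Rightarrow> nat \<Rightarrow> nat \<Rightarrow> bool" where
  "of_bidegree c p q \<longleftrightarrow> tensorial c \<and> (\<forall>Ws a b x. ptype Ws a b \<longrightarrow> (a, b) \<noteq> (p, q) \<longrightarrow> c Ws x = 0)"

lemma of_bidegree_tens: "of_bidegree c p q \<Longrightarrow> tensorial c" by (simp add: of_bidegree_def)

lemma of_bidegreeD: "of_bidegree c p q \<Longrightarrow> ptype Ws a b \<Longrightarrow> (a, b) \<noteq> (p, q) \<Longrightarrow> c Ws x = 0" unfolding of_bidegree_def by blast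

lemma of_bidegree_add: "of_bidegree c p q \<Longrightarrow> of_bidegree d p q \<Longrightarrow> of_bidegree (\<lambda>Vs x. c Vs x + d Vs x) p q"
  unfolding of_bidegree_def by (auto intro: tens_sum2)

lemma of_bidegree_mult: "h \<in> SC \<Longrightarrow> of_bidegree c p q \<Longrightarrow> of_bidegree (\<lambda>Vs x. h x * c Vs x) p q"
  unfolding of_bidegree_def by (auto intro: tens_mult)

lemma of_bidegree_Sum: "(\<And>i. i \<in> I \<Longrightarrow> of_bidegree (c i) p q) \<Longrightarrow> of_bidegree (\<lambda>Vs x. \<Sum>i\<in>I. c i Vs x) p q"
  unfolding of_bidegree_def by (auto intro!: tens_Sum sum.neutral)

lemma bideg_coch_of_bidegree:
  assumes c: "of_bidegree c p0 q0" and V: "Vs \<in> lists VF"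
  shows "bideg_coch Vs p q c x = (if p = p0 \<and> q = q0 then c Vs x else 0)"
proof (cases "p = p0 \<and> q = q0")
  case True
  have "bideg_coch Vs p q c x = c Vs x"
    by (rule tens_pure_eqI[OF tens_bideg_coch[OF of_bidegree_tens[OF c]] of_bidegree_tens[OF c] V])
      (use True of_bidegreeD[OF c] in \<open>auto simp: bideg_coch_pure of_bidegree_tens[OF c]\<close>)
  then show ?thesis using True by simp
next
  case False
  have "bideg_coch Vs p q c x = 0"
    by (rule tens_pure_eq_0[OF tens_bideg_coch[OF of_bidegree_tens[OF c]] V])
      (use False of_bidegreeD[OF c] in \<open>auto simp: bideg_coch_pure of_bidegree_tens[OF c]\<close>)
  then show ?thesis using False by auto
qed

lemma dce_bideg_coch_of_bidegree:
  assumes c: "of_bidegree c p0 q0" and V: "Vs \<in> lists VF"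
  shows "dce Vs (\<lambda>Xs. bideg_coch Xs p q c) x = (if p = p0 \<and> q = q0 then dce Vs c x else 0)"
proof (cases "p = p0 \<and> q = q0")
  case True
  have "dce Vs (\<lambda>Xs. bideg_coch Xs p q c) = dce Vs c"
    by (intro dce_cong V ext) (use True in \<open>simp add: bideg_coch_of_bidegree[OF c]\<close>)
  then show ?thesis using True by simp
next
  case False
  have "dce Vs (\<lambda>Xs. bideg_coch Xs p q c) = dce Vs (\<lambda>Xs x. 0)"
    by (intro dce_cong V ext) (use False in \<open>auto simp: bideg_coch_of_bidegree[OF c]\<close>)
  then show ?thesis using False by (auto simp: dce_zero V)
qed

lemma mubc_10:
  assumes c: "of_bidegree c 1 0" and W: "ptype Ws a b"
  shows "mubc c Ws x = (if a = 0 \<and> b = 2 then dce Ws c x else 0)"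
  unfolding mubc_pure[OF W of_bidegree_tens[OF c]] dce_bideg_coch_of_bidegree[OF c ptype_VF[OF W]] by auto

lemma mubc_01:
  assumes c: "of_bidegree c 0 1" and W: "ptype Ws a b"
  shows "mubc c Ws x = 0"
  unfolding mubc_pure[OF W of_bidegree_tens[OF c]] dce_bideg_coch_of_bidegree[OF c ptype_VF[OF W]] by auto

lemma delbc_01:
  assumes c: "of_bidegree c 0 1" and W: "ptype Ws a b"
  shows "delbc c Ws x = (if a = 0 \<and> b = 2 then dce Ws c x else 0)"
  unfolding delbc_pure[OF W of_bidegree_tens[OF c]] dce_bideg_coch_of_bidegree[OF c ptype_VF[OF W]] by auto

lemma ptype_0: "ptype Ws a b \<Longrightarrow> a = 0 \<Longrightarrow> \<forall>W\<in>set Ws. pure False W"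
  by (induction rule: ptype.induct) auto

lemma ptype_02:
  assumes "ptype Ws 0 2" obtains Y Y' where "Ws = [Y, Y']" "pure False Y" "pure False Y'"
  using ptype_0[OF assms] ptype_length[OF assms] that by (cases Ws; cases "tl Ws") auto

lemma ptype_single: "pure False Y \<Longrightarrow> ptype [Y] 0 1"
  using ptype.False[OF _ ptype.Nil] by simp

text \<open>The terms in which the form is evaluated on a single field of type \<open>(0, 1)\<close> vanish. This shows that
  \<open>mubar\<close> is function-linear on \<open>(1, 0)\<close>-forms.\<close>

lemma dce_10_pair:
  assumes c: "of_bidegree c 1 0" and Y: "pure False Y" "pure False Y'"
  shows "dce [Y, Y'] c x = - c [lie_bracket Y Y'] x"
proof -
  have "c [Y] = (\<lambda>x. 0)" "c [Y'] = (\<lambda>x. 0)"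
    using of_bidegreeD[OF c ptype_single[OF Y(1)]] of_bidegreeD[OF c ptype_single[OF Y(2)]] by auto
  then show ?thesis unfolding dce_pair using act_zero pure_VF Y by simp
qed

lemma pq_forms_of_bidegree:
  assumes \<omega>: "\<omega> \<in> pq_forms M J 1 0" shows "of_bidegree (coch \<omega>) 1 0"
  unfolding of_bidegree_def
proof (intro conjI allI impI)
  have \<omega>F: "\<omega> \<in> forms M" using \<omega> by (simp add: pq_forms_def)
  show t: "tensorial (coch \<omega>)" by (rule tens_coch[OF \<omega>F])
  fix Ws a b x assume W: "ptype Ws a b" and ne: "(a, b) \<noteq> (1, 0)"
  show "coch \<omega> Ws x = 0"
  proof (cases "x \<in> points M")
    case False
    then show ?thesis using tens_outside[OF t ptype_VF[OF W]] by blast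
  next
    case x: True
    have p10: "V x \<in> T10 M J x" if "pure True V" for V
      using JC_pr[OF x VF_tangent[OF pure_VF[OF that] x], of True] P_at[OF x, of True V] pure_same[OF that]
        VF_tangent[OF pure_VF[OF that] x] by (simp add: T10_def)
    have p01: "V x \<in> T01 M J x" if "pure False V" for V
      using JC_pr[OF x VF_tangent[OF pure_VF[OF that] x], of False] P_at[OF x, of False V] pure_same[OF that]
        VF_tangent[OF pure_VF[OF that] x] by (simp add: T01_def)
    have l: "map (\<lambda>V. V x) Ws \<in> lists (T10 M J x \<union> T01 M J x)"
      using W by (induction rule: ptype.induct) (auto dest: p10 p01)
    show ?thesis
    proof (rule ccontr)
      assume nz: "coch \<omega> Ws x \<noteq> 0"
      then have f: "length (filter (\<lambda>v. v \<in> T10 M J x) (map (\<lambda>V. V x) Ws)) = 1"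
        "length (filter (\<lambda>v. v \<in> T01 M J x) (map (\<lambda>V. V x) Ws)) = 0"
        using \<omega> x l unfolding pq_forms_def coch_def by blast+
      have "b \<le> length (filter (\<lambda>v. v \<in> T01 M J x) (map (\<lambda>V. V x) Ws))"
        "a \<le> length (filter (\<lambda>v. v \<in> T10 M J x) (map (\<lambda>V. V x) Ws))"
        using W by (induction rule: ptype.induct) (auto dest: p10 p01)
      then have "b = 0" "a \<le> 1" using f by auto
      moreover have "a \<noteq> 0"
      proof
        assume "a = 0"
        then have "Ws = []" using ptype_length[OF W] \<open>b = 0\<close> by simp
        then show False using f(1) by simp
      qed
      ultimately show False using ne by auto
    qed
  qed
qed

text \<open>A basis of the image of \<open>mubar\<close> at \<open>p\<close> consists of the values of \<open>r\<close> forms; linear independence of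
  these values is tested on pairs of fields of type \<open>(0, 1)\<close>.\<close>

lemma independent_mubar:
  assumes p: "p \<in> points M" and r: "r > 0"
    and rank: "vector_space.dim (\<lambda>(c::complex) \<eta> vs. c * \<eta> vs) ((\<lambda>\<alpha>. mubar M J \<alpha> p) ` pq_forms M J 1 0) = r"
  obtains \<xi> where "\<And>j. j < r \<Longrightarrow> of_bidegree (\<xi> j) 1 0"
    "\<And>a. (\<And>Y Y'. pure False Y \<Longrightarrow> pure False Y' \<Longrightarrow> (\<Sum>j<r. a j * dce [Y, Y'] (\<xi> j) p) = 0) \<Longrightarrow> \<forall>j<r. a j = 0"
proof -
  let ?V = "(\<lambda>\<alpha>. mubar M J \<alpha> p) ` pq_forms M J 1 0"
  interpret vs: vector_space "\<lambda>(c::complex) (\<eta> :: ('a, complex) tvec list \<Rightarrow> complex) vs. c * \<eta> vs"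
    by unfold_locales (auto simp: fun_eq_iff algebra_simps)
  obtain B where B: "B \<subseteq> ?V" "vs.independent B" "card B = r"
    using vs.basis_exists[of ?V] rank by metis
  have fB: "finite B" using B(3) r by (simp add: card_ge_0_finite)
  obtain h where h: "bij_betw h {..<r} B" using ex_bij_betw_nat_finite[OF fB] B(3) by (auto simp: atLeast0LessThan)
  have "\<exists>\<alpha>. \<alpha> \<in> pq_forms M J 1 0 \<and> h j = mubar M J \<alpha> p" if "j < r" for j
    using bij_betwE[OF h] B(1) that by blast
  then obtain \<alpha> where \<alpha>: "\<And>j. j < r \<Longrightarrow> \<alpha> j \<in> pq_forms M J 1 0" "\<And>j. j < r \<Longrightarrow> h j = mubar M J (\<alpha> j) p" by metis
  have \<alpha>F: "\<alpha> j \<in> forms M" if "j < r" for j using \<alpha>(1)[OF that] by (simp add: pq_forms_def)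
  note hom = pq_forms_of_bidegree[OF \<alpha>(1)]
  show ?thesis
  proof (rule that[of "\<lambda>j. coch (\<alpha> j)"])
    show "of_bidegree (coch (\<alpha> j)) 1 0" if "j < r" for j by (rule hom[OF that])
    fix a assume 0: "\<And>Y Y'. pure False Y \<Longrightarrow> pure False Y' \<Longrightarrow> (\<Sum>j<r. a j * dce [Y, Y'] (coch (\<alpha> j)) p) = 0"
    define C where "C = (\<lambda>Vs x. \<Sum>j<r. a j * mubc (coch (\<alpha> j)) Vs x)"
    have tC: "tensorial C" unfolding C_def by (intro tens_Sum tens_cmult tens_mubc of_bidegree_tens[OF hom]) auto
    have C0: "C Vs p = 0" if V: "Vs \<in> lists VF" for Vs
    proof (rule tens_pure_eq_0[OF tC V])
      fix Ws c b assume W: "ptype Ws c b"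
      show "C Ws p = 0"
      proof (cases "c = 0 \<and> b = 2")
        case True
        then obtain Y Y' where Y: "Ws = [Y, Y']" "pure False Y" "pure False Y'" using ptype_02 W by metis
        have "C Ws p = (\<Sum>j<r. a j * dce Ws (coch (\<alpha> j)) p)"
          unfolding C_def by (rule sum.cong) (use True in \<open>simp_all add: mubc_10[OF hom W]\<close>)
        then have "C Ws p = (\<Sum>j<r. a j * dce [Y, Y'] (coch (\<alpha> j)) p)" unfolding Y(1) .
        then show ?thesis using 0[OF Y(2,3)] by simp
      next
        case False
        then show ?thesis unfolding C_def by (intro sum.neutral) (auto simp: mubc_10[OF hom W])
      qed
    qed
    have "(\<Sum>j<r. a j * h j vs) = 0" for vs
    proof -
      have "(\<Sum>j<r. a j * h j vs) = (\<Sum>j<r. a j * frm (mubc (coch (\<alpha> j))) p vs)"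
        by (rule sum.cong) (auto simp: \<alpha>(2) mubar_frm \<alpha>F)
      also have "\<dots> = frm C p vs"
      proof (cases "p \<in> points M \<and> vs \<in> lists (T p)")
        case True
        then show ?thesis by (simp add: frm_def C_def)
      next
        case False
        show ?thesis unfolding frm_def if_not_P[OF False] by simp
      qed
      also have "\<dots> = 0" using C0 ext_lists by (auto simp: frm_def)
      finally show ?thesis .
    qed
    moreover have "(\<Sum>j<r. (\<lambda>vs. a j * h j vs)) = (\<lambda>vs. \<Sum>j<r. a j * h j vs)"
    proof -
      have "(\<Sum>j\<in>I. (\<lambda>vs. a j * h j vs)) vs = (\<Sum>j\<in>I. a j * h j vs)" for I vs
        by (induction I rule: infinite_finite_induct) auto
      then show ?thesis by (intro ext)
    qed
    ultimately have z: "(\<Sum>j<r. (\<lambda>vs. a j * h j vs)) = 0" by (simp add: fun_eq_iff)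
    let ?g = "the_inv_into {..<r} h"
    have g: "?g (h j) = j" if "j < r" for j
      using the_inv_into_f_f[of h "{..<r}" j] h that by (simp add: bij_betw_def)
    have "(\<Sum>v\<in>B. (\<lambda>vs. a (?g v) * v vs)) = (\<Sum>j<r. (\<lambda>vs. a (?g (h j)) * h j vs))"
      by (rule sum.reindex_bij_betw[OF h, symmetric])
    also have "\<dots> = (\<Sum>j<r. (\<lambda>vs. a j * h j vs))" by (rule sum.cong) (auto simp: g)
    finally have "(\<Sum>v\<in>B. (\<lambda>vs. a (?g v) * v vs)) = 0" using z by simp
    then have "a (?g v) = 0" if "v \<in> B" for v
      using vs.independentD[OF B(2) fB subset_refl, of "\<lambda>v. a (?g v)" v] that by blast
    then show "\<forall>j<r. a j = 0" using g bij_betwE[OF h] by (metis lessThan_iff)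
  qed
qed

text \<open>The general form of the result: instead of the invariant forms, \<open>\<Omega>0\<close> is any space of forms
  whose values on single vectors are determined by those at the point \<open>p\<close>.\<close>

theorem not_surjective:
  assumes n: "DIM('e) = 2 * n" and r: "r = card {(i, j). i < j \<and> j < n}" "r > 0"
    and p: "p \<in> points M"
    and rank: "vector_space.dim (\<lambda>(c::complex) \<eta> vs. c * \<eta> vs) ((\<lambda>\<alpha>. mubar M J \<alpha> p) ` pq_forms M J 1 0) = r"
    and \<Omega>0: "\<Omega>0 \<subseteq> forms M" "0 \<in> \<Omega>0"
      "\<And>\<omega> \<eta> a. \<omega> \<in> \<Omega>0 \<Longrightarrow> \<eta> \<in> \<Omega>0 \<Longrightarrow> (\<lambda>x vs. \<omega> x vs - a * \<eta> x vs) \<in> \<Omega>0"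
      "\<And>\<omega> x v. \<omega> \<in> \<Omega>0 \<Longrightarrow> (\<And>v. v \<in> T p \<Longrightarrow> \<omega> p [v] = 0) \<Longrightarrow> x \<in> points M \<Longrightarrow> v \<in> T x \<Longrightarrow> \<omega> x [v] = 0"
  shows "\<not> carrier (dolbeault M J (forms M)) \<subseteq> dolbeault_inclusion M J (forms M) ` carrier (dolbeault M J \<Omega>0)"
proof
  assume surj: "carrier (dolbeault M J (forms M)) \<subseteq> dolbeault_inclusion M J (forms M) ` carrier (dolbeault M J \<Omega>0)"
  define D where "D = {(Y, Y'). pure False Y \<and> pure False Y'}"
  define \<Phi> where "\<Phi> = {\<psi>. \<exists>\<xi>. of_bidegree \<xi> 1 0 \<and> (\<forall>s\<in>D. \<psi> s = dce [fst s, snd s] \<xi>)}"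
  have DVF: "fst s \<in> VF" "snd s \<in> VF" "pure False (fst s)" "pure False (snd s)" if "s \<in> D" for s
    using that pure_VF by (auto simp: D_def)
  obtain \<xi>0 where \<xi>0: "\<And>j. j < r \<Longrightarrow> of_bidegree (\<xi>0 j) 1 0"
    "\<And>a. (\<And>Y Y'. pure False Y \<Longrightarrow> pure False Y' \<Longrightarrow> (\<Sum>j<r. a j * dce [Y, Y'] (\<xi>0 j) p) = 0) \<Longrightarrow> \<forall>j<r. a j = 0"
    using independent_mubar[OF p r(2) rank] by blast
  have "\<exists>\<psi> s d. (\<forall>i<r. \<psi> i \<in> \<Phi> \<and> s i \<in> D) \<and> d \<in> SC \<and> d p \<noteq> 0 \<and>
    (\<forall>i<r. \<forall>j<r. \<forall>x. \<psi> i (s j) x = (if i = j then d x else 0))"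
  proof (rule adjugate_basis[OF p, where \<phi> = "\<lambda>j s. dce [fst s, snd s] (\<xi>0 j)" and r = r])
    show "\<psi> s \<in> SC" if "\<psi> \<in> \<Phi>" "s \<in> D" for \<psi> s
    proof -
      obtain \<xi> where x: "of_bidegree \<xi> 1 0" "\<psi> s = dce [fst s, snd s] \<xi>" using \<open>\<psi> \<in> \<Phi>\<close> \<open>s \<in> D\<close> unfolding \<Phi>_def by blast
      have "[fst s, snd s] \<in> lists VF" using DVF[OF \<open>s \<in> D\<close>] by simp
      then show ?thesis unfolding x(2) by (rule dce_SC[OF tens_smooth_values[OF of_bidegree_tens[OF x(1)]]])
    qed
    show "(\<lambda>s x. \<psi> s x + \<psi>' s x) \<in> \<Phi>" if "\<psi> \<in> \<Phi>" "\<psi>' \<in> \<Phi>" for \<psi> \<psi>'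
    proof -
      obtain \<xi> \<xi>' where x: "of_bidegree \<xi> 1 0" "\<forall>s\<in>D. \<psi> s = dce [fst s, snd s] \<xi>" "of_bidegree \<xi>' 1 0" "\<forall>s\<in>D. \<psi>' s = dce [fst s, snd s] \<xi>'"
        using \<open>\<psi> \<in> \<Phi>\<close> \<open>\<psi>' \<in> \<Phi>\<close> unfolding \<Phi>_def by blast
      show ?thesis
        unfolding \<Phi>_def
        by (intro CollectI exI[of _ "\<lambda>Vs x. \<xi> Vs x + \<xi>' Vs x"] conjI of_bidegree_add x ballI ext)
          (use x DVF dce_add[OF tens_smooth_values[OF of_bidegree_tens[OF x(1)]] tens_smooth_values[OF of_bidegree_tens[OF x(3)]]] in \<open>auto simp del: dce.simps\<close>)
    qed
    show "(\<lambda>s x. h x * \<psi> s x) \<in> \<Phi>" if "\<psi> \<in> \<Phi>" and h: "h \<in> SC" for \<psi> h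
    proof -
      obtain \<xi> where x: "of_bidegree \<xi> 1 0" "\<forall>s\<in>D. \<psi> s = dce [fst s, snd s] \<xi>"
        using \<open>\<psi> \<in> \<Phi>\<close> unfolding \<Phi>_def by blast
      show ?thesis
        unfolding \<Phi>_def
        by (intro CollectI exI[of _ "\<lambda>Vs x. h x * \<xi> Vs x"] conjI of_bidegree_mult x h ballI ext)
          (use x DVF dce_10_pair[OF of_bidegree_mult[OF h x(1)]] dce_10_pair[OF x(1)] in \<open>auto simp del: dce.simps\<close>)
    qed
    show "(\<lambda>s. dce [fst s, snd s] (\<xi>0 j)) \<in> \<Phi>" if "j < r" for j
      unfolding \<Phi>_def using \<xi>0(1)[OF that] by blast
    show "\<forall>j<r. a j = 0" if "\<And>s. s \<in> D \<Longrightarrow> (\<Sum>j<r. a j * dce [fst s, snd s] (\<xi>0 j) p) = 0" for a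
    proof (rule \<xi>0(2))
      fix Y Y' assume "pure False Y" "pure False Y'"
      then show "(\<Sum>j<r. a j * dce [Y, Y'] (\<xi>0 j) p) = 0" using that[of "(Y, Y')"] by (simp add: D_def del: dce.simps)
    qed
  qed simp
  then obtain \<psi> s d where \<psi>: "\<And>i. i < r \<Longrightarrow> \<psi> i \<in> \<Phi>" and s: "\<And>i. i < r \<Longrightarrow> s i \<in> D" and d: "d \<in> SC" "d p \<noteq> 0"
    and \<psi>s: "\<And>i j x. i < r \<Longrightarrow> j < r \<Longrightarrow> \<psi> i (s j) x = (if i = j then d x else 0)" by blast
  have "\<exists>\<xi>. of_bidegree \<xi> 1 0 \<and> (\<forall>s\<in>D. \<psi> i s = dce [fst s, snd s] \<xi>)" if "i < r" for i
    using \<psi>[OF that] by (simp add: \<Phi>_def)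
  then obtain \<xi> where \<xi>: "\<And>i. i < r \<Longrightarrow> of_bidegree (\<xi> i) 1 0" "\<And>i t. i < r \<Longrightarrow> t \<in> D \<Longrightarrow> \<psi> i t = dce [fst t, snd t] (\<xi> i)" by metis
  have \<xi>s: "dce [fst (s j), snd (s j)] (\<xi> i) x = (if i = j then d x else 0)" if "i < r" "j < r" for i j x
    using \<psi>s[OF that, of x] \<xi>(2)[OF that(1) s[OF that(2)]] by simp
  \<comment> \<open>Since \<open>dce \<xi>\<^sub>0\<close> does not vanish on the first pair at \<open>p\<close>, its two fields are independent there.\<close>
  define Z1 where "Z1 = fst (s 0)"
  define Z2 where "Z2 = snd (s 0)"
  have Zp: "pure False Z1" "pure False Z2" and Z: "Z1 \<in> VF" "Z2 \<in> VF" using DVF s[OF r(2)] by (auto simp: Z1_def Z2_def)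
  have "dce [Z1, Z2] (\<xi> 0) p \<noteq> 0" using \<xi>s[OF r(2) r(2), of p] d by (simp add: Z1_def Z2_def del: dce.simps)
  then obtain f g where fg: "f \<in> S" "g \<in> S" "Z1 p f * Z2 p g - Z1 p g * Z2 p f \<noteq> 0"
    using exists_det[OF tens_dce[OF of_bidegree_tens[OF \<xi>(1)[OF r(2)]]] Z p] by blast
  define q where "q = (\<lambda>x. Z1 x f * Z2 x g - Z1 x g * Z2 x f)"
  have qSC: "q \<in> SC" unfolding q_def using VF_smooth[OF Z(1)] VF_smooth[OF Z(2)] fg by (intro smooth_fun_diff smooth_fun_mult) auto
  have qp: "q p \<noteq> 0" using fg by (simp add: q_def)
  obtain f0 where f0: "f0 \<in> S" "Z1 p f0 \<noteq> 0" using fg by (cases "Z1 p f = 0") auto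
  define u where "u = (\<lambda>x. complex_of_real (f0 x - f0 p * (if x \<in> points M then 1 else 0)))"
  have u0: "(\<lambda>x. f0 x - f0 p * (if x \<in> points M then 1 else 0)) \<in> S"
    by (intro smooth_fun_diff smooth_fun_cmult smooth_fun_const f0)
  have u: "u \<in> SC" "u p = 0" unfolding u_def using SC_of_real[OF u0] p by auto
  have Zu: "apply_complex (Z1 p) u \<noteq> 0"
    unfolding u_def act_of_real[OF Z(1)]
    using tangent_diff[OF VF_tangent[OF Z(1) p] f0(1) smooth_fun_cmult[OF smooth_fun_const[of 1]], of "f0 p"]
      tangent_cmult[OF VF_tangent[OF Z(1) p] smooth_fun_const[of 1], of "f0 p"]
      vec_const[OF VF_tangent[OF Z(1) p] p] f0(2) by simp
  \<comment> \<open>The functionals \<open>L h \<omega> k\<close> vanish where the finitely many functionals \<open>e h \<omega>\<close> do: these are the derivatives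
    of \<open>h\<close> along a frame at \<open>p\<close> and the values of \<open>\<omega>\<close> on it. Hence there is a relation between the
    functionals \<open>L h \<omega> k\<close>; let \<open>K\<close> be its highest index.\<close>
  obtain b E l where b: "b p \<noteq> 0" and E: "\<And>i. E i \<in> VF"
    and fr: "\<And>x (v::('a, complex) tvec) f. x \<in> points M \<Longrightarrow> v \<in> T x \<Longrightarrow> f \<in> S \<Longrightarrow>
        b x * v f = (\<Sum>i\<in>(Basis::'e set). l i x v * E i x f)"
    and frc: "\<And>c V Us Vs x. tensorial c \<Longrightarrow> V \<in> VF \<Longrightarrow> Us \<in> lists VF \<Longrightarrow> Vs \<in> lists VF \<Longrightarrow>
        b x * c (Us @ V # Vs) x = (\<Sum>i\<in>Basis. l i x (V x) * c (Us @ E i # Vs) x)"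
    by (rule frame_VF[OF p]) blast
  define L where "L h \<omega> k = apply_complex (iter_bracket Z1 Z2 k p) h + iter_op Z1 Z2 k (coch \<omega> [Z1]) (coch \<omega> [Z2]) p" for h \<omega> k
  define e where "e h \<omega> = (\<lambda>(t, i). if t then apply_complex (E i p) h else coch \<omega> [E i] p)" for h \<omega>
  define Y where "Y = {(L h \<omega>, e h \<omega>) | h \<omega>. h \<in> SC \<and> \<omega> \<in> \<Omega>0}"
  have YI: "h \<in> SC \<Longrightarrow> \<omega> \<in> \<Omega>0 \<Longrightarrow> (L h \<omega>, e h \<omega>) \<in> Y" for h \<omega> unfolding Y_def by blast
  have \<Omega>t: "tensorial (coch \<omega>)" if "\<omega> \<in> \<Omega>0" for \<omega> using that \<Omega>0(1) tens_coch by blast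
  have \<Omega>SC: "coch \<omega> [V] \<in> SC" if "\<omega> \<in> \<Omega>0" "V \<in> VF" for \<omega> V using tens_SC[OF \<Omega>t[OF that(1)]] that(2) by simp
  have "\<exists>c N. (\<forall>k. c k \<noteq> 0 \<longrightarrow> 0 \<le> k \<and> k < N) \<and> (\<exists>k. c k \<noteq> 0) \<and>
      (\<forall>N'\<ge>N. \<forall>(l, e)\<in>Y. (\<Sum>k<N'. c k * l k) = 0)"
  proof (rule finite_relation[of "UNIV \<times> (Basis :: 'e set)"])
    fix l e' l' e'' a assume "(l, e') \<in> Y" "(l', e'') \<in> Y"
    then obtain h \<omega> h' \<omega>' where h: "h \<in> SC" "\<omega> \<in> \<Omega>0" "h' \<in> SC" "\<omega>' \<in> \<Omega>0" "l = L h \<omega>" "e' = e h \<omega>" "l' = L h' \<omega>'" "e'' = e h' \<omega>'"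
      unfolding Y_def by blast
    let ?h = "\<lambda>x. h x + (- a) * h' x" and ?\<omega> = "\<lambda>x vs. \<omega> x vs - a * \<omega>' x vs"
    have hl: "apply_complex (V p) ?h = apply_complex (V p) h - a * apply_complex (V p) h'" if "V \<in> VF" for V
      using act_add[OF that h(1) smooth_fun_cmult[OF h(3)], of p "- a"] act_cmult[OF that h(3), of p "- a"] by simp
    have c: "coch ?\<omega> [V] = (\<lambda>x. coch \<omega> [V] x + (- a) * coch \<omega>' [V] x)" for V by (simp add: coch_def)
    have "L ?h ?\<omega> k = l k - a * l' k" for k
      unfolding L_def h c iter_op_lin[OF Z \<Omega>SC[OF h(2) Z(1)] \<Omega>SC[OF h(2) Z(2)] \<Omega>SC[OF h(4) Z(1)] \<Omega>SC[OF h(4) Z(2)]]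
        hl[OF iter_bracket_VF[OF Z]] by (simp add: algebra_simps)
    then have L': "L ?h ?\<omega> = (\<lambda>k. l k - a * l' k)" by (rule ext)
    have e': "e ?h ?\<omega> = (\<lambda>i. e' i - a * e'' i)"
      unfolding e_def h hl[OF E] c by (auto simp: fun_eq_iff)
    have "?h \<in> SC" by (intro smooth_fun_add smooth_fun_cmult h)
    then have "(L ?h ?\<omega>, e ?h ?\<omega>) \<in> Y" by (rule YI) (rule \<Omega>0(3)[OF h(2,4)])
    then show "(\<lambda>k. l k - a * l' k, \<lambda>i. e' i - a * e'' i) \<in> Y" unfolding L' e' .
  next
    fix l0 e' k assume "(l0, e') \<in> Y" and 0: "\<forall>i\<in>UNIV \<times> Basis. e' i = 0"
    then obtain h \<omega> where h: "h \<in> SC" "\<omega> \<in> \<Omega>0" "l0 = L h \<omega>" "e' = e h \<omega>" unfolding Y_def by blast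
    have E0: "apply_complex (E i p) h = 0" "coch \<omega> [E i] p = 0" if "i \<in> Basis" for i
      using bspec[OF 0, of "(True, i)"] bspec[OF 0, of "(False, i)"] that unfolding h(4) e_def by simp_all
    have "apply_complex (V p) h = 0" if V: "V \<in> VF" for V
    proof -
      have "b p * apply_complex (V p) h = (\<Sum>i\<in>Basis. l i p (V p) * apply_complex (E i p) h)"
        using fr[OF p VF_tangent[OF V p] SC_Re[OF h(1)]] fr[OF p VF_tangent[OF V p] SC_Im[OF h(1)]]
        by (simp add: apply_complex_def algebra_simps sum.distrib sum_distrib_left)
      then show ?thesis using b E0(1) by simp
    qed
    moreover have "coch \<omega> [V] x = 0" if V: "V \<in> VF" for V x
    proof (cases "x \<in> points M")
      case True
      have "\<omega> p [v] = 0" if v: "v \<in> T p" for v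
      proof -
        let ?V = "field_extension M p v"
        note fe = field_extension[OF p v]
        have "b p * coch \<omega> [?V] p = (\<Sum>i\<in>Basis. l i p (?V p) * coch \<omega> [E i] p)"
          using frc[OF \<Omega>t[OF h(2)] fe(1), of "[]" "[]" p] by simp
        then have "coch \<omega> [?V] p = 0" using b E0(2) by simp
        then show ?thesis using fe(2) by (simp add: coch_def)
      qed
      then show ?thesis using \<Omega>0(4)[OF h(2) _ True VF_tangent[OF V True]] by (simp add: coch_def)
    next
      case False
      then show ?thesis using tens_outside[OF \<Omega>t[OF h(2)], of "[V]"] V by simp
    qed
    then have "coch \<omega> [V] = (\<lambda>x. 0)" if "V \<in> VF" for V using that by auto
    moreover have "iter_op Z1 Z2 k (\<lambda>x. 0) (\<lambda>x. 0) p = 0"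
      using fun_cong[OF iter_op_exact[OF Z smooth_fun_zero, of k], of p] by (simp add: act_zero Z iter_bracket_VF)
    ultimately show "l0 k = 0" using Z iter_bracket_VF[OF Z] by (simp add: h(3) L_def)
  qed simp
  then obtain c N where cN: "\<forall>k. c k \<noteq> 0 \<longrightarrow> 0 \<le> k \<and> k < N" "\<exists>k. c k \<noteq> 0"
    "\<forall>N'\<ge>N. \<forall>(l, e)\<in>Y. (\<Sum>k<N'. c k * l k) = 0"
    by blast
  have c: "c k \<noteq> 0 \<Longrightarrow> k < N" for k using cN(1) by blast
  have rel: "(\<Sum>k<N. c k * L h \<omega> k) = 0" if "h \<in> SC" "\<omega> \<in> \<Omega>0" for h \<omega>
    using cN(3)[rule_format, OF order_refl YI[OF that]] by simp
  define K where "K = Max {k. c k \<noteq> 0}"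
  have fin: "finite {k. c k \<noteq> 0}" by (rule finite_subset[of _ "{..<N}"]) (use c in auto)
  have K: "c K \<noteq> 0" "\<And>k. c k \<noteq> 0 \<Longrightarrow> k \<le> K" using Max_in[OF fin] Max_ge[OF fin] cN(2) by (auto simp: K_def)
  \<comment> \<open>The contraction of \<open>df \<and> dg\<close> with \<open>Z1\<close>, restricted to type \<open>(0, 1)\<close>: it vanishes on \<open>Z1\<close> and has the
    value \<open>q\<close> on \<open>Z2\<close>. The factor \<open>u ^ K\<close> is chosen to single out the last term of the relation. Of the
    four factors \<open>d\<close>, three make the exterior derivative divisible by \<open>d * d\<close>, as the division in
    Cramer's rule requires.\<close>
  define A where "A w = one_coch (\<lambda>V x. w x * (Z1 x f * P False V x g - Z1 x g * P False V x f))" for w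
  have tA: "tensorial (A w)" if w: "w \<in> SC" for w
    unfolding A_def
  proof (rule tens_one_coch)
    show "(\<lambda>x. w x * (Z1 x f * P False V x g - Z1 x g * P False V x f)) \<in> SC" if "V \<in> VF" for V
      using VF_smooth[OF Z(1)] VF_smooth[OF P_VF[OF that]] fg w by (intro smooth_fun_diff smooth_fun_mult) auto
  qed (auto simp: P_vadd P_smul vadd_def smul_def algebra_simps P_vadd[unfolded vadd_def] P_smul[unfolded smul_def])
  have hA: "of_bidegree (A w) 0 1" if w: "w \<in> SC" for w
    unfolding of_bidegree_def
  proof (intro conjI tA w allI impI)
    fix Ws a b x assume W: "ptype Ws a b" "(a, b) \<noteq> (0, 1)"
    show "A w Ws x = 0"
    proof (cases "\<exists>V. Ws = [V]")
      case True
      then obtain V where V: "Ws = [V]" by blast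
      have "pure True V" using W unfolding V by (auto elim!: ptype.cases)
      then have "P False V = (\<lambda>x f. 0)" using pure_other[of True V] by simp
      then show ?thesis unfolding V A_def one_coch_def by simp
    next
      case False
      then show ?thesis by (auto simp: A_def one_coch_def split: list.split)
    qed
  qed
  define w0 where "w0 = (\<lambda>x. u x ^ K * (d x * (d x * (d x * d x))))"
  have d3: "(\<lambda>x. d x * (d x * d x)) \<in> SC" using d(1) by (intro smooth_fun_mult)
  have w0: "w0 \<in> SC" unfolding w0_def using SC_power[OF u(1) smooth_fun_mult[OF d(1) d3]] .
  define \<alpha> where "\<alpha> = A w0"
  have h\<alpha>: "of_bidegree \<alpha> 0 1" unfolding \<alpha>_def by (rule hA[OF w0])
  note t\<alpha> = of_bidegree_tens[OF h\<alpha>]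
  \<comment> \<open>\<open>\<eta>\<close> is the quotient of \<open>dce\<close> of \<open>\<alpha> = d\<^sup>3 \<alpha>'\<close> by \<open>d\<^sup>2\<close>, written without a division.\<close>
  define \<alpha>' where "\<alpha>' = A (\<lambda>x. u x ^ K * d x)"
  have t\<alpha>': "tensorial \<alpha>'" unfolding \<alpha>'_def by (rule tA[OF SC_power[OF u(1) d(1)]])
  have \<alpha>\<alpha>': "\<alpha> = (\<lambda>Vs x. (d x * (d x * d x)) * \<alpha>' Vs x)"
    by (auto simp: \<alpha>_def \<alpha>'_def A_def w0_def one_coch_def fun_eq_iff algebra_simps split: list.split)
  define \<eta> where "\<eta> t x = d x * dce [fst t, snd t] \<alpha>' x
      + 3 * (apply_complex (fst t x) d * \<alpha>' [snd t] x - apply_complex (snd t x) d * \<alpha>' [fst t] x)" for t x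
  have \<eta>: "dce [Y, Y'] \<alpha> x = d x * d x * \<eta> (Y, Y') x" if Y: "Y \<in> VF" "Y' \<in> VF" for Y Y' x
  proof -
    have "apply_complex (V x) (\<lambda>x. d x * (d x * d x)) = 3 * (d x * d x) * apply_complex (V x) d" if "V \<in> VF" for V
      unfolding act_mult[OF that d(1) smooth_fun_mult[OF d(1) d(1)]] act_mult[OF that d(1) d(1)]
      by (simp add: algebra_simps)
    then show ?thesis
      unfolding \<alpha>\<alpha>' dce_pair_mult[OF t\<alpha>' Y d3] \<eta>_def using Y by (simp add: algebra_simps)
  qed
  have \<eta>SC: "\<eta> t \<in> SC" if t: "t \<in> D" for t
  proof -
    have "\<alpha>' [fst t] \<in> SC" "\<alpha>' [snd t] \<in> SC" using tens_SC[OF t\<alpha>'] DVF[OF t] by auto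
    moreover have "dce [fst t, snd t] \<alpha>' \<in> SC" using dce_SC[OF tens_smooth_values[OF t\<alpha>']] DVF[OF t] by simp
    ultimately show ?thesis
      unfolding \<eta>_def[abs_def]
      by (intro smooth_fun_add[OF smooth_fun_mult smooth_fun_cmult[OF smooth_fun_diff[OF smooth_fun_mult smooth_fun_mult]]]
          act_smooth d(1) DVF[OF t])
  qed
  \<comment> \<open>The solution of \<open>mubar X = delbar \<alpha>\<close> by Cramer's rule. Where \<open>d\<close> is nonzero, the two sides agree
    because they do so on the pairs \<open>s j\<close>; where \<open>d\<close> vanishes, so do both sides.\<close>
  define X where "X = (\<lambda>Vs x. \<Sum>i<r. (d x * \<eta> (s i) x) * \<xi> i Vs x)"
  have hX: "of_bidegree X 1 0"
    unfolding X_def by (intro of_bidegree_Sum of_bidegree_mult smooth_fun_mult d(1) \<eta>SC s \<xi>(1)) auto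
  note tX = of_bidegree_tens[OF hX]
  have dX: "dce [Y, Y'] X x = (\<Sum>i<r. (d x * \<eta> (s i) x) * dce [Y, Y'] (\<xi> i) x)"
    if "pure False Y" "pure False Y'" for Y Y' x
  proof -
    have "dce [Y, Y'] X x = - X [lie_bracket Y Y'] x" by (rule dce_10_pair[OF hX that])
    also have "\<dots> = (\<Sum>i<r. (d x * \<eta> (s i) x) * - \<xi> i [lie_bracket Y Y'] x)" by (simp add: X_def sum_negf)
    also have "\<dots> = (\<Sum>i<r. (d x * \<eta> (s i) x) * dce [Y, Y'] (\<xi> i) x)"
      by (rule sum.cong) (auto simp: dce_10_pair[OF \<xi>(1) that])
    finally show ?thesis .
  qed
  have key: "dce [Y, Y'] \<alpha> x = dce [Y, Y'] X x" if Y: "pure False Y" "pure False Y'" for Y Y' x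
  proof -
    have YV: "[Y, Y'] \<in> lists VF" "Y \<in> VF" "Y' \<in> VF" using pure_VF Y by auto
    consider "x \<notin> points M" | "d x = 0" | "x \<in> points M" "d x \<noteq> 0" by blast
    then show ?thesis
    proof cases
      case 1
      then show ?thesis
        using smooth_fun_outside[OF dce_SC[OF tens_smooth_values[OF t\<alpha>] YV(1)]] smooth_fun_outside[OF dce_SC[OF tens_smooth_values[OF tX] YV(1)]] by simp
    next
      case 2
      then show ?thesis unfolding dX[OF Y] \<eta>[OF YV(2,3)] by simp
    next
      case 3
      let ?\<beta> = "\<lambda>Vs x. dce Vs \<alpha> x - dce Vs X x"
      have "?\<beta> [Y, Y'] x = 0"
      proof (rule two_forms_span[where \<psi> = "\<lambda>i Vs. dce Vs (\<xi> i)" and s = s and D = "d x", OF 3(1) n r(1)])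
        fix j assume j: "j < r"
        have "dce [fst (s j), snd (s j)] X x = (\<Sum>i<r. (d x * \<eta> (s i) x) * (if i = j then d x else 0))"
          unfolding dX[OF DVF(3,4)[OF s[OF j]]] by (rule sum.cong) (auto simp: \<xi>s j)
        also have "\<dots> = d x * d x * \<eta> (s j) x" using j by (simp add: if_distrib cong: if_cong)
        finally show "dce [fst (s j), snd (s j)] \<alpha> x - dce [fst (s j), snd (s j)] X x = 0"
          using \<eta>[OF DVF(1,2)[OF s[OF j]], of x] by simp
      qed (use 3 Y YV tens_dce[OF of_bidegree_tens[OF \<xi>(1)]] tens_diff[OF tens_dce[OF t\<alpha>] tens_dce[OF tX]] DVF s \<xi>s in auto)
      then show ?thesis by simp
    qed
  qed
  have \<alpha>F: "frm \<alpha> \<in> forms M" by (rule frm_forms[OF t\<alpha>])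
  have XF: "frm X \<in> forms M" by (rule frm_forms[OF tX])
  have m0: "mubar M J (frm \<alpha>) = 0"
  proof -
    have "mubar M J (frm \<alpha>) = frm (\<lambda>Vs x. 0)"
      unfolding mubar_frm[OF \<alpha>F]
    proof (intro frm_cong ext)
      fix Vs x assume V: "Vs \<in> lists VF"
      have "mubc (coch (frm \<alpha>)) Vs x = mubc \<alpha> Vs x"
        by (rule fun_cong[OF mubc_cong[OF coch_frm[OF t\<alpha>] V]])
      also have "\<dots> = 0" by (rule tens_pure_eq_0[OF tens_mubc[OF t\<alpha>] V]) (rule mubc_01[OF h\<alpha>])
      finally show "mubc (coch (frm \<alpha>)) Vs x = 0" .
    qed
    also have "\<dots> = 0" by (intro ext) (simp add: frm_def)
    finally show ?thesis .
  qed
  have dm: "delbar M J (frm \<alpha>) = mubar M J (frm X)"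
    unfolding mubar_frm[OF XF] delbar_frm[OF \<alpha>F]
  proof (intro frm_cong ext)
    fix Vs x assume V: "Vs \<in> lists VF"
    have "delbc (coch (frm \<alpha>)) Vs x = delbc \<alpha> Vs x"
      by (rule fun_cong[OF delbc_cong[OF coch_frm[OF t\<alpha>] V]])
    also have "\<dots> = mubc X Vs x"
    proof (rule tens_pure_eqI[OF tens_delbc[OF t\<alpha>] tens_mubc[OF tX] V])
      fix Ws a b assume W: "ptype Ws a b"
      show "delbc \<alpha> Ws x = mubc X Ws x"
      proof (cases "a = 0 \<and> b = 2")
        case True
        then obtain Y Y' where "Ws = [Y, Y']" "pure False Y" "pure False Y'" using ptype_02 W by metis
        then show ?thesis unfolding delbc_01[OF h\<alpha> W] mubc_10[OF hX W] using key by simp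
      next
        case False
        then show ?thesis unfolding delbc_01[OF h\<alpha> W] mubc_10[OF hX W] by auto
      qed
    qed
    also have "\<dots> = mubc (coch (frm X)) Vs x"
      by (rule fun_cong[OF mubc_cong[OF coch_frm[OF tX] V], symmetric])
    finally show "delbc (coch (frm \<alpha>)) Vs x = mubc (coch (frm X)) Vs x" .
  qed
  \<comment> \<open>Surjectivity would express the test form by \<open>delbar\<close> of a function and a form in \<open>\<Omega>0\<close>.\<close>
  define R where "R = {\<zeta> \<in> forms M. \<exists>h\<in>SC. \<exists>\<omega>\<in>\<Omega>0. \<forall>V x. pure False V \<longrightarrow> coch \<zeta> [V] x = apply_complex (V x) h + coch \<omega> [V] x}"
  have RI: "\<zeta> \<in> R" if "\<zeta> \<in> forms M" "h \<in> SC" "\<omega> \<in> \<Omega>0" "\<And>V x. pure False V \<Longrightarrow> coch \<zeta> [V] x = apply_complex (V x) h + coch \<omega> [V] x" for \<zeta> h \<omega>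
    using that unfolding R_def by blast
  have z: "coch 0 [V] x = 0" for V x by (simp add: coch_def)
  have a0: "apply_complex (V x) (\<lambda>x. 0) = 0" if "pure False V" for V x using act_zero[OF pure_VF[OF that]] .
  have "frm \<alpha> \<in> R"
  proof (rule surjective_imp_mem[OF surj \<Omega>0(1) _ \<alpha>F m0])
    show "\<Omega>0 \<subseteq> R" using \<Omega>0(1) a0 by (auto intro!: RI[of _ "\<lambda>x. 0"])
    show "delbar M J (frm \<alpha>) \<in> mubar M J ` forms M" unfolding dm using XF by blast
    show "mubar M J \<beta> \<in> R" if \<beta>: "\<beta> \<in> forms M" for \<beta>
    proof (rule RI[of _ "\<lambda>x. 0" 0])
      fix V x assume V: "pure False V"
      note t = tens_coch[OF \<beta>]
      have "coch (mubar M J \<beta>) [V] x = mubc (coch \<beta>) [V] x"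
        unfolding mubar_frm[OF \<beta>] using coch_frm[OF tens_mubc[OF t], of "[V]"] pure_VF[OF V] by simp
      also have "\<dots> = 0" unfolding mubc_pure[OF ptype_single[OF V] t] by simp
      finally show "coch (mubar M J \<beta>) [V] x = apply_complex (V x) (\<lambda>x. 0) + coch 0 [V] x" using a0[OF V] z by simp
    qed (use mubar_forms[OF \<beta>] \<Omega>0 in auto)
    show "delbar M J \<beta> \<in> R" if \<beta>: "\<beta> \<in> forms M" for \<beta>
    proof (rule RI[of _ "coch \<beta> []" 0])
      fix V x assume V: "pure False V"
      note t = tens_coch[OF \<beta>]
      have "coch (delbar M J \<beta>) [V] x = delbc (coch \<beta>) [V] x"
        unfolding delbar_frm[OF \<beta>] using coch_frm[OF tens_delbc[OF t], of "[V]"] pure_VF[OF V] by simp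
      also have "\<dots> = apply_complex (V x) (coch \<beta> [])"
        unfolding delbc_pure[OF ptype_single[OF V] t] by (simp add: dce.simps)
      finally show "coch (delbar M J \<beta>) [V] x = apply_complex (V x) (coch \<beta> []) + coch 0 [V] x" using z by simp
    qed (use delbar_forms[OF \<beta>] \<Omega>0 tens_SC[OF tens_coch[OF \<beta>], of "[]"] in auto)
    fix \<beta> \<gamma> assume "\<beta> \<in> R" "\<gamma> \<in> R"
    then obtain h \<omega> h' \<omega>' where h: "\<beta> \<in> forms M" "\<gamma> \<in> forms M" "h \<in> SC" "h' \<in> SC" "\<omega> \<in> \<Omega>0" "\<omega>' \<in> \<Omega>0"
      "\<And>V x. pure False V \<Longrightarrow> coch \<beta> [V] x = apply_complex (V x) h + coch \<omega> [V] x"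
      "\<And>V x. pure False V \<Longrightarrow> coch \<gamma> [V] x = apply_complex (V x) h' + coch \<omega>' [V] x"
      unfolding R_def by blast
    show "\<beta> + \<gamma> \<in> R"
    proof (rule RI[OF forms_add[OF h(1,2)] smooth_fun_add[OF h(3,4)] \<Omega>0(3)[OF h(5,6), of "-1"]])
      fix V x assume V: "pure False V"
      show "coch (\<beta> + \<gamma>) [V] x = apply_complex (V x) (\<lambda>x. h x + h' x) + coch (\<lambda>x vs. \<omega> x vs - (-1) * \<omega>' x vs) [V] x"
        unfolding act_add[OF pure_VF[OF V] h(3,4)] using h(7,8)[OF V, of x] by (simp add: coch_def)
    qed
    show "\<beta> - \<gamma> \<in> R"
    proof (rule RI[OF forms_diff[OF h(1,2)] smooth_fun_diff[OF h(3,4)] \<Omega>0(3)[OF h(5,6), of 1]])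
      fix V x assume V: "pure False V"
      show "coch (\<beta> - \<gamma>) [V] x = apply_complex (V x) (\<lambda>x. h x - h' x) + coch (\<lambda>x vs. \<omega> x vs - 1 * \<omega>' x vs) [V] x"
        unfolding act_diff[OF pure_VF[OF V] h(3,4)] using h(7,8)[OF V, of x] by (simp add: coch_def)
    qed
  qed
  then obtain h \<omega> where h: "h \<in> SC" "\<omega> \<in> \<Omega>0"
    "\<And>V x. pure False V \<Longrightarrow> coch (frm \<alpha>) [V] x = apply_complex (V x) h + coch \<omega> [V] x" unfolding R_def by blast
  have \<alpha>e: "\<alpha> [V] = (\<lambda>x. apply_complex (V x) h + 1 * coch \<omega> [V] x)" if "pure False V" for V
    using h(3)[OF that] coch_frm[OF t\<alpha>, of "[V]"] pure_VF[OF that] by (simp add: fun_eq_iff)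
  define w where "w = (\<lambda>x. d x * (d x * (d x * d x)) * q x)"
  have w: "w \<in> SC" "w p \<noteq> 0" unfolding w_def using smooth_fun_mult[OF smooth_fun_mult[OF d(1) d3] qSC] d(2) qp by auto
  have \<alpha>1: "\<alpha> [Z1] = (\<lambda>x. 0)" by (simp add: \<alpha>_def A_def one_coch_def pure_same[OF Zp(1)] mult.commute)
  have \<alpha>2: "\<alpha> [Z2] = (\<lambda>x. u x ^ K * w x)"
    by (auto simp: \<alpha>_def A_def one_coch_def pure_same[OF Zp(2)] w0_def w_def q_def fun_eq_iff algebra_simps)
  \<comment> \<open>Only the term with \<open>k = K\<close> of the relation survives, and it is not zero.\<close>
  have L: "L h \<omega> k = ((\<lambda>h x. apply_complex (Z1 x) h) ^^ k) (\<lambda>x. u x ^ K * w x) p" for k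
  proof -
    have "iter_op Z1 Z2 k (\<alpha> [Z1]) (\<alpha> [Z2]) p = L h \<omega> k"
      unfolding \<alpha>e[OF Zp(1)] \<alpha>e[OF Zp(2)] L_def
        iter_op_lin[OF Z act_smooth[OF Z(1) h(1)] act_smooth[OF Z(2) h(1)] \<Omega>SC[OF h(2) Z(1)] \<Omega>SC[OF h(2) Z(2)]]
        iter_op_exact[OF Z h(1)] by simp
    then show ?thesis unfolding \<alpha>1 \<alpha>2 iter_op_zero[OF Z] by simp
  qed
  have "0 = (\<Sum>k<N. c k * L h \<omega> k)" using rel[OF h(1,2)] by simp
  also have "\<dots> = (\<Sum>k<N. if k = K then c K * (fact K * apply_complex (Z1 p) u ^ K * w p) else 0)"
  proof (rule sum.cong[OF refl])
    fix k
    show "c k * L h \<omega> k = (if k = K then c K * (fact K * apply_complex (Z1 p) u ^ K * w p) else 0)"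
    proof (cases "k \<le> K")
      case True
      then show ?thesis unfolding L iter_act_power[OF Z(1) u w(1) True] by simp
    next
      case False
      then have "c k = 0" using K(2)[of k] by blast
      then show ?thesis using False by simp
    qed
  qed
  also have "\<dots> = c K * (fact K * apply_complex (Z1 p) u ^ K * w p)" using c[OF K(1)] by simp
  finally show False using K(1) Zu w(2) by simp
qed

end

section \<open>Left-invariant forms on the quotient\<close>

context lie_quotient
begin

lemma left_invariant_forms_diff_cmult:
  assumes \<omega>: "\<omega> \<in> left_invariant_forms G M \<Gamma>" and \<eta>: "\<eta> \<in> left_invariant_forms G M \<Gamma>"
  shows "(\<lambda>x vs. \<omega> x vs - a * \<eta> x vs) \<in> left_invariant_forms G M \<Gamma>"
proof -
  let ?\<zeta> = "\<lambda>x vs. \<omega> x vs - a * \<eta> x vs"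
  have pull: "form_pullback M N F (\<lambda>x vs. \<sigma> x vs - a * \<tau> x vs) =
      (\<lambda>x vs. form_pullback M N F \<sigma> x vs - a * form_pullback M N F \<tau> x vs)"
    for N :: "('b, 'e) manifold" and F \<sigma> \<tau> by (intro ext) (simp add: form_pullback_def)
  note inv = \<omega>[unfolded left_invariant_forms_def left_invariant_form_on_group_def mem_Collect_eq]
    \<eta>[unfolded left_invariant_forms_def left_invariant_form_on_group_def mem_Collect_eq]
  have "?\<zeta> \<in> forms Q" by (rule Q.forms_diff_cmult) (use inv in blast)+
  moreover have "form_pullback M Q \<pi> ?\<zeta> \<in> forms M"
    unfolding pull by (rule M.forms_diff_cmult) (use inv in blast)+
  moreover have "form_pullback M M (\<lambda>h. a \<otimes> h) (form_pullback M Q \<pi> ?\<zeta>) = form_pullback M Q \<pi> ?\<zeta>"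
    if "a \<in> carrier G" for a
    unfolding pull using inv that by simp
  ultimately show ?thesis by (simp only: left_invariant_forms_def left_invariant_form_on_group_def mem_Collect_eq) blast
qed

lemma left_invariant_forms_zero: "0 \<in> left_invariant_forms G M \<Gamma>"
proof -
  have pull: "form_pullback M N F 0 = 0" for N :: "('b, 'e) manifold" and F
    by (intro ext) (simp add: form_pullback_def)
  show ?thesis
    by (simp add: left_invariant_forms_def left_invariant_form_on_group_def pull Q.forms_zero M.forms_zero)
qed

end

theorem corollary2p3:
  fixes G :: "'g monoid" and M :: "('g, 'e::euclidean_space) manifold"
    and \<Gamma> :: "'g set" and J :: "'g set acs"
  defines "X \<equiv> quotient_manifold G M \<Gamma>"
  assumes "nilmanifold_data G M \<Gamma>"
    and "DIM('e) = 4 \<or> DIM('e) = 6"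
    and "almost_complex X J"
    and "left_invariant_acs G M \<Gamma> J"
    and "max_non_integrable X J"
  shows "\<not> bij_betw (dolbeault_inclusion X J (forms X))
            (carrier (dolbeault X J (left_invariant_forms G M \<Gamma>)))
            (carrier (dolbeault X J (forms X)))"
proof -
  interpret lq: lie_quotient G M \<Gamma>
    using assms(2) unfolding nilmanifold_data_def by unfold_locales auto
  interpret almost_complex_manifold X J
    unfolding X_def
    by (intro almost_complex_manifold.intro almost_complex_manifold_axioms.intro lq.charted_Q)
      (use assms(4) in \<open>simp add: X_def\<close>)
  define n where "n = DIM('e) div 2"
  define r where "r = card {(i, j). i < j \<and> j < n}"
  let ?p = "\<Gamma> #>\<^bsub>G\<^esub> \<one>\<^bsub>G\<^esub>"
  have n: "DIM('e) = 2 * n" "n = 2 \<or> n = 3" using assms(3) by (auto simp: n_def)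
  \<comment> \<open>Only for \<open>n = 2\<close> and \<open>n = 3\<close> is the maximal rank positive and equal to the rank of the bundle of
    \<open>(0, 2)\<close>-forms.\<close>
  have r: "r = min n (n choose 2)" "r > 0"
  proof -
    have "{(i, j). i < j \<and> j < (2::nat)} = {(0, 1)}"
      "{(i, j). i < j \<and> j < (3::nat)} = {(0, 1), (0, 2), (1, 2)}" by auto
    then have "n = 2 \<and> r = 1 \<or> n = 3 \<and> r = 3" using n(2) unfolding r_def by (elim disjE) simp_all
    then show "r = min n (n choose 2)" "r > 0" by (auto simp: choose_two)
  qed
  have p: "?p \<in> points X" unfolding X_def by (rule lq.proj_in_points) simp
  have rank: "vector_space.dim (\<lambda>(c::complex) \<eta> vs. c * \<eta> vs) ((\<lambda>\<alpha>. mubar X J \<alpha> ?p) ` pq_forms X J 1 0) = r"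
    using assms(6) p unfolding max_non_integrable_def r(1) n_def by blast
  have "\<not> carrier (dolbeault X J (forms X)) \<subseteq>
      dolbeault_inclusion X J (forms X) ` carrier (dolbeault X J (left_invariant_forms G M \<Gamma>))"
  proof (rule not_surjective[OF n(1) r_def r(2) p rank])
    show "left_invariant_forms G M \<Gamma> \<subseteq> forms X" by (auto simp: left_invariant_forms_def X_def)
    show "\<omega> x [v] = 0" if "\<omega> \<in> left_invariant_forms G M \<Gamma>" "\<And>v. v \<in> tangent_space X ?p \<Longrightarrow> \<omega> ?p [v] = 0"
        "x \<in> points X" "v \<in> tangent_space X x" for \<omega> x v
      using lq.left_invariant_form_eq_0[OF that[unfolded X_def]] .
  qed (rule lq.left_invariant_forms_zero lq.left_invariant_forms_diff_cmult; assumption)+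
  then show ?thesis by (auto simp: bij_betw_def)
qed

end
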